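(* Let $\gamma:[0,T]\to\mathbb{R}^5$ be an ample and equiregular (normal) geodesic in the Cartan group $\mathfrak{C}$, with $\gamma(0)=x_0$ and initial covector $\lambda_0\in T^*_{x_0}\mathbb{R}^5$. Then there is an orthonormal basis of $\mathscr{D}_{x_0}$ in which the quadratic form $d^2_{x_0}\dot c_t|_{\mathscr{D}_{x_0}}$ (equivalently, the operator $\mathcal{Q}_{\lambda_0}(t)$) has, as $t\to0$, the expansion $$d^2_{x_0}\dot{c}_t|_{\mathscr{D}}=\frac{1}{t^2}\mathcal{I}_{\lambda_0}+\frac{1}{3}\mathcal{R}_{\lambda_0}+O(t)=\frac{1}{t^2}\begin{pmatrix}16&0\\0&1\end{pmatrix}+\frac13\begin{pmatrix}\frac{4}{21}R_{11}(\lambda_0)&0\\0&0\end{pmatrix}+O(t),$$ where $$R_{11}(\lambda_0)=6E-\frac{8}{h_3^2}\bigl(h_1h_4+h_2h_5\bigr)^2,\qquad E=\frac{h_3^2}{2}+h_1h_5-h_2h_4,$$ all $h_i$ being evaluated at $\lambda_0$.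
   Context: The Cartan group. $\mathfrak{C}$ is the simply connected nilpotent Lie group, with underlying manifold $\mathbb{R}^5$, whose Lie algebra of left-invariant vector fields is $\mathrm{span}\{X_1,\dots,X_5\}$ with $[X_1,X_2]=X_3$, $[X_1,X_3]=X_4$, $[X_2,X_3]=X_5$ and all other brackets zero. It carries the sub-Riemannian structure $(\mathscr{D},g)$: $\mathscr{D}=\mathrm{span}\{X_1,X_2\}$ with $X_1,X_2$ orthonormal for $g$. Let $d$ be the sub-Riemannian distance (infimum of $g$-lengths of Lipschitz curves tangent a.e. to $\mathscr{D}$). Normal geodesics. $h_i(\lambda)=\langle\lambda,X_i\rangle$ for $\lambda\in T^*\mathbb{R}^5$, $H=\frac12(h_1^2+h_2^2)$, and $\vec H$ is the Hamiltonian vector field of $H$ ($dH=\sigma(\cdot,\vec H)$, $\sigma$ the differential of the Liouville form). A normal geodesic with initial covector $\lambda_0$ is $\gamma(t)=\pi(\lambda(t))$, $\lambda(t)=e^{t\vec H}(\lambda_0)$, $\pi:T^*\mathbb{R}^5\to\mathbb{R}^5$ the projection. Ample/equiregular. For a smooth admissible curve $\gamma$ choose a horizontal vector field $\mathsf T$ with $\mathsf T|_{\gamma(t)}=\dot\gamma(t)$. The flag of $\gamma$ is $\mathscr{F}^i_\gamma(t)=\mathrm{span}\{\mathcal{L}^j_{\mathsf T}(X)|_{\gamma(t)}: X \text{ a horizontal vector field},\ j\le i-1\}\subset T_{\gamma(t)}\mathbb{R}^5$ (independent of $\mathsf T$), where $\mathcal L_{\mathsf T}$ is the Lie derivative, and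 the growth vector is $\mathcal{G}_\gamma(t)=(k_1(t),k_2(t),\dots)$ with $k_i(t)=\dim\mathscr{F}^i_\gamma(t)$. $\gamma$ is equiregular at $t$ if its growth vector is locally constant at $t$, and ample at $t$ if $\mathscr{F}^m_\gamma(t)=T_{\gamma(t)}\mathbb{R}^5$ for some $m$. It is ample (equiregular) if it is so at every $t\in[0,T]$. Geodesic cost and curvature operator. $c_t(x)=-\frac{1}{2t}d^2(x,\gamma(t))$ for $t>0$ and $\dot c_t=\frac{\partial}{\partial t}c_t$. For an ample normal geodesic it is known that $(t,x)\mapsto c_t(x)$ is smooth for small $t>0$ and $x$ near $x_0$, and that $x_0$ is a critical point of $\dot c_t$, so the second differential (Hessian) $d^2_{x_0}\dot c_t$ is a well-defined quadratic form on $T_{x_0}\mathbb{R}^5$. The symmetric operators $\mathcal{Q}_{\lambda_0}(t):\mathscr{D}_{x_0}\to\mathscr{D}_{x_0}$ are defined by $d^2_{x_0}\dot c_t(v)=g(\mathcal{Q}_{\lambda_0}(t)v,v)$ for $v\in\mathscr{D}_{x_0}$. It is known that $t^2\mathcal{Q}_{\lambda_0}(t)$ extends smoothly to $t=0$. One sets $\mathcal{I}_{\lambda_0}=\lim_{t\to0^+}t^2\mathcal{Q}_{\lambda_0}(t)$ and $\mathcal{R}_{\lambda_0}=\frac32\frac{d^2}{dt^2}\big|_{t=0}t^2\mathcal{Q}_{\lambda_0}(t)$ (the curvature operator). *)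

theory Defs
  imports "HOL-Analysis.Analysis" "HOL-Library.Landau_Symbols"
begin

type_synonym pt = "real^5"

text \<open>
  The simply connected Lie group with the required Lie algebra is unique up to isomorphism; we
  realise it on \<open>\<real>\<^sup>5\<close> by a polynomial group law.  Note that the index \<open>5\<close> of the
  numeral type \<open>5\<close> is its zero.
\<close>

definition cartan_mult :: "pt \<Rightarrow> pt \<Rightarrow> pt" where
  "cartan_mult a x =
     axis 1 (a$1 + x$1) + axis 2 (a$2 + x$2) + axis 3 (a$3 + x$3 + a$1 * x$2)
     + axis 4 (a$4 + x$4 + a$1 * x$3 + (a$1)^2 / 2 * x$2)
     + axis 5 (a$5 + x$5 + a$1 * a$2 * x$2 + a$1 * (x$2)^2 / 2 + a$2 * x$3)"

definition left_invariant_field :: "pt \<Rightarrow> pt \<Rightarrow> pt" where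
  "left_invariant_field v x = frechet_derivative (cartan_mult x) (at 0) v"

definition X :: "5 \<Rightarrow> pt \<Rightarrow> pt" where
  "X i = left_invariant_field (axis i 1)"

definition lie_bracket :: "(pt \<Rightarrow> pt) \<Rightarrow> (pt \<Rightarrow> pt) \<Rightarrow> pt \<Rightarrow> pt" where
  "lie_bracket V W x = frechet_derivative W (at x) (V x) - frechet_derivative V (at x) (W x)"

primrec C_k :: "nat \<Rightarrow> ('a::real_normed_vector \<Rightarrow> 'b::real_normed_vector) \<Rightarrow> bool" where
  "C_k 0 f = continuous_on UNIV f"
| "C_k (Suc k) f \<longleftrightarrow>
     (\<forall>x. f differentiable (at x)) \<and> (\<forall>v. C_k k (\<lambda>x. frechet_derivative f (at x) v))"

definition smooth :: "('a::real_normed_vector \<Rightarrow> 'b::real_normed_vector) \<Rightarrow> bool" where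
  "smooth f \<longleftrightarrow> (\<forall>k. C_k k f)"

definition horizontal_plane :: "pt \<Rightarrow> pt set" where
  "horizontal_plane x = span {X 1 x, X 2 x}"

definition sr_metric :: "pt \<Rightarrow> pt \<Rightarrow> pt \<Rightarrow> real" where
  "sr_metric x v w = (THE c. \<exists>a1 a2 b1 b2.
      v = a1 *\<^sub>R X 1 x + a2 *\<^sub>R X 2 x \<and> w = b1 *\<^sub>R X 1 x + b2 *\<^sub>R X 2 x \<and> c = a1 * b1 + a2 * b2)"

definition orthonormal_basis_at :: "pt \<Rightarrow> (2 \<Rightarrow> pt) \<Rightarrow> bool" where
  "orthonormal_basis_at x e \<longleftrightarrow> span (range e) = horizontal_plane x \<and>
     (\<forall>i j. sr_metric x (e i) (e j) = (if i = j then 1 else 0))"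

definition horizontal_field :: "(pt \<Rightarrow> pt) \<Rightarrow> bool" where
  "horizontal_field V \<longleftrightarrow> smooth V \<and> (\<forall>x. V x \<in> horizontal_plane x)"

definition admissible_curve :: "real \<Rightarrow> (real \<Rightarrow> pt) \<Rightarrow> bool" where
  "admissible_curve T \<omega> \<longleftrightarrow> (\<exists>L. L-lipschitz_on {0..T} \<omega>) \<and>
     (AE t in lebesgue_on {0..T}.
        \<omega> differentiable (at t) \<and> vector_derivative \<omega> (at t) \<in> horizontal_plane (\<omega> t))"

definition sr_length :: "real \<Rightarrow> (real \<Rightarrow> pt) \<Rightarrow> real" where
  "sr_length T \<omega> = integral {0..T}
     (\<lambda>t. sqrt (sr_metric (\<omega> t) (vector_derivative \<omega> (at t)) (vector_derivative \<omega> (at t))))"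

definition sr_dist :: "pt \<Rightarrow> pt \<Rightarrow> real" where
  "sr_dist x y =
     Inf {sr_length T \<omega> | T \<omega>. 0 < T \<and> admissible_curve T \<omega> \<and> \<omega> 0 = x \<and> \<omega> T = y}"

text \<open>The cotangent bundle is trivialised: a covector \<open>p\<close> at \<open>x\<close> is the pair \<open>(x, p)\<close>,
  acting on tangent vectors by the inner product.\<close>

type_synonym covec = "pt \<times> pt"

definition h :: "5 \<Rightarrow> covec \<Rightarrow> real" where
  "h i l = snd l \<bullet> X i (fst l)"

definition Ham :: "covec \<Rightarrow> real" where
  "Ham l = ((h 1 l)^2 + (h 2 l)^2) / 2"

definition liouville :: "covec \<Rightarrow> covec \<Rightarrow> real" where
  "liouville l w = snd l \<bullet> fst w"

text \<open>The exterior derivative of the Liouville form, evaluated on constant fields \<open>v\<close>, \<open>w\<close>.\<close>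

definition symplectic :: "covec \<Rightarrow> covec \<Rightarrow> covec \<Rightarrow> real" where
  "symplectic l v w = frechet_derivative (\<lambda>k. liouville k w) (at l) v
               - frechet_derivative (\<lambda>k. liouville k v) (at l) w"

definition hamiltonian_field :: "(covec \<Rightarrow> real) \<Rightarrow> covec \<Rightarrow> covec" where
  "hamiltonian_field K l = (THE v. \<forall>w. frechet_derivative K (at l) w = symplectic l w v)"

definition normal_geodesic :: "real \<Rightarrow> (real \<Rightarrow> pt) \<Rightarrow> covec \<Rightarrow> bool" where
  "normal_geodesic T \<gamma> l0 \<longleftrightarrow> (\<exists>l. l 0 = l0 \<and>
     (\<forall>t\<in>{0..T}. (l has_vector_derivative hamiltonian_field Ham (l t)) (at t within {0..T}) \<and>
                 \<gamma> t = fst (l t)))"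

text \<open>The curve is only required to be extended near the time \<open>t\<close>, since a curve
  that crosses itself need not have a single extension of its whole velocity field.\<close>

definition velocity_extension :: "real \<Rightarrow> (real \<Rightarrow> pt) \<Rightarrow> real \<Rightarrow> (pt \<Rightarrow> pt) \<Rightarrow> bool" where
  "velocity_extension T \<gamma> t V \<longleftrightarrow> horizontal_field V \<and>
     (\<forall>\<^sub>F s in nhds t. s \<in> {0..T} \<longrightarrow> V (\<gamma> s) = vector_derivative \<gamma> (at s within {0..T}))"

text \<open>The flag does not depend on the extension \<open>V\<close>, so all of them are used instead of
  choosing one.  For \<open>i \<ge> 1\<close> the condition \<open>j < i\<close> is \<open>j \<le> i - 1\<close>.\<close>

definition flag :: "real \<Rightarrow> (real \<Rightarrow> pt) \<Rightarrow> real \<Rightarrow> nat \<Rightarrow> pt set" where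
  "flag T \<gamma> t i = span {((lie_bracket V) ^^ j) W (\<gamma> t) | V W j.
      velocity_extension T \<gamma> t V \<and> horizontal_field W \<and> j < i}"

definition growth_vector :: "real \<Rightarrow> (real \<Rightarrow> pt) \<Rightarrow> real \<Rightarrow> nat \<Rightarrow> nat" where
  "growth_vector T \<gamma> t i = dim (flag T \<gamma> t i)"

definition equiregular :: "real \<Rightarrow> (real \<Rightarrow> pt) \<Rightarrow> bool" where
  "equiregular T \<gamma> \<longleftrightarrow> (\<forall>t\<in>{0..T}. \<forall>\<^sub>F s in at t within {0..T}.
      \<forall>i\<ge>1. growth_vector T \<gamma> s i = growth_vector T \<gamma> t i)"

definition ample :: "real \<Rightarrow> (real \<Rightarrow> pt) \<Rightarrow> bool" where
  "ample T \<gamma> \<longleftrightarrow> (\<forall>t\<in>{0..T}. \<exists>m\<ge>1. flag T \<gamma> t m = UNIV)"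

definition cost :: "(real \<Rightarrow> pt) \<Rightarrow> real \<Rightarrow> pt \<Rightarrow> real" where
  "cost \<gamma> t x = - (1 / (2 * t)) * (sr_dist x (\<gamma> t))^2"

definition cost_dot :: "(real \<Rightarrow> pt) \<Rightarrow> real \<Rightarrow> pt \<Rightarrow> real" where
  "cost_dot \<gamma> t x = deriv (\<lambda>s. cost \<gamma> s x) t"

text \<open>At a critical point the coordinate expression of the second differential is intrinsic.\<close>

definition second_differential :: "(pt \<Rightarrow> real) \<Rightarrow> pt \<Rightarrow> pt \<Rightarrow> real" where
  "second_differential f x v =
     frechet_derivative (\<lambda>y. frechet_derivative f (at y) v) (at x) v"

definition symmetric_operator_at :: "pt \<Rightarrow> (pt \<Rightarrow> pt) \<Rightarrow> bool" where
  "symmetric_operator_at x A \<longleftrightarrow> A \<in> horizontal_plane x \<rightarrow>\<^sub>E horizontal_plane x \<and>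
     (\<forall>v\<in>horizontal_plane x. \<forall>w\<in>horizontal_plane x. \<forall>a b. A (a *\<^sub>R v + b *\<^sub>R w) = a *\<^sub>R A v + b *\<^sub>R A w) \<and>
     (\<forall>v\<in>horizontal_plane x. \<forall>w\<in>horizontal_plane x. sr_metric x (A v) w = sr_metric x v (A w))"

definition cost_op :: "(real \<Rightarrow> pt) \<Rightarrow> real \<Rightarrow> pt \<Rightarrow> pt" where
  "cost_op \<gamma> t = (THE A. symmetric_operator_at (\<gamma> 0) A \<and>
     (\<forall>v\<in>horizontal_plane (\<gamma> 0).
        second_differential (cost_dot \<gamma> t) (\<gamma> 0) v = sr_metric (\<gamma> 0) (A v) v))"

definition I_op :: "(real \<Rightarrow> pt) \<Rightarrow> pt \<Rightarrow> pt" where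
  "I_op \<gamma> v = Lim (at_right 0) (\<lambda>t. t^2 *\<^sub>R cost_op \<gamma> t v)"

text \<open>The extension of \<open>t\<^sup>2 Q(t) v\<close> to \<open>t = 0\<close>; as \<open>Q\<close> lives on \<open>t > 0\<close>, its derivatives
  at \<open>0\<close> are one-sided.\<close>

definition ext_op :: "(real \<Rightarrow> pt) \<Rightarrow> pt \<Rightarrow> real \<Rightarrow> pt" where
  "ext_op \<gamma> v t = (if t = 0 then I_op \<gamma> v else t^2 *\<^sub>R cost_op \<gamma> t v)"

definition R_op :: "(real \<Rightarrow> pt) \<Rightarrow> pt \<Rightarrow> pt" where
  "R_op \<gamma> v = (3/2) *\<^sub>R
     vector_derivative (\<lambda>s. vector_derivative (ext_op \<gamma> v) (at s within {0..})) (at 0 within {0..})"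

definition op_matrix :: "pt \<Rightarrow> (2 \<Rightarrow> pt) \<Rightarrow> (pt \<Rightarrow> pt) \<Rightarrow> real^2^2" where
  "op_matrix x e A = (\<chi> i j. sr_metric x (e i) (A (e j)))"

definition E_inv :: "covec \<Rightarrow> real" where
  "E_inv l = (h 3 l)^2 / 2 + h 1 l * h 5 l - h 2 l * h 4 l"

definition R11 :: "covec \<Rightarrow> real" where
  "R11 l = 6 * E_inv l - 8 / (h 3 l)^2 * (h 1 l * h 4 l + h 2 l * h 5 l)^2"

lemma UNIV5: "(UNIV :: 5 set) = {1, 2, 3, 4, 5}"
proof -
  have "x \<in> {1, 2, 3, 4, 5}" for x :: 5
  proof (cases x)
    case (of_int z)
    then have "z = 0 \<or> z = 1 \<or> z = 2 \<or> z = 3 \<or> z = 4" by auto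
    then show ?thesis using of_int by auto
  qed
  then show ?thesis by blast
qed

lemma forall5: "(\<forall>i::5. P i) \<longleftrightarrow> P 1 \<and> P 2 \<and> P 3 \<and> P 4 \<and> P 5"
proof -
  have "(\<forall>i::5. P i) \<longleftrightarrow> (\<forall>i\<in>(UNIV :: 5 set). P i)" by simp
  then show ?thesis unfolding UNIV5 by simp
qed

lemma cartan_mult_nth [simp]:
  "cartan_mult a x $ 1 = a$1 + x$1"
  "cartan_mult a x $ 2 = a$2 + x$2"
  "cartan_mult a x $ 3 = a$3 + x$3 + a$1 * x$2"
  "cartan_mult a x $ 4 = a$4 + x$4 + a$1 * x$3 + (a$1)^2 / 2 * x$2"
  "cartan_mult a x $ 5 = a$5 + x$5 + a$1 * a$2 * x$2 + a$1 * (x$2)^2 / 2 + a$2 * x$3"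
  by (simp_all add: cartan_mult_def axis_def)

lemma cartan_mult_assoc: "cartan_mult (cartan_mult a b) c = cartan_mult a (cartan_mult b c)"
  by (simp add: vec_eq_iff forall5 algebra_simps power2_eq_square add_divide_distrib)

lemma cartan_mult_0: "cartan_mult 0 x = x" "cartan_mult x 0 = x"
  by (simp_all add: vec_eq_iff forall5)

lemma cartan_mult_inverse: "\<exists>b. cartan_mult b a = 0 \<and> cartan_mult a b = 0"
proof -
  have right: "\<exists>b. cartan_mult a b = 0" for a
  proof -
    define y where "y = - a$3 + a$1 * a$2"
    define b :: pt where "b = axis 1 (- a$1) + axis 2 (- a$2) + axis 3 y
       + axis 4 (- a$4 - a$1 * y + (a$1)^2 / 2 * a$2)
       + axis 5 (- a$5 + a$1 * a$2 * a$2 - a$1 * (a$2)^2 / 2 - a$2 * y)"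
    have "b$1 = - a$1" "b$2 = - a$2" "b$3 = y" "b$4 = - a$4 - a$1 * y + (a$1)^2 / 2 * a$2"
      "b$5 = - a$5 + a$1 * a$2 * a$2 - a$1 * (a$2)^2 / 2 - a$2 * y"
      by (simp_all add: b_def axis_def)
    then have "cartan_mult a b = 0"
      by (simp add: vec_eq_iff forall5 y_def)
    then show ?thesis ..
  qed
  obtain b where b: "cartan_mult a b = 0" using right by blast
  obtain c where c: "cartan_mult b c = 0" using right by blast
  have "a = cartan_mult a (cartan_mult b c)" by (simp add: c cartan_mult_0)
  also have "\<dots> = c" by (simp add: cartan_mult_assoc [symmetric] b cartan_mult_0)
  finally show ?thesis using b c by blast
qed

lemma cartan_mult_has_derivative:
  "(cartan_mult a has_derivative (\<lambda>v.
      axis 1 (v$1) + axis 2 (v$2) + axis 3 (v$3 + a$1 * v$2)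
     + axis 4 (v$4 + a$1 * v$3 + (a$1)^2 / 2 * v$2)
     + axis 5 (v$5 + a$1 * a$2 * v$2 + a$1 * x$2 * v$2 + a$2 * v$3))) (at x)"
proof -
  have eq: "axis i r = r *\<^sub>R axis i (1::real)" for i :: 5 and r
    by (simp add: vec_eq_iff axis_def)
  have nth: "((\<lambda>x::pt. x $ i) has_derivative (\<lambda>v. v $ i)) F" for i F
    by (rule bounded_linear_imp_has_derivative) (rule bounded_linear_vec_nth)
  show ?thesis
    unfolding cartan_mult_def [abs_def] eq [of _ "_ + _"] eq [of _ "_ $ _"]
    by (auto intro!: derivative_eq_intros nth simp: algebra_simps)
qed

lemmas cartan_mult_frechet =
  frechet_derivative_at [OF cartan_mult_has_derivative, symmetric]

lemma X_eq:
  "X 1 x = axis 1 1"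
  "X 2 x = axis 2 1 + x$1 *\<^sub>R axis 3 1 + ((x$1)^2 / 2) *\<^sub>R axis 4 1 + (x$1 * x$2) *\<^sub>R axis 5 1"
  "X 3 x = axis 3 1 + x$1 *\<^sub>R axis 4 1 + x$2 *\<^sub>R axis 5 1"
  "X 4 x = axis 4 1"
  "X 5 x = axis 5 1"
  by (simp_all add: X_def left_invariant_field_def cartan_mult_frechet vec_eq_iff forall5)
     (simp_all add: axis_def)

lemma X_left_invariant:
  "frechet_derivative (cartan_mult a) (at x) (X i x) = X i (cartan_mult a x)"
proof -
  have "\<forall>i. frechet_derivative (cartan_mult a) (at x) (X i x) = X i (cartan_mult a x)"
    by (simp only: forall5 X_eq cartan_mult_frechet)
       (simp add: vec_eq_iff forall5 axis_def algebra_simps power2_eq_square add_divide_distrib)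
  then show ?thesis ..
qed

lemma X_has_derivative:
  "(X 1 has_derivative (\<lambda>v. 0)) (at x)"
  "(X 2 has_derivative (\<lambda>v. v$1 *\<^sub>R axis 3 1 + (x$1 * v$1) *\<^sub>R axis 4 1
      + (x$1 * v$2 + v$1 * x$2) *\<^sub>R axis 5 1)) (at x)"
  "(X 3 has_derivative (\<lambda>v. v$1 *\<^sub>R axis 4 1 + v$2 *\<^sub>R axis 5 1)) (at x)"
  "(X 4 has_derivative (\<lambda>v. 0)) (at x)"
  "(X 5 has_derivative (\<lambda>v. 0)) (at x)"
proof -
  have nth: "((\<lambda>x::pt. x $ i) has_derivative (\<lambda>v. v $ i)) F" for i F
    by (rule bounded_linear_imp_has_derivative) (rule bounded_linear_vec_nth)
  show "(X 2 has_derivative (\<lambda>v. v$1 *\<^sub>R axis 3 1 + (x$1 * v$1) *\<^sub>R axis 4 1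
      + (x$1 * v$2 + v$1 * x$2) *\<^sub>R axis 5 1)) (at x)"
    unfolding X_eq [abs_def] by (auto intro!: derivative_eq_intros nth)
  show "(X 3 has_derivative (\<lambda>v. v$1 *\<^sub>R axis 4 1 + v$2 *\<^sub>R axis 5 1)) (at x)"
    unfolding X_eq [abs_def] by (auto intro!: derivative_eq_intros nth)
qed (simp_all add: X_eq [abs_def])

lemmas X_frechet = X_has_derivative [THEN frechet_derivative_at, symmetric]

lemma cartan_brackets:
  "lie_bracket (X 1) (X 2) = X 3"
  "lie_bracket (X 1) (X 3) = X 4"
  "lie_bracket (X 2) (X 3) = X 5"
  "lie_bracket (X 1) (X 4) = (\<lambda>x. 0)" "lie_bracket (X 1) (X 5) = (\<lambda>x. 0)"
  "lie_bracket (X 2) (X 4) = (\<lambda>x. 0)" "lie_bracket (X 2) (X 5) = (\<lambda>x. 0)"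
  "lie_bracket (X 3) (X 4) = (\<lambda>x. 0)" "lie_bracket (X 3) (X 5) = (\<lambda>x. 0)"
  "lie_bracket (X 4) (X 5) = (\<lambda>x. 0)"
  by (simp_all add: fun_eq_iff lie_bracket_def X_frechet X_eq vec_eq_iff forall5)
     (simp_all add: axis_def)

lemma sr_metric_eq:
  "sr_metric x (a1 *\<^sub>R X 1 x + a2 *\<^sub>R X 2 x) (b1 *\<^sub>R X 1 x + b2 *\<^sub>R X 2 x) = a1 * b1 + a2 * b2"
proof -
  have inj: "a = c \<and> b = d" if "a *\<^sub>R X 1 x + b *\<^sub>R X 2 x = c *\<^sub>R X 1 x + d *\<^sub>R X 2 x" for a b c d
    using arg_cong [OF that, of "\<lambda>v. v $ 1"] arg_cong [OF that, of "\<lambda>v. v $ 2"]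
    by (simp add: X_eq axis_def)
  show ?thesis
    unfolding sr_metric_def by (rule the_equality) (use inj in blast)+
qed

lemma symplectic_eq: "symplectic l v w = snd v \<bullet> fst w - snd w \<bullet> fst v"
proof -
  have D: "((\<lambda>k. liouville k w) has_derivative (\<lambda>v. snd v \<bullet> fst w)) (at l)" for w
    unfolding liouville_def by (auto intro!: derivative_eq_intros)
  then show ?thesis
    unfolding symplectic_def by (simp add: frechet_derivative_at [OF D, symmetric])
qed

end

theory Submission
  imports Defs
begin

text \<open>
  Near a short geodesic all nearby points are reached by geodesics ending at \<open>\<gamma>(t)\<close>, so by minimality
  and the inverse function theorem \<open>\<partial>\<^sub>t c\<^sub>t\<close> is, up to terms linear in the momentum, half the square
  of the final horizontal momentum.  Its Hessian at \<open>x\<^sub>0\<close> is therefore determined by the Jacobi fields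
  that vanish at \<open>\<gamma>(t)\<close>; by conservation of the symplectic form these are dual to those vanishing at
  \<open>x\<^sub>0\<close>.  The Gauss lemma decouples the direction of \<open>\<gamma>\<close>, which contributes \<open>1 / t\<^sup>2\<close>.  The
  transversal eigenvalue is \<open>(M(t) / t)\<^sup>2\<close>, where \<open>M(t) / t\<close> is the initial angular momentum variation of
  the Jacobi field with prescribed horizontal value at time \<open>t\<close>.  By Cramer's rule \<open>M\<close> is a quotient of
  two determinants of Jacobi fields; after division by powers of \<open>t\<close> their power series give
  \<open>M = - 4 - R\<^sub>1\<^sub>1 t\<^sup>2 / 126 + O(t\<^sup>3)\<close>, hence \<open>M\<^sup>2 = 16 + 4 R\<^sub>1\<^sub>1 t\<^sup>2 / 63 + O(t\<^sup>3)\<close>.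

  Minimality is proved by calibration: a competing curve is compared with the geodesic at equal values of a
  linear functional of the first two coordinates.  Ampleness and equiregularity are only used to
  exclude constant curves and zeros of \<open>h\<^sub>3\<close>: at such a zero the fourth flag is still a proper subspace, or
  the curve is a straight line.
\<close>

section \<open>Power series solutions of homogeneous quadratic differential equations\<close>

text \<open>The Jacobi fields in the Hessian vanish at \<gamma>(t) and belong to the covector
  \<open>m t\<close>, so each t has its own flow; duality trades them for fields of the fixed
  covector \<open>m 0\<close>, and only then do the quotients of determinants form one power series
  in t. The analysis rests on one device: with a few monomials added as unknowns, the geodesic
  equations are homogeneous quadratic, so a geometric majorant yields solutions on a time interval
  uniform in the covector, differentiability in the covector (the variational equation is of the
  same kind) and expansions in t. Since \<gamma>(t) moves with t, the inverse function theorem is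
  applied to time and covector jointly, and minimality must hold uniformly in both. For the inverse
  only continuity of its first derivatives is established; this suffices for a second differential
  because the derivative of the cost rate has factors vanishing at x0. The constant 16 is the square
  of -4, a ratio of two rational determinants. In the basis that is constructed the first vector is
  normal to the geodesic and the second is its normalised velocity.\<close>

lemma has_vector_derivative_eventually_eq:
  assumes "(f has_vector_derivative D) (at s)" "\<forall>\<^sub>F s in nhds s. f s = g s"
  shows "(g has_vector_derivative D) (at s)"
proof -
  have "\<forall>\<^sub>F x in nhds s. x \<in> UNIV \<longrightarrow> f x = g x"
    using assms(2) by (auto elim: eventually_mono)
  then show ?thesis
    using assms(1) has_vector_derivative_cong_ev [where S = UNIV and x = s and f = f and g = g] eventually_nhds_x_imp_x [OF assms(2)]
    by blast
qed

lemma norm_snd_le_norm: "norm (snd p) \<le> norm p"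
  by (metis norm_snd_le prod.collapse)

locale quadratic_ode =
  fixes B :: "'a::euclidean_space \<Rightarrow> 'a \<Rightarrow> 'a"
  assumes bilin: "bounded_bilinear B"
begin

text \<open>Taylor coefficients of the solution of z' = B z z: comparison of coefficients turns the
  right side into a Cauchy product.\<close>

fun coef :: "nat \<Rightarrow> 'a \<Rightarrow> 'a" where
  "coef 0 z = z"
| "coef (Suc n) z = (1 / real (Suc n)) *\<^sub>R (\<Sum>i\<le>n. B (coef i z) (coef (n - i) z))"

definition K :: real where
  "K = (SOME K. 0 < K \<and> (\<forall>a b. norm (B a b) \<le> norm a * norm b * K))"

lemma K: "0 < K" "norm (B a b) \<le> norm a * norm b * K"
proof -
  have "\<exists>K. 0 < K \<and> (\<forall>a b. norm (B a b) \<le> norm a * norm b * K)"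
    using bounded_bilinear.pos_bounded [OF bilin] by blast
  then have "0 < K \<and> (\<forall>a b. norm (B a b) \<le> norm a * norm b * K)"
    unfolding K_def by (rule someI_ex)
  then show "0 < K" "norm (B a b) \<le> norm a * norm b * K" by blast+
qed

text \<open>The numbers \<open>R * (K * R) ^ n\<close> are the Taylor coefficients of R / (1 - K R
  s), the solution of the scalar equation z' = K z^2 with z(0) = R, which majorises the given
  equation.\<close>

lemma norm_coef_le:
  assumes "norm z \<le> R"
  shows "norm (coef n z) \<le> R * (K * R) ^ n"
proof (induction n rule: less_induct)
  case (less n)
  have R: "0 \<le> R" using assms norm_ge_zero order_trans by blast
  show ?case
  proof (cases n)
    case 0
    then show ?thesis using assms by simp
  next
    case (Suc m)
    have b: "norm (B (coef i z) (coef (m - i) z)) \<le> R * (K * R) ^ Suc m" if "i \<le> m" for i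
    proof -
      have "norm (B (coef i z) (coef (m - i) z)) \<le> norm (coef i z) * norm (coef (m - i) z) * K"
        by (rule K)
      also have "\<dots> \<le> (R * (K * R) ^ i) * (R * (K * R) ^ (m - i)) * K"
        using that K(1) R by (intro mult_mono less.IH mult_nonneg_nonneg) (auto simp: Suc)
      also have "\<dots> = R * (K * R) ^ Suc m"
        using that by (simp add: field_simps flip: power_add power_mult_distrib)
      finally show ?thesis .
    qed
    have "norm (coef n z) = (1 / real (Suc m)) * norm (\<Sum>i\<le>m. B (coef i z) (coef (m - i) z))"
      by (simp add: Suc)
    also have "\<dots> \<le> (1 / real (Suc m)) * (\<Sum>i\<le>m. R * (K * R) ^ Suc m)"
      by (intro mult_left_mono sum_norm_le b) auto
    also have "\<dots> = R * (K * R) ^ Suc m" by (simp del: power_Suc)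
    finally show ?thesis by (simp add: Suc)
  qed
qed

definition flow :: "'a \<Rightarrow> real \<Rightarrow> 'a" where
  "flow z s = (\<Sum>n. s ^ n *\<^sub>R coef n z)"

lemma term_bound:
  assumes "norm z \<le> R" "\<bar>s\<bar> \<le> \<rho>"
  shows "norm (s ^ n *\<^sub>R coef n z) \<le> R * (\<rho> * (K * R)) ^ n"
proof -
  have "norm (s ^ n *\<^sub>R coef n z) = \<bar>s\<bar> ^ n * norm (coef n z)" by (simp add: power_abs)
  also have "\<dots> \<le> \<rho> ^ n * (R * (K * R) ^ n)"
    using assms by (intro mult_mono power_mono norm_coef_le) auto
  finally show ?thesis by (simp add: power_mult_distrib algebra_simps)
qed

lemma summable_majorant:
  assumes "0 \<le> \<rho>" "0 \<le> R" "\<rho> * (K * R) < 1"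
  shows "summable (\<lambda>n. R * (\<rho> * (K * R)) ^ n)"
  using assms K(1) by (intro summable_mult summable_geometric) (auto simp: abs_mult)

lemma summable_norm_flow:
  assumes "norm z \<le> R" "\<bar>s\<bar> * (K * R) < 1"
  shows "summable (\<lambda>n. norm (s ^ n *\<^sub>R coef n z))"
proof (rule summable_comparison_test' [OF summable_majorant [of "\<bar>s\<bar>" R]])
  show "0 \<le> R" using assms norm_ge_zero order_trans by blast
qed (use assms term_bound [of z R s "\<bar>s\<bar>"] in auto)

lemma flow_sums:
  assumes "norm z \<le> R" "\<bar>s\<bar> * (K * R) < 1"
  shows "(\<lambda>n. s ^ n *\<^sub>R coef n z) sums flow z s"
  unfolding flow_def
  using summable_norm_cancel [OF summable_norm_flow [OF assms]] by (rule summable_sums)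

lemma flow_0 [simp]: "flow z 0 = z"
proof -
  have "(\<lambda>n. 0 ^ n *\<^sub>R coef n z) sums (0 ^ 0 *\<^sub>R coef 0 z)"
    using sums_finite [of "{0}" "\<lambda>n. (0::real) ^ n *\<^sub>R coef n z"] by simp
  then show ?thesis unfolding flow_def by (simp add: sums_iff)
qed

lemma flow_inner_sums:
  assumes "norm z \<le> R" "\<bar>s\<bar> * (K * R) < 1"
  shows "(\<lambda>n. (coef n z \<bullet> b) * s ^ n) sums (flow z s \<bullet> b)"
  using bounded_linear.sums [OF bounded_linear_inner_left flow_sums [OF assms], of b]
  by (simp add: mult.commute)

lemma summable_norm_inner:
  assumes "norm z \<le> R" "\<bar>s\<bar> * (K * R) < 1" "b \<in> Basis"
  shows "summable (\<lambda>n. norm ((coef n z \<bullet> b) * s ^ n))"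
  using summable_norm_flow [OF assms(1,2)]
proof (rule summable_comparison_test')
  show "norm (norm ((coef n z \<bullet> b) * s ^ n)) \<le> norm (s ^ n *\<^sub>R coef n z)" for n
    using mult_right_mono [OF Basis_le_norm [OF assms(3), of "coef n z"], of "\<bar>s\<bar> ^ n"]
    by (simp add: abs_mult mult.commute power_abs)
qed

lemma bilin_expand: "B x y = (\<Sum>b\<in>Basis. \<Sum>c\<in>Basis. ((x \<bullet> b) * (y \<bullet> c)) *\<^sub>R B b c)"
proof -
  interpret bounded_bilinear B by (rule bilin)
  have "B x y = B (\<Sum>b\<in>Basis. (x \<bullet> b) *\<^sub>R b) (\<Sum>c\<in>Basis. (y \<bullet> c) *\<^sub>R c)"
    by (simp add: euclidean_representation)
  also have "\<dots> = (\<Sum>c\<in>Basis. \<Sum>b\<in>Basis. ((x \<bullet> b) * (y \<bullet> c)) *\<^sub>R B b c)"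
    by (simp add: sum_left sum_right scaleR_left scaleR_right scaleR_sum_right mult.commute)
  also have "\<dots> = (\<Sum>b\<in>Basis. \<Sum>c\<in>Basis. ((x \<bullet> b) * (y \<bullet> c)) *\<^sub>R B b c)"
    by (rule sum.swap)
  finally show ?thesis .
qed

text \<open>In a basis, by \<open>bilin_expand\<close>, B of two series is a finite combination of
  products of absolutely convergent real series, to which the Cauchy product applies.\<close>

lemma flow_product_sums:
  assumes "norm z \<le> R" "\<bar>s\<bar> * (K * R) < 1"
  shows "(\<lambda>n. s ^ n *\<^sub>R (\<Sum>i\<le>n. B (coef i z) (coef (n - i) z))) sums B (flow z s) (flow z s)"
proof -
  have "(\<lambda>n. \<Sum>i\<le>n. ((coef i z \<bullet> b) * s ^ i) * ((coef (n - i) z \<bullet> c) * s ^ (n - i)))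
      sums ((flow z s \<bullet> b) * (flow z s \<bullet> c))" if "b \<in> Basis" "c \<in> Basis" for b c
    using Cauchy_product_sums [OF summable_norm_inner [OF assms that(1)] summable_norm_inner [OF assms that(2)]]
      flow_inner_sums [OF assms, of b] flow_inner_sums [OF assms, of c]
    by (simp add: sums_iff)
  then have "(\<lambda>n. \<Sum>b\<in>Basis. \<Sum>c\<in>Basis.
        (\<Sum>i\<le>n. ((coef i z \<bullet> b) * s ^ i) * ((coef (n - i) z \<bullet> c) * s ^ (n - i))) *\<^sub>R B b c)
      sums (\<Sum>b\<in>Basis. \<Sum>c\<in>Basis. ((flow z s \<bullet> b) * (flow z s \<bullet> c)) *\<^sub>R B b c)"
    by (intro sums_sum sums_scaleR_left)
  moreover have "(\<Sum>b\<in>Basis. \<Sum>c\<in>Basis.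
        (\<Sum>i\<le>n. ((coef i z \<bullet> b) * s ^ i) * ((coef (n - i) z \<bullet> c) * s ^ (n - i))) *\<^sub>R B b c)
      = s ^ n *\<^sub>R (\<Sum>i\<le>n. B (coef i z) (coef (n - i) z))" (is "?L = _") for n
  proof -
    have p: "((coef i z \<bullet> b) * s ^ i) * ((coef (n - i) z \<bullet> c) * s ^ (n - i))
        = s ^ n * ((coef i z \<bullet> b) * (coef (n - i) z \<bullet> c))" if "i \<le> n" for i b c
      using that by (simp add: algebra_simps flip: power_add)
    have "?L = (\<Sum>b\<in>Basis. \<Sum>c\<in>Basis. \<Sum>i\<le>n.
        s ^ n *\<^sub>R ((coef i z \<bullet> b) * (coef (n - i) z \<bullet> c)) *\<^sub>R B b c)"
      by (simp add: p scaleR_sum_left)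
    also have "\<dots> = (\<Sum>b\<in>Basis. \<Sum>i\<le>n. \<Sum>c\<in>Basis.
        s ^ n *\<^sub>R ((coef i z \<bullet> b) * (coef (n - i) z \<bullet> c)) *\<^sub>R B b c)"
      by (intro sum.cong refl sum.swap)
    also have "\<dots> = (\<Sum>i\<le>n. \<Sum>b\<in>Basis. \<Sum>c\<in>Basis.
        s ^ n *\<^sub>R ((coef i z \<bullet> b) * (coef (n - i) z \<bullet> c)) *\<^sub>R B b c)"
      by (rule sum.swap)
    also have "\<dots> = s ^ n *\<^sub>R (\<Sum>i\<le>n. B (coef i z) (coef (n - i) z))"
      by (subst bilin_expand) (simp add: scaleR_sum_right)
    finally show ?thesis .
  qed
  ultimately show ?thesis by (subst bilin_expand) simp
qed

lemma flow_has_vector_derivative: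
  assumes "norm z \<le> R" "\<bar>s\<bar> * (K * R) < 1"
  shows "((flow z) has_vector_derivative B (flow z s) (flow z s)) (at s within S)"
proof -
  have R: "0 \<le> R" using assms norm_ge_zero order_trans by blast
  \<comment> \<open>Termwise differentiation at s needs convergence at a strictly larger
    radius.\<close>
  obtain \<rho> where \<rho>: "\<bar>s\<bar> < \<rho>" "\<rho> * (K * R) < 1"
  proof (cases "K * R = 0")
    case True
    then show ?thesis by (intro that [of "\<bar>s\<bar> + 1"]) auto
  next
    case False
    then have p: "0 < K * R" using K(1) R by (simp add: zero_less_mult_iff)
    then have "\<bar>s\<bar> < 1 / (K * R)" using assms by (simp add: field_simps)
    then obtain \<rho> where "\<bar>s\<bar> < \<rho>" "\<rho> < 1 / (K * R)" using dense by blast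
    then show ?thesis using p by (intro that [of \<rho>]) (auto simp: field_simps)
  qed
  have \<rho>0: "0 < \<rho>" using \<rho>(1) by linarith
  have "((\<lambda>x. flow z x \<bullet> b) has_real_derivative (B (flow z s) (flow z s) \<bullet> b)) (at s)" if b: "b \<in> Basis" for b
  proof -
    have "((\<lambda>x. \<Sum>n. (coef n z \<bullet> b) * x ^ n) has_real_derivative
        (\<Sum>n. diffs (\<lambda>n. coef n z \<bullet> b) n * s ^ n)) (at s)"
    proof (rule termdiffs_strong)
      show "summable (\<lambda>n. (coef n z \<bullet> b) * \<rho> ^ n)"
        using flow_inner_sums [OF assms(1), of \<rho> b] \<rho> \<rho>0 by (simp add: sums_iff)
    qed (use \<rho> in auto)
    moreover have "(\<Sum>n. diffs (\<lambda>n. coef n z \<bullet> b) n * s ^ n) = B (flow z s) (flow z s) \<bullet> b"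
    proof -
      \<comment> \<open>The factor n + 1 from differentiation cancels the factor 1 / (n + 1) in
        \<open>coef\<close> and leaves the Cauchy product.\<close>
      have "diffs (\<lambda>n. coef n z \<bullet> b) n * s ^ n
          = (s ^ n *\<^sub>R (\<Sum>i\<le>n. B (coef i z) (coef (n - i) z))) \<bullet> b" for n
        by (simp add: diffs_def inner_sum_left field_simps del: of_nat_Suc)
      then show ?thesis
        using bounded_linear.sums [OF bounded_linear_inner_left flow_product_sums [OF assms], of b]
        by (simp only: sums_iff)
    qed
    moreover have "\<forall>\<^sub>F x in nhds s. (\<Sum>n. (coef n z \<bullet> b) * x ^ n) = flow z x \<bullet> b"
    proof -
      have "\<forall>\<^sub>F x in nhds s. x \<in> {-\<rho><..<\<rho>}"
        using \<rho> by (intro eventually_nhds_in_open) auto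
      then show ?thesis
      proof eventually_elim
        case (elim x)
        then have "\<bar>x\<bar> * (K * R) \<le> \<rho> * (K * R)" using K(1) R by (intro mult_right_mono) auto
        then show ?case using flow_inner_sums [OF assms(1), of x b] \<rho> by (simp add: sums_iff)
      qed
    qed
    ultimately show ?thesis
      by (simp add: DERIV_cong_ev)
  qed
  then have "((flow z) has_vector_derivative B (flow z s) (flow z s)) (at s)"
    unfolding has_vector_derivative_def
    by (subst has_derivative_componentwise_within)
       (auto simp: has_field_derivative_def mult_commute_abs)
  then show ?thesis by (rule has_vector_derivative_at_within)
qed

lemma continuous_coef: "continuous_on S (coef n)"
proof (induction n rule: less_induct)
  case (less n)
  interpret bounded_bilinear B by (rule bilin)
  show ?case
  proof (cases n)
    case 0
    then show ?thesis by (simp add: continuous_on_id cong: continuous_on_cong)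
  next
    case (Suc m)
    have "coef n = (\<lambda>z. (1 / real (Suc m)) *\<^sub>R (\<Sum>i\<le>m. B (coef i z) (coef (m - i) z)))"
      by (simp add: Suc fun_eq_iff)
    then show ?thesis
      using less.IH by (auto intro!: continuous_intros continuous_on simp: Suc simp del: of_nat_Suc coef.simps)
  qed
qed

lemma continuous_flow:
  assumes "0 \<le> R" "0 \<le> \<rho>" "\<rho> * (K * R) < 1"
  shows "continuous_on (cball 0 R \<times> {-\<rho>..\<rho>}) (\<lambda>(z, s). flow z s)"
proof (rule uniform_limit_theorem)
  have "uniform_limit (cball 0 R \<times> {-\<rho>..\<rho>}) (\<lambda>n p. \<Sum>i<n. snd p ^ i *\<^sub>R coef i (fst p))
     (\<lambda>p. \<Sum>i. snd p ^ i *\<^sub>R coef i (fst p)) sequentially"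
    using assms term_bound [of _ R _ \<rho>]
    by (intro Weierstrass_m_test [OF _ summable_majorant [of \<rho> R]]) auto
  then show "uniform_limit (cball 0 R \<times> {-\<rho>..\<rho>}) (\<lambda>n p. \<Sum>i<n. snd p ^ i *\<^sub>R coef i (fst p))
     (\<lambda>(z, s). flow z s) sequentially"
    by (simp add: flow_def case_prod_unfold)
  show "\<forall>\<^sub>F n in sequentially.
     continuous_on (cball 0 R \<times> {-\<rho>..\<rho>}) (\<lambda>p. \<Sum>i<n. snd p ^ i *\<^sub>R coef i (fst p))"
    by (intro always_eventually allI continuous_intros continuous_on_compose2 [OF continuous_coef]) auto
qed simp

section \<open>The variational equation and differentiability of the flow in its initial
  value\<close>

text \<open>The tangent system: the second component solves the equation linearised along the first.
  It is again homogeneous quadratic, so every bound proved for B applies to it.\<close>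

definition B2 :: "'a \<times> 'a \<Rightarrow> 'a \<times> 'a \<Rightarrow> 'a \<times> 'a" where
  "B2 p q = (B (fst p) (fst q), B (fst p) (snd q) + B (snd p) (fst q))"

lemma B2_simps: "fst (B2 p q) = B (fst p) (fst q)" "snd (B2 p q) = B (fst p) (snd q) + B (snd p) (fst q)"
  by (simp_all add: B2_def)

lemma bounded_bilinear_B2: "bounded_bilinear B2"
proof -
  interpret bounded_bilinear B by (rule bilin)
  have "bilinear B2"
    by (auto simp: bilinear_def B2_def intro!: linearI simp: add_left add_right scaleR_left scaleR_right algebra_simps)
  then show ?thesis by (simp add: bilinear_conv_bounded_bilinear)
qed

lemma quadratic_ode_B2: "quadratic_ode B2"
  by (rule quadratic_ode.intro) (rule bounded_bilinear_B2)

definition dcoef :: "nat \<Rightarrow> 'a \<Rightarrow> 'a \<Rightarrow> 'a" where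
  "dcoef n z k = snd (quadratic_ode.coef B2 n (z, k))"

definition dflow :: "'a \<Rightarrow> real \<Rightarrow> 'a \<Rightarrow> 'a" where
  "dflow z s k = (\<Sum>n. s ^ n *\<^sub>R dcoef n z k)"

lemma fst_tangent_coef: "fst (quadratic_ode.coef B2 n (z, k)) = coef n z"
proof (induction n rule: less_induct)
  case (less n)
  interpret tan: quadratic_ode B2 by (rule quadratic_ode_B2)
  show ?case
  proof (cases n)
    case (Suc m)
    then show ?thesis
      using less.IH by (auto simp: fst_sum B2_simps simp del: of_nat_Suc intro!: sum.cong)
  qed simp
qed

lemma dcoef_0: "dcoef 0 z k = k"
proof -
  interpret tan: quadratic_ode B2 by (rule quadratic_ode_B2)
  show ?thesis by (simp add: dcoef_def)
qed

lemma dcoef_Suc: "dcoef (Suc n) z k = (1 / real (Suc n)) *\<^sub>R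
    (\<Sum>i\<le>n. B (coef i z) (dcoef (n - i) z k) + B (dcoef i z k) (coef (n - i) z))"
proof -
  interpret tan: quadratic_ode B2 by (rule quadratic_ode_B2)
  show ?thesis
    by (simp add: dcoef_def snd_sum B2_simps fst_tangent_coef del: of_nat_Suc)
qed

text \<open>Each coefficient is a polynomial in the initial value, and the product rule turns its
  recursion into that of the tangent system.\<close>

lemma coef_has_derivative: "(coef n has_derivative dcoef n z) (at z within S)"
proof (induction n rule: less_induct)
  case (less n)
  interpret bounded_bilinear B by (rule bilin)
  show ?case
  proof (cases n)
    case 0
    have "coef 0 = (\<lambda>z. z)" "dcoef 0 z = (\<lambda>z. z)" by (auto simp: fun_eq_iff dcoef_0)
    then show ?thesis by (simp add: 0)
  next
    case (Suc m)
    have "((\<lambda>z. (1 / real (Suc m)) *\<^sub>R (\<Sum>i\<le>m. B (coef i z) (coef (m - i) z))) has_derivative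
       (\<lambda>k. (1 / real (Suc m)) *\<^sub>R
        (\<Sum>i\<le>m. B (coef i z) (dcoef (m - i) z k) + B (dcoef i z k) (coef (m - i) z)))) (at z within S)"
      using less.IH
      by (intro has_derivative_scaleR_right has_derivative_sum FDERIV) (auto simp: Suc)
    moreover have "coef n = (\<lambda>z. (1 / real (Suc m)) *\<^sub>R (\<Sum>i\<le>m. B (coef i z) (coef (m - i) z)))"
      by (simp add: Suc fun_eq_iff)
    moreover have "dcoef n z = (\<lambda>k. (1 / real (Suc m)) *\<^sub>R
        (\<Sum>i\<le>m. B (coef i z) (dcoef (m - i) z k) + B (dcoef i z k) (coef (m - i) z)))"
      by (simp add: Suc fun_eq_iff dcoef_Suc del: of_nat_Suc)
    ultimately show ?thesis by simp
  qed
qed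

lemma linear_dcoef: "linear (dcoef n z)"
  using coef_has_derivative has_derivative_linear by blast

definition K2 :: real where "K2 = quadratic_ode.K B2"

lemma K2_pos: "0 < K2"
proof -
  interpret tan: quadratic_ode B2 by (rule quadratic_ode_B2)
  show ?thesis by (simp add: K2_def tan.K)
qed

lemma norm_pair_le: "norm z \<le> R \<Longrightarrow> norm k \<le> 1 \<Longrightarrow> norm (z, k) \<le> R + 1"
  using norm_Pair_le [of z k] by linarith

text \<open>The majorant of the tangent system needs a bound on the whole pair. It is therefore used
  at a unit vector, where norm (z, k) \<le> R + 1, and linearity in k supplies the factor
  \<open>norm k\<close>.\<close>

lemma dterm_bound:
  assumes "norm z \<le> R" "\<bar>s\<bar> \<le> \<rho>"
  shows "norm (s ^ n *\<^sub>R dcoef n z k) \<le> (R + 1) * (\<rho> * (K2 * (R + 1))) ^ n * norm k"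
proof (cases "k = 0")
  case True
  then show ?thesis using linear_0 [OF linear_dcoef] by simp
next
  case False
  interpret tan: quadratic_ode B2 by (rule quadratic_ode_B2)
  let ?u = "(1 / norm k) *\<^sub>R k"
  have "norm (s ^ n *\<^sub>R dcoef n z ?u) \<le> norm (s ^ n *\<^sub>R tan.coef n (z, ?u))"
    by (simp add: dcoef_def mult_left_mono norm_snd_le_norm)
  also have "\<dots> \<le> (R + 1) * (\<rho> * (K2 * (R + 1))) ^ n"
    unfolding K2_def using assms False by (intro tan.term_bound norm_pair_le) auto
  finally have "norm (s ^ n *\<^sub>R dcoef n z ?u) * norm k \<le> (R + 1) * (\<rho> * (K2 * (R + 1))) ^ n * norm k"
    by (rule mult_right_mono) simp
  moreover have "norm (s ^ n *\<^sub>R dcoef n z ?u) * norm k = norm (s ^ n *\<^sub>R dcoef n z k)"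
    using False by (simp add: linear_cmul [OF linear_dcoef])
  ultimately show ?thesis by (simp only:)
qed

lemma dflow_sums:
  assumes "norm z \<le> R" "\<bar>s\<bar> * (K2 * (R + 1)) < 1"
  shows "(\<lambda>n. s ^ n *\<^sub>R dcoef n z k) sums dflow z s k"
proof -
  interpret tan: quadratic_ode B2 by (rule quadratic_ode_B2)
  have "0 \<le> R" using assms norm_ge_zero order_trans by blast
  then have "summable (\<lambda>n. (R + 1) * (\<bar>s\<bar> * (K2 * (R + 1))) ^ n * norm k)"
    using assms(2) unfolding K2_def by (intro summable_mult2 tan.summable_majorant) auto
  then have "summable (\<lambda>n. s ^ n *\<^sub>R dcoef n z k)"
    by (rule summable_comparison_test') (use dterm_bound [OF assms(1) order_refl] in auto)
  then show ?thesis unfolding dflow_def by (rule summable_sums)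
qed

lemma tangent_flow:
  assumes "norm z \<le> R" "norm k \<le> 1" "\<bar>s\<bar> * (K2 * (R + 1)) < 1"
  shows "quadratic_ode.flow B2 (z, k) s = (flow z s, dflow z s k)"
proof -
  interpret tan: quadratic_ode B2 by (rule quadratic_ode_B2)
  have "(\<lambda>n. s ^ n *\<^sub>R tan.coef n (z, k)) sums tan.flow (z, k) s"
    using assms(3) by (intro tan.flow_sums [of _ "R + 1"] norm_pair_le assms) (simp add: K2_def)
  from bounded_linear.sums [OF bounded_linear_fst this] bounded_linear.sums [OF bounded_linear_snd this]
  show ?thesis
    by (simp add: fst_tangent_coef prod_eq_iff flow_def dflow_def sums_iff flip: dcoef_def)
qed

lemma linear_dflow:
  assumes "norm z \<le> R" "\<bar>s\<bar> * (K2 * (R + 1)) < 1"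
  shows "linear (dflow z s)"
proof (rule linearI)
  show "dflow z s (k + l) = dflow z s k + dflow z s l" for k l
    using sums_add [OF dflow_sums [OF assms, of k] dflow_sums [OF assms, of l]]
      sums_unique2 [OF _ dflow_sums [OF assms, of "k + l"]]
    by (simp add: linear_add [OF linear_dcoef] scaleR_right_distrib)
  show "dflow z s (c *\<^sub>R k) = c *\<^sub>R dflow z s k" for c k
    using sums_scaleR_right [OF dflow_sums [OF assms, of k], of c]
      sums_unique2 [OF _ dflow_sums [OF assms, of "c *\<^sub>R k"]]
    by (simp add: linear_cmul [OF linear_dcoef] mult.commute)
qed

lemma dflow_0: "norm z \<le> R \<Longrightarrow> dflow z 0 k = k"
  using sums_finite [of "{0}" "\<lambda>n. (0::real) ^ n *\<^sub>R dcoef n z k"]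
  by (simp add: dflow_def sums_iff dcoef_0)

lemma dflow_has_vector_derivative:
  assumes "norm z \<le> R" "\<bar>s\<bar> * (K2 * (R + 1)) < 1"
  shows "((\<lambda>s. dflow z s k) has_vector_derivative
    B (flow z s) (dflow z s k) + B (dflow z s k) (flow z s)) (at s within S)"
proof -
  interpret bounded_bilinear B by (rule bilin)
  interpret tan: quadratic_ode B2 by (rule quadratic_ode_B2)
  have unit: "((\<lambda>s. dflow z s k) has_vector_derivative
    B (flow z s) (dflow z s k) + B (dflow z s k) (flow z s)) (at s)" if k: "norm k \<le> 1" for k
  proof -
    have "(tan.flow (z, k) has_vector_derivative B2 (tan.flow (z, k) s) (tan.flow (z, k) s)) (at s)"
      using assms by (intro tan.flow_has_vector_derivative [of _ "R + 1"] norm_pair_le k) (auto simp: K2_def)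
    then have "((\<lambda>s. snd (tan.flow (z, k) s)) has_vector_derivative
        snd (B2 (tan.flow (z, k) s) (tan.flow (z, k) s))) (at s)"
      by (rule bounded_linear.has_vector_derivative [OF bounded_linear_snd])
    then have "((\<lambda>s. snd (tan.flow (z, k) s)) has_vector_derivative
        B (flow z s) (dflow z s k) + B (dflow z s k) (flow z s)) (at s)"
      by (simp add: tangent_flow [OF assms(1) k assms(2)] B2_simps)
    moreover have "\<forall>\<^sub>F s in nhds s. snd (tan.flow (z, k) s) = dflow z s k"
    proof -
      have "\<forall>\<^sub>F s in nhds s. s \<in> {s. \<bar>s\<bar> * (K2 * (R + 1)) < 1}"
        using assms(2) by (intro eventually_nhds_in_open open_Collect_less continuous_intros) auto
      then show ?thesis
        by eventually_elim (use tangent_flow [OF assms(1) k] in auto)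
    qed
    ultimately show ?thesis
      by (rule has_vector_derivative_eventually_eq)
  qed
  show ?thesis
  proof (cases "k = 0")
    case True
    then show ?thesis using unit [of 0] by (auto intro: has_vector_derivative_at_within)
  next
    case False
    let ?u = "(1 / norm k) *\<^sub>R k"
    have k: "k = norm k *\<^sub>R ?u" using False by simp
    have lin: "\<forall>\<^sub>F s in nhds s. norm k *\<^sub>R dflow z s ?u = dflow z s k"
    proof -
      have "\<forall>\<^sub>F s in nhds s. s \<in> {s. \<bar>s\<bar> * (K2 * (R + 1)) < 1}"
        using assms(2) by (intro eventually_nhds_in_open open_Collect_less continuous_intros) auto
      then show ?thesis
        by eventually_elim
          (use linear_cmul [OF linear_dflow [OF assms(1)], of _ "norm k" ?u] False in auto)
    qed
    have "((\<lambda>s. norm k *\<^sub>R dflow z s ?u) has_vector_derivative norm k *\<^sub>R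
      (B (flow z s) (dflow z s ?u) + B (dflow z s ?u) (flow z s))) (at s)"
      by (rule bounded_linear.has_vector_derivative [OF bounded_linear_scaleR_right unit]) simp
    also have "norm k *\<^sub>R (B (flow z s) (dflow z s ?u) + B (dflow z s ?u) (flow z s))
      = B (flow z s) (norm k *\<^sub>R dflow z s ?u) + B (norm k *\<^sub>R dflow z s ?u) (flow z s)"
      by (simp add: scaleR_left scaleR_right scaleR_right_distrib)
    also have "norm k *\<^sub>R dflow z s ?u = dflow z s k"
      using eventually_nhds_x_imp_x [OF lin] .
    finally have "((\<lambda>s. norm k *\<^sub>R dflow z s ?u) has_vector_derivative
       B (flow z s) (dflow z s k) + B (dflow z s k) (flow z s)) (at s)" .
    then have "((\<lambda>s. dflow z s k) has_vector_derivative
       B (flow z s) (dflow z s k) + B (dflow z s k) (flow z s)) (at s)"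
      by (rule has_vector_derivative_eventually_eq [OF _ lin])
    then show ?thesis by (rule has_vector_derivative_at_within)
  qed
qed

lemma continuous_dflow:
  assumes "0 \<le> R" "0 \<le> \<rho>" "\<rho> * (K2 * (R + 1)) < 1"
  shows "continuous_on (cball 0 R \<times> {-\<rho>..\<rho>}) (\<lambda>(z, s). dflow z s k)"
proof -
  interpret tan: quadratic_ode B2 by (rule quadratic_ode_B2)
  have small: "\<bar>s\<bar> * (K2 * (R + 1)) < 1" if "s \<in> {-\<rho>..\<rho>}" for s
  proof -
    have "\<bar>s\<bar> * (K2 * (R + 1)) \<le> \<rho> * (K2 * (R + 1))"
      using that K2_pos assms(1) by (intro mult_right_mono) auto
    then show ?thesis using assms(3) by linarith
  qed
  have unit: "continuous_on (cball 0 R \<times> {-\<rho>..\<rho>}) (\<lambda>(z, s). dflow z s k)" if k: "norm k \<le> 1" for k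
  proof -
    have "continuous_on (cball 0 R \<times> {-\<rho>..\<rho>}) (\<lambda>p. snd ((\<lambda>(z, s). tan.flow z s) ((fst p, k), snd p)))"
      using assms k norm_pair_le
      by (intro continuous_on_snd continuous_on_compose2 [OF tan.continuous_flow [of "R + 1" \<rho>]] continuous_intros)
         (auto simp: K2_def)
    then show ?thesis
      by (rule continuous_on_cong [THEN iffD1, rotated -1])
         (auto simp: tangent_flow [of _ R k] k small)
  qed
  show ?thesis
  proof (cases "k = 0")
    case True
    then show ?thesis using unit [of 0] by simp
  next
    case False
    have "continuous_on (cball 0 R \<times> {-\<rho>..\<rho>}) (\<lambda>p. norm k *\<^sub>R (\<lambda>(z, s). dflow z s ((1 / norm k) *\<^sub>R k)) p)"
      using False by (intro continuous_intros unit) auto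
    then show ?thesis
      by (rule continuous_on_cong [THEN iffD1, rotated -1])
         (use False in \<open>auto simp: linear_cmul [OF linear_dflow [of _ R]] small\<close>)
  qed
qed

lemma flow_has_derivative:
  assumes "norm z < R" "\<bar>s\<bar> * (K2 * (R + 1)) < 1" "\<bar>s\<bar> * (K * R) < 1"
  shows "((\<lambda>z. flow z s) has_derivative dflow z s) (at z)"
proof -
  have R: "0 < R" using assms(1) norm_ge_zero [of z] by linarith
  interpret tan: quadratic_ode B2 by (rule quadratic_ode_B2)
  define q where "q = \<bar>s\<bar> * (K2 * (R + 1))"
  have q: "0 \<le> q" "q < 1" using assms(2) K2_pos R by (auto simp: q_def)
  have "\<exists>g. \<forall>x\<in>ball 0 R. (\<lambda>n. s ^ n *\<^sub>R coef n x) sums g x \<and> (g has_derivative dflow x s) (at x within ball 0 R)"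
  proof (rule has_derivative_series)
    show "((\<lambda>z. s ^ n *\<^sub>R coef n z) has_derivative (\<lambda>k. s ^ n *\<^sub>R dcoef n x k)) (at x within ball 0 R)" for n x
      by (intro has_derivative_scaleR_right coef_has_derivative)
    show "(\<lambda>n. s ^ n *\<^sub>R coef n 0) sums flow 0 s"
      by (rule flow_sums [of _ R]) (use assms R in auto)
    show "\<forall>\<^sub>F n in sequentially. \<forall>x\<in>ball 0 R. \<forall>k.
       norm ((\<Sum>i<n. s ^ i *\<^sub>R dcoef i x k) - dflow x s k) \<le> e * norm k" if e: "e > 0" for e
    proof -
      \<comment> \<open>The tail of the differentiated series is dominated by the tail of a
        geometric series in q, uniformly over the ball and relative to
        \<open>norm k\<close>.\<close>
      have sq: "summable (\<lambda>n. (R + 1) * q ^ n)"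
        using q by (intro summable_mult summable_geometric) auto
      have "(\<lambda>n. \<Sum>i. (R + 1) * q ^ (i + n)) \<longlonglongrightarrow> 0" by (rule suminf_exist_split2 [OF sq])
      then have "\<forall>\<^sub>F n in sequentially. (\<Sum>i. (R + 1) * q ^ (i + n)) < e"
        using e by (rule order_tendstoD)
      then show ?thesis
      proof eventually_elim
        case (elim n)
        show ?case
        proof (intro ballI allI)
          fix x k :: 'a assume x: "x \<in> ball 0 R"
          have le: "norm (s ^ (i + n) *\<^sub>R dcoef (i + n) x k) \<le> (R + 1) * q ^ (i + n) * norm k" for i
            unfolding q_def using x by (intro dterm_bound) auto
          have sm: "summable (\<lambda>i. (R + 1) * q ^ (i + n) * norm k)"
            using summable_ignore_initial_segment [OF sq, of n] by (intro summable_mult2)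
          have ds: "(\<lambda>n. s ^ n *\<^sub>R dcoef n x k) sums dflow x s k"
            by (rule dflow_sums [of _ R]) (use x assms in auto)
          have "norm ((\<Sum>i<n. s ^ i *\<^sub>R dcoef i x k) - dflow x s k)
            = norm (\<Sum>i. s ^ (i + n) *\<^sub>R dcoef (i + n) x k)"
            using suminf_minus_initial_segment [OF sums_summable [OF ds], of n] ds
            by (simp add: sums_iff norm_minus_commute)
          also have "\<dots> \<le> (\<Sum>i. (R + 1) * q ^ (i + n) * norm k)"
            by (rule norm_suminf_le [OF le sm])
          also have "\<dots> = (\<Sum>i. (R + 1) * q ^ (i + n)) * norm k"
            using summable_ignore_initial_segment [OF sq, of n] by (rule suminf_mult2 [symmetric])
          also have "\<dots> \<le> e * norm k" using elim by (intro mult_right_mono) auto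
          finally show "norm ((\<Sum>i<n. s ^ i *\<^sub>R dcoef i x k) - dflow x s k) \<le> e * norm k" .
        qed
      qed
    qed
  qed (use R in auto)
  then obtain g where g: "\<And>x. x \<in> ball 0 R \<Longrightarrow> (\<lambda>n. s ^ n *\<^sub>R coef n x) sums g x"
    "\<And>x. x \<in> ball 0 R \<Longrightarrow> (g has_derivative dflow x s) (at x within ball 0 R)" by blast
  have eq: "g x = flow x s" if "x \<in> ball 0 R" for x
    using g(1) [OF that] by (simp add: flow_def sums_iff)
  have "(g has_derivative dflow z s) (at z)"
    using g(2) [of z] assms(1) at_within_open [of z "ball 0 R"] by simp
  then show ?thesis
    by (rule has_derivative_transform_within_open [where s = "ball 0 R"]) (use assms(1) eq in auto)
qed

end

section \<open>The exponential map of the Cartan group\<close>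

context quadratic_ode begin

text \<open>One time that serves both the flow and its derivative; the summand 1 makes the two
  convergence conditions strict.\<close>

definition time_bound :: "real \<Rightarrow> real" where
  "time_bound R = 1 / (1 + K * R + K2 * (R + 1))"

lemma time_bound:
  assumes "0 \<le> R"
  shows "0 < time_bound R"
    and "\<bar>s\<bar> \<le> time_bound R \<Longrightarrow> \<bar>s\<bar> * (K * R) < 1"
    and "\<bar>s\<bar> \<le> time_bound R \<Longrightarrow> \<bar>s\<bar> * (K2 * (R + 1)) < 1"
proof -
  have p: "0 \<le> K * R" "0 < K2 * (R + 1)" using assms K(1) K2_pos by auto
  then show "0 < time_bound R" by (simp add: time_bound_def)
  assume "\<bar>s\<bar> \<le> time_bound R"
  then have s: "\<bar>s\<bar> + \<bar>s\<bar> * (K * R) + \<bar>s\<bar> * (K2 * (R + 1)) \<le> 1"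
    using p by (simp add: time_bound_def field_simps)
  have q: "0 \<le> \<bar>s\<bar> * (K * R)" "0 \<le> \<bar>s\<bar> * (K2 * (R + 1))" "s \<noteq> 0 \<Longrightarrow> 0 < \<bar>s\<bar>"
    using p by auto
  show "\<bar>s\<bar> * (K * R) < 1"
  proof (cases "s = 0")
    case False
    show ?thesis using s q(1,2) q(3) [OF False] by linarith
  qed simp
  show "\<bar>s\<bar> * (K2 * (R + 1)) < 1"
  proof (cases "s = 0")
    case False
    show ?thesis using s q(1,2) q(3) [OF False] by linarith
  qed simp
qed

lemma linear_flow_has_fps_expansion:
  fixes f :: "'a \<Rightarrow> real"
  assumes f: "bounded_linear f"
  shows "(\<lambda>s. f (flow z s)) has_fps_expansion Abs_fps (\<lambda>n. f (coef n z))"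
proof (rule has_fps_expansionI)
  have "\<forall>\<^sub>F s in nhds 0. s \<in> {-time_bound (norm z)<..<time_bound (norm z)}"
    using time_bound(1) [of "norm z"] by (intro eventually_nhds_in_open) auto
  then show "\<forall>\<^sub>F s in nhds 0. (\<lambda>n. fps_nth (Abs_fps (\<lambda>n. f (coef n z))) n * s ^ n) sums f (flow z s)"
  proof eventually_elim
    case (elim s)
    then have "(\<lambda>n. s ^ n *\<^sub>R coef n z) sums flow z s"
      by (intro flow_sums [of _ "norm z"] time_bound) auto
    from bounded_linear.sums [OF f this] show ?case
      using f by (simp add: linear_simps mult.commute)
  qed
qed

lemma linear_dflow_has_fps_expansion:
  fixes f :: "'a \<Rightarrow> real"
  assumes f: "bounded_linear f"
  shows "(\<lambda>s. f (dflow z s k)) has_fps_expansion Abs_fps (\<lambda>n. f (dcoef n z k))"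
proof (rule has_fps_expansionI)
  have "\<forall>\<^sub>F s in nhds 0. s \<in> {-time_bound (norm z)<..<time_bound (norm z)}"
    using time_bound(1) [of "norm z"] by (intro eventually_nhds_in_open) auto
  then show "\<forall>\<^sub>F s in nhds 0. (\<lambda>n. fps_nth (Abs_fps (\<lambda>n. f (dcoef n z k))) n * s ^ n) sums f (dflow z s k)"
  proof eventually_elim
    case (elim s)
    then have "(\<lambda>n. s ^ n *\<^sub>R dcoef n z k) sums dflow z s k"
      by (intro dflow_sums [of _ "norm z"] time_bound) auto
    from bounded_linear.sums [OF f this] show ?case
      using f by (simp add: linear_simps mult.commute)
  qed
qed

end

lemma has_real_derivative_zero_interval:
  fixes f :: "real \<Rightarrow> real"
  assumes "\<And>s. \<bar>s\<bar> < \<rho> \<Longrightarrow> (f has_real_derivative 0) (at s)" "\<bar>s\<bar> < \<rho>"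
  shows "f s = f 0"
proof -
  have "\<exists>c. \<forall>x\<in>{-\<rho><..<\<rho>}. f x = c"
    by (rule has_field_derivative_zero_constant)
       (auto intro!: has_field_derivative_at_within assms)
  then obtain c where "\<And>x. x \<in> {-\<rho><..<\<rho>} \<Longrightarrow> f x = c" by blast
  moreover have "s \<in> {-\<rho><..<\<rho>}" "0 \<in> {-\<rho><..<\<rho>}" using assms(2) by auto
  ultimately show ?thesis by metis
qed

definition vec5 :: "real \<Rightarrow> real \<Rightarrow> real \<Rightarrow> real \<Rightarrow> real \<Rightarrow> pt" where
  "vec5 a b c d e = axis 1 a + axis 2 b + axis 3 c + axis 4 d + axis 5 e"

lemma vec5_nth [simp]:
  "vec5 a b c d e $ 1 = a" "vec5 a b c d e $ 2 = b" "vec5 a b c d e $ 3 = c"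
  "vec5 a b c d e $ 4 = d" "vec5 a b c d e $ 5 = e"
  by (simp_all add: vec5_def axis_def)

type_synonym cartan_state = "pt \<times> pt \<times> real \<times> real \<times> real"

text \<open>The components of a state are the momenta \<open>h\<close>, the point \<open>y\<close> and the auxiliary
  quantities \<open>y\<^sub>1\<^sup>2 / 2\<close>, \<open>y\<^sub>1 y\<^sub>2\<close> and \<open>1\<close>, which make the geodesic equations
  homogeneous quadratic.\<close>

definition cartan_field :: "cartan_state \<Rightarrow> cartan_state \<Rightarrow> cartan_state" where
  "cartan_field = (\<lambda>(h, y, g, q, e) (h', y', g', q', e').
     (vec5 (- (h$2 * h'$3)) (h$1 * h'$3) (h$1 * h'$4 + h$2 * h'$5) 0 0,
      vec5 (e * h'$1) (e * h'$2) (y$1 * h'$2) (g * h'$2) (q * h'$2),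
      y$1 * h'$1, y$1 * h'$2 + y$2 * h'$1, 0))"

interpretation cartan: quadratic_ode cartan_field
proof (rule quadratic_ode.intro)
  have "bilinear cartan_field"
    by (auto simp: bilinear_def cartan_field_def vec_eq_iff forall5 algebra_simps intro!: linearI)
  then show "bounded_bilinear cartan_field" by (simp add: bilinear_conv_bounded_bilinear)
qed

text \<open>The geodesic starts at the identity, where both auxiliary monomials vanish;
  \<open>dstart\<close> is the derivative of \<open>start\<close>, hence its last entry is
  0.\<close>

definition start :: "pt \<Rightarrow> cartan_state" where "start k = (k, 0, 0, 0, 1)"
definition dstart :: "pt \<Rightarrow> cartan_state" where "dstart k = (k, 0, 0, 0, 0)"

text \<open>\<open>Hf k\<close> is the momentum in the left-invariant frame and \<open>Yf k\<close>
  the geodesic from the identity with initial momentum k. The momentum equations do not involve the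
  point, so left translates of \<open>Yf k\<close> give the geodesics from all other points.
  \<open>dHf\<close> and \<open>dYf\<close> are the variations in direction l.\<close>

definition Hf :: "pt \<Rightarrow> real \<Rightarrow> pt" where "Hf k s = fst (cartan.flow (start k) s)"
definition Yf :: "pt \<Rightarrow> real \<Rightarrow> pt" where "Yf k s = fst (snd (cartan.flow (start k) s))"
definition dHf :: "pt \<Rightarrow> real \<Rightarrow> pt \<Rightarrow> pt" where
  "dHf k s l = fst (cartan.dflow (start k) s (dstart l))"
definition dYf :: "pt \<Rightarrow> real \<Rightarrow> pt \<Rightarrow> pt" where
  "dYf k s l = fst (snd (cartan.dflow (start k) s (dstart l)))"
definition tmax :: "real \<Rightarrow> real" where "tmax R = cartan.time_bound (R + 1)"

lemma norm_start: "norm (start k) \<le> norm k + 1"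
  using norm_Pair_le [of k "(0, 0, 0, 1) :: pt \<times> real \<times> real \<times> real"]
  by (simp add: start_def norm_Pair)

lemma norm_start_le: "norm k \<le> R \<Longrightarrow> norm (start k) \<le> R + 1"
  using norm_start [of k] by linarith

lemma tmax_pos: "0 \<le> R \<Longrightarrow> 0 < tmax R"
  by (simp add: tmax_def cartan.time_bound)

lemma Hf_0 [simp]: "Hf k 0 = k" and Yf_0 [simp]: "Yf k 0 = 0"
  by (simp_all add: Hf_def Yf_def start_def)

lemma dHf_0 [simp]: "dHf k 0 l = l" and dYf_0 [simp]: "dYf k 0 l = 0"
  using cartan.dflow_0 [of "start k" _ "dstart l", OF order_refl]
  by (simp_all add: dHf_def dYf_def dstart_def)

lemma cartan_flow_component:
  assumes f: "bounded_linear f" and k: "norm k \<le> R" "\<bar>s\<bar> \<le> tmax R"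
  shows "((\<lambda>s. f (cartan.flow (start k) s)) has_real_derivative
      f (cartan_field (cartan.flow (start k) s) (cartan.flow (start k) s))) (at s)"
proof -
  have "0 \<le> R" using k norm_ge_zero order_trans by blast
  then have "(cartan.flow (start k) has_vector_derivative
      cartan_field (cartan.flow (start k) s) (cartan.flow (start k) s)) (at s)"
    using k norm_start [of k]
    by (intro cartan.flow_has_vector_derivative [of _ "R + 1"] cartan.time_bound) (auto simp: tmax_def)
  from bounded_linear.has_vector_derivative [OF f this] show ?thesis
    by (simp add: has_real_derivative_iff_has_vector_derivative)
qed

lemma cartan_dflow_component:
  assumes f: "bounded_linear f" and k: "norm k \<le> R" "\<bar>s\<bar> \<le> tmax R"
  shows "((\<lambda>s. f (cartan.dflow (start k) s (dstart l))) has_real_derivative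
      f (cartan_field (cartan.flow (start k) s) (cartan.dflow (start k) s (dstart l))
        + cartan_field (cartan.dflow (start k) s (dstart l)) (cartan.flow (start k) s))) (at s)"
proof -
  have "0 \<le> R" using k norm_ge_zero order_trans by blast
  then have "((\<lambda>s. cartan.dflow (start k) s (dstart l)) has_vector_derivative
      cartan_field (cartan.flow (start k) s) (cartan.dflow (start k) s (dstart l))
        + cartan_field (cartan.dflow (start k) s (dstart l)) (cartan.flow (start k) s)) (at s)"
    using k norm_start [of k]
    by (intro cartan.dflow_has_vector_derivative [of _ "R + 1"] cartan.time_bound) (auto simp: tmax_def)
  from bounded_linear.has_vector_derivative [OF f this] show ?thesis
    by (simp add: has_real_derivative_iff_has_vector_derivative)
qed

lemma bounded_linear_components:
  "bounded_linear (\<lambda>v :: cartan_state. fst v $ i)"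
  "bounded_linear (\<lambda>v :: cartan_state. fst (snd v) $ i)"
  "bounded_linear (\<lambda>v :: cartan_state. fst (snd (snd v)))"
  "bounded_linear (\<lambda>v :: cartan_state. fst (snd (snd (snd v))))"
  "bounded_linear (\<lambda>v :: cartan_state. snd (snd (snd (snd v))))"
  by (intro bounded_linear_compose [OF bounded_linear_vec_nth]
      bounded_linear_compose [OF bounded_linear_fst] bounded_linear_compose [OF bounded_linear_snd]
      bounded_linear_fst bounded_linear_snd)+

lemma cartan_field_components:
  "fst (cartan_field v w) $ 1 = - (fst v $ 2 * fst w $ 3)"
  "fst (cartan_field v w) $ 2 = fst v $ 1 * fst w $ 3"
  "fst (cartan_field v w) $ 3 = fst v $ 1 * fst w $ 4 + fst v $ 2 * fst w $ 5"
  "fst (cartan_field v w) $ 4 = 0"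
  "fst (cartan_field v w) $ 5 = 0"
  "fst (snd (cartan_field v w)) $ 1 = snd (snd (snd (snd v))) * fst w $ 1"
  "fst (snd (cartan_field v w)) $ 2 = snd (snd (snd (snd v))) * fst w $ 2"
  "fst (snd (cartan_field v w)) $ 3 = fst (snd v) $ 1 * fst w $ 2"
  "fst (snd (cartan_field v w)) $ 4 = fst (snd (snd v)) * fst w $ 2"
  "fst (snd (cartan_field v w)) $ 5 = fst (snd (snd (snd v))) * fst w $ 2"
  "fst (snd (snd (cartan_field v w))) = fst (snd v) $ 1 * fst w $ 1"
  "fst (snd (snd (snd (cartan_field v w)))) = fst (snd v) $ 1 * fst w $ 2 + fst (snd v) $ 2 * fst w $ 1"
  "snd (snd (snd (snd (cartan_field v w)))) = 0"
  by (simp_all add: cartan_field_def case_prod_beta)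

lemma flow_one:
  assumes "norm k \<le> R" "\<bar>s\<bar> < tmax R"
  shows "snd (snd (snd (snd (cartan.flow (start k) s)))) = 1"
proof -
  have "snd (snd (snd (snd (cartan.flow (start k) s)))) = snd (snd (snd (snd (cartan.flow (start k) 0))))"
    by (rule has_real_derivative_zero_interval [OF _ assms(2)])
       (use cartan_flow_component [OF bounded_linear_components(5) assms(1)] in \<open>auto simp: cartan_field_components\<close>)
  then show ?thesis by (simp add: start_def)
qed

lemma dflow_one:
  assumes "norm k \<le> R" "\<bar>s\<bar> < tmax R"
  shows "snd (snd (snd (snd (cartan.dflow (start k) s (dstart l))))) = 0"
proof -
  have "snd (snd (snd (snd (cartan.dflow (start k) s (dstart l)))))
      = snd (snd (snd (snd (cartan.dflow (start k) 0 (dstart l)))))"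
    by (rule has_real_derivative_zero_interval [OF _ assms(2)])
       (use cartan_dflow_component [OF bounded_linear_components(5) assms(1)] in \<open>auto simp: cartan_field_components\<close>)
  then show ?thesis using cartan.dflow_0 [OF order_refl] by (simp add: dstart_def)
qed

lemma flow_y12:
  assumes "norm k \<le> R" "\<bar>s\<bar> < tmax R"
  shows "((\<lambda>s. Yf k s $ 1) has_real_derivative Hf k s $ 1) (at s)"
    and "((\<lambda>s. Yf k s $ 2) has_real_derivative Hf k s $ 2) (at s)"
    and "((\<lambda>s. dYf k s l $ 1) has_real_derivative dHf k s l $ 1) (at s)"
    and "((\<lambda>s. dYf k s l $ 2) has_real_derivative dHf k s l $ 2) (at s)"
  using cartan_flow_component [OF bounded_linear_components(2) [of 1] assms(1), where s = s]
    cartan_flow_component [OF bounded_linear_components(2) [of 2] assms(1), where s = s]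
    cartan_dflow_component [OF bounded_linear_components(2) [of 1] assms(1), where s = s and l = l]
    cartan_dflow_component [OF bounded_linear_components(2) [of 2] assms(1), where s = s and l = l] assms
  by (simp_all add: Yf_def Hf_def dYf_def dHf_def cartan_field_components flow_one [OF assms] dflow_one [OF assms])

text \<open>The auxiliary unknowns satisfy the same differential equations as the monomials they
  stand for and agree with them at time 0; likewise for their variations.\<close>

lemma flow_quadratic:
  assumes "norm k \<le> R" "\<bar>s\<bar> < tmax R"
  shows "fst (snd (snd (cartan.flow (start k) s))) = (Yf k s $ 1)\<^sup>2 / 2" (is "?g s = _")
    and "fst (snd (snd (snd (cartan.flow (start k) s)))) = Yf k s $ 1 * Yf k s $ 2" (is "?q s = _")
    and "fst (snd (snd (cartan.dflow (start k) s (dstart l)))) = Yf k s $ 1 * dYf k s l $ 1" (is "?dg s = _")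
    and "fst (snd (snd (snd (cartan.dflow (start k) s (dstart l)))))
      = dYf k s l $ 1 * Yf k s $ 2 + Yf k s $ 1 * dYf k s l $ 2" (is "?dq s = _")
proof -
  note d [derivative_intros] = flow_y12 [OF assms(1)]
  have g: "(?g has_real_derivative Yf k s $ 1 * Hf k s $ 1) (at s)"
    "(?q has_real_derivative Yf k s $ 1 * Hf k s $ 2 + Yf k s $ 2 * Hf k s $ 1) (at s)"
    "(?dg has_real_derivative Yf k s $ 1 * dHf k s l $ 1 + dYf k s l $ 1 * Hf k s $ 1) (at s)"
    "(?dq has_real_derivative Yf k s $ 1 * dHf k s l $ 2 + Yf k s $ 2 * dHf k s l $ 1
      + dYf k s l $ 1 * Hf k s $ 2 + dYf k s l $ 2 * Hf k s $ 1) (at s)"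
    if "\<bar>s\<bar> < tmax R" for s
    using cartan_flow_component [OF bounded_linear_components(3) assms(1), of s]
      cartan_flow_component [OF bounded_linear_components(4) assms(1), of s]
      cartan_dflow_component [OF bounded_linear_components(3) assms(1), where s = s and l = l]
      cartan_dflow_component [OF bounded_linear_components(4) assms(1), where s = s and l = l] that
    by (simp_all add: Yf_def Hf_def dYf_def dHf_def cartan_field_components algebra_simps)
  have "?g s - (Yf k s $ 1)\<^sup>2 / 2 = ?g 0 - (Yf k 0 $ 1)\<^sup>2 / 2"
    by (rule has_real_derivative_zero_interval [OF _ assms(2)])
       (auto intro!: derivative_eq_intros g)
  then show "?g s = (Yf k s $ 1)\<^sup>2 / 2" by (simp add: start_def)
  have "?q s - Yf k s $ 1 * Yf k s $ 2 = ?q 0 - Yf k 0 $ 1 * Yf k 0 $ 2"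
    by (rule has_real_derivative_zero_interval [OF _ assms(2)])
       (auto intro!: derivative_eq_intros g)
  then show "?q s = Yf k s $ 1 * Yf k s $ 2" by (simp add: start_def)
  have "?dg s - Yf k s $ 1 * dYf k s l $ 1 = ?dg 0 - Yf k 0 $ 1 * dYf k 0 l $ 1"
    by (rule has_real_derivative_zero_interval [OF _ assms(2)])
       (auto intro!: derivative_eq_intros g simp: algebra_simps)
  then show "?dg s = Yf k s $ 1 * dYf k s l $ 1"
    using cartan.dflow_0 [OF order_refl] by (simp add: dstart_def)
  have "?dq s - (dYf k s l $ 1 * Yf k s $ 2 + Yf k s $ 1 * dYf k s l $ 2)
      = ?dq 0 - (dYf k 0 l $ 1 * Yf k 0 $ 2 + Yf k 0 $ 1 * dYf k 0 l $ 2)"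
    by (rule has_real_derivative_zero_interval [OF _ assms(2)])
       (auto intro!: derivative_eq_intros g simp: algebra_simps)
  then show "?dq s = dYf k s l $ 1 * Yf k s $ 2 + Yf k s $ 1 * dYf k s l $ 2"
    using cartan.dflow_0 [OF order_refl] by (simp add: dstart_def)
qed

lemma Hf_deriv:
  assumes "norm k \<le> R" "\<bar>s\<bar> < tmax R"
  shows "((\<lambda>s. Hf k s $ 1) has_real_derivative - (Hf k s $ 2 * Hf k s $ 3)) (at s)"
    and "((\<lambda>s. Hf k s $ 2) has_real_derivative Hf k s $ 1 * Hf k s $ 3) (at s)"
    and "((\<lambda>s. Hf k s $ 3) has_real_derivative Hf k s $ 1 * k $ 4 + Hf k s $ 2 * k $ 5) (at s)"
    and "Hf k s $ 4 = k $ 4" and "Hf k s $ 5 = k $ 5"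
proof -
  show e: "Hf k s $ 4 = k $ 4"
    using has_real_derivative_zero_interval [of "tmax R" "\<lambda>s. Hf k s $ 4", OF _ assms(2)]
      cartan_flow_component [OF bounded_linear_components(1) [of 4] assms(1), where s = _]
    by (simp add: Hf_def cartan_field_components start_def)
  show f: "Hf k s $ 5 = k $ 5"
    using has_real_derivative_zero_interval [of "tmax R" "\<lambda>s. Hf k s $ 5", OF _ assms(2)]
      cartan_flow_component [OF bounded_linear_components(1) [of 5] assms(1), where s = _]
    by (simp add: Hf_def cartan_field_components start_def)
  show "((\<lambda>s. Hf k s $ 1) has_real_derivative - (Hf k s $ 2 * Hf k s $ 3)) (at s)"
    "((\<lambda>s. Hf k s $ 2) has_real_derivative Hf k s $ 1 * Hf k s $ 3) (at s)"
    "((\<lambda>s. Hf k s $ 3) has_real_derivative Hf k s $ 1 * k $ 4 + Hf k s $ 2 * k $ 5) (at s)"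
    using cartan_flow_component [OF bounded_linear_components(1) [of 1] assms(1), where s = s]
      cartan_flow_component [OF bounded_linear_components(1) [of 2] assms(1), where s = s]
      cartan_flow_component [OF bounded_linear_components(1) [of 3] assms(1), where s = s] assms
    by (simp_all add: cartan_field_components flip: e f) (simp_all add: Hf_def)
qed

lemma Yf_deriv:
  assumes "norm k \<le> R" "\<bar>s\<bar> < tmax R"
  shows "((\<lambda>s. Yf k s $ 3) has_real_derivative Yf k s $ 1 * Hf k s $ 2) (at s)"
    and "((\<lambda>s. Yf k s $ 4) has_real_derivative (Yf k s $ 1)\<^sup>2 / 2 * Hf k s $ 2) (at s)"
    and "((\<lambda>s. Yf k s $ 5) has_real_derivative Yf k s $ 1 * Yf k s $ 2 * Hf k s $ 2) (at s)"
  using cartan_flow_component [OF bounded_linear_components(2) [of 3] assms(1), where s = s]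
    cartan_flow_component [OF bounded_linear_components(2) [of 4] assms(1), where s = s]
    cartan_flow_component [OF bounded_linear_components(2) [of 5] assms(1), where s = s] assms
  by (simp_all add: cartan_field_components flow_quadratic [OF assms]) (simp_all add: Hf_def Yf_def)

lemma dHf_deriv:
  assumes "norm k \<le> R" "\<bar>s\<bar> < tmax R"
  shows "((\<lambda>s. dHf k s l $ 1) has_real_derivative - (Hf k s $ 2 * dHf k s l $ 3 + dHf k s l $ 2 * Hf k s $ 3)) (at s)"
    and "((\<lambda>s. dHf k s l $ 2) has_real_derivative Hf k s $ 1 * dHf k s l $ 3 + dHf k s l $ 1 * Hf k s $ 3) (at s)"
    and "((\<lambda>s. dHf k s l $ 3) has_real_derivative Hf k s $ 1 * l $ 4 + dHf k s l $ 1 * k $ 4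
      + Hf k s $ 2 * l $ 5 + dHf k s l $ 2 * k $ 5) (at s)"
    and "dHf k s l $ 4 = l $ 4" and "dHf k s l $ 5 = l $ 5"
proof -
  have z: "cartan.dflow (start k) 0 (dstart l) = dstart l" using cartan.dflow_0 [OF order_refl] .
  show e: "dHf k s l $ 4 = l $ 4"
    using has_real_derivative_zero_interval [of "tmax R" "\<lambda>s. dHf k s l $ 4", OF _ assms(2)]
      cartan_dflow_component [OF bounded_linear_components(1) [of 4] assms(1), where s = _ and l = l]
    by (simp add: dHf_def cartan_field_components dstart_def z [unfolded dstart_def])
  show f: "dHf k s l $ 5 = l $ 5"
    using has_real_derivative_zero_interval [of "tmax R" "\<lambda>s. dHf k s l $ 5", OF _ assms(2)]
      cartan_dflow_component [OF bounded_linear_components(1) [of 5] assms(1), where s = _ and l = l]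
    by (simp add: dHf_def cartan_field_components dstart_def z [unfolded dstart_def])
  have g: "Hf k s $ 4 = k $ 4" "Hf k s $ 5 = k $ 5" using Hf_deriv [OF assms] by auto
  show "((\<lambda>s. dHf k s l $ 1) has_real_derivative - (Hf k s $ 2 * dHf k s l $ 3 + dHf k s l $ 2 * Hf k s $ 3)) (at s)"
    "((\<lambda>s. dHf k s l $ 2) has_real_derivative Hf k s $ 1 * dHf k s l $ 3 + dHf k s l $ 1 * Hf k s $ 3) (at s)"
    "((\<lambda>s. dHf k s l $ 3) has_real_derivative Hf k s $ 1 * l $ 4 + dHf k s l $ 1 * k $ 4
      + Hf k s $ 2 * l $ 5 + dHf k s l $ 2 * k $ 5) (at s)"
    using cartan_dflow_component [OF bounded_linear_components(1) [of 1] assms(1), where s = s and l = l]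
      cartan_dflow_component [OF bounded_linear_components(1) [of 2] assms(1), where s = s and l = l]
      cartan_dflow_component [OF bounded_linear_components(1) [of 3] assms(1), where s = s and l = l] assms
    by (simp_all add: cartan_field_components flip: e f g) (simp_all add: Hf_def dHf_def algebra_simps)
qed

lemma dYf_deriv:
  assumes "norm k \<le> R" "\<bar>s\<bar> < tmax R"
  shows "((\<lambda>s. dYf k s l $ 3) has_real_derivative Yf k s $ 1 * dHf k s l $ 2 + dYf k s l $ 1 * Hf k s $ 2) (at s)"
    and "((\<lambda>s. dYf k s l $ 4) has_real_derivative (Yf k s $ 1)\<^sup>2 / 2 * dHf k s l $ 2
      + Yf k s $ 1 * dYf k s l $ 1 * Hf k s $ 2) (at s)"
    and "((\<lambda>s. dYf k s l $ 5) has_real_derivative Yf k s $ 1 * Yf k s $ 2 * dHf k s l $ 2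
      + (dYf k s l $ 1 * Yf k s $ 2 + Yf k s $ 1 * dYf k s l $ 2) * Hf k s $ 2) (at s)"
  using cartan_dflow_component [OF bounded_linear_components(2) [of 3] assms(1), where s = s and l = l]
    cartan_dflow_component [OF bounded_linear_components(2) [of 4] assms(1), where s = s and l = l]
    cartan_dflow_component [OF bounded_linear_components(2) [of 5] assms(1), where s = s and l = l] assms
  by (simp_all add: cartan_field_components flow_quadratic [OF assms])
     (simp_all add: Hf_def Yf_def dHf_def dYf_def)

lemma Yf_has_derivative:
  assumes "norm k < R" "\<bar>s\<bar> \<le> tmax R"
  shows "((\<lambda>k. Yf k s) has_derivative dYf k s) (at k)"
proof -
  have R: "0 \<le> R" using assms norm_ge_zero [of k] by linarith
  have n: "norm (start k) < R + 1" using norm_start [of k] assms by linarith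
  have s: "(start has_derivative dstart) (at k)"
    unfolding start_def [abs_def] dstart_def [abs_def] by (auto intro!: derivative_eq_intros simp: zero_prod_def)
  have "((\<lambda>z. cartan.flow z s) has_derivative cartan.dflow (start k) s) (at (start k))"
    using assms(2) R by (intro cartan.flow_has_derivative [OF n] cartan.time_bound) (auto simp: tmax_def)
  from has_derivative_compose [OF s this]
  show ?thesis
    unfolding Yf_def [abs_def] dYf_def [abs_def] by (auto intro: derivative_intros)
qed

lemma linear_dYf:
  assumes "norm k < R" "\<bar>s\<bar> \<le> tmax R"
  shows "linear (dYf k s)"
  using Yf_has_derivative [OF assms] has_derivative_linear by blast

lemma cartan_flow_fps:
  "\<exists>F. (\<lambda>s. Hf k s $ i) has_fps_expansion F"
  "\<exists>F. (\<lambda>s. Yf k s $ i) has_fps_expansion F"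
  "\<exists>F. (\<lambda>s. dHf k s l $ i) has_fps_expansion F"
  "\<exists>F. (\<lambda>s. dYf k s l $ i) has_fps_expansion F"
  unfolding Hf_def Yf_def dHf_def dYf_def
  using cartan.linear_flow_has_fps_expansion [OF bounded_linear_components(1)]
    cartan.linear_flow_has_fps_expansion [OF bounded_linear_components(2)]
    cartan.linear_dflow_has_fps_expansion [OF bounded_linear_components(1)]
    cartan.linear_dflow_has_fps_expansion [OF bounded_linear_components(2)]
  by blast+

lemma continuous_on_flow:
  assumes "0 \<le> R"
  shows "continuous_on (cball 0 R \<times> {-tmax R..tmax R}) (\<lambda>(k, s). Hf k s)"
    and "continuous_on (cball 0 R \<times> {-tmax R..tmax R}) (\<lambda>(k, s). Yf k s)"
    and "continuous_on (cball 0 R \<times> {-tmax R..tmax R}) (\<lambda>(k, s). dYf k s l)"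
proof -
  have st: "continuous_on UNIV start"
    unfolding start_def [abs_def] by (intro continuous_intros)
  have st2: "continuous_on A (\<lambda>p. start (f p))" if "continuous_on A f" for A and f :: "'b::topological_space \<Rightarrow> pt"
    using continuous_on_compose2 [OF st that] by auto
  have b: "tmax R * (cartan.K * (R + 1)) < 1" "tmax R * (cartan.K2 * (R + 1 + 1)) < 1"
    using cartan.time_bound(2,3) [of "R + 1" "tmax R"] assms tmax_pos [OF assms] by (simp_all add: tmax_def)
  have "continuous_on (cball 0 R \<times> {-tmax R..tmax R}) (\<lambda>p. (\<lambda>(z, s). cartan.flow z s) (start (fst p), snd p))"
    using assms b tmax_pos [OF assms]
    by (intro continuous_on_compose2 [OF cartan.continuous_flow [of "R + 1" "tmax R"]] continuous_intros st2)
       (auto intro: norm_start_le)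
  then show "continuous_on (cball 0 R \<times> {-tmax R..tmax R}) (\<lambda>(k, s). Hf k s)"
    "continuous_on (cball 0 R \<times> {-tmax R..tmax R}) (\<lambda>(k, s). Yf k s)"
    unfolding Hf_def Yf_def case_prod_beta by (auto intro!: continuous_intros)
  have "continuous_on (cball 0 R \<times> {-tmax R..tmax R}) (\<lambda>p. (\<lambda>(z, s). cartan.dflow z s (dstart l)) (start (fst p), snd p))"
    using assms b tmax_pos [OF assms]
    by (intro continuous_on_compose2 [OF cartan.continuous_dflow [of "R + 1" "tmax R"]] continuous_intros st2)
       (auto intro: norm_start_le)
  then show "continuous_on (cball 0 R \<times> {-tmax R..tmax R}) (\<lambda>(k, s). dYf k s l)"
    unfolding dYf_def case_prod_beta by (auto intro!: continuous_intros)
qed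

section \<open>Normal geodesics\<close>

lemma inner5: "(a::pt) \<bullet> b = a$1 * b$1 + a$2 * b$2 + a$3 * b$3 + a$4 * b$4 + a$5 * b$5"
  unfolding inner_vec_def UNIV5 by simp

lemma X_nth:
  "X 1 x $ 1 = 1" "X 1 x $ 2 = 0" "X 1 x $ 3 = 0" "X 1 x $ 4 = 0" "X 1 x $ 5 = 0"
  "X 2 x $ 1 = 0" "X 2 x $ 2 = 1" "X 2 x $ 3 = x$1" "X 2 x $ 4 = (x$1)\<^sup>2 / 2" "X 2 x $ 5 = x$1 * x$2"
  "X 3 x $ 1 = 0" "X 3 x $ 2 = 0" "X 3 x $ 3 = 1" "X 3 x $ 4 = x$1" "X 3 x $ 5 = x$2"
  "X 4 x $ 1 = 0" "X 4 x $ 2 = 0" "X 4 x $ 3 = 0" "X 4 x $ 4 = 1" "X 4 x $ 5 = 0"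
  "X 5 x $ 1 = 0" "X 5 x $ 2 = 0" "X 5 x $ 3 = 0" "X 5 x $ 4 = 0" "X 5 x $ 5 = 1"
  by (simp_all add: X_eq axis_def)

definition horiz :: "pt \<Rightarrow> real \<Rightarrow> real \<Rightarrow> pt" where
  "horiz x a b = a *\<^sub>R X 1 x + b *\<^sub>R X 2 x"

lemma horiz_nth [simp]:
  "horiz x a b $ 1 = a" "horiz x a b $ 2 = b" "horiz x a b $ 3 = x$1 * b"
  "horiz x a b $ 4 = (x$1)\<^sup>2 / 2 * b" "horiz x a b $ 5 = x$1 * x$2 * b"
  by (simp_all add: horiz_def X_nth)

lemma horizontal_plane_iff: "v \<in> horizontal_plane x \<longleftrightarrow> v = horiz x (v$1) (v$2)"
proof
  assume "v \<in> horizontal_plane x"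
  then obtain a b where "v = horiz x a b"
    by (auto simp: horizontal_plane_def span_insert span_empty horiz_def algebra_simps)
  then show "v = horiz x (v$1) (v$2)" by simp
next
  assume "v = horiz x (v$1) (v$2)"
  then show "v \<in> horizontal_plane x"
    unfolding horizontal_plane_def horiz_def
    by (metis insertCI span_add span_base span_scale)
qed

lemma horiz_in_plane [simp]: "horiz x a b \<in> horizontal_plane x"
  by (simp add: horizontal_plane_iff)

lemma sr_metric_horiz: "sr_metric x (horiz x a b) (horiz x c d) = a * c + b * d"
  unfolding horiz_def by (rule sr_metric_eq)

text \<open>The left-invariant coframe at x, that is, the components of v with respect to
  \<open>X 1\<close>, ..., \<open>X 5\<close>.\<close>

definition frame_comp :: "pt \<Rightarrow> pt \<Rightarrow> pt" where
  "frame_comp x v = vec5 (v$1) (v$2) (v$3 - x$1 * v$2) (v$4 - x$1 * v$3 + (x$1)\<^sup>2 / 2 * v$2) (v$5 - x$2 * v$3)"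

definition frame_vec :: "pt \<Rightarrow> pt \<Rightarrow> pt" where
  "frame_vec x c = c$1 *\<^sub>R X 1 x + c$2 *\<^sub>R X 2 x + c$3 *\<^sub>R X 3 x + c$4 *\<^sub>R X 4 x + c$5 *\<^sub>R X 5 x"

lemma frame_vec_comp: "frame_vec x (frame_comp x v) = v"
  by (simp add: frame_vec_def frame_comp_def vec_eq_iff forall5 X_nth algebra_simps power2_eq_square)

lemma frame_comp_vec: "frame_comp x (frame_vec x c) = c"
  by (simp add: frame_vec_def frame_comp_def vec_eq_iff forall5 X_nth algebra_simps power2_eq_square)

lemma linear_frame_comp: "linear (frame_comp x)"
  by (rule linearI) (simp_all add: frame_comp_def vec_eq_iff forall5 algebra_simps)

lemma frame_comp_horiz: "frame_comp x (horiz x a b) = vec5 a b 0 0 0"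
  by (simp add: frame_comp_def vec_eq_iff forall5 power2_eq_square)

text \<open>Hamilton's equations in the left trivialisation: m holds the momenta h1, ..., h5, and
  the brackets X3, X4, X5 produce the quadratic right-hand sides. Derivatives within S cover the
  endpoints of a closed interval as well as interior times.\<close>

definition geo_at :: "(real \<Rightarrow> pt) \<Rightarrow> (real \<Rightarrow> pt) \<Rightarrow> real \<Rightarrow> real set \<Rightarrow> bool" where
  "geo_at m x t S \<longleftrightarrow>
    ((\<lambda>s. m s $ 1) has_real_derivative - (m t $ 2 * m t $ 3)) (at t within S) \<and>
    ((\<lambda>s. m s $ 2) has_real_derivative m t $ 1 * m t $ 3) (at t within S) \<and>
    ((\<lambda>s. m s $ 3) has_real_derivative m t $ 1 * m t $ 4 + m t $ 2 * m t $ 5) (at t within S) \<and>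
    ((\<lambda>s. m s $ 4) has_real_derivative 0) (at t within S) \<and>
    ((\<lambda>s. m s $ 5) has_real_derivative 0) (at t within S) \<and>
    ((\<lambda>s. x s $ 1) has_real_derivative m t $ 1) (at t within S) \<and>
    ((\<lambda>s. x s $ 2) has_real_derivative m t $ 2) (at t within S) \<and>
    ((\<lambda>s. x s $ 3) has_real_derivative x t $ 1 * m t $ 2) (at t within S) \<and>
    ((\<lambda>s. x s $ 4) has_real_derivative (x t $ 1)\<^sup>2 / 2 * m t $ 2) (at t within S) \<and>
    ((\<lambda>s. x s $ 5) has_real_derivative x t $ 1 * x t $ 2 * m t $ 2) (at t within S)"

lemma geo_atD:
  assumes "geo_at m x t S"
  shows "((\<lambda>s. m s $ 1) has_real_derivative - (m t $ 2 * m t $ 3)) (at t within S)"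
    "((\<lambda>s. m s $ 2) has_real_derivative m t $ 1 * m t $ 3) (at t within S)"
    "((\<lambda>s. m s $ 3) has_real_derivative m t $ 1 * m t $ 4 + m t $ 2 * m t $ 5) (at t within S)"
    "((\<lambda>s. m s $ 4) has_real_derivative 0) (at t within S)"
    "((\<lambda>s. m s $ 5) has_real_derivative 0) (at t within S)"
    "((\<lambda>s. x s $ 1) has_real_derivative m t $ 1) (at t within S)"
    "((\<lambda>s. x s $ 2) has_real_derivative m t $ 2) (at t within S)"
    "((\<lambda>s. x s $ 3) has_real_derivative x t $ 1 * m t $ 2) (at t within S)"
    "((\<lambda>s. x s $ 4) has_real_derivative (x t $ 1)\<^sup>2 / 2 * m t $ 2) (at t within S)"
    "((\<lambda>s. x s $ 5) has_real_derivative x t $ 1 * x t $ 2 * m t $ 2) (at t within S)"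
  using assms unfolding geo_at_def by blast+

lemma has_vector_derivative_componentsI:
  fixes f :: "real \<Rightarrow> pt"
  assumes "\<And>i. ((\<lambda>s. f s $ i) has_real_derivative v $ i) (at t within S)"
  shows "(f has_vector_derivative v) (at t within S)"
  unfolding has_vector_derivative_def
proof (subst has_derivative_componentwise_within, intro ballI)
  fix b :: pt assume "b \<in> Basis"
  then obtain i where b: "b = axis i 1" by (auto simp: Basis_vec_def)
  show "((\<lambda>s. f s \<bullet> b) has_derivative (\<lambda>s. s *\<^sub>R v \<bullet> b)) (at t within S)"
    using assms [of i] by (simp add: b inner_axis has_field_derivative_def mult_commute_abs)
qed

lemma has_real_derivative_component:
  fixes f :: "real \<Rightarrow> pt"
  assumes "(f has_vector_derivative v) (at t within S)"
  shows "((\<lambda>s. f s $ i) has_real_derivative v $ i) (at t within S)"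
  using bounded_linear.has_vector_derivative [OF bounded_linear_vec_nth assms]
  by (simp add: has_real_derivative_iff_has_vector_derivative)

lemma geo_at_cong:
  assumes "geo_at m x t S" "t \<in> S" "\<And>s. s \<in> S \<Longrightarrow> x s = y s"
  shows "geo_at m y t S"
proof -
  have "((\<lambda>s. y s $ i) has_real_derivative D) (at t within S)"
    if "((\<lambda>s. x s $ i) has_real_derivative D) (at t within S)" for i D
    using that unfolding has_field_derivative_def
    by (rule has_derivative_transform [OF assms(2), rotated]) (simp add: assms(3))
  then show ?thesis
    using assms(1) assms(3) [OF assms(2)] unfolding geo_at_def by auto
qed

lemma geo_at_velocity:
  assumes "geo_at m x t S"
  shows "(x has_vector_derivative horiz (x t) (m t $ 1) (m t $ 2)) (at t within S)"
proof (rule has_vector_derivative_componentsI)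
  fix i
  have "\<forall>i. ((\<lambda>s. x s $ i) has_real_derivative horiz (x t) (m t $ 1) (m t $ 2) $ i) (at t within S)"
    unfolding forall5 using geo_atD [OF assms] by simp
  then show "((\<lambda>s. x s $ i) has_real_derivative horiz (x t) (m t $ 1) (m t $ 2) $ i) (at t within S)" ..
qed

text \<open>D times exp (- L t) decreases to the right of c, and D times exp (L t) increases to its
  left, so D is at most 0 on both sides.\<close>

lemma gronwall_zero:
  fixes D :: "real \<Rightarrow> real"
  assumes D: "\<And>t. t \<in> {a..b} \<Longrightarrow> (D has_real_derivative D' t) (at t within {a..b})"
    and nn: "\<And>t. 0 \<le> D t"
    and bd: "\<And>t. t \<in> {a..b} \<Longrightarrow> \<bar>D' t\<bar> \<le> L * D t"
    and c: "c \<in> {a..b}" "D c = 0" and t: "t \<in> {a..b}"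
  shows "D t = 0"
proof -
  have cont: "continuous_on {a..b} D" using D DERIV_continuous_on by blast
  have D_in: "(D has_real_derivative D' s) (at s)" if "a < s" "s < b" for s
    using D [of s] that at_within_Icc_at [of a s b] by simp
  show ?thesis
  proof (cases "c \<le> t")
    case True
    have "D t * exp (- (L * t)) \<le> D c * exp (- (L * c))"
    proof (rule DERIV_nonpos_imp_decreasing_open [OF True])
      fix s assume s: "c < s" "s < t"
      have "((\<lambda>s. D s * exp (- (L * s))) has_real_derivative (D' s - L * D s) * exp (- (L * s))) (at s)"
        using s c t by (auto intro!: derivative_eq_intros D_in simp: algebra_simps)
      moreover have "(D' s - L * D s) * exp (- (L * s)) \<le> 0"
        using bd [of s] s c t by (intro mult_nonpos_nonneg) auto
      ultimately show "\<exists>y. ((\<lambda>s. D s * exp (- (L * s))) has_real_derivative y) (at s) \<and> y \<le> 0" by blast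
    next
      show "continuous_on {c..t} (\<lambda>s. D s * exp (- (L * s)))"
        using c t by (intro continuous_intros continuous_on_subset [OF cont]) auto
    qed
    then have "D t * exp (- (L * t)) \<le> 0" using c by simp
    then show ?thesis using nn [of t] by (simp add: mult_le_0_iff)
  next
    case False
    have "D t * exp (L * t) \<le> D c * exp (L * c)"
    proof (rule DERIV_nonneg_imp_increasing_open [of t c])
      fix s assume s: "t < s" "s < c"
      have "((\<lambda>s. D s * exp (L * s)) has_real_derivative (D' s + L * D s) * exp (L * s)) (at s)"
        using s c t by (auto intro!: derivative_eq_intros D_in simp: algebra_simps)
      moreover have "0 \<le> (D' s + L * D s) * exp (L * s)"
        using bd [of s] s c t by (intro mult_nonneg_nonneg) auto
      ultimately show "\<exists>y. ((\<lambda>s. D s * exp (L * s)) has_real_derivative y) (at s) \<and> 0 \<le> y" by blast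
    next
      show "continuous_on {t..c} (\<lambda>s. D s * exp (L * s))"
        using c t by (intro continuous_intros continuous_on_subset [OF cont]) auto
    qed (use False in auto)
    then have "D t * exp (L * t) \<le> 0" using c by simp
    then show ?thesis using nn [of t] by (simp add: mult_le_0_iff)
  qed
qed

lemma eq_on_interval_if_same_derivative:
  fixes f g :: "real \<Rightarrow> real"
  assumes "\<And>t. t \<in> {a..b} \<Longrightarrow> (f has_real_derivative f' t) (at t within {a..b})"
    and "\<And>t. t \<in> {a..b} \<Longrightarrow> (g has_real_derivative f' t) (at t within {a..b})"
    and "c \<in> {a..b}" "f c = g c" "t \<in> {a..b}"
  shows "f t = g t"
proof -
  have "\<exists>k. \<forall>x\<in>{a..b}. f x - g x = k"
    by (rule has_field_derivative_zero_constant) (auto intro!: derivative_eq_intros assms)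
  then obtain k where "\<And>x. x \<in> {a..b} \<Longrightarrow> f x - g x = k" by blast
  then show ?thesis using assms(3-5) by (metis eq_iff_diff_eq_0)
qed

lemma geo_unique:
  assumes g: "\<And>t. t \<in> {a..b} \<Longrightarrow> geo_at m x t {a..b}" and g': "\<And>t. t \<in> {a..b} \<Longrightarrow> geo_at n y t {a..b}"
    and c: "c \<in> {a..b}" "m c = n c" "x c = y c" and t: "t \<in> {a..b}"
  shows "m t = n t \<and> x t = y t"
proof -
  note d = geo_atD [OF g] and e = geo_atD [OF g']
  have m4: "m t $ 4 = n t $ 4" and m5: "m t $ 5 = n t $ 5" if "t \<in> {a..b}" for t
    using eq_on_interval_if_same_derivative [OF d(4) e(4) c(1) _ that]
      eq_on_interval_if_same_derivative [OF d(5) e(5) c(1) _ that] c by auto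
  have "continuous_on {a..b} (\<lambda>t. \<bar>m t $ 4 - n t $ 2\<bar> + \<bar>n t $ 1 + m t $ 5\<bar>)"
    using d(4,5) e(1,2) by (intro continuous_intros DERIV_continuous_on) auto
  then have "bounded ((\<lambda>t. \<bar>m t $ 4 - n t $ 2\<bar> + \<bar>n t $ 1 + m t $ 5\<bar>) ` {a..b})"
    by (intro compact_imp_bounded compact_continuous_image) auto
  then obtain M where "\<forall>y\<in>(\<lambda>t. \<bar>m t $ 4 - n t $ 2\<bar> + \<bar>n t $ 1 + m t $ 5\<bar>) ` {a..b}. \<bar>y\<bar> \<le> M"
    by (auto simp only: bounded_real)
  then have M: "\<bar>m t $ 4 - n t $ 2\<bar> + \<bar>n t $ 1 + m t $ 5\<bar> \<le> M" if "t \<in> {a..b}" for t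
    using that by fastforce
  \<comment> \<open>The momenta form a closed system in which h4 and h5 are constant, so three
    differences suffice; the points then follow by successive quadrature.\<close>
  define D where "D t = (m t $ 1 - n t $ 1)\<^sup>2 + (m t $ 2 - n t $ 2)\<^sup>2 + (m t $ 3 - n t $ 3)\<^sup>2" for t
  have D: "D t = 0" if t: "t \<in> {a..b}" for t
  proof (rule gronwall_zero [where D = D and L = "2 * M", OF _ _ _ c(1) _ t])
    fix t assume t: "t \<in> {a..b}"
    \<comment> \<open>The terms with the factor m3 cancel because they only rotate the first two
      components. The two factors that remain are bounded by M.\<close>
    let ?D' = "2 * ((m t $ 1 - n t $ 1) * (m t $ 3 - n t $ 3) * (m t $ 4 - n t $ 2)
      + (m t $ 2 - n t $ 2) * (m t $ 3 - n t $ 3) * (n t $ 1 + m t $ 5))"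
    show "(D has_real_derivative ?D') (at t within {a..b})"
      unfolding D_def
      by (rule derivative_eq_intros d [OF t] e [OF t] refl)+
         (simp add: m4 [OF t] m5 [OF t] algebra_simps)
    have "\<bar>m t $ 4 - n t $ 2\<bar> \<le> M" "\<bar>n t $ 1 + m t $ 5\<bar> \<le> M"
      using M [OF t] abs_ge_zero [of "m t $ 4 - n t $ 2"] abs_ge_zero [of "n t $ 1 + m t $ 5"] by linarith+
    then have "\<bar>(m t $ 1 - n t $ 1) * (m t $ 3 - n t $ 3)\<bar> * \<bar>m t $ 4 - n t $ 2\<bar>
        \<le> \<bar>(m t $ 1 - n t $ 1) * (m t $ 3 - n t $ 3)\<bar> * M"
      "\<bar>(m t $ 2 - n t $ 2) * (m t $ 3 - n t $ 3)\<bar> * \<bar>n t $ 1 + m t $ 5\<bar>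
        \<le> \<bar>(m t $ 2 - n t $ 2) * (m t $ 3 - n t $ 3)\<bar> * M" "0 \<le> M"
      by (auto intro: mult_left_mono)
    moreover have "2 * \<bar>(m t $ 1 - n t $ 1) * (m t $ 3 - n t $ 3)\<bar> \<le> D t - (m t $ 2 - n t $ 2)\<^sup>2"
      "2 * \<bar>(m t $ 2 - n t $ 2) * (m t $ 3 - n t $ 3)\<bar> \<le> D t - (m t $ 1 - n t $ 1)\<^sup>2"
      using sum_squares_bound [of "\<bar>m t $ 1 - n t $ 1\<bar>" "\<bar>m t $ 3 - n t $ 3\<bar>"]
        sum_squares_bound [of "\<bar>m t $ 2 - n t $ 2\<bar>" "\<bar>m t $ 3 - n t $ 3\<bar>"]
      by (simp_all add: D_def abs_mult)
    then have "2 * \<bar>(m t $ 1 - n t $ 1) * (m t $ 3 - n t $ 3)\<bar> \<le> D t"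
      "2 * \<bar>(m t $ 2 - n t $ 2) * (m t $ 3 - n t $ 3)\<bar> \<le> D t"
      using zero_le_power2 [of "m t $ 2 - n t $ 2"] zero_le_power2 [of "m t $ 1 - n t $ 1"] by linarith+
    then have "2 * \<bar>(m t $ 1 - n t $ 1) * (m t $ 3 - n t $ 3)\<bar> * M \<le> D t * M"
      "2 * \<bar>(m t $ 2 - n t $ 2) * (m t $ 3 - n t $ 3)\<bar> * M \<le> D t * M"
      using \<open>0 \<le> M\<close> by (auto intro: mult_right_mono)
    ultimately have "2 * (\<bar>(m t $ 1 - n t $ 1) * (m t $ 3 - n t $ 3)\<bar> * \<bar>m t $ 4 - n t $ 2\<bar>)
       + 2 * (\<bar>(m t $ 2 - n t $ 2) * (m t $ 3 - n t $ 3)\<bar> * \<bar>n t $ 1 + m t $ 5\<bar>) \<le> 2 * M * D t"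
      by (simp add: algebra_simps)
    then show "\<bar>?D'\<bar> \<le> 2 * M * D t"
      by (simp flip: abs_mult)
  qed (use c in \<open>auto simp: D_def\<close>)
  have m123: "m t $ 1 = n t $ 1" "m t $ 2 = n t $ 2" "m t $ 3 = n t $ 3" if "t \<in> {a..b}" for t
    using D [OF that] by (auto simp: D_def add_nonneg_eq_0_iff)
  have mn: "m t = n t" if "t \<in> {a..b}" for t
    using m123 [OF that] m4 [OF that] m5 [OF that] by (simp add: vec_eq_iff forall5)
  have x1: "x t $ 1 = y t $ 1" if "t \<in> {a..b}" for t
    using eq_on_interval_if_same_derivative [OF d(6) _ c(1) _ that, of "\<lambda>s. y s $ 1"] e(6) c mn by auto
  have x2: "x t $ 2 = y t $ 2" if "t \<in> {a..b}" for t
    using eq_on_interval_if_same_derivative [OF d(7) _ c(1) _ that, of "\<lambda>s. y s $ 2"] e(7) c mn by auto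
  have x3: "x t $ 3 = y t $ 3" if "t \<in> {a..b}" for t
    using eq_on_interval_if_same_derivative [OF d(8) _ c(1) _ that, of "\<lambda>s. y s $ 3"] e(8) c mn x1 by auto
  have x4: "x t $ 4 = y t $ 4" if "t \<in> {a..b}" for t
    using eq_on_interval_if_same_derivative [OF d(9) _ c(1) _ that, of "\<lambda>s. y s $ 4"] e(9) c mn x1 by auto
  have x5: "x t $ 5 = y t $ 5" if "t \<in> {a..b}" for t
    using eq_on_interval_if_same_derivative [OF d(10) _ c(1) _ that, of "\<lambda>s. y s $ 5"] e(10) c mn x1 x2 by auto
  show ?thesis using t by (simp add: mn vec_eq_iff [of "x t"] forall5 x1 x2 x3 x4 x5)
qed

lemma h_eq:
  "h 1 l = snd l $ 1"
  "h 2 l = snd l $ 2 + fst l $ 1 * snd l $ 3 + (fst l $ 1)\<^sup>2 / 2 * snd l $ 4 + fst l $ 1 * fst l $ 2 * snd l $ 5"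
  "h 3 l = snd l $ 3 + fst l $ 1 * snd l $ 4 + fst l $ 2 * snd l $ 5"
  "h 4 l = snd l $ 4" "h 5 l = snd l $ 5"
  by (simp_all add: h_def inner5 X_nth algebra_simps)

definition momentum :: "covec \<Rightarrow> pt" where
  "momentum l = (\<chi> i. h i l)"

lemma Ham_has_derivative:
  "(Ham has_derivative (\<lambda>w. snd w \<bullet> horiz (fst l) (h 1 l) (h 2 l)
     + fst w $ 1 * (h 2 l * h 3 l) + fst w $ 2 * (h 2 l * fst l $ 1 * snd l $ 5))) (at l)"
proof -
  have d: "((\<lambda>l :: covec. fst l $ i) has_derivative (\<lambda>w. fst w $ i)) (at l)"
    "((\<lambda>l :: covec. snd l $ i) has_derivative (\<lambda>w. snd w $ i)) (at l)" for i
    by (intro bounded_linear_imp_has_derivative bounded_linear_compose [OF bounded_linear_vec_nth]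
        bounded_linear_fst bounded_linear_snd)+
  show ?thesis
    unfolding Ham_def [abs_def] h_eq
    apply (rule derivative_eq_intros d refl numeral_neq_zero)+
    apply (simp add: fun_eq_iff inner5 h_eq)
    apply (simp add: algebra_simps power2_eq_square)
    done
qed

text \<open>Uniqueness is the nondegeneracy of the symplectic form: pairing with (0, z) and with (z,
  0) isolates the two components.\<close>

lemma hamiltonian_field_Ham:
  "hamiltonian_field Ham l = (horiz (fst l) (h 1 l) (h 2 l),
     vec5 (- (h 2 l * h 3 l)) (- (h 2 l * fst l $ 1 * snd l $ 5)) 0 0 0)" (is "_ = ?v")
  unfolding hamiltonian_field_def
proof (rule the_equality)
  show v: "\<forall>w. frechet_derivative Ham (at l) w = symplectic l w ?v"
    by (simp add: frechet_derivative_at [OF Ham_has_derivative, symmetric] symplectic_eq inner5)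
  fix v assume "\<forall>w. frechet_derivative Ham (at l) w = symplectic l w v"
  with v have eq: "symplectic l w v = symplectic l w ?v" for w by metis
  have "fst v = fst ?v"
  proof (rule vector_eq_rdot [THEN iffD1], rule allI)
    fix z show "fst v \<bullet> z = fst ?v \<bullet> z"
      using eq [of "(0, z)"] by (simp add: symplectic_eq inner_commute)
  qed
  moreover have "snd v = snd ?v"
  proof (rule vector_eq_rdot [THEN iffD1], rule allI)
    fix z show "snd v \<bullet> z = snd ?v \<bullet> z"
      using eq [of "(z, 0)"] by (simp add: symplectic_eq inner_commute)
  qed
  ultimately show "v = ?v" by (simp add: prod_eq_iff)
qed

lemma normal_geodesic_geo:
  assumes "normal_geodesic T \<gamma> l0"
  obtains m where "m 0 = momentum l0" "\<And>t. t \<in> {0..T} \<Longrightarrow> geo_at m \<gamma> t {0..T}"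
proof -
  obtain l where l: "l 0 = l0"
    "\<And>t. t \<in> {0..T} \<Longrightarrow> (l has_vector_derivative hamiltonian_field Ham (l t)) (at t within {0..T})"
    "\<And>t. t \<in> {0..T} \<Longrightarrow> \<gamma> t = fst (l t)"
    using assms unfolding normal_geodesic_def by blast
  define m where "m t = momentum (l t)" for t
  have m: "m t $ i = h i (l t)" for t i by (simp add: m_def momentum_def)
  have "geo_at m \<gamma> t {0..T}" if t: "t \<in> {0..T}" for t
  proof -
    note d = has_real_derivative_component [OF bounded_linear.has_vector_derivative [OF bounded_linear_fst l(2) [OF t]]]
      has_real_derivative_component [OF bounded_linear.has_vector_derivative [OF bounded_linear_snd l(2) [OF t]]]
    have f: "((\<lambda>s. fst (l s) $ 1) has_real_derivative h 1 (l t)) (at t within {0..T})"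
      "((\<lambda>s. fst (l s) $ 2) has_real_derivative h 2 (l t)) (at t within {0..T})"
      "((\<lambda>s. fst (l s) $ 3) has_real_derivative fst (l t) $ 1 * h 2 (l t)) (at t within {0..T})"
      "((\<lambda>s. fst (l s) $ 4) has_real_derivative (fst (l t) $ 1)\<^sup>2 / 2 * h 2 (l t)) (at t within {0..T})"
      "((\<lambda>s. fst (l s) $ 5) has_real_derivative fst (l t) $ 1 * fst (l t) $ 2 * h 2 (l t)) (at t within {0..T})"
      "((\<lambda>s. snd (l s) $ 1) has_real_derivative - (h 2 (l t) * h 3 (l t))) (at t within {0..T})"
      "((\<lambda>s. snd (l s) $ 2) has_real_derivative - (h 2 (l t) * fst (l t) $ 1 * snd (l t) $ 5)) (at t within {0..T})"
      "((\<lambda>s. snd (l s) $ 3) has_real_derivative 0) (at t within {0..T})"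
      "((\<lambda>s. snd (l s) $ 4) has_real_derivative 0) (at t within {0..T})"
      "((\<lambda>s. snd (l s) $ 5) has_real_derivative 0) (at t within {0..T})"
      using d(1) [of 1] d(1) [of 2] d(1) [of 3] d(1) [of 4] d(1) [of 5]
        d(2) [of 1] d(2) [of 2] d(2) [of 3] d(2) [of 4] d(2) [of 5]
      by (simp_all add: hamiltonian_field_Ham)
    have "geo_at m (\<lambda>s. fst (l s)) t {0..T}"
      unfolding geo_at_def m
      apply (intro conjI)
      subgoal using f(6) by (simp add: h_eq)
      subgoal unfolding h_eq(2) by (rule derivative_eq_intros f refl numeral_neq_zero)+ (simp add: h_eq algebra_simps power2_eq_square)
      subgoal unfolding h_eq(3) by (rule derivative_eq_intros f refl numeral_neq_zero)+ (simp add: h_eq algebra_simps)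
      subgoal using f(9) by (simp add: h_eq)
      subgoal using f(10) by (simp add: h_eq)
      using f by auto
    then show ?thesis by (rule geo_at_cong) (use t l(3) in auto)
  qed
  with l(1) show ?thesis by (intro that [of m]) (auto simp: m_def)
qed

lemma geo_at_left_translate:
  assumes "geo_at m x t S"
  shows "geo_at m (\<lambda>s. cartan_mult a (x s)) t S"
  unfolding geo_at_def cartan_mult_nth
  apply (intro conjI)
  using geo_atD [OF assms] apply auto[5]
  by (rule derivative_eq_intros geo_atD [OF assms] refl | simp add: algebra_simps power2_eq_square add_divide_distrib)+

lemma flow_geo_at:
  assumes "norm k \<le> R" "\<bar>s\<bar> < tmax R"
  shows "geo_at (Hf k) (Yf k) s S"
proof -
  have "((\<lambda>s. Hf k s $ i) has_real_derivative 0) (at s)" if "i = 4 \<or> i = 5" for i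
  proof (rule has_field_derivative_transform_within_open [of "\<lambda>_. k $ i" _ _ "{-tmax R<..<tmax R}"])
    fix x assume "x \<in> {-tmax R<..<tmax R}"
    then show "k $ i = Hf k x $ i" using Hf_deriv(4,5) [OF assms(1), of x] that by auto
  qed (use assms in auto)
  then show ?thesis
    unfolding geo_at_def
    using Hf_deriv [OF assms] Yf_deriv [OF assms] flow_y12 [OF assms]
    by (auto intro: has_field_derivative_at_within)
qed

section \<open>Flags of geodesics\<close>

lemma C_k_Suc_imp: "C_k (Suc k) f \<Longrightarrow> C_k k f"
proof (induction k arbitrary: f)
  case 0
  then show ?case
    by (auto intro!: continuous_at_imp_continuous_on differentiable_imp_continuous_within)
next
  case (Suc k)
  then show ?case by (metis C_k.simps(2))
qed

lemma C_k_const: "C_k k (\<lambda>x. c)"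
proof (induction k arbitrary: c)
  case (Suc k)
  have "frechet_derivative (\<lambda>x :: 'a. c) (at x) = (\<lambda>v. 0)" for x
    by simp
  then show ?case using Suc [of 0] by simp
qed simp

lemma C_k_bounded_linear:
  assumes "bounded_linear f"
  shows "C_k k f"
proof (cases k)
  case 0
  then show ?thesis using assms by (simp add: linear_continuous_on)
next
  case (Suc n)
  have d: "(f has_derivative f) (at x)" for x using assms by (rule bounded_linear_imp_has_derivative)
  then show ?thesis
    using frechet_derivative_at [OF d, symmetric]
    by (auto simp: Suc differentiable_def C_k_const intro!: exI [of _ f])
qed

lemma C_k_compose_bounded_linear:
  assumes "bounded_linear g" "C_k k f"
  shows "C_k k (\<lambda>x. g (f x))"
  using assms(2)
proof (induction k arbitrary: f)
  case 0
  then show ?case using bounded_linear.continuous_on [OF assms(1)] by auto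
next
  case (Suc k)
  have d: "((\<lambda>x. g (f x)) has_derivative (\<lambda>v. g (frechet_derivative f (at x) v))) (at x)" for x
    using Suc.prems by (intro bounded_linear.has_derivative [OF assms(1)]) (auto simp: frechet_derivative_works)
  show ?case
    using Suc.IH Suc.prems frechet_derivative_at [OF d, symmetric] d
    by (auto simp: differentiable_def)
qed

lemma C_k_add:
  assumes "C_k k f" "C_k k g"
  shows "C_k k (\<lambda>x. f x + g x)"
  using assms
proof (induction k arbitrary: f g)
  case 0
  then show ?case by (auto intro: continuous_intros)
next
  case (Suc k)
  have d: "((\<lambda>x. f x + g x) has_derivative
      (\<lambda>v. frechet_derivative f (at x) v + frechet_derivative g (at x) v)) (at x)" for x
    using Suc.prems by (intro has_derivative_add) (auto simp: frechet_derivative_works)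
  show ?case
    using Suc.IH Suc.prems frechet_derivative_at [OF d, symmetric] differentiableI [OF d]
    by (simp only: C_k.simps) blast
qed

lemma C_k_scaleR:
  fixes f :: "'a::real_normed_vector \<Rightarrow> real"
  assumes "C_k k f" "C_k k g"
  shows "C_k k (\<lambda>x. f x *\<^sub>R g x)"
  using assms
proof (induction k arbitrary: f g)
  case 0
  then show ?case by (auto intro: continuous_intros)
next
  case (Suc k)
  have d: "((\<lambda>x. f x *\<^sub>R g x) has_derivative
      (\<lambda>v. f x *\<^sub>R frechet_derivative g (at x) v + frechet_derivative f (at x) v *\<^sub>R g x)) (at x)" for x
    using Suc.prems by (intro has_derivative_scaleR) (auto simp: frechet_derivative_works)
  have "C_k k f" "C_k k g" using Suc.prems C_k_Suc_imp by blast+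
  then have "C_k k (\<lambda>x. f x *\<^sub>R frechet_derivative g (at x) v + frechet_derivative f (at x) v *\<^sub>R g x)" for v
    using Suc.IH Suc.prems by (intro C_k_add) auto
  then show ?case
    using frechet_derivative_at [OF d, symmetric] d
    by (auto simp: differentiable_def)
qed

lemma smooth_add: "smooth f \<Longrightarrow> smooth g \<Longrightarrow> smooth (\<lambda>x. f x + g x)"
  and smooth_scaleR: "smooth (u :: 'a::real_normed_vector \<Rightarrow> real) \<Longrightarrow> smooth g \<Longrightarrow> smooth (\<lambda>x. u x *\<^sub>R g x)"
  and smooth_const: "smooth (\<lambda>x. c)"
  and smooth_bounded_linear: "bounded_linear l \<Longrightarrow> smooth l"
  and smooth_compose_bounded_linear: "bounded_linear l' \<Longrightarrow> smooth f \<Longrightarrow> smooth (\<lambda>x. l' (f x))"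
  by (simp_all add: smooth_def C_k_add C_k_scaleR C_k_const C_k_bounded_linear C_k_compose_bounded_linear)

lemma smooth_mult: "smooth f \<Longrightarrow> smooth g \<Longrightarrow> smooth (\<lambda>x. f x * g x :: real)"
  using smooth_scaleR [of f g] by simp

lemma smooth_uminus: "smooth f \<Longrightarrow> smooth (\<lambda>x. - f x)"
  using smooth_compose_bounded_linear [OF bounded_linear_minus [OF bounded_linear_ident]] .

lemma smooth_diff: "smooth f \<Longrightarrow> smooth g \<Longrightarrow> smooth (\<lambda>x. f x - g x)"
  using smooth_add [OF _ smooth_uminus, of f g] by simp

lemma smooth_nth: "smooth (f :: pt \<Rightarrow> pt) \<Longrightarrow> smooth (\<lambda>x. f x $ i)"
  using smooth_compose_bounded_linear [OF bounded_linear_vec_nth] .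

lemma smooth_coord: "smooth (\<lambda>x :: pt. x $ i)"
  by (rule smooth_bounded_linear [OF bounded_linear_vec_nth])

lemma smooth_power2: "smooth f \<Longrightarrow> smooth (\<lambda>x. (f x)\<^sup>2 :: real)"
  unfolding power2_eq_square by (rule smooth_mult)

lemma smooth_divide: "smooth f \<Longrightarrow> smooth (\<lambda>x. f x / c :: real)"
  using smooth_mult [OF _ smooth_const, of f "inverse c"] by (simp add: divide_inverse)

lemmas smooth_intros = smooth_divide smooth_add smooth_scaleR smooth_const smooth_mult smooth_uminus smooth_diff
  smooth_coord smooth_power2

lemma smooth_differentiable: "smooth f \<Longrightarrow> f differentiable (at x)"
  unfolding smooth_def by (metis C_k.simps(2))

lemma smooth_frechet_derivative: "smooth f \<Longrightarrow> smooth (\<lambda>x. frechet_derivative f (at x) v)"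
  unfolding smooth_def by (metis C_k.simps(2))

text \<open>\<open>C_k\<close> speaks of derivatives in constant directions. The direction
  \<open>V x\<close> varies, so it is expanded in coordinates with smooth coefficients.\<close>

lemma smooth_directional:
  assumes "smooth (V :: pt \<Rightarrow> pt)" "smooth (W :: pt \<Rightarrow> pt)"
  shows "smooth (\<lambda>x. frechet_derivative W (at x) (V x))"
proof -
  have lin: "linear (frechet_derivative W (at x))" for x
    using smooth_differentiable [OF assms(2)] by (simp add: linear_frechet_derivative)
  have "frechet_derivative W (at x) (V x) =
      V x $ 1 *\<^sub>R frechet_derivative W (at x) (axis 1 1) + V x $ 2 *\<^sub>R frechet_derivative W (at x) (axis 2 1)
      + V x $ 3 *\<^sub>R frechet_derivative W (at x) (axis 3 1) + V x $ 4 *\<^sub>R frechet_derivative W (at x) (axis 4 1)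
      + V x $ 5 *\<^sub>R frechet_derivative W (at x) (axis 5 1)" for x
  proof -
    have "V x = V x $ 1 *\<^sub>R axis 1 1 + V x $ 2 *\<^sub>R axis 2 1 + V x $ 3 *\<^sub>R axis 3 1
        + V x $ 4 *\<^sub>R axis 4 1 + V x $ 5 *\<^sub>R axis 5 1"
      by (simp add: vec_eq_iff forall5) (simp add: axis_def)
    then have "frechet_derivative W (at x) (V x) = frechet_derivative W (at x)
        (V x $ 1 *\<^sub>R axis 1 1 + V x $ 2 *\<^sub>R axis 2 1 + V x $ 3 *\<^sub>R axis 3 1
        + V x $ 4 *\<^sub>R axis 4 1 + V x $ 5 *\<^sub>R axis 5 1)" by metis
    then show ?thesis by (simp add: linear_add [OF lin] linear_cmul [OF lin])
  qed
  then show ?thesis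
    using assms by (auto intro!: smooth_intros smooth_nth smooth_frechet_derivative)
qed

lemma smooth_lie_bracket: "smooth V \<Longrightarrow> smooth W \<Longrightarrow> smooth (lie_bracket V W)"
  unfolding lie_bracket_def [abs_def] by (intro smooth_diff smooth_directional)

lemma smooth_lie_bracket_funpow: "smooth V \<Longrightarrow> smooth W \<Longrightarrow> smooth ((lie_bracket V ^^ j) W)"
  by (induction j) (auto intro: smooth_lie_bracket)

lemma smooth_frame: "smooth (X 1)" "smooth (X 2)"
  unfolding X_eq [abs_def] by (intro smooth_intros)+

lemma horizontal_field_horiz:
  "smooth f \<Longrightarrow> smooth g \<Longrightarrow> horizontal_field (\<lambda>x. horiz x (f x) (g x))"
  unfolding horizontal_field_def
  by (simp add: horiz_def [abs_def] smooth_add smooth_scaleR smooth_frame) (simp flip: horiz_def)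

lemma frechet_nth:
  assumes "(V :: pt \<Rightarrow> pt) differentiable (at x)"
  shows "((\<lambda>y. V y $ i) has_derivative (\<lambda>v. frechet_derivative V (at x) v $ i)) (at x)"
  using assms by (intro bounded_linear.has_derivative [OF bounded_linear_vec_nth])
    (auto simp: frechet_derivative_works)

text \<open>Components 3, 4, 5 of a horizontal field are polynomial multiples of the second one;
  these identities are differentiated.\<close>

lemma frechet_horizontal:
  assumes "V differentiable (at x)" and V: "\<And>y. V y \<in> horizontal_plane y"
  shows "frechet_derivative V (at x) v $ 3 = v$1 * V x $ 2 + x$1 * frechet_derivative V (at x) v $ 2"
    and "frechet_derivative V (at x) v $ 4 = x$1 * v$1 * V x $ 2 + (x$1)\<^sup>2 / 2 * frechet_derivative V (at x) v $ 2"
    and "frechet_derivative V (at x) v $ 5 = (v$1 * x$2 + x$1 * v$2) * V x $ 2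
      + x$1 * x$2 * frechet_derivative V (at x) v $ 2"
proof -
  note d = frechet_nth [OF assms(1)]
  have n: "((\<lambda>y::pt. y $ i) has_derivative (\<lambda>v. v $ i)) (at x)" for i
    by (rule bounded_linear_imp_has_derivative) (rule bounded_linear_vec_nth)
  have V': "V y $ 3 = y$1 * V y $ 2" "V y $ 4 = (y$1)\<^sup>2 / 2 * V y $ 2" "V y $ 5 = y$1 * y$2 * V y $ 2" for y
  proof -
    have eq: "V y = horiz y (V y $ 1) (V y $ 2)" using V [of y] by (simp add: horizontal_plane_iff)
    show "V y $ 3 = y$1 * V y $ 2" "V y $ 4 = (y$1)\<^sup>2 / 2 * V y $ 2" "V y $ 5 = y$1 * y$2 * V y $ 2"
      by (subst eq, simp)+
  qed
  have "((\<lambda>y. y$1 * V y $ 2) has_derivative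
      (\<lambda>v. x$1 * frechet_derivative V (at x) v $ 2 + v$1 * V x $ 2)) (at x)"
    by (rule derivative_eq_intros n d refl)+
  note eq = fun_cong [OF has_derivative_unique [OF d [of 3, unfolded V'] this], of v]
  show "frechet_derivative V (at x) v $ 3 = v$1 * V x $ 2 + x$1 * frechet_derivative V (at x) v $ 2"
    using eq by (simp only: add.commute)
  have "((\<lambda>y. (y$1)\<^sup>2 / 2 * V y $ 2) has_derivative
      (\<lambda>v. x$1 * v$1 * V x $ 2 + (x$1)\<^sup>2 / 2 * frechet_derivative V (at x) v $ 2)) (at x)"
    by (rule derivative_eq_intros n d refl numeral_neq_zero)+ (simp add: fun_eq_iff)
  note eq = fun_cong [OF has_derivative_unique [OF d [of 4, unfolded V'] this], of v]
  show "frechet_derivative V (at x) v $ 4 = x$1 * v$1 * V x $ 2 + (x$1)\<^sup>2 / 2 * frechet_derivative V (at x) v $ 2"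
    using eq by (simp only:)
  have "((\<lambda>y. y$1 * y$2 * V y $ 2) has_derivative
      (\<lambda>v. (v$1 * x$2 + x$1 * v$2) * V x $ 2 + x$1 * x$2 * frechet_derivative V (at x) v $ 2)) (at x)"
    by (rule derivative_eq_intros n d refl)+ (simp add: fun_eq_iff algebra_simps)
  note eq = fun_cong [OF has_derivative_unique [OF d [of 5, unfolded V'] this], of v]
  show "frechet_derivative V (at x) v $ 5 = (v$1 * x$2 + x$1 * v$2) * V x $ 2
      + x$1 * x$2 * frechet_derivative V (at x) v $ 2"
    using eq by (simp only:)
qed

lemma derivative_within_unique:
  assumes "a < b" "t \<in> {a..b}" "(f has_real_derivative d) (at t within {a..b})"
    "(f has_real_derivative e) (at t within {a..b})"
  shows "d = e"
  using vector_derivative_unique_within_closed_interval [of a b t f d e] assms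
  by (simp add: has_real_derivative_iff_has_vector_derivative)

section \<open>Iterated brackets along a geodesic\<close>

locale cartan_geodesic =
  fixes T :: real and \<gamma> m :: "real \<Rightarrow> pt"
  assumes T: "0 < T" and geo: "\<And>t. t \<in> {0..T} \<Longrightarrow> geo_at m \<gamma> t {0..T}"
begin

lemmas geod = geo_atD [OF geo]

text \<open>A neighbourhood of t relative to [0, T] that contains t, so that a property can be both
  evaluated at t and differentiated there.\<close>

abbreviation near :: "real \<Rightarrow> (real \<Rightarrow> bool) \<Rightarrow> bool" where
  "near t P \<equiv> \<forall>\<^sub>F s in nhds t. s \<in> {0..T} \<longrightarrow> P s"

definition fc :: "(pt \<Rightarrow> pt) \<Rightarrow> real \<Rightarrow> pt" where
  "fc W s = frame_comp (\<gamma> s) (W (\<gamma> s))"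

definition along :: "(pt \<Rightarrow> pt) \<Rightarrow> real \<Rightarrow> bool" where
  "along V s \<longleftrightarrow> V (\<gamma> s) = horiz (\<gamma> s) (m s $ 1) (m s $ 2)"

lemma const_on:
  assumes "\<And>t. t \<in> {0..T} \<Longrightarrow> (f has_real_derivative 0) (at t within {0..T})" "t \<in> {0..T}"
  shows "f t = f 0"
  using eq_on_interval_if_same_derivative [of 0 T f "\<lambda>_. 0" "\<lambda>_. f 0" 0 t] assms T by simp

lemma momentum_const:
  assumes "t \<in> {0..T}"
  shows "m t $ 4 = m 0 $ 4" "m t $ 5 = m 0 $ 5"
    "(m t $ 1)\<^sup>2 + (m t $ 2)\<^sup>2 = (m 0 $ 1)\<^sup>2 + (m 0 $ 2)\<^sup>2"
proof -
  show 4: "m t $ 4 = m 0 $ 4" and 5: "m t $ 5 = m 0 $ 5" using const_on geod(4,5) assms by auto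
  show "(m t $ 1)\<^sup>2 + (m t $ 2)\<^sup>2 = (m 0 $ 1)\<^sup>2 + (m 0 $ 2)\<^sup>2"
    by (rule const_on [OF _ assms]) (auto intro!: derivative_eq_intros geod)
qed

lemma velocity: "t \<in> {0..T} \<Longrightarrow> vector_derivative \<gamma> (at t within {0..T}) = horiz (\<gamma> t) (m t $ 1) (m t $ 2)"
  using geo_at_velocity [OF geo] T by (intro vector_derivative_within_closed_interval) auto

lemma velocity_extension_iff:
  "velocity_extension T \<gamma> t V \<longleftrightarrow> horizontal_field V \<and> near t (along V)"
  unfolding velocity_extension_def along_def using velocity by (auto elim: eventually_mono)

lemma fc_derivative:
  assumes W: "W differentiable (at (\<gamma> s))" and s: "s \<in> {0..T}" and V: "along V s"
  defines "w \<equiv> frechet_derivative W (at (\<gamma> s)) (V (\<gamma> s))"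
  shows "((\<lambda>t. fc W t $ 3) has_real_derivative
      w $ 3 - \<gamma> s $ 1 * w $ 2 - m s $ 1 * W (\<gamma> s) $ 2) (at s within {0..T})"
    and "((\<lambda>t. fc W t $ 4) has_real_derivative
      w $ 4 - \<gamma> s $ 1 * w $ 3 - m s $ 1 * W (\<gamma> s) $ 3 + \<gamma> s $ 1 * m s $ 1 * W (\<gamma> s) $ 2
      + (\<gamma> s $ 1)\<^sup>2 / 2 * w $ 2) (at s within {0..T})"
    and "((\<lambda>t. fc W t $ 5) has_real_derivative
      w $ 5 - \<gamma> s $ 2 * w $ 3 - m s $ 2 * W (\<gamma> s) $ 3) (at s within {0..T})"
proof -
  have "(W has_derivative frechet_derivative W (at (\<gamma> s))) (at (\<gamma> s))"
    using W by (simp add: frechet_derivative_works)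
  then have lin: "linear (frechet_derivative W (at (\<gamma> s)))"
    and D: "(W has_derivative frechet_derivative W (at (\<gamma> s))) (at (\<gamma> s))"
    by (auto dest: has_derivative_linear)
  have "((\<lambda>t. W (\<gamma> t)) has_vector_derivative w) (at s within {0..T})"
    using has_derivative_compose [OF geo_at_velocity [OF geo [OF s], unfolded has_vector_derivative_def] D] V
    by (simp add: w_def along_def has_vector_derivative_def linear_cmul [OF lin])
  note d = has_real_derivative_component [OF this]
  note g = geod [OF s]
  show "((\<lambda>t. fc W t $ 3) has_real_derivative
      w $ 3 - \<gamma> s $ 1 * w $ 2 - m s $ 1 * W (\<gamma> s) $ 2) (at s within {0..T})"
    unfolding fc_def frame_comp_def vec5_nth
    by (rule derivative_eq_intros d g refl)+ (simp add: algebra_simps)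
  show "((\<lambda>t. fc W t $ 4) has_real_derivative
      w $ 4 - \<gamma> s $ 1 * w $ 3 - m s $ 1 * W (\<gamma> s) $ 3 + \<gamma> s $ 1 * m s $ 1 * W (\<gamma> s) $ 2
      + (\<gamma> s $ 1)\<^sup>2 / 2 * w $ 2) (at s within {0..T})"
    unfolding fc_def frame_comp_def vec5_nth
    by (rule derivative_eq_intros d g refl numeral_neq_zero)+ (simp add: algebra_simps)
  show "((\<lambda>t. fc W t $ 5) has_real_derivative
      w $ 5 - \<gamma> s $ 2 * w $ 3 - m s $ 2 * W (\<gamma> s) $ 3) (at s within {0..T})"
    unfolding fc_def frame_comp_def vec5_nth
    by (rule derivative_eq_intros d g refl)+ (simp add: algebra_simps)
qed

text \<open>As V is horizontal, derivatives of its frame coefficients contribute to the bracket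
  along \<open>X 1\<close> and \<open>X 2\<close> alone. Components 3, 4, 5 consist of the
  derivative of W along the curve and of structure constants, so V enters them only through the
  velocity.\<close>

lemma fc_bracket:
  assumes W: "W differentiable (at (\<gamma> s))" and s: "s \<in> {0..T}" and V: "along V s" "horizontal_field V"
  shows "((\<lambda>t. fc W t $ 3) has_real_derivative
      fc (lie_bracket V W) s $ 3 - (m s $ 1 * fc W s $ 2 - m s $ 2 * fc W s $ 1)) (at s within {0..T})"
    and "((\<lambda>t. fc W t $ 4) has_real_derivative
      fc (lie_bracket V W) s $ 4 - m s $ 1 * fc W s $ 3) (at s within {0..T})"
    and "((\<lambda>t. fc W t $ 5) has_real_derivative
      fc (lie_bracket V W) s $ 5 - m s $ 2 * fc W s $ 3) (at s within {0..T})"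
proof -
  have dV: "V differentiable (at (\<gamma> s))" and hV: "\<And>y. V y \<in> horizontal_plane y"
    using V(2) by (auto simp: horizontal_field_def smooth_differentiable)
  note f = frechet_horizontal [OF dV hV, of "W (\<gamma> s)"]
  have v: "V (\<gamma> s) $ 1 = m s $ 1" "V (\<gamma> s) $ 2 = m s $ 2" using V(1) by (simp_all add: along_def)
  note d = fc_derivative [OF W s V(1)]
  show "((\<lambda>t. fc W t $ 3) has_real_derivative
      fc (lie_bracket V W) s $ 3 - (m s $ 1 * fc W s $ 2 - m s $ 2 * fc W s $ 1)) (at s within {0..T})"
    by (rule DERIV_cong [OF d(1)]) (simp add: fc_def frame_comp_def lie_bracket_def f v algebra_simps)
  show "((\<lambda>t. fc W t $ 4) has_real_derivative
      fc (lie_bracket V W) s $ 4 - m s $ 1 * fc W s $ 3) (at s within {0..T})"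
    by (rule DERIV_cong [OF d(2)])
       (simp add: fc_def frame_comp_def lie_bracket_def f v algebra_simps power2_eq_square)
  show "((\<lambda>t. fc W t $ 5) has_real_derivative
      fc (lie_bracket V W) s $ 5 - m s $ 2 * fc W s $ 3) (at s within {0..T})"
    by (rule DERIV_cong [OF d(3)]) (simp add: fc_def frame_comp_def lie_bracket_def f v algebra_simps)
qed

lemma near_zero_derivative:
  assumes "near t (\<lambda>s. f s = (0::real))" "t \<in> {0..T}" "(f has_real_derivative d) (at t within {0..T})"
  shows "d = 0"
proof (rule derivative_within_unique [OF T assms(2,3)])
  have "f t = 0" using eventually_nhds_x_imp_x [OF assms(1)] assms(2) by simp
  moreover have "\<forall>\<^sub>F x in at t within {0..T}. 0 = f x"
    using assms(1) by (auto simp: eventually_at_filter elim: eventually_mono)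
  moreover have "(*) (0::real) = (\<lambda>_. 0)" by auto
  ultimately show "(f has_real_derivative 0) (at t within {0..T})"
    unfolding has_field_derivative_def
    using has_derivative_transform_eventually [of "\<lambda>_. 0" "(*) 0" t "{0..T}" f] assms(2) by auto
qed

text \<open>An identity valid near t is valid near each s close to t, hence it may be differentiated
  at s.\<close>

lemma near_differentiate:
  assumes "near t (\<lambda>s. f s = (0::real))" "near t (\<lambda>s. (f has_real_derivative f' s) (at s within {0..T}))"
  shows "near t (\<lambda>s. f' s = 0)"
proof -
  have "\<forall>\<^sub>F s in nhds t. near s (\<lambda>s. f s = 0)"
    using assms(1) by (simp add: eventually_eventually)
  with assms(2) show ?thesis
    by eventually_elim (use near_zero_derivative in blast)
qed

lemma fc_horizontal: "horizontal_field W \<Longrightarrow> fc W s $ 3 = 0 \<and> fc W s $ 4 = 0 \<and> fc W s $ 5 = 0"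
proof -
  assume "horizontal_field W"
  then have "W (\<gamma> s) = horiz (\<gamma> s) (W (\<gamma> s) $ 1) (W (\<gamma> s) $ 2)"
    by (simp add: horizontal_field_def horizontal_plane_iff)
  then show ?thesis using frame_comp_horiz unfolding fc_def by (metis vec5_nth(3-5))
qed

context
  fixes V W :: "pt \<Rightarrow> pt" and t :: real
  assumes V: "horizontal_field V" "near t (along V)" and W: "horizontal_field W"
begin

definition "c j = fc ((lie_bracket V ^^ j) W)"

lemma c_deriv:
  "near t (\<lambda>s. ((\<lambda>t. c j t $ 3) has_real_derivative
      c (Suc j) s $ 3 - (m s $ 1 * c j s $ 2 - m s $ 2 * c j s $ 1)) (at s within {0..T}))"
  "near t (\<lambda>s. ((\<lambda>t. c j t $ 4) has_real_derivative
      c (Suc j) s $ 4 - m s $ 1 * c j s $ 3) (at s within {0..T}))"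
  "near t (\<lambda>s. ((\<lambda>t. c j t $ 5) has_real_derivative
      c (Suc j) s $ 5 - m s $ 2 * c j s $ 3) (at s within {0..T}))"
proof -
  have d: "(lie_bracket V ^^ j) W differentiable (at x)" for x
    using V(1) W by (intro smooth_differentiable smooth_lie_bracket_funpow) (auto simp: horizontal_field_def)
  show "near t (\<lambda>s. ((\<lambda>t. c j t $ 3) has_real_derivative
      c (Suc j) s $ 3 - (m s $ 1 * c j s $ 2 - m s $ 2 * c j s $ 1)) (at s within {0..T}))"
    "near t (\<lambda>s. ((\<lambda>t. c j t $ 4) has_real_derivative
      c (Suc j) s $ 4 - m s $ 1 * c j s $ 3) (at s within {0..T}))"
    "near t (\<lambda>s. ((\<lambda>t. c j t $ 5) has_real_derivative
      c (Suc j) s $ 5 - m s $ 2 * c j s $ 3) (at s within {0..T}))"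
    using V(2) fc_bracket [OF d _ _ V(1)] by (auto simp: c_def elim!: eventually_mono)
qed

lemma c_0: "c 0 s $ 3 = 0" "c 0 s $ 4 = 0" "c 0 s $ 5 = 0"
  using fc_horizontal [OF W] by (simp_all add: c_def)

lemma c_1: "near t (\<lambda>s. c 1 s $ 4 = 0)" "near t (\<lambda>s. c 1 s $ 5 = 0)"
  using near_differentiate [OF _ c_deriv(2) [of 0]] near_differentiate [OF _ c_deriv(3) [of 0]]
  by (simp_all add: c_0)

lemma c_2: "near t (\<lambda>s. c 2 s $ 4 = m s $ 1 * c 1 s $ 3)" "near t (\<lambda>s. c 2 s $ 5 = m s $ 2 * c 1 s $ 3)"
  using near_differentiate [OF c_1(1) c_deriv(2) [of 1]] near_differentiate [OF c_1(2) c_deriv(3) [of 1]]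
  by (simp_all add: numeral_2_eq_2)

text \<open>The left side is, up to the factor of the speed, the part of components (4, 5) normal to
  the velocity. It vanishes through the second bracket by \<open>c_2\<close>; differentiating
  \<open>c_2\<close> once more brings in the rotation of the velocity, whose angular speed is
  m3.\<close>

lemma c_3:
  assumes t: "t \<in> {0..T}"
  shows "m t $ 1 * c 3 t $ 5 - m t $ 2 * c 3 t $ 4
    = ((m t $ 1)\<^sup>2 + (m t $ 2)\<^sup>2) * m t $ 3 * c 1 t $ 3"
proof -
  have at: "P t" if "near t P" for P using eventually_nhds_x_imp_x [OF that] t by simp
  note d1 = at [OF c_deriv(1) [of 1]]
  define e where "e = c (Suc 1) t $ 3 - (m t $ 1 * c 1 t $ 2 - m t $ 2 * c 1 t $ 1)"
  have "((\<lambda>s. c 2 s $ 4 - m s $ 1 * c 1 s $ 3) has_real_derivative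
     c (Suc 2) t $ 4 - m t $ 1 * c 2 t $ 3 - (m t $ 1 * e + - (m t $ 2 * m t $ 3) * c 1 t $ 3)) (at t within {0..T})"
    by (rule derivative_eq_intros at [OF c_deriv(2)] geod [OF t] d1 refl)+ (simp add: e_def algebra_simps)
  note da = this
  have "((\<lambda>s. c 2 s $ 5 - m s $ 2 * c 1 s $ 3) has_real_derivative
     c (Suc 2) t $ 5 - m t $ 2 * c 2 t $ 3 - (m t $ 2 * e + m t $ 1 * m t $ 3 * c 1 t $ 3)) (at t within {0..T})"
    by (rule derivative_eq_intros at [OF c_deriv(3)] geod [OF t] d1 refl)+ (simp add: e_def algebra_simps)
  note db = this
  have "near t (\<lambda>s. c 2 s $ 4 - m s $ 1 * c 1 s $ 3 = 0)" "near t (\<lambda>s. c 2 s $ 5 - m s $ 2 * c 1 s $ 3 = 0)"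
    using c_2 by simp_all
  from near_zero_derivative [OF this(1) t da] near_zero_derivative [OF this(2) t db]
  have "c 3 t $ 4 = m t $ 1 * c 2 t $ 3 + (m t $ 1 * e + - (m t $ 2 * m t $ 3) * c 1 t $ 3)"
    "c 3 t $ 5 = m t $ 2 * c 2 t $ 3 + (m t $ 2 * e + m t $ 1 * m t $ 3 * c 1 t $ 3)"
    by (simp_all add: eval_nat_numeral)
  then show ?thesis by (simp only:) (simp add: algebra_simps power2_eq_square)
qed

text \<open>With m3 = 0 near t the velocity has constant frame components, so the relation that
  components (4, 5) are parallel to it survives differentiation and passes to brackets of every
  order.\<close>

lemma c_flat:
  assumes "near t (\<lambda>s. m s $ 3 = 0)"
  shows "near t (\<lambda>s. m s $ 1 * c j s $ 5 - m s $ 2 * c j s $ 4 = 0)"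
proof (induction j)
  case (Suc j)
  have "near t (\<lambda>s. ((\<lambda>s. m s $ 1 * c j s $ 5 - m s $ 2 * c j s $ 4) has_real_derivative
     m s $ 1 * c (Suc j) s $ 5 - m s $ 2 * c (Suc j) s $ 4) (at s within {0..T}))"
    using c_deriv(2) [of j] c_deriv(3) [of j] assms
  proof eventually_elim
    case (elim s)
    show ?case
    proof
      assume s: "s \<in> {0..T}"
      note d = elim(1,2) [THEN mp, OF s]
      have m3: "m s $ 3 = 0" using elim s by blast
      show "((\<lambda>s. m s $ 1 * c j s $ 5 - m s $ 2 * c j s $ 4) has_real_derivative
          m s $ 1 * c (Suc j) s $ 5 - m s $ 2 * c (Suc j) s $ 4) (at s within {0..T})"
        by (rule derivative_eq_intros d geod [OF s] refl)+ (simp add: m3 algebra_simps)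
    qed
  qed
  from near_differentiate [OF Suc.IH this] show ?case .
qed (simp add: c_0)

lemma c_rest:
  assumes "\<And>s. s \<in> {0..T} \<Longrightarrow> m s $ 1 = 0 \<and> m s $ 2 = 0"
  shows "near t (\<lambda>s. c j s $ 3 = 0)"
proof (induction j)
  case (Suc j)
  have "near t (\<lambda>s. ((\<lambda>t. c j t $ 3) has_real_derivative c (Suc j) s $ 3) (at s within {0..T}))"
    using c_deriv(1) [of j] by eventually_elim (use assms in auto)
  from near_differentiate [OF Suc.IH this] show ?case .
qed (simp add: c_0)

end

text \<open>A nonzero linear functional of the frame components that kills every generator shows
  that the flag is proper.\<close>

lemma flag_subset:
  assumes t: "t \<in> {0..T}" and f: "linear f"
    and z: "\<And>V W j. horizontal_field V \<Longrightarrow> near t (along V) \<Longrightarrow> horizontal_field W \<Longrightarrow> j < i \<Longrightarrow>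
      f (c V W j t) = (0::real)"
    and nz: "f u \<noteq> 0"
  shows "flag T \<gamma> t i \<noteq> UNIV"
proof
  assume U: "flag T \<gamma> t i = UNIV"
  have lin: "linear (\<lambda>v. f (frame_comp (\<gamma> t) v))"
    using linear_compose [OF linear_frame_comp f] by (simp add: o_def)
  have "f (frame_comp (\<gamma> t) v) = 0" if "v \<in> flag T \<gamma> t i" for v
    using that unfolding flag_def
  proof (rule span_induct)
    show "subspace {v. f (frame_comp (\<gamma> t) v) = 0}"
      using lin by (rule linear_subspace_kernel)
  next
    fix v assume "v \<in> {((lie_bracket V) ^^ j) W (\<gamma> t) | V W j.
      velocity_extension T \<gamma> t V \<and> horizontal_field W \<and> j < i}"
    then show "f (frame_comp (\<gamma> t) v) = 0"
      using z by (auto simp: velocity_extension_iff c_def fc_def)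
  qed
  then have "f (frame_comp (\<gamma> t) (frame_vec (\<gamma> t) u)) = 0" using U by blast
  then show False using nz by (simp add: frame_comp_vec)
qed

text \<open>The functional is the normal part of components (4, 5). At a zero of m3 it kills the
  third bracket too, by \<open>c_3\<close>.\<close>

lemma flag_not_UNIV_of_inflection:
  assumes t: "t \<in> {0..T}" and m3: "m t $ 3 = 0" and r: "(m t $ 1)\<^sup>2 + (m t $ 2)\<^sup>2 \<noteq> 0"
  shows "flag T \<gamma> t 4 \<noteq> UNIV"
proof (rule flag_subset [OF t, of "\<lambda>v. m t $ 1 * v $ 5 - m t $ 2 * v $ 4" _ "vec5 0 0 0 (- m t $ 2) (m t $ 1)"])
  show "linear (\<lambda>v :: pt. m t $ 1 * v $ 5 - m t $ 2 * v $ 4)"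
    by (rule linearI) (simp_all add: algebra_simps)
  show "m t $ 1 * vec5 0 0 0 (- m t $ 2) (m t $ 1) $ 5 - m t $ 2 * vec5 0 0 0 (- m t $ 2) (m t $ 1) $ 4 \<noteq> 0"
    using r by (simp add: power2_eq_square)
  fix V W and j :: nat
  assume a: "horizontal_field V" "near t (along V)" "horizontal_field W" "j < 4"
  have at: "P t" if "near t P" for P using eventually_nhds_x_imp_x [OF that] t by simp
  from a(4) consider "j = 0" | "j = 1" | "j = 2" | "j = 3" by linarith
  then show "m t $ 1 * c V W j t $ 5 - m t $ 2 * c V W j t $ 4 = 0"
  proof cases
    case 1
    then show ?thesis using c_0 [OF a(1-3)] by simp
  next
    case 2
    then show ?thesis using at [OF c_1(1) [OF a(1-3)]] at [OF c_1(2) [OF a(1-3)]] by simp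
  next
    case 3
    then show ?thesis using at [OF c_2(1) [OF a(1-3)]] at [OF c_2(2) [OF a(1-3)]] by simp
  next
    case 4
    then show ?thesis using c_3 [OF a(1-3) t] m3 by simp
  qed
qed

lemma flag_not_UNIV_of_line:
  assumes t: "t \<in> {0..T}" and m3: "near t (\<lambda>s. m s $ 3 = 0)" and r: "(m t $ 1)\<^sup>2 + (m t $ 2)\<^sup>2 \<noteq> 0"
  shows "flag T \<gamma> t i \<noteq> UNIV"
proof (rule flag_subset [OF t, of "\<lambda>v. m t $ 1 * v $ 5 - m t $ 2 * v $ 4" _ "vec5 0 0 0 (- m t $ 2) (m t $ 1)"])
  show "linear (\<lambda>v :: pt. m t $ 1 * v $ 5 - m t $ 2 * v $ 4)"
    by (rule linearI) (simp_all add: algebra_simps)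
  show "m t $ 1 * vec5 0 0 0 (- m t $ 2) (m t $ 1) $ 5 - m t $ 2 * vec5 0 0 0 (- m t $ 2) (m t $ 1) $ 4 \<noteq> 0"
    using r by (simp add: power2_eq_square)
  fix V W and j :: nat
  assume a: "horizontal_field V" "near t (along V)" "horizontal_field W"
  show "m t $ 1 * c V W j t $ 5 - m t $ 2 * c V W j t $ 4 = 0"
    using eventually_nhds_x_imp_x [OF c_flat [OF a m3]] t by simp
qed

lemma flag_not_UNIV_of_rest:
  assumes t: "t \<in> {0..T}" and r: "(m 0 $ 1)\<^sup>2 + (m 0 $ 2)\<^sup>2 = 0"
  shows "flag T \<gamma> t i \<noteq> UNIV"
proof (rule flag_subset [OF t, of "\<lambda>v. v $ 3" _ "axis 3 1"])
  show "linear (\<lambda>v :: pt. v $ 3)" by (rule linearI) simp_all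
  fix V W and j :: nat
  assume a: "horizontal_field V" "near t (along V)" "horizontal_field W"
  have "m s $ 1 = 0 \<and> m s $ 2 = 0" if "s \<in> {0..T}" for s
    using momentum_const(3) [OF that] r by (simp add: sum_power2_eq_zero_iff)
  from eventually_nhds_x_imp_x [OF c_rest [OF a this]] show "c V W j t $ 3 = 0" using t by simp
qed simp

text \<open>The three expressions are momenta of right-invariant fields, which are conserved by left
  invariance of the Hamiltonian. Solved for m1 and m2 they give the velocity as a polynomial in the
  position, hence a global extension even if the curve crosses itself.\<close>

lemma velocity_polynomial:
  obtains f g :: "pt \<Rightarrow> real" where "smooth f" "smooth g"
    "\<And>t. t \<in> {0..T} \<Longrightarrow> f (\<gamma> t) = m t $ 1 \<and> g (\<gamma> t) = m t $ 2"
proof -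
  let ?c3 = "\<lambda>t. m t $ 3 - \<gamma> t $ 1 * m t $ 4 - \<gamma> t $ 2 * m t $ 5"
  let ?c1 = "\<lambda>t. m t $ 1 + \<gamma> t $ 2 * m t $ 3 + (\<gamma> t $ 3 - \<gamma> t $ 1 * \<gamma> t $ 2) * m t $ 4 - (\<gamma> t $ 2)\<^sup>2 / 2 * m t $ 5"
  let ?c2 = "\<lambda>t. m t $ 2 - \<gamma> t $ 1 * m t $ 3 + (\<gamma> t $ 1)\<^sup>2 / 2 * m t $ 4 + \<gamma> t $ 3 * m t $ 5"
  have c: "?c3 t = ?c3 0" "?c1 t = ?c1 0" "?c2 t = ?c2 0" if "t \<in> {0..T}" for t
  proof -
    show "?c3 t = ?c3 0"
    proof (rule const_on [OF _ that])
      show "(?c3 has_real_derivative 0) (at t within {0..T})" if "t \<in> {0..T}" for t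
        by (rule derivative_eq_intros geod [OF that] refl)+ simp
    qed
    show "?c1 t = ?c1 0"
    proof (rule const_on [OF _ that])
      show "(?c1 has_real_derivative 0) (at t within {0..T})" if "t \<in> {0..T}" for t
        by (rule derivative_eq_intros geod [OF that] refl numeral_neq_zero)+ (simp add: algebra_simps)
    qed
    show "?c2 t = ?c2 0"
    proof (rule const_on [OF _ that])
      show "(?c2 has_real_derivative 0) (at t within {0..T})" if "t \<in> {0..T}" for t
        by (rule derivative_eq_intros geod [OF that] refl numeral_neq_zero)+ (simp add: algebra_simps)
    qed
  qed
  define h3 where "h3 x = ?c3 0 + x $ 1 * m 0 $ 4 + x $ 2 * m 0 $ 5" for x :: pt
  define f where "f x = ?c1 0 - x $ 2 * h3 x - (x $ 3 - x $ 1 * x $ 2) * m 0 $ 4 + (x $ 2)\<^sup>2 * (m 0 $ 5 / 2)" for x :: pt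
  define g where "g x = ?c2 0 + x $ 1 * h3 x - (x $ 1)\<^sup>2 * (m 0 $ 4 / 2) - x $ 3 * m 0 $ 5" for x :: pt
  have h: "h3 (\<gamma> t) = m t $ 3" if "t \<in> {0..T}" for t
    using c(1) [OF that] momentum_const [OF that] by (simp add: h3_def)
  show ?thesis
  proof
    show "smooth f" "smooth g"
      unfolding f_def [abs_def] g_def [abs_def] h3_def by (intro smooth_intros)+
    show "f (\<gamma> t) = m t $ 1 \<and> g (\<gamma> t) = m t $ 2" if "t \<in> {0..T}" for t
      using c(2,3) [OF that] momentum_const [OF that] h [OF that]
      unfolding f_def g_def by (simp add: algebra_simps)
  qed
qed

lemma flag_4_UNIV:
  assumes t: "t \<in> {0..T}" and m3: "m t $ 3 \<noteq> 0" and r: "(m 0 $ 1)\<^sup>2 + (m 0 $ 2)\<^sup>2 \<noteq> 0"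
  shows "flag T \<gamma> t 4 = UNIV"
proof -
  obtain f g where fg: "smooth f" "smooth g"
    "\<And>t. t \<in> {0..T} \<Longrightarrow> f (\<gamma> t) = m t $ 1 \<and> g (\<gamma> t) = m t $ 2"
    using velocity_polynomial by blast
  define V where "V x = horiz x (f x) (g x)" for x
  \<comment> \<open>The velocity turned by a right angle: the X3-component of its bracket with V is
    the squared speed.\<close>
  define W where "W x = horiz x (- g x) (f x)" for x
  have V: "horizontal_field V" and W: "horizontal_field W"
    unfolding V_def [abs_def] W_def [abs_def] by (intro horizontal_field_horiz fg smooth_uminus)+
  have al: "along V s" if "s \<in> {0..T}" for s using fg(3) [OF that] by (simp add: along_def V_def)
  then have nV: "near t (along V)" by simp
  define F where "F = flag T \<gamma> t 4"
  have in_F: "((lie_bracket V) ^^ j) W' (\<gamma> t) \<in> F" if "j < 4" "horizontal_field W'" for j W'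
    unfolding F_def flag_def using that V nV by (intro span_base) (auto simp: velocity_extension_iff)
  have sub: "subspace F" unfolding F_def flag_def by (rule subspace_span)
  let ?r = "(m 0 $ 1)\<^sup>2 + (m 0 $ 2)\<^sup>2"
  have at: "P t" if "near t P" for P using eventually_nhds_x_imp_x [OF that] t by simp
  have X1: "X 1 (\<gamma> t) \<in> F" and X2: "X 2 (\<gamma> t) \<in> F"
    using in_F [of 0 "X 1"] in_F [of 0 "X 2"] horizontal_field_horiz [of "\<lambda>_. 1" "\<lambda>_. 0"]
      horizontal_field_horiz [of "\<lambda>_. 0" "\<lambda>_. 1"] by (simp_all add: smooth_const horiz_def)
  have c13: "c V W 1 t $ 3 = ?r"
  proof -
    have "c V W 0 s = vec5 (- m s $ 2) (m s $ 1) 0 0 0" if "s \<in> {0..T}" for s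
      using fg(3) [OF that] by (simp add: c_def [OF V nV W] fc_def W_def frame_comp_horiz)
    moreover have "((\<lambda>s. c V W 0 s $ 3) has_real_derivative 0) (at t within {0..T})"
      using c_0 [OF V nV W] by simp
    moreover note at [OF c_deriv(1) [OF V nV W, of 0]]
    ultimately have "c V W (Suc 0) t $ 3 = m t $ 1 * m t $ 1 + m t $ 2 * m t $ 2"
      using derivative_within_unique [OF T t] t by fastforce
    then show ?thesis using momentum_const(3) [OF t] by (simp add: power2_eq_square)
  qed
  have fr: "frame_vec (\<gamma> t) (c V W j t) = ((lie_bracket V) ^^ j) W (\<gamma> t)" for j
    by (simp add: c_def [OF V nV W] fc_def frame_vec_comp)
  let ?x = "\<gamma> t"
  have scale_cancel: "v \<in> F" if "a *\<^sub>R v \<in> F" "a \<noteq> 0" for a v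
    using subspace_scale [OF sub that(1), of "1 / a"] that(2) by simp
  have horiz_F: "a *\<^sub>R X 1 ?x + b *\<^sub>R X 2 ?x \<in> F" for a b
    using sub X1 X2 by (intro subspace_add subspace_scale)
  have X3: "X 3 ?x \<in> F"
  proof -
    have "frame_vec ?x (c V W 1 t) - (c V W 1 t $ 1 *\<^sub>R X 1 ?x + c V W 1 t $ 2 *\<^sub>R X 2 ?x) \<in> F"
      using in_F [of 1 W] W fr [of 1] horiz_F sub by (intro subspace_diff) auto
    moreover have "frame_vec ?x (c V W 1 t) - (c V W 1 t $ 1 *\<^sub>R X 1 ?x + c V W 1 t $ 2 *\<^sub>R X 2 ?x)
        = ?r *\<^sub>R X 3 ?x"
      using at [OF c_1(1) [OF V nV W]] at [OF c_1(2) [OF V nV W]] c13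
      by (simp add: frame_vec_def)
    ultimately have "?r *\<^sub>R X 3 ?x \<in> F" by simp
    from scale_cancel [OF this r] show ?thesis .
  qed
  have tail: "c V W j t $ 4 *\<^sub>R X 4 ?x + c V W j t $ 5 *\<^sub>R X 5 ?x \<in> F" if "j < 4" for j
  proof -
    have "frame_vec ?x (c V W j t) - (c V W j t $ 1 *\<^sub>R X 1 ?x + c V W j t $ 2 *\<^sub>R X 2 ?x) - c V W j t $ 3 *\<^sub>R X 3 ?x \<in> F"
      using in_F [of j W] that W fr [of j] horiz_F sub X3 by (intro subspace_diff subspace_scale) auto
    then show ?thesis by (simp add: frame_vec_def algebra_simps)
  qed
  define A where "A = c V W 2 t $ 4" define B where "B = c V W 2 t $ 5"
  define C where "C = c V W 3 t $ 4" define D where "D = c V W 3 t $ 5"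
  have A: "A = m t $ 1 * ?r" "B = m t $ 2 * ?r"
    using at [OF c_2(1) [OF V nV W]] at [OF c_2(2) [OF V nV W]] c13 by (simp_all add: A_def B_def)
  \<comment> \<open>By \<open>c_2\<close> and \<open>c_3\<close> the X4 and X5 parts of the second
    and third brackets have as determinant the cube of the squared speed times m3; elimination then
    isolates X4 and X5.\<close>
  have det: "A * D - B * C = ?r * (?r * m t $ 3 * ?r)"
  proof -
    have "A * D - B * C = ?r * (m t $ 1 * D - m t $ 2 * C)" by (simp add: A algebra_simps)
    then show ?thesis
      using c_3 [OF V nV W t] momentum_const(3) [OF t] c13 by (simp add: C_def D_def)
  qed
  have d0: "A * D - B * C \<noteq> 0" unfolding det using r m3 by simp
  have X4: "X 4 ?x \<in> F"
  proof -
    have "D *\<^sub>R (A *\<^sub>R X 4 ?x + B *\<^sub>R X 5 ?x) - B *\<^sub>R (C *\<^sub>R X 4 ?x + D *\<^sub>R X 5 ?x) \<in> F"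
      using tail [of 2] tail [of 3] sub by (intro subspace_diff subspace_scale) (auto simp: A_def B_def C_def D_def)
    also have "D *\<^sub>R (A *\<^sub>R X 4 ?x + B *\<^sub>R X 5 ?x) - B *\<^sub>R (C *\<^sub>R X 4 ?x + D *\<^sub>R X 5 ?x) = (A * D - B * C) *\<^sub>R X 4 ?x"
      by (simp add: algebra_simps)
    finally show ?thesis by (rule scale_cancel [OF _ d0])
  qed
  have X5: "X 5 ?x \<in> F"
  proof -
    have "A *\<^sub>R (C *\<^sub>R X 4 ?x + D *\<^sub>R X 5 ?x) - C *\<^sub>R (A *\<^sub>R X 4 ?x + B *\<^sub>R X 5 ?x) \<in> F"
      using tail [of 2] tail [of 3] sub by (intro subspace_diff subspace_scale) (auto simp: A_def B_def C_def D_def)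
    also have "A *\<^sub>R (C *\<^sub>R X 4 ?x + D *\<^sub>R X 5 ?x) - C *\<^sub>R (A *\<^sub>R X 4 ?x + B *\<^sub>R X 5 ?x) = (A * D - B * C) *\<^sub>R X 5 ?x"
      by (simp add: algebra_simps)
    finally show ?thesis by (rule scale_cancel [OF _ d0])
  qed
  have "v \<in> F" for v
  proof -
    have "frame_vec ?x (frame_comp ?x v) \<in> F"
      unfolding frame_vec_def using sub X1 X2 X3 X4 X5 by (intro subspace_add subspace_scale)
    then show ?thesis by (simp add: frame_vec_comp)
  qed
  then show ?thesis unfolding F_def by blast
qed

lemma dim_flag: "growth_vector T \<gamma> t i = 5 \<longleftrightarrow> flag T \<gamma> t i = UNIV"
proof -
  have "span (flag T \<gamma> t i) = flag T \<gamma> t i" unfolding flag_def by simp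
  moreover have "DIM(pt) = 5" by simp
  ultimately show ?thesis unfolding growth_vector_def using dim_eq_full [of "flag T \<gamma> t i"] by metis
qed

theorem ample_equiregular_nondegenerate:
  assumes "ample T \<gamma>" "equiregular T \<gamma>"
  shows "(m 0 $ 1)\<^sup>2 + (m 0 $ 2)\<^sup>2 \<noteq> 0" "m 0 $ 3 \<noteq> 0"
proof -
  have 0: "0 \<in> {0..T}" using T by simp
  obtain i where i: "flag T \<gamma> 0 i = UNIV" using assms(1) 0 unfolding ample_def by blast
  show r: "(m 0 $ 1)\<^sup>2 + (m 0 $ 2)\<^sup>2 \<noteq> 0" using flag_not_UNIV_of_rest [OF 0] i by blast
  show "m 0 $ 3 \<noteq> 0"
  proof
    assume z: "m 0 $ 3 = 0"
    have g: "growth_vector T \<gamma> 0 4 \<noteq> 5"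
      using flag_not_UNIV_of_inflection [OF 0 z r] by (simp add: dim_flag)
    have "\<forall>\<^sub>F s in at 0 within {0..T}. growth_vector T \<gamma> s 4 = growth_vector T \<gamma> 0 4"
    proof -
      have "\<forall>\<^sub>F s in at 0 within {0..T}. \<forall>i\<ge>1. growth_vector T \<gamma> s i = growth_vector T \<gamma> 0 i"
        using assms(2) 0 unfolding equiregular_def by blast
      then show ?thesis by (rule eventually_mono) auto
    qed
    then have "\<forall>\<^sub>F s in at 0 within {0..T}. s \<in> {0..T} \<longrightarrow> m s $ 3 = 0"
      by (rule eventually_mono) (use g flag_4_UNIV [OF _ _ r] dim_flag in metis)
    \<comment> \<open>Equiregularity carries the defect of the fourth flag from 0 to nearby times,
      where \<open>flag_4_UNIV\<close> turns it into m3 = 0. The curve is then straight near 0 and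
      no flag at 0 is full.\<close>
    then have "near 0 (\<lambda>s. m s $ 3 = 0)"
      using z by (auto simp: eventually_at_filter elim!: eventually_mono)
    then show False using flag_not_UNIV_of_line [OF 0 _ r] i by blast
  qed
qed

end

section \<open>Minimality of short geodesics\<close>

text \<open>Forward difference quotients are bounded by the Lipschitz constant and converge off a
  null set, so dominated convergence applies. Their integrals are difference quotients of a
  primitive \<Phi> at the two ends, with limit f b - f a.\<close>

lemma lipschitz_ftc:
  fixes f f' :: "real \<Rightarrow> real"
  assumes ab: "a < b" and lip: "L-lipschitz_on {a..b} f" and N: "negligible N"
    and d: "\<And>t. t \<in> {a..b} - N \<Longrightarrow> (f has_real_derivative f' t) (at t)"
  shows "f' absolutely_integrable_on {a..b}" "(f' has_integral f b - f a) {a..b}"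
proof -
  \<comment> \<open>Continuing f by constants makes the forward quotients available up to b with the
    same Lipschitz constant.\<close>
  define F where "F t = f (min b (max a t))" for t
  have L: "0 \<le> L" using lip lipschitz_on_nonneg by blast
  have F_lip: "L-lipschitz_on UNIV F"
  proof (rule lipschitz_onI [OF _ L])
    fix s t :: real
    have "dist (F s) (F t) \<le> L * dist (min b (max a s)) (min b (max a t))"
      unfolding F_def using ab by (intro lipschitz_onD [OF lip]) auto
    also have "\<dots> \<le> L * dist s t" using L by (intro mult_left_mono) (auto simp: dist_real_def)
    finally show "dist (F s) (F t) \<le> L * dist s t" .
  qed
  then have F_cont: "continuous_on A F" for A
    using lipschitz_on_continuous_on lipschitz_on_subset by (metis subset_UNIV)
  define \<delta> where "\<delta> k = 1 / real (Suc k)" for k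
  have \<delta>: "0 < \<delta> k" "\<delta> k \<le> 1" for k by (auto simp: \<delta>_def)
  have \<delta>0: "\<delta> \<longlonglongrightarrow> 0" unfolding \<delta>_def by (rule LIMSEQ_Suc [OF lim_1_over_n])
  define Q where "Q k t = (F (t + \<delta> k) - F t) / \<delta> k" for k t
  \<comment> \<open>At b the forward quotients of F see only the constant continuation; the
    endpoints therefore join the exceptional set.\<close>
  define Z where "Z = insert a (insert b N)"
  have Z: "negligible Z" unfolding Z_def using N by (simp add: negligible_insert)
  define D where "D k t = (if t \<in> Z then 0 else Q k t)" for k t
  define g where "g t = (if t \<in> Z then 0 else f' t)" for t
  define \<Phi> where "\<Phi> t = integral {a - 1..t} F" for t
  have \<Phi>: "(\<Phi> has_real_derivative F t) (at t)" if "t \<in> {a..b + 1}" for t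
  proof -
    have "(\<Phi> has_real_derivative F t) (at t within {a - 1..b + 2})"
      unfolding \<Phi>_def using that by (intro integral_has_real_derivative F_cont) auto
    then show ?thesis using that at_within_Icc_at [of "a - 1" t "b + 2"] by simp
  qed
  have shift: "((\<lambda>t. F (t + d)) has_integral \<Phi> (b + d) - \<Phi> (a + d)) {a..b}" if "0 \<le> d" "d \<le> 1" for d
  proof (rule fundamental_theorem_of_calculus)
    fix t assume t: "t \<in> {a..b}"
    have "((\<lambda>t. \<Phi> (t + d)) has_real_derivative F (t + d) * 1) (at t within {a..b})"
      using t that by (intro DERIV_chain2 [where f = \<Phi>] \<Phi>) (auto intro!: derivative_eq_intros)
    then show "((\<lambda>t. \<Phi> (t + d)) has_vector_derivative F (t + d)) (at t within {a..b})"
      by (simp add: has_real_derivative_iff_has_vector_derivative)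
  qed (use ab in auto)
  have quot: "(\<lambda>k. (h (t + \<delta> k) - h t) / \<delta> k) \<longlonglongrightarrow> D" if "(h has_real_derivative D) (at t)" for h t D
  proof (rule filterlim_compose [OF DERIV_D [OF that]])
    show "filterlim \<delta> (at 0) sequentially"
      unfolding filterlim_at using \<delta>0 \<delta>(1) by (auto intro!: always_eventually simp: less_imp_neq [symmetric])
  qed
  have Q: "(Q k has_integral (\<Phi> (b + \<delta> k) - \<Phi> b) / \<delta> k - (\<Phi> (a + \<delta> k) - \<Phi> a) / \<delta> k) {a..b}" for k
  proof -
    have "((\<lambda>t. (F (t + \<delta> k) - F (t + 0)) / \<delta> k) has_integral
        ((\<Phi> (b + \<delta> k) - \<Phi> (a + \<delta> k)) - (\<Phi> (b + 0) - \<Phi> (a + 0))) / \<delta> k) {a..b}"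
      using \<delta> [of k] by (intro has_integral_divide has_integral_diff shift) auto
    then show ?thesis unfolding Q_def by (simp add: diff_divide_distrib add_divide_distrib algebra_simps)
  qed
  have D: "(D k has_integral (\<Phi> (b + \<delta> k) - \<Phi> b) / \<delta> k - (\<Phi> (a + \<delta> k) - \<Phi> a) / \<delta> k) {a..b}" for k
    by (rule has_integral_spike [OF Z _ Q]) (simp add: D_def)
  have bound: "norm (D k t) \<le> L" for k t
    using lipschitz_onD [OF F_lip, of "t + \<delta> k" t] \<delta>(1) [of k] L
    by (auto simp: D_def Q_def dist_real_def divide_simps)
  have conv: "(\<lambda>k. D k t) \<longlonglongrightarrow> g t" if t: "t \<in> {a..b}" for t
  proof (cases "t \<in> Z")
    case False
    then have t': "a < t" "t < b" "t \<notin> N" using t by (auto simp: Z_def)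
    have "(\<lambda>k. (f (t + \<delta> k) - f t) / \<delta> k) \<longlonglongrightarrow> f' t" using t t' by (intro quot d) auto
    moreover have "\<forall>\<^sub>F k in sequentially. (f (t + \<delta> k) - f t) / \<delta> k = D k t"
    proof -
      have "\<forall>\<^sub>F k in sequentially. \<delta> k < b - t" using \<delta>0 t' by (intro order_tendstoD) auto
      then show ?thesis
      proof eventually_elim
        case (elim k)
        then show ?case using t' \<delta>(1) [of k] False by (simp add: D_def Q_def F_def)
      qed
    qed
    ultimately have "(\<lambda>k. D k t) \<longlonglongrightarrow> f' t" by (rule Lim_transform_eventually)
    then show ?thesis using False by (simp add: g_def)
  qed (simp add: D_def g_def)
  have int: "D k integrable_on {a..b}" for k using D by blast
  have gi: "g integrable_on {a..b}" "(\<lambda>k. integral {a..b} (D k)) \<longlonglongrightarrow> integral {a..b} g"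
    by (rule dominated_convergence [OF int integrable_const_ivl [of L] bound conv]; assumption)+
  have "(\<lambda>k. integral {a..b} (D k)) \<longlonglongrightarrow> F b - F a"
    unfolding integral_unique [OF D] using ab by (intro tendsto_diff quot \<Phi>) auto
  then have "integral {a..b} g = f b - f a"
    using LIMSEQ_unique [OF gi(2)] ab by (simp add: F_def)
  then have g: "(g has_integral f b - f a) {a..b}" using gi(1) integrable_integral by fastforce
  then show "(f' has_integral f b - f a) {a..b}"
    by (rule has_integral_spike [OF Z, rotated]) (simp add: g_def)
  have "norm (g t) \<le> L" if "t \<in> {a..b}" for t
    by (rule LIMSEQ_le_const2 [OF tendsto_norm [OF conv [OF that]]]) (use bound in auto)
  then have "g absolutely_integrable_on {a..b}"
    by (intro absolutely_integrable_integrable_bound [OF _ gi(1) integrable_const_ivl [of L]]) auto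
  then show "f' absolutely_integrable_on {a..b}"
    by (rule absolutely_integrable_spike [OF _ Z]) (simp add: g_def)
qed

lemma AE_lebesgue_on_negligible:
  assumes "AE t in lebesgue_on S. P t" "S \<in> sets lebesgue"
  obtains N where "negligible N" "\<And>t. t \<in> S - N \<Longrightarrow> P t"
proof -
  have "AE t in lebesgue. t \<in> S \<longrightarrow> P t"
    using assms by (subst (asm) AE_restrict_space_iff) auto
  then obtain N where "N \<in> null_sets lebesgue" "{t \<in> space lebesgue. \<not> (t \<in> S \<longrightarrow> P t)} \<subseteq> N"
    unfolding eventually_ae_filter by blast
  then show ?thesis by (intro that [of N]) (auto simp: negligible_iff_null_sets)
qed

lemma component_lipschitz:
  fixes f :: "real \<Rightarrow> pt"
  assumes "L-lipschitz_on S f"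
  shows "L-lipschitz_on S (\<lambda>t. f t $ i)"
proof (rule lipschitz_onI)
  fix x y assume "x \<in> S" "y \<in> S"
  have "dist (f x $ i) (f y $ i) \<le> dist (f x) (f y)" by (rule dist_vec_nth_le)
  also have "\<dots> \<le> L * dist x y" using \<open>x \<in> S\<close> \<open>y \<in> S\<close> by (rule lipschitz_onD [OF assms])
  finally show "dist (f x $ i) (f y $ i) \<le> L * dist x y" .
qed (use assms lipschitz_on_nonneg in blast)

lemma admissible_curveE:
  assumes "admissible_curve T \<omega>" "0 < T"
  obtains L N u1 u2 where "negligible N" "L-lipschitz_on {0..T} \<omega>"
    "\<And>t i. t \<in> {0..T} - N \<Longrightarrow> ((\<lambda>s. \<omega> s $ i) has_real_derivative horiz (\<omega> t) (u1 t) (u2 t) $ i) (at t)"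
    "sr_length T \<omega> = integral {0..T} (\<lambda>t. sqrt ((u1 t)\<^sup>2 + (u2 t)\<^sup>2))"
proof -
  obtain L where L: "L-lipschitz_on {0..T} \<omega>" using assms(1) unfolding admissible_curve_def by blast
  have ae: "AE t in lebesgue_on {0..T}. \<omega> differentiable (at t) \<and> vector_derivative \<omega> (at t) \<in> horizontal_plane (\<omega> t)"
    using assms(1) unfolding admissible_curve_def by blast
  obtain N where N: "negligible N" "\<And>t. t \<in> {0..T} - N \<Longrightarrow>
      \<omega> differentiable (at t) \<and> vector_derivative \<omega> (at t) \<in> horizontal_plane (\<omega> t)"
    by (rule AE_lebesgue_on_negligible [OF ae]) auto
  define u1 where "u1 t = vector_derivative \<omega> (at t) $ 1" for t
  define u2 where "u2 t = vector_derivative \<omega> (at t) $ 2" for t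
  have v: "vector_derivative \<omega> (at t) = horiz (\<omega> t) (u1 t) (u2 t)" if "t \<in> {0..T} - N" for t
    using N(2) [OF that] by (simp add: horizontal_plane_iff u1_def u2_def)
  show ?thesis
  proof (rule that [OF N(1) L])
    fix t i assume t: "t \<in> {0..T} - N"
    then have "(\<omega> has_vector_derivative horiz (\<omega> t) (u1 t) (u2 t)) (at t)"
      using N(2) [OF t] v [OF t] vector_derivative_works [of \<omega> "at t"] by simp
    then show "((\<lambda>s. \<omega> s $ i) has_real_derivative horiz (\<omega> t) (u1 t) (u2 t) $ i) (at t)"
      by (rule has_real_derivative_component)
  next
    show "sr_length T \<omega> = integral {0..T} (\<lambda>t. sqrt ((u1 t)\<^sup>2 + (u2 t)\<^sup>2))"
      unfolding sr_length_def
      by (rule integral_spike [OF N(1)]) (simp only: v sr_metric_horiz power2_eq_square)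
  qed
qed

text \<open>The constant is hidden, so that products, compositions and C1 functions can be combined
  without bookkeeping.\<close>

definition lip :: "real \<Rightarrow> real \<Rightarrow> (real \<Rightarrow> real) \<Rightarrow> bool" where
  "lip a b f \<longleftrightarrow> (\<exists>L. L-lipschitz_on {a..b} f)"

lemma lip_const: "lip a b (\<lambda>_. c)"
  and lip_add: "lip a b f \<Longrightarrow> lip a b g \<Longrightarrow> lip a b (\<lambda>x. f x + g x)"
  and lip_diff: "lip a b f \<Longrightarrow> lip a b g \<Longrightarrow> lip a b (\<lambda>x. f x - g x)"
  unfolding lip_def using lipschitz_on_constant lipschitz_on_add lipschitz_on_diff by blast+

lemma lip_continuous: "lip a b f \<Longrightarrow> continuous_on {a..b} f"
  unfolding lip_def using lipschitz_on_continuous_on by blast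

lemma lip_mult:
  assumes "lip a b f" "lip a b g"
  shows "lip a b (\<lambda>x. f x * g x)"
proof -
  obtain L M where L: "L-lipschitz_on {a..b} f" and M: "M-lipschitz_on {a..b} g"
    using assms unfolding lip_def by blast
  have "bounded (f ` {a..b})" "bounded (g ` {a..b})"
    using lip_continuous [OF assms(1)] lip_continuous [OF assms(2)]
    by (auto intro!: compact_imp_bounded compact_continuous_image)
  then obtain A B where A: "\<And>x. x \<in> {a..b} \<Longrightarrow> \<bar>f x\<bar> \<le> A" and B: "\<And>x. x \<in> {a..b} \<Longrightarrow> \<bar>g x\<bar> \<le> B"
    by (auto simp only: bounded_real ball_simps)
  have "(\<bar>A\<bar> * M + L * \<bar>B\<bar>)-lipschitz_on {a..b} (\<lambda>x. f x * g x)"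
  proof (rule lipschitz_onI)
    fix x y assume xy: "x \<in> {a..b}" "y \<in> {a..b}"
    have "dist (f x * g x) (f y * g y) = \<bar>f x * (g x - g y) + (f x - f y) * g y\<bar>"
      by (simp add: dist_real_def algebra_simps)
    also have "\<dots> \<le> \<bar>f x * (g x - g y)\<bar> + \<bar>(f x - f y) * g y\<bar>"
      by (rule abs_triangle_ineq)
    also have "\<dots> = \<bar>f x\<bar> * \<bar>g x - g y\<bar> + \<bar>f x - f y\<bar> * \<bar>g y\<bar>"
      by (simp only: abs_mult)
    also have "\<dots> \<le> \<bar>A\<bar> * (M * dist x y) + (L * dist x y) * \<bar>B\<bar>"
    proof (intro add_mono mult_mono)
      show "\<bar>f x\<bar> \<le> \<bar>A\<bar>" "\<bar>g y\<bar> \<le> \<bar>B\<bar>" using A [OF xy(1)] B [OF xy(2)] by linarith+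
      show "\<bar>g x - g y\<bar> \<le> M * dist x y" "\<bar>f x - f y\<bar> \<le> L * dist x y"
        using lipschitz_onD [OF L xy] lipschitz_onD [OF M xy] by (simp_all add: dist_real_def)
    qed (use lipschitz_on_nonneg [OF L] in auto)
    finally show "dist (f x * g x) (f y * g y) \<le> (\<bar>A\<bar> * M + L * \<bar>B\<bar>) * dist x y"
      by (simp add: algebra_simps)
  qed (use lipschitz_on_nonneg [OF L] lipschitz_on_nonneg [OF M] in auto)
  then show ?thesis unfolding lip_def by blast
qed

lemma lip_C1:
  assumes "\<And>x. x \<in> {a..b} \<Longrightarrow> (f has_real_derivative f' x) (at x)" "continuous_on {a..b} f'"
  shows "lip a b f"
proof -
  have "bounded (f' ` {a..b})" using assms(2) by (intro compact_imp_bounded compact_continuous_image) auto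
  then obtain B where B: "\<And>x. x \<in> {a..b} \<Longrightarrow> \<bar>f' x\<bar> \<le> B" by (auto simp only: bounded_real ball_simps)
  have "\<bar>B\<bar>-lipschitz_on {a..b} f"
  proof (rule lipschitz_onI)
    fix x y assume "x \<in> {a..b}" "y \<in> {a..b}"
    then have "norm (f x - f y) \<le> \<bar>B\<bar> * norm (x - y)"
      using B by (intro field_differentiable_bound [of "{a..b}" f f'])
        (auto intro!: has_field_derivative_at_within assms(1) order_trans [OF _ abs_ge_self])
    then show "dist (f x) (f y) \<le> \<bar>B\<bar> * dist x y" by (simp add: dist_norm)
  qed simp
  then show ?thesis unfolding lip_def by blast
qed

lemma lip_compose:
  assumes "lip a b f" "lip c d g" "f ` {a..b} \<subseteq> {c..d}"
  shows "lip a b (\<lambda>x. g (f x))"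
proof -
  obtain L M where "L-lipschitz_on {a..b} f" "M-lipschitz_on {c..d} g" using assms unfolding lip_def by blast
  then have "(M * L)-lipschitz_on {a..b} (\<lambda>x. g (f x))"
    using assms(3) by (intro lipschitz_on_compose2) (auto intro: lipschitz_on_subset)
  then show ?thesis unfolding lip_def by blast
qed

lemmas lip_intros = lip_const lip_add lip_diff lip_mult

lemma lip_ftc:
  assumes "a < b" "lip a b f" "negligible N" "\<And>t. t \<in> {a..b} - N \<Longrightarrow> (f has_real_derivative f' t) (at t)"
  shows "f' absolutely_integrable_on {a..b}" "(f' has_integral f b - f a) {a..b}"
proof -
  obtain L where L: "L-lipschitz_on {a..b} f" using assms(2) unfolding lip_def by blast
  show "f' absolutely_integrable_on {a..b}" "(f' has_integral f b - f a) {a..b}"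
    using assms by (auto intro!: lipschitz_ftc [OF assms(1) L assms(3)])
qed

text \<open>Here \<open>w\<close> is the part of \<open>u\<close> not accounted for by the reparametrised reference velocity
  \<open>s m\<close>, and \<open>q\<close> the pointwise loss of length; \<open>w\<close> is orthogonal to \<open>e\<close>, hence a multiple of
  the cross product of \<open>u\<close> and \<open>m\<close>.\<close>

lemma excess_bound:
  fixes u1 u2 m1 m2 e1 e2 r :: real
  assumes r: "0 < r" "m1\<^sup>2 + m2\<^sup>2 = r\<^sup>2" and e: "e1\<^sup>2 + e2\<^sup>2 = 1" "r / 2 \<le> e1 * m1 + e2 * m2"
  defines "s \<equiv> (e1 * u1 + e2 * u2) / (e1 * m1 + e2 * m2)"
  defines "n \<equiv> sqrt (u1\<^sup>2 + u2\<^sup>2)"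
  defines "q \<equiv> n - (u1 * m1 + u2 * m2) / r"
  shows "0 \<le> q" "q \<le> 2 * n" "(u1 - s * m1)\<^sup>2 \<le> 8 * n * q" "(u2 - s * m2)\<^sup>2 \<le> 8 * n * q"
proof -
  let ?D = "e1 * m1 + e2 * m2" and ?c = "u1 * m2 - u2 * m1" and ?p = "u1 * m1 + u2 * m2"
  have D: "0 < ?D" using r(1) e(2) by linarith
  have n: "0 \<le> n" "n\<^sup>2 = u1\<^sup>2 + u2\<^sup>2" by (simp_all add: n_def)
  \<comment> \<open>Lagrange's identity for the plane vectors u and m.\<close>
  have lag: "?c\<^sup>2 + ?p\<^sup>2 = n\<^sup>2 * r\<^sup>2"
    unfolding n(2) r(2) [symmetric] by (simp add: power2_eq_square algebra_simps)
  have "\<bar>?p\<bar> \<le> \<bar>n * r\<bar>"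
    by (rule abs_le_square_iff [THEN iffD2]) (unfold power_mult_distrib, use lag zero_le_power2 [of ?c] in linarith)
  then have p: "?p \<le> n * r" "- (n * r) \<le> ?p" using n r(1) by auto
  show q: "0 \<le> q" using p r(1) by (simp add: q_def field_simps)
  show "q \<le> 2 * n" using p r(1) by (simp add: q_def field_simps)
  have qr: "r * q = n * r - ?p" using r(1) by (simp add: q_def field_simps)
  have "?c\<^sup>2 = (r * q) * (n * r + ?p)" using lag unfolding qr by (simp add: algebra_simps power2_eq_square)
  also have "\<dots> \<le> (r * q) * (2 * n * r)" using p q r(1) by (intro mult_left_mono) auto
  finally have c: "?c\<^sup>2 \<le> 2 * r\<^sup>2 * (n * q)" by (simp add: power2_eq_square algebra_simps)
  have w: "u1 - s * m1 = e2 * ?c / ?D" "u2 - s * m2 = - (e1 * ?c) / ?D"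
    using D by (simp_all add: s_def divide_simps) (simp_all add: algebra_simps)
  have D2: "r\<^sup>2 / 4 \<le> ?D\<^sup>2" using power_mono [OF e(2), of 2] r(1) by (simp add: power_divide)
  have nq: "0 \<le> n * q" using n q by simp
  have e12: "e1\<^sup>2 \<le> 1" "e2\<^sup>2 \<le> 1" using e(1) zero_le_power2 [of e1] zero_le_power2 [of e2] by linarith+
  have main: "(x * ?c / ?D)\<^sup>2 \<le> 8 * n * q" if "x\<^sup>2 \<le> 1" for x
  proof -
    have "(x * ?c)\<^sup>2 \<le> 1 * (2 * r\<^sup>2 * (n * q))"
      unfolding power_mult_distrib using that c by (intro mult_mono) auto
    also have "\<dots> = 8 * (n * q) * (r\<^sup>2 / 4)" by simp
    also have "\<dots> \<le> 8 * (n * q) * ?D\<^sup>2" using D2 nq by (intro mult_left_mono) auto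
    finally show ?thesis using D by (simp add: power_divide divide_le_eq)
  qed
  show "(u1 - s * m1)\<^sup>2 \<le> 8 * n * q" unfolding w using main [OF e12(2)] .
  show "(u2 - s * m2)\<^sup>2 \<le> 8 * n * q" unfolding w using main [of "- e1"] e12(1) by simp
qed

text \<open>The inequality of arithmetic and geometric means with weight \<tau>. It takes the place
  of the Cauchy-Schwarz inequality under the integral: the bound is linear in the integrable
  functions n and q, and \<tau> is chosen only after integration.\<close>

lemma abs_le_of_square_le:
  fixes w n q \<tau> :: real
  assumes "w\<^sup>2 \<le> 8 * n * q" "0 \<le> n" "0 \<le> q" "0 < \<tau>"
  shows "\<bar>w\<bar> \<le> \<tau> * n / 2 + 4 * q / \<tau>"
proof -
  have "8 * n * q \<le> (\<tau> * n / 2 + 4 * q / \<tau>)\<^sup>2"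
    using zero_le_power2 [of "\<tau> * n / 2 - 4 * q / \<tau>"] assms(4)
    by (simp add: power2_eq_square algebra_simps)
  then have "w\<^sup>2 \<le> (\<tau> * n / 2 + 4 * q / \<tau>)\<^sup>2" using assms(1) by linarith
  then have "\<bar>w\<bar> \<le> \<bar>\<tau> * n / 2 + 4 * q / \<tau>\<bar>" by (simp add: abs_le_square_iff)
  then show ?thesis using assms by simp
qed

lemma lip_subset: "lip a b f \<Longrightarrow> {c..d} \<subseteq> {a..b} \<Longrightarrow> lip c d f"
  unfolding lip_def using lipschitz_on_subset by blast

lemma lip_increment_bound:
  assumes f: "lip 0 T f" and N: "negligible N"
    and d: "\<And>t. t \<in> {0..T} - N \<Longrightarrow> (f has_real_derivative f' t) (at t)"
    and le: "\<And>t. t \<in> {0..T} - N \<Longrightarrow> \<bar>f' t\<bar> \<le> B t"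
    and B: "B integrable_on {0..T}" "\<And>t. t \<in> {0..T} \<Longrightarrow> 0 \<le> B t" and t: "t \<in> {0..T}"
  shows "\<bar>f t - f 0\<bar> \<le> integral {0..T} B"
proof (cases "t = 0")
  case True
  then show ?thesis using B by (auto intro: integral_nonneg)
next
  case False
  then have t0: "0 < t" using t by simp
  have sub: "{0..t} \<subseteq> {0..T}" using t by auto
  have hi: "(f' has_integral f t - f 0) {0..t}"
    by (rule lip_ftc [OF t0 lip_subset [OF f sub] N]) (use d sub in auto)
  define g where "g t = (if t \<in> N then 0 else f' t)" for t
  have g: "(g has_integral f t - f 0) {0..t}"
    by (rule has_integral_spike [OF N _ hi]) (simp add: g_def)
  have Bt: "B integrable_on {0..t}" using B(1) sub integrable_subinterval_real by blast
  have "\<bar>integral {0..t} g\<bar> \<le> integral {0..t} B"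
    using integral_norm_bound_integral [OF has_integral_integrable [OF g] Bt] le B(2) sub
    by (auto simp: g_def subset_iff)
  also have "\<dots> \<le> integral {0..T} B" using integral_subset_le [OF sub Bt B(1)] B(2) by simp
  finally show ?thesis using integral_unique [OF g] by simp
qed

text \<open>Supplies the reparametrisation that reads the time on the geodesic off the value of the
  calibrating functional. The positive lower bound on the slope makes the inverse Lipschitz.\<close>

lemma inverse_increasing:
  fixes f f' :: "real \<Rightarrow> real"
  assumes d: "\<And>s. s \<in> {c..d} \<Longrightarrow> (f has_real_derivative f' s) (at s)"
    and pos: "0 < k" "\<And>s. s \<in> {c..d} \<Longrightarrow> k \<le> f' s" and cd: "c < d"
  obtains g where "\<And>y. y \<in> {f c..f d} \<Longrightarrow> g y \<in> {c..d} \<and> f (g y) = y"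
    "\<And>s. s \<in> {c..d} \<Longrightarrow> g (f s) = s"
    "lip (f c) (f d) g"
    "\<And>y. y \<in> {f c<..<f d} \<Longrightarrow> (g has_real_derivative inverse (f' (g y))) (at y)"
    "\<And>s t. s \<in> {c..d} \<Longrightarrow> t \<in> {c..d} \<Longrightarrow> s \<le> t \<Longrightarrow> k * (t - s) \<le> f t - f s"
proof -
  have grow: "k * (t - s) \<le> f t - f s" if "s \<in> {c..d}" "t \<in> {c..d}" "s \<le> t" for s t
  proof -
    have "f s - k * s \<le> f t - k * t"
    proof (rule DERIV_nonneg_imp_nondecreasing [OF that(3)])
      fix x assume "s \<le> x" "x \<le> t"
      then have x: "x \<in> {c..d}" using that by auto
      show "\<exists>y. ((\<lambda>x. f x - k * x) has_real_derivative y) (at x) \<and> 0 \<le> y"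
        using pos(2) [OF x] by (intro exI [of _ "f' x - k"]) (auto intro!: derivative_eq_intros d x)
    qed
    then show ?thesis by (simp add: algebra_simps)
  qed
  have "\<exists>s\<in>{c..d}. f s = y" if "y \<in> {f c..f d}" for y
  proof -
    have "continuous_on {c..d} f"
      by (rule DERIV_continuous_on) (erule d [THEN has_field_derivative_at_within])
    then obtain s where "c \<le> s" "s \<le> d" "f s = y" using IVT' [of f c y d] \<open>y \<in> _\<close> cd by fastforce
    then show ?thesis by auto
  qed
  then obtain g where g: "\<And>y. y \<in> {f c..f d} \<Longrightarrow> g y \<in> {c..d} \<and> f (g y) = y" by metis
  have inj: "s = t" if "s \<in> {c..d}" "t \<in> {c..d}" "f s = f t" for s t
  proof (rule ccontr)
    assume "s \<noteq> t"
    then consider "s < t" | "t < s" by linarith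
    then show False
      using grow [of s t] grow [of t s] that mult_pos_pos [OF pos(1), of "t - s"] mult_pos_pos [OF pos(1), of "s - t"]
      by cases auto
  qed
  have range: "f s \<in> {f c..f d}" if "s \<in> {c..d}" for s
  proof -
    have "0 \<le> k * (s - c)" "0 \<le> k * (d - s)" using that pos(1) by auto
    moreover have "k * (s - c) \<le> f s - f c" "k * (d - s) \<le> f d - f s"
      using grow [of c s] grow [of s d] that cd by auto
    ultimately have "f c \<le> f s" "f s \<le> f d" by linarith+
    then show ?thesis by simp
  qed
  have gf: "g (f s) = s" if "s \<in> {c..d}" for s using inj g range that by metis
  have lipg: "(1 / k)-lipschitz_on {f c..f d} g"
  proof (rule lipschitz_onI)
    fix y z assume y: "y \<in> {f c..f d}" and z: "z \<in> {f c..f d}"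
    have "k * \<bar>g y - g z\<bar> \<le> \<bar>y - z\<bar>"
      using grow [of "g y" "g z"] grow [of "g z" "g y"] g [OF y] g [OF z] by (cases "g y \<le> g z") auto
    then show "dist (g y) (g z) \<le> 1 / k * dist y z"
      using pos(1) by (simp add: dist_real_def field_simps)
  qed (use pos in simp)
  then have lip: "lip (f c) (f d) g" unfolding lip_def by blast
  show ?thesis
  proof (rule that [OF g gf lip _ grow])
    fix y assume y: "y \<in> {f c<..<f d}"
    have "isCont g y"
      using lip_continuous [OF lip] y continuous_on_interior [of "{f c..f d}" g y] by simp
    moreover have "f' (g y) \<noteq> 0" "g y \<in> {c..d}" using pos g [of y] y by force+
    ultimately show "(g has_real_derivative inverse (f' (g y))) (at y)"
      using y g by (intro DERIV_inverse_function [where f = f and g = g and a = "f c" and b = "f d"] d) auto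
  qed auto
qed

text \<open>Each point of the competitor is matched with the point of the geodesic having the same
  value of e1 y1 + e2 y2. Applying the covector of the geodesic to the difference of the two points
  shows that r times the excess length is the integral of r q minus a remainder of second order in
  the deviation. The deviation is itself controlled by q, so for short curves the remainder is
  absorbed.\<close>

theorem geodesic_minimizing:
  fixes m x \<omega> :: "real \<Rightarrow> pt" and \<epsilon> r e1 e2 M a b T :: real
  assumes eps: "0 < \<epsilon>" and geo: "\<And>s. s \<in> {-\<epsilon>..\<epsilon>} \<Longrightarrow> geo_at m x s UNIV"
    and r: "0 < r" "\<And>s. s \<in> {-\<epsilon>..\<epsilon>} \<Longrightarrow> (m s $ 1)\<^sup>2 + (m s $ 2)\<^sup>2 = r\<^sup>2"
    and e: "e1\<^sup>2 + e2\<^sup>2 = 1" "\<And>s. s \<in> {-\<epsilon>..\<epsilon>} \<Longrightarrow> r / 2 \<le> e1 * m s $ 1 + e2 * m s $ 2"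
    and M: "1 \<le> M" "\<And>s. s \<in> {-\<epsilon>..\<epsilon>} \<Longrightarrow> \<bar>x s $ 1\<bar> \<le> M \<and> \<bar>x s $ 2\<bar> \<le> M \<and> \<bar>m s $ 4\<bar> \<le> M \<and> \<bar>m s $ 5\<bar> \<le> M \<and>
       \<bar>m s $ 3 - x s $ 1 * m s $ 4 - x s $ 2 * m s $ 5\<bar> \<le> M"
    and ab: "- (\<epsilon> / 2) \<le> a" "a \<le> \<epsilon> / 2" "b \<in> {-\<epsilon>..\<epsilon>}"
    and short: "r * (b - a) \<le> min 1 (min (\<epsilon> * r / 4) (r / (8 * (3 * M + 3 * M\<^sup>2))))"
    and \<omega>: "0 < T" "admissible_curve T \<omega>" "\<omega> 0 = x a" "\<omega> T = x b"
  shows "r * (b - a) \<le> sr_length T \<omega>"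
proof -
  define C where "C = 3 * M + 3 * M\<^sup>2"
  have C: "0 < C" using M(1) by (simp add: C_def add_pos_nonneg)
  obtain L' N0 u1 u2 where N0: "negligible N0" and Lip: "L'-lipschitz_on {0..T} \<omega>"
    and d\<omega>: "\<And>t i. t \<in> {0..T} - N0 \<Longrightarrow>
      ((\<lambda>s. \<omega> s $ i) has_real_derivative horiz (\<omega> t) (u1 t) (u2 t) $ i) (at t)"
    and len: "sr_length T \<omega> = integral {0..T} (\<lambda>t. sqrt ((u1 t)\<^sup>2 + (u2 t)\<^sup>2))"
    by (rule admissible_curveE [OF \<omega>(2,1)]) blast
  define n where "n t = sqrt ((u1 t)\<^sup>2 + (u2 t)\<^sup>2)" for t
  define L where "L = integral {0..T} n"
  have len: "sr_length T \<omega> = L" by (simp add: len L_def n_def [abs_def])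
  have n0: "0 \<le> n t" for t by (simp add: n_def)
  have lip\<omega>: "lip 0 T (\<lambda>t. \<omega> t $ i)" for i
    unfolding lip_def using component_lipschitz [OF Lip] by blast
  have d1: "((\<lambda>s. \<omega> s $ 1) has_real_derivative u1 t) (at t)"
    and d2: "((\<lambda>s. \<omega> s $ 2) has_real_derivative u2 t) (at t)"
    and d3: "((\<lambda>s. \<omega> s $ 3) has_real_derivative \<omega> t $ 1 * u2 t) (at t)"
    and d4: "((\<lambda>s. \<omega> s $ 4) has_real_derivative (\<omega> t $ 1)\<^sup>2 / 2 * u2 t) (at t)"
    and d5: "((\<lambda>s. \<omega> s $ 5) has_real_derivative \<omega> t $ 1 * \<omega> t $ 2 * u2 t) (at t)"
    if "t \<in> {0..T} - N0" for t
    using d\<omega> [OF that, of 1] d\<omega> [OF that, of 2] d\<omega> [OF that, of 3] d\<omega> [OF that, of 4] d\<omega> [OF that, of 5]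
    by simp_all
  have u: "u1 absolutely_integrable_on {0..T}" "u2 absolutely_integrable_on {0..T}"
    using lip_ftc(1) [OF \<omega>(1) lip\<omega> N0 d1] lip_ftc(1) [OF \<omega>(1) lip\<omega> N0 d2] by auto
  have "(\<lambda>t. (u1 t, u2 t)) absolutely_integrable_on {0..T}"
    using u by (subst absolutely_integrable_componentwise_iff) (auto simp: Basis_prod_def)
  then have "(\<lambda>t. norm (u1 t, u2 t)) integrable_on {0..T}"
    unfolding absolutely_integrable_on_def by blast
  moreover have "(\<lambda>t. norm (u1 t, u2 t)) = n" by (simp add: n_def fun_eq_iff norm_Pair)
  ultimately have n_int: "n integrable_on {0..T}" by (simp only:)
  show ?thesis
  \<comment> \<open>A competitor above the threshold is longer than the geodesic by
    \<open>short\<close>. Below it, \<epsilon> r / 4 keeps the curve where the reparametrisation is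
    defined, and r / (8 C) will absorb the remainder.\<close>
  proof (cases "L < min 1 (min (\<epsilon> * r / 4) (r / (8 * C)))")
    case False
    then show ?thesis using short unfolding len C_def by (simp only: not_less)
  next
    case True
    then have L: "L < 1" "L < \<epsilon> * r / 4" "L < r / (8 * C)" by auto
    have L0: "0 \<le> L" unfolding L_def using n_int n0 by (intro integral_nonneg) auto
    note g = geo_atD [OF geo]
    define \<phi> where "\<phi> s = e1 * x s $ 1 + e2 * x s $ 2" for s
    have d\<phi>: "(\<phi> has_real_derivative e1 * m s $ 1 + e2 * m s $ 2) (at s)" if "s \<in> {-\<epsilon>..\<epsilon>}" for s
      unfolding \<phi>_def using that by (auto intro!: derivative_eq_intros g)
    obtain \<psi> where \<psi>: "\<And>y. y \<in> {\<phi> (-\<epsilon>)..\<phi> \<epsilon>} \<Longrightarrow> \<psi> y \<in> {-\<epsilon>..\<epsilon>} \<and> \<phi> (\<psi> y) = y"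
      "\<And>s. s \<in> {-\<epsilon>..\<epsilon>} \<Longrightarrow> \<psi> (\<phi> s) = s" "lip (\<phi> (-\<epsilon>)) (\<phi> \<epsilon>) \<psi>"
      "\<And>y. y \<in> {\<phi> (-\<epsilon>)<..<\<phi> \<epsilon>} \<Longrightarrow>
         (\<psi> has_real_derivative inverse (e1 * m (\<psi> y) $ 1 + e2 * m (\<psi> y) $ 2)) (at y)"
      "\<And>s t. s \<in> {-\<epsilon>..\<epsilon>} \<Longrightarrow> t \<in> {-\<epsilon>..\<epsilon>} \<Longrightarrow> s \<le> t \<Longrightarrow> r / 2 * (t - s) \<le> \<phi> t - \<phi> s"
      by (rule inverse_increasing [of "-\<epsilon>" \<epsilon> \<phi> "\<lambda>s. e1 * m s $ 1 + e2 * m s $ 2" "r / 2", OF d\<phi>])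
         (use r eps e in auto)
    have a: "a \<in> {-\<epsilon>..\<epsilon>}" using ab eps by auto
    define y where "y t = e1 * \<omega> t $ 1 + e2 * \<omega> t $ 2" for t
    have lipy: "lip 0 T y" unfolding y_def by (intro lip_intros lip\<omega>)
    have dy: "(y has_real_derivative e1 * u1 t + e2 * u2 t) (at t)" if "t \<in> {0..T} - N0" for t
      unfolding y_def using that by (auto intro!: derivative_eq_intros d1 d2)
    have e_u: "\<bar>e1 * u1 t + e2 * u2 t\<bar> \<le> n t" for t
    proof -
      have "(e1 * u1 t + e2 * u2 t)\<^sup>2 \<le> (e1\<^sup>2 + e2\<^sup>2) * ((u1 t)\<^sup>2 + (u2 t)\<^sup>2)"
        using zero_le_power2 [of "e1 * u2 t - e2 * u1 t"] by (simp add: power2_eq_square algebra_simps)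
      then show ?thesis unfolding n_def e(1) by (intro real_le_rsqrt) simp
    qed
    have y_near: "\<bar>y t - \<phi> a\<bar> \<le> L" if "t \<in> {0..T}" for t
      using lip_increment_bound [OF lipy N0 dy e_u n_int n0 that] \<omega>(3) by (simp add: L_def y_def \<phi>_def)
    have y_in: "y t \<in> {\<phi> (-\<epsilon>)<..<\<phi> \<epsilon>}" if "t \<in> {0..T}" for t
    proof -
      have "r / 2 * (a - - \<epsilon>) \<le> \<phi> a - \<phi> (-\<epsilon>)" "r / 2 * (\<epsilon> - a) \<le> \<phi> \<epsilon> - \<phi> a"
        using \<psi>(5) [of "-\<epsilon>" a] \<psi>(5) [of a \<epsilon>] a eps by auto
      moreover have "r / 2 * (\<epsilon> / 2) \<le> r / 2 * (a - - \<epsilon>)" "r / 2 * (\<epsilon> / 2) \<le> r / 2 * (\<epsilon> - a)"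
        using ab r(1) by (intro mult_left_mono; simp)+
      moreover have "r / 2 * (\<epsilon> / 2) = \<epsilon> * r / 4" by simp
      ultimately have "\<epsilon> * r / 4 \<le> \<phi> a - \<phi> (-\<epsilon>)" "\<epsilon> * r / 4 \<le> \<phi> \<epsilon> - \<phi> a"
        by linarith+
      then show ?thesis using y_near [OF that] L(2) by auto
    qed
    define \<sigma> where "\<sigma> t = \<psi> (y t)" for t
    have \<sigma>: "\<sigma> t \<in> {-\<epsilon>..\<epsilon>}" if "t \<in> {0..T}" for t
      using \<psi>(1) [of "y t"] y_in [OF that] by (auto simp: \<sigma>_def)
    have lip\<sigma>: "lip 0 T \<sigma>"
      unfolding \<sigma>_def by (rule lip_compose [OF lipy \<psi>(3)]) (use y_in in force)
    define s' where "s' t = (e1 * u1 t + e2 * u2 t) / (e1 * m (\<sigma> t) $ 1 + e2 * m (\<sigma> t) $ 2)" for t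
    have d\<sigma>: "(\<sigma> has_real_derivative s' t) (at t)" if "t \<in> {0..T} - N0" for t
    proof -
      have "((\<lambda>t. \<psi> (y t)) has_real_derivative
          inverse (e1 * m (\<psi> (y t)) $ 1 + e2 * m (\<psi> (y t)) $ 2) * (e1 * u1 t + e2 * u2 t)) (at t)"
        using that by (intro DERIV_chain2 [where f = \<psi>] \<psi>(4) dy y_in) auto
      then show ?thesis unfolding \<sigma>_def [abs_def] s'_def by (simp add: divide_inverse mult.commute)
    qed
    have \<sigma>0: "\<sigma> 0 = a" and \<sigma>T: "\<sigma> T = b"
      using \<psi>(2) [OF a] \<psi>(2) [OF ab(3)] \<omega>(3,4) by (simp_all add: \<sigma>_def y_def \<phi>_def)
    \<comment> \<open>With m1, m4 and m5 these are the coordinates of the covector with respect to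
      the dx_i: the relations h_i = <p, X_i> solved for p.\<close>
    define p3 where "p3 s = m s $ 3 - x s $ 1 * m s $ 4 - x s $ 2 * m s $ 5" for s
    define p2 where "p2 s = m s $ 2 - x s $ 1 * p3 s - x s $ 1 * x s $ 1 * m s $ 4 / 2 - x s $ 1 * x s $ 2 * m s $ 5" for s
    have dm: "((\<lambda>t. m (\<sigma> t) $ 1) has_real_derivative - (m (\<sigma> t) $ 2 * m (\<sigma> t) $ 3) * s' t) (at t)"
      "((\<lambda>t. m (\<sigma> t) $ 2) has_real_derivative m (\<sigma> t) $ 1 * m (\<sigma> t) $ 3 * s' t) (at t)"
      "((\<lambda>t. m (\<sigma> t) $ 3) has_real_derivative (m (\<sigma> t) $ 1 * m (\<sigma> t) $ 4 + m (\<sigma> t) $ 2 * m (\<sigma> t) $ 5) * s' t) (at t)"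
      "((\<lambda>t. m (\<sigma> t) $ 4) has_real_derivative 0 * s' t) (at t)"
      "((\<lambda>t. m (\<sigma> t) $ 5) has_real_derivative 0 * s' t) (at t)"
      "((\<lambda>t. x (\<sigma> t) $ 1) has_real_derivative m (\<sigma> t) $ 1 * s' t) (at t)"
      "((\<lambda>t. x (\<sigma> t) $ 2) has_real_derivative m (\<sigma> t) $ 2 * s' t) (at t)"
      "((\<lambda>t. x (\<sigma> t) $ 3) has_real_derivative x (\<sigma> t) $ 1 * m (\<sigma> t) $ 2 * s' t) (at t)"
      "((\<lambda>t. x (\<sigma> t) $ 4) has_real_derivative (x (\<sigma> t) $ 1)\<^sup>2 / 2 * m (\<sigma> t) $ 2 * s' t) (at t)"
      "((\<lambda>t. x (\<sigma> t) $ 5) has_real_derivative x (\<sigma> t) $ 1 * x (\<sigma> t) $ 2 * m (\<sigma> t) $ 2 * s' t) (at t)"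
      if "t \<in> {0..T} - N0" for t
      using that \<sigma> [of t]
      by (intro DERIV_chain2 [where g = \<sigma>, OF _ d\<sigma>] g; simp)+
    define w1 where "w1 t = u1 t - s' t * m (\<sigma> t) $ 1" for t
    define w2 where "w2 t = u2 t - s' t * m (\<sigma> t) $ 2" for t
    define q where "q t = n t - (u1 t * m (\<sigma> t) $ 1 + u2 t * m (\<sigma> t) $ 2) / r" for t
    define \<delta>1 where "\<delta>1 t = \<omega> t $ 1 - x (\<sigma> t) $ 1" for t
    define \<delta>2 where "\<delta>2 t = \<omega> t $ 2 - x (\<sigma> t) $ 2" for t
    \<comment> \<open>What is left of the derivative of G beyond the pairing of momentum and w;
      every summand carries two small factors, each a deviation or w.\<close>
    define Rem where "Rem t = (p3 (\<sigma> t) * \<delta>1 t + m (\<sigma> t) $ 4 * x (\<sigma> t) $ 1 * \<delta>1 t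
        + m (\<sigma> t) $ 5 * (x (\<sigma> t) $ 1 * \<delta>2 t + x (\<sigma> t) $ 2 * \<delta>1 t)) * w2 t
        + (m (\<sigma> t) $ 4 * (\<delta>1 t)\<^sup>2 / 2 + m (\<sigma> t) $ 5 * \<delta>1 t * \<delta>2 t) * u2 t" for t
    \<comment> \<open>The covector at \<sigma>(t) applied to the difference of coordinates. It
      vanishes at both ends, so its derivative integrates to 0.\<close>
    define G where "G t = m (\<sigma> t) $ 1 * (\<omega> t $ 1 - x (\<sigma> t) $ 1) + p2 (\<sigma> t) * (\<omega> t $ 2 - x (\<sigma> t) $ 2)
        + p3 (\<sigma> t) * (\<omega> t $ 3 - x (\<sigma> t) $ 3) + m (\<sigma> t) $ 4 * (\<omega> t $ 4 - x (\<sigma> t) $ 4)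
        + m (\<sigma> t) $ 5 * (\<omega> t $ 5 - x (\<sigma> t) $ 5)" for t
    define G' where "G' t = m (\<sigma> t) $ 1 * w1 t + m (\<sigma> t) $ 2 * w2 t + Rem t" for t
    have dG: "(G has_real_derivative G' t) (at t)" if "t \<in> {0..T} - N0" for t
      unfolding G_def p2_def p3_def
      apply (rule derivative_eq_intros dm [OF that] d1 [OF that] d2 [OF that] d3 [OF that] d4 [OF that] d5 [OF that]
          refl numeral_neq_zero)+
      apply (simp add: G'_def Rem_def \<delta>1_def \<delta>2_def w1_def w2_def p3_def field_simps power2_eq_square)
      done
    have cm: "continuous_on {-\<epsilon>..\<epsilon>} (\<lambda>s. m s $ 1)" "continuous_on {-\<epsilon>..\<epsilon>} (\<lambda>s. m s $ 2)"
      "continuous_on {-\<epsilon>..\<epsilon>} (\<lambda>s. m s $ 3)" "continuous_on {-\<epsilon>..\<epsilon>} (\<lambda>s. m s $ 4)"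
      "continuous_on {-\<epsilon>..\<epsilon>} (\<lambda>s. m s $ 5)" "continuous_on {-\<epsilon>..\<epsilon>} (\<lambda>s. x s $ 1)"
      "continuous_on {-\<epsilon>..\<epsilon>} (\<lambda>s. x s $ 2)"
      by (rule DERIV_continuous_on, rule has_field_derivative_at_within, erule g)+
    have lm: "lip (-\<epsilon>) \<epsilon> (\<lambda>s. m s $ 1)" "lip (-\<epsilon>) \<epsilon> (\<lambda>s. m s $ 2)" "lip (-\<epsilon>) \<epsilon> (\<lambda>s. m s $ 3)"
      "lip (-\<epsilon>) \<epsilon> (\<lambda>s. m s $ 4)" "lip (-\<epsilon>) \<epsilon> (\<lambda>s. m s $ 5)" "lip (-\<epsilon>) \<epsilon> (\<lambda>s. x s $ 1)"
      "lip (-\<epsilon>) \<epsilon> (\<lambda>s. x s $ 2)" "lip (-\<epsilon>) \<epsilon> (\<lambda>s. x s $ 3)" "lip (-\<epsilon>) \<epsilon> (\<lambda>s. x s $ 4)"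
      "lip (-\<epsilon>) \<epsilon> (\<lambda>s. x s $ 5)"
      by (rule lip_C1, erule g, intro continuous_intros cm, simp?)+
    have l\<sigma>: "lip 0 T (\<lambda>t. f (\<sigma> t))" if "lip (-\<epsilon>) \<epsilon> f" for f
      by (rule lip_compose [OF lip\<sigma> that]) (use \<sigma> in auto)
    have half: "lip c d (\<lambda>t. f t / 2)" if "lip c d f" for c d f
      using lip_mult [OF that lip_const [of c d "1 / 2"]] by simp
    have "lip 0 T G"
      unfolding G_def p2_def p3_def by (intro lip_intros half lip\<omega> l\<sigma> lm)
    from lip_ftc [OF \<omega>(1) this N0 dG]
    have G': "(G' has_integral 0) {0..T}"
      using \<sigma>0 \<sigma>T \<omega>(3,4) by (simp add: G_def)
    have s'_int: "(s' has_integral b - a) {0..T}"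
      using lip_ftc(2) [OF \<omega>(1) lip\<sigma> N0 d\<sigma>] \<sigma>0 \<sigma>T by simp
    have um: "(\<lambda>t. m (\<sigma> t) $ i * v t) absolutely_integrable_on {0..T}"
      if "v absolutely_integrable_on {0..T}" "i = 1 \<or> i = 2" for v i
    proof -
      have c: "continuous_on {0..T} (\<lambda>t. m (\<sigma> t) $ i)"
        using l\<sigma> [OF lm(1)] l\<sigma> [OF lm(2)] that(2) lip_continuous by auto
      show ?thesis
        by (intro absolutely_integrable_bounded_measurable_product_real that(1)
            continuous_imp_measurable_on_sets_lebesgue c compact_imp_bounded compact_continuous_image) auto
    qed
    have q_int: "q integrable_on {0..T}"
    proof -
      have "(\<lambda>t. n t - (m (\<sigma> t) $ 1 * u1 t + m (\<sigma> t) $ 2 * u2 t) / r) integrable_on {0..T}"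
        using n_int um [OF u(1), of 1] um [OF u(2), of 2] set_lebesgue_integral_eq_integral(1)
        by (intro integrable_diff integrable_on_divide integrable_add) auto
      then show ?thesis by (simp add: q_def [abs_def] mult.commute)
    qed
    have ex: "0 \<le> q t" "q t \<le> 2 * n t" "(w1 t)\<^sup>2 \<le> 8 * n t * q t" "(w2 t)\<^sup>2 \<le> 8 * n t * q t" if "t \<in> {0..T}" for t
      using excess_bound [OF r(1) r(2) [OF \<sigma> [OF that]] e(1) e(2) [OF \<sigma> [OF that]],
          where ?u1.0 = "u1 t" and ?u2.0 = "u2 t"]
      unfolding q_def n_def w1_def w2_def s'_def by blast+
    define Q where "Q = integral {0..T} q"
    have Q0: "0 \<le> Q" unfolding Q_def using q_int ex by (intro integral_nonneg) auto
    have Q2: "Q \<le> 2 * L"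
    proof -
      have "integral {0..T} q \<le> integral {0..T} (\<lambda>t. 2 * n t)"
        using q_int n_int ex by (intro integral_le integrable_on_mult_right) auto
      then show ?thesis by (simp add: Q_def L_def)
    qed
    \<comment> \<open>The squared expression is W^2, where W bounds the deviation in the first two
      coordinates; C W^2 dominates the integral of the remainder. The weight \<tau> stays
      free.\<close>
    have key: "r * Q - C * (\<tau> * L / 2 + 4 * Q / \<tau>)\<^sup>2 \<le> r * L - r\<^sup>2 * (b - a)" if \<tau>: "0 < \<tau>" for \<tau>
    proof -
      define v where "v t = \<tau> * n t / 2 + 4 * q t / \<tau>" for t
      define W where "W = \<tau> * L / 2 + 4 * Q / \<tau>"
      have v_has: "(v has_integral W) {0..T}"
        unfolding v_def W_def L_def Q_def using n_int q_int
        by (intro has_integral_add has_integral_divide has_integral_mult_right integrable_integral)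
      have v_int: "v integrable_on {0..T}" and v_W: "integral {0..T} v = W"
        using v_has by (auto simp: has_integral_iff)
      have w_le: "\<bar>w1 t\<bar> \<le> v t" "\<bar>w2 t\<bar> \<le> v t" if "t \<in> {0..T}" for t
        unfolding v_def using ex [OF that] n0 \<tau> by (auto intro: abs_le_of_square_le)
      have v0: "0 \<le> v t" if "t \<in> {0..T}" for t using w_le(1) [OF that] by linarith
      have \<delta>_le: "\<bar>\<delta>1 t\<bar> \<le> W" "\<bar>\<delta>2 t\<bar> \<le> W" if t: "t \<in> {0..T}" for t
      proof -
        have "\<bar>\<delta>1 t - \<delta>1 0\<bar> \<le> integral {0..T} v"
        proof (rule lip_increment_bound [OF _ N0 _ _ v_int v0 t])
          show "lip 0 T \<delta>1" unfolding \<delta>1_def by (intro lip_intros lip\<omega> l\<sigma> lm)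
          show "(\<delta>1 has_real_derivative w1 s) (at s)" if "s \<in> {0..T} - N0" for s
            unfolding \<delta>1_def w1_def using d1 [OF that] dm(6) [OF that] by (auto intro!: derivative_eq_intros)
        qed (use w_le in auto)
        then show "\<bar>\<delta>1 t\<bar> \<le> W" using \<sigma>0 \<omega>(3) v_W by (simp add: \<delta>1_def)
        have "\<bar>\<delta>2 t - \<delta>2 0\<bar> \<le> integral {0..T} v"
        proof (rule lip_increment_bound [OF _ N0 _ _ v_int v0 t])
          show "lip 0 T \<delta>2" unfolding \<delta>2_def by (intro lip_intros lip\<omega> l\<sigma> lm)
          show "(\<delta>2 has_real_derivative w2 s) (at s)" if "s \<in> {0..T} - N0" for s
            unfolding \<delta>2_def w2_def using d2 [OF that] dm(7) [OF that] by (auto intro!: derivative_eq_intros)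
        qed (use w_le in auto)
        then show "\<bar>\<delta>2 t\<bar> \<le> W" using \<sigma>0 \<omega>(3) v_W by (simp add: \<delta>2_def)
      qed
      have W0: "0 \<le> W" using \<delta>_le(1) [of 0] \<omega>(1) by (auto intro: order_trans [OF abs_ge_zero])
      define B where "B t = (M + 3 * M\<^sup>2) * W * v t + 3 / 2 * M * W\<^sup>2 * n t" for t
      have Rem_le: "Rem t \<le> B t" if t: "t \<in> {0..T}" for t
      proof -
        note Mt = M(2) [OF \<sigma> [OF t]]
        have p3: "\<bar>p3 (\<sigma> t)\<bar> \<le> M" using Mt by (simp add: p3_def)
        have M0: "0 \<le> M" using M(1) by simp
        have "\<bar>p3 (\<sigma> t) * \<delta>1 t + m (\<sigma> t) $ 4 * x (\<sigma> t) $ 1 * \<delta>1 t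
            + m (\<sigma> t) $ 5 * (x (\<sigma> t) $ 1 * \<delta>2 t + x (\<sigma> t) $ 2 * \<delta>1 t)\<bar>
          \<le> \<bar>p3 (\<sigma> t)\<bar> * \<bar>\<delta>1 t\<bar> + \<bar>m (\<sigma> t) $ 4\<bar> * \<bar>x (\<sigma> t) $ 1\<bar> * \<bar>\<delta>1 t\<bar>
            + \<bar>m (\<sigma> t) $ 5\<bar> * (\<bar>x (\<sigma> t) $ 1\<bar> * \<bar>\<delta>2 t\<bar> + \<bar>x (\<sigma> t) $ 2\<bar> * \<bar>\<delta>1 t\<bar>)"
        proof -
          have "\<bar>m (\<sigma> t) $ 5 * (x (\<sigma> t) $ 1 * \<delta>2 t + x (\<sigma> t) $ 2 * \<delta>1 t)\<bar>
              \<le> \<bar>m (\<sigma> t) $ 5\<bar> * (\<bar>x (\<sigma> t) $ 1 * \<delta>2 t\<bar> + \<bar>x (\<sigma> t) $ 2 * \<delta>1 t\<bar>)"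
            by (subst abs_mult) (intro mult_left_mono abs_triangle_ineq abs_ge_zero)
          moreover have "\<bar>p + q + s\<bar> \<le> \<bar>p\<bar> + \<bar>q\<bar> + \<bar>s\<bar>" for p q s :: real by linarith
          ultimately show ?thesis
            unfolding abs_mult [symmetric] by (smt (verit) abs_mult mult.assoc)
        qed
        also have "\<dots> \<le> M * W + M * M * W + M * (M * W + M * W)"
          using Mt p3 \<delta>_le [OF t] M0 W0 by (intro add_mono mult_mono) auto
        also have "\<dots> = (M + 3 * M\<^sup>2) * W" by (simp add: power2_eq_square algebra_simps)
        finally have A: "\<bar>p3 (\<sigma> t) * \<delta>1 t + m (\<sigma> t) $ 4 * x (\<sigma> t) $ 1 * \<delta>1 t
            + m (\<sigma> t) $ 5 * (x (\<sigma> t) $ 1 * \<delta>2 t + x (\<sigma> t) $ 2 * \<delta>1 t)\<bar> \<le> (M + 3 * M\<^sup>2) * W" .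
        have "\<bar>m (\<sigma> t) $ 4 * (\<delta>1 t)\<^sup>2 / 2 + m (\<sigma> t) $ 5 * \<delta>1 t * \<delta>2 t\<bar>
          \<le> \<bar>m (\<sigma> t) $ 4\<bar> * (\<bar>\<delta>1 t\<bar> * \<bar>\<delta>1 t\<bar>) / 2 + \<bar>m (\<sigma> t) $ 5\<bar> * \<bar>\<delta>1 t\<bar> * \<bar>\<delta>2 t\<bar>"
          by (rule order_trans [OF abs_triangle_ineq]) (simp add: abs_mult power2_eq_square)
        also have "\<dots> \<le> M * (W * W) / 2 + M * W * W"
          using Mt \<delta>_le [OF t] M0 W0 by (intro add_mono mult_mono divide_right_mono) auto
        also have "\<dots> = 3 / 2 * M * W\<^sup>2" by (simp add: power2_eq_square)
        finally have B: "\<bar>m (\<sigma> t) $ 4 * (\<delta>1 t)\<^sup>2 / 2 + m (\<sigma> t) $ 5 * \<delta>1 t * \<delta>2 t\<bar> \<le> 3 / 2 * M * W\<^sup>2" .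
        have u2n: "\<bar>u2 t\<bar> \<le> n t"
          unfolding n_def by (rule real_le_rsqrt) simp
        have "Rem t \<le> (M + 3 * M\<^sup>2) * W * v t + 3 / 2 * M * W\<^sup>2 * n t"
          unfolding Rem_def
          by (rule add_mono; rule order_trans [OF abs_ge_self]; unfold abs_mult [of _ "w2 t"] abs_mult [of _ "u2 t"];
              rule mult_mono) (use A B w_le(2) [OF t] u2n M0 W0 in auto)
        then show ?thesis by (simp add: B_def)
      qed
      have f_has: "((\<lambda>t. r * n t - r\<^sup>2 * s' t - G' t) has_integral r * L - r\<^sup>2 * (b - a) - 0) {0..T}"
        unfolding L_def using n_int
        by (intro has_integral_diff has_integral_mult_right G' s'_int integrable_integral)
      have g_has: "((\<lambda>t. r * q t - B t) has_integral r * Q - ((M + 3 * M\<^sup>2) * W * W + 3 / 2 * M * W\<^sup>2 * L)) {0..T}"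
        unfolding Q_def L_def B_def using n_int q_int
        by (intro has_integral_diff has_integral_add has_integral_mult_right v_has integrable_integral)
      have pt: "r * q t - Rem t = r * n t - r\<^sup>2 * s' t - G' t" if "t \<in> {0..T}" for t
      proof -
        have "m (\<sigma> t) $ 1 * w1 t + m (\<sigma> t) $ 2 * w2 t
            = (u1 t * m (\<sigma> t) $ 1 + u2 t * m (\<sigma> t) $ 2) - s' t * ((m (\<sigma> t) $ 1)\<^sup>2 + (m (\<sigma> t) $ 2)\<^sup>2)"
          by (simp add: w1_def w2_def power2_eq_square algebra_simps)
        then show ?thesis
          using r(1) r(2) [OF \<sigma> [OF that]] by (simp add: G'_def q_def field_simps)
      qed
      have "r * Q - ((M + 3 * M\<^sup>2) * W * W + 3 / 2 * M * W\<^sup>2 * L) \<le> r * L - r\<^sup>2 * (b - a) - 0"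
        by (rule has_integral_le [OF g_has f_has]) (use pt Rem_le in \<open>simp flip: pt\<close>)
      moreover have "(M + 3 * M\<^sup>2) * W * W + 3 / 2 * M * W\<^sup>2 * L \<le> C * W\<^sup>2"
      proof -
        have "3 / 2 * M * W\<^sup>2 * L \<le> 3 / 2 * M * W\<^sup>2 * 1"
          using L(1) M(1) by (intro mult_left_mono) auto
        also have "\<dots> \<le> 2 * M * W\<^sup>2" using M(1) by (simp add: mult_right_mono)
        finally show ?thesis by (simp add: C_def power2_eq_square algebra_simps)
      qed
      ultimately show ?thesis by (simp add: W_def)
    qed
    have "0 \<le> r * L - r\<^sup>2 * (b - a)"
    proof (cases "Q = 0")
      case True
      show ?thesis
      proof (rule field_le_epsilon)
        fix d :: real assume d: "0 < d"
        \<comment> \<open>When Q = 0 only C (\<tau> L / 2)^2 is left, which this weight makes d L^2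
          \<le> d.\<close>
        define \<tau> where "\<tau> = sqrt (4 * d / C)"
        have \<tau>: "0 < \<tau>" "\<tau>\<^sup>2 = 4 * d / C" using d C by (simp_all add: \<tau>_def)
        have "C * (\<tau> * L / 2)\<^sup>2 = d * L\<^sup>2"
          using C by (simp add: power_mult_distrib power_divide \<tau>(2))
        also have "\<dots> \<le> d * 1" using L(1) L0 d by (intro mult_left_mono) (auto simp: power_le_one)
        finally show "0 \<le> r * L - r\<^sup>2 * (b - a) + d" using key [OF \<tau>(1)] True by simp
      qed
    next
      case False
      then have Q: "0 < Q" "0 < L" using Q0 Q2 L0 by auto
      \<comment> \<open>The minimising weight: the two summands become equal and their sum has
        square 8 Q L. Then C times this is at most r Q because L < r / (8 C).\<close>
      define \<tau> where "\<tau> = sqrt (8 * Q / L)"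
      have \<tau>: "0 < \<tau>" "\<tau>\<^sup>2 = 8 * Q / L" using Q by (simp_all add: \<tau>_def)
      have "(\<tau> * L / 2 + 4 * Q / \<tau>)\<^sup>2 = \<tau>\<^sup>2 * L\<^sup>2 / 4 + 4 * Q * L + 16 * Q\<^sup>2 / \<tau>\<^sup>2"
        using \<tau>(1) by (simp add: power2_eq_square field_simps)
      also have "\<dots> = 8 * Q * L" unfolding \<tau>(2) using Q by (simp add: power2_eq_square field_simps)
      finally have "r * Q - C * (8 * Q * L) \<le> r * L - r\<^sup>2 * (b - a)" using key [OF \<tau>(1)] by simp
      moreover have "0 \<le> Q * (r - 8 * C * L)"
        using L(3) C Q by (intro mult_nonneg_nonneg) (auto simp: field_simps)
      ultimately show ?thesis by (simp add: algebra_simps)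
    qed
    then have "r * (r * (b - a)) \<le> r * L" by (simp add: power2_eq_square algebra_simps)
    then show ?thesis using r(1) len by simp
  qed
qed

lemma sr_length_geodesic:
  fixes m x :: "real \<Rightarrow> pt"
  assumes ab: "a < b" and geo: "\<And>s. s \<in> {a..b} \<Longrightarrow> geo_at m x s UNIV"
    and r: "0 \<le> r" "\<And>s. s \<in> {a..b} \<Longrightarrow> (m s $ 1)\<^sup>2 + (m s $ 2)\<^sup>2 = r\<^sup>2"
  shows "admissible_curve (b - a) (\<lambda>t. x (a + t))" "sr_length (b - a) (\<lambda>t. x (a + t)) = r * (b - a)"
proof -
  note g = geo_atD [OF geo]
  have v: "((\<lambda>t. x (a + t)) has_vector_derivative horiz (x (a + t)) (m (a + t) $ 1) (m (a + t) $ 2)) (at t)"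
    if "t \<in> {0..b - a}" for t
  proof -
    have "((\<lambda>t. a + t) has_vector_derivative 1) (at t)" by (auto intro!: derivative_eq_intros)
    moreover have "(x has_vector_derivative horiz (x (a + t)) (m (a + t) $ 1) (m (a + t) $ 2)) (at (a + t))"
      using that by (intro geo_at_velocity geo) auto
    ultimately show ?thesis using vector_diff_chain_at [of "\<lambda>t. a + t" 1 t x] by (simp add: o_def)
  qed
  have cm: "continuous_on {a..b} (\<lambda>s. m s $ 1)" "continuous_on {a..b} (\<lambda>s. m s $ 2)"
    "continuous_on {a..b} (\<lambda>s. x s $ 1)" "continuous_on {a..b} (\<lambda>s. x s $ 2)"
    by (rule DERIV_continuous_on, rule has_field_derivative_at_within, erule g)+
  have "\<forall>i. lip a b (\<lambda>s. x s $ i)"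
    unfolding forall5 by (intro conjI; rule lip_C1, erule g, intro continuous_intros cm, simp?)
  then obtain L where L: "(L i)-lipschitz_on {a..b} (\<lambda>s. x s $ i)" for i
    unfolding lip_def by metis
  have "(\<Sum>i\<in>UNIV. L i)-lipschitz_on {0..b - a} (\<lambda>t. x (a + t))"
  proof (rule lipschitz_onI)
    fix s t assume st: "s \<in> {0..b - a}" "t \<in> {0..b - a}"
    have "dist (x (a + s)) (x (a + t)) \<le> (\<Sum>i\<in>UNIV. \<bar>(x (a + s) - x (a + t)) $ i\<bar>)"
      unfolding dist_norm by (rule norm_le_l1_cart)
    also have "\<dots> \<le> (\<Sum>i\<in>UNIV. L i * dist s t)"
    proof (rule sum_mono)
      fix i
      have "dist (x (a + s) $ i) (x (a + t) $ i) \<le> L i * dist (a + s) (a + t)"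
        using st by (intro lipschitz_onD [OF L]) auto
      then show "\<bar>(x (a + s) - x (a + t)) $ i\<bar> \<le> L i * dist s t" by (simp add: dist_real_def)
    qed
    finally show "dist (x (a + s)) (x (a + t)) \<le> (\<Sum>i\<in>UNIV. L i) * dist s t" by (simp add: sum_distrib_right)
  qed (use lipschitz_on_nonneg [OF L] in \<open>auto intro: sum_nonneg\<close>)
  moreover have vd: "vector_derivative (\<lambda>t. x (a + t)) (at t) = horiz (x (a + t)) (m (a + t) $ 1) (m (a + t) $ 2)"
    if "t \<in> {0..b - a}" for t
    using v [OF that] by (rule vector_derivative_at)
  moreover have "(\<lambda>t. x (a + t)) differentiable (at t)" if "t \<in> {0..b - a}" for t
    using v [OF that] by (rule differentiableI_vector)
  ultimately show "admissible_curve (b - a) (\<lambda>t. x (a + t))"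
    unfolding admissible_curve_def by (auto intro!: AE_I2)
  have "sr_length (b - a) (\<lambda>t. x (a + t)) = integral {0..b - a} (\<lambda>t. r)"
    unfolding sr_length_def
  proof (rule integral_cong)
    fix t assume t: "t \<in> {0..b - a}"
    then have "(m (a + t) $ 1)\<^sup>2 + (m (a + t) $ 2)\<^sup>2 = r\<^sup>2" using r(2) [of "a + t"] by simp
    then show "sqrt (sr_metric (x (a + t)) (vector_derivative (\<lambda>t. x (a + t)) (at t))
        (vector_derivative (\<lambda>t. x (a + t)) (at t))) = r"
      using r(1) by (simp add: vd [OF t] sr_metric_horiz flip: power2_eq_square)
  qed
  then show "sr_length (b - a) (\<lambda>t. x (a + t)) = r * (b - a)" using ab by simp
qed

lemma sr_dist_eqI:
  assumes "0 < T" "admissible_curve T \<omega>" "\<omega> 0 = x" "\<omega> T = y"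
    and "\<And>T' \<omega>'. 0 < T' \<Longrightarrow> admissible_curve T' \<omega>' \<Longrightarrow> \<omega>' 0 = x \<Longrightarrow> \<omega>' T' = y \<Longrightarrow> sr_length T \<omega> \<le> sr_length T' \<omega>'"
  shows "sr_dist x y = sr_length T \<omega>"
  unfolding sr_dist_def using assms by (intro cInf_eq_minimum) blast+

lemma flow_speed:
  assumes "norm k \<le> R" "\<bar>s\<bar> < tmax R"
  shows "(Hf k s $ 1)\<^sup>2 + (Hf k s $ 2)\<^sup>2 = (k $ 1)\<^sup>2 + (k $ 2)\<^sup>2"
proof -
  have "(Hf k s $ 1)\<^sup>2 + (Hf k s $ 2)\<^sup>2 = (Hf k 0 $ 1)\<^sup>2 + (Hf k 0 $ 2)\<^sup>2"
    by (rule has_real_derivative_zero_interval [OF _ assms(2)])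
       (auto intro!: derivative_eq_intros Hf_deriv [OF assms(1)])
  then show ?thesis by simp
qed

text \<open>All constants of \<open>geodesic_minimizing\<close> are chosen once, on a compact set of
  covectors and times. Left translation keeps the momenta, so the base point a enters only through
  bounds on the first two coordinates.\<close>

lemma uniformly_minimizing:
  fixes k0 :: pt and \<Gamma> :: real
  assumes k0: "(k0 $ 1)\<^sup>2 + (k0 $ 2)\<^sup>2 \<noteq> 0" and R: "norm k0 + 1 \<le> R"
  obtains \<delta> \<tau> where "0 < \<delta>" "\<delta> \<le> 1" "0 < \<tau>" "\<tau> < tmax R"
    "\<And>a k s. norm a \<le> \<Gamma> \<Longrightarrow> dist k k0 < \<delta> \<Longrightarrow> 0 < s \<Longrightarrow> s \<le> \<tau> \<Longrightarrow>
       sr_dist (cartan_mult a (Yf k (- s))) a = s * sqrt ((k $ 1)\<^sup>2 + (k $ 2)\<^sup>2)"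
proof -
  have R0: "1 \<le> R" using R norm_ge_zero [of k0] by linarith
  define t where "t = tmax R"
  have t: "0 < t" using tmax_pos R0 by (simp add: t_def)
  define S where "S = cball (0::pt) R \<times> {-t..t}"
  have cH: "continuous_on S (\<lambda>p. Hf (fst p) (snd p))" and cY: "continuous_on S (\<lambda>p. Yf (fst p) (snd p))"
    using continuous_on_flow [of R] R0 by (simp_all add: S_def t_def case_prod_beta)
  define r0 where "r0 = sqrt ((k0 $ 1)\<^sup>2 + (k0 $ 2)\<^sup>2)"
  have r0: "0 < r0" "r0\<^sup>2 = (k0 $ 1)\<^sup>2 + (k0 $ 2)\<^sup>2"
    unfolding r0_def using k0 by (auto simp: sum_power2_gt_zero_iff sum_power2_eq_zero_iff)
  define e1 where "e1 = k0 $ 1 / r0"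
  define e2 where "e2 = k0 $ 2 / r0"
  have e: "e1\<^sup>2 + e2\<^sup>2 = 1"
    unfolding e1_def e2_def power_divide add_divide_distrib [symmetric] r0(2) [symmetric]
    using r0(1) by simp
  \<comment> \<open>F > 0 is the calibration inequality in strict form, with e the direction of k0.
    It is an open condition, and at (k0, 0) the value is r0 / 2.\<close>
  define F where "F p = e1 * Hf (fst p) (snd p) $ 1 + e2 * Hf (fst p) (snd p) $ 2
      - sqrt ((fst p $ 1)\<^sup>2 + (fst p $ 2)\<^sup>2) / 2" for p :: "pt \<times> real"
  have cF: "continuous_on S F"
    unfolding F_def by (intro continuous_intros cH) simp
  have in_S: "(k0, 0) \<in> interior S"
    unfolding S_def interior_Times using t R by (simp add: interior_cball)
  have "F (k0, 0) = r0 / 2"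
  proof -
    have "e1 * k0 $ 1 + e2 * k0 $ 2 = r0\<^sup>2 / r0" unfolding r0(2) by (simp add: e1_def e2_def power2_eq_square add_divide_distrib)
    also have "\<dots> = r0" using r0(1) by (simp add: power2_eq_square)
    finally show ?thesis by (simp add: F_def flip: r0_def)
  qed
  then have "0 < F (k0, 0)" using r0 by simp
  moreover have "isCont F (k0, 0)" using cF in_S by (rule continuous_on_interior)
  then have "(F \<longlongrightarrow> F (k0, 0)) (nhds (k0, 0))"
    by (simp add: isCont_def tendsto_at_iff_tendsto_nhds)
  ultimately have "\<forall>\<^sub>F p in nhds (k0, 0). 0 < F p"
    by (simp add: order_tendstoD)
  then obtain d where d: "0 < d" "\<And>p. dist p (k0, 0) < d \<Longrightarrow> 0 < F p"
    unfolding eventually_nhds_metric by blast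
  have "compact S" unfolding S_def by (intro compact_Times) auto
  then have "bounded ((\<lambda>p. Hf (fst p) (snd p)) ` S)" "bounded ((\<lambda>p. Yf (fst p) (snd p)) ` S)"
    using cH cY by (auto intro!: compact_imp_bounded compact_continuous_image)
  then obtain BH BY where BH: "\<And>p. p \<in> S \<Longrightarrow> norm (Hf (fst p) (snd p)) \<le> BH"
    and BY: "\<And>p. p \<in> S \<Longrightarrow> norm (Yf (fst p) (snd p)) \<le> BY"
    unfolding bounded_iff by blast
  define P where "P = \<bar>\<Gamma>\<bar> + \<bar>BY\<bar>"
  define M where "M = 1 + P + \<bar>BH\<bar> + 2 * P * \<bar>BH\<bar>"
  have M: "1 \<le> M" "P \<le> M" "\<bar>BH\<bar> \<le> M" "\<bar>BH\<bar> + 2 * P * \<bar>BH\<bar> \<le> M"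
    by (auto simp: M_def P_def)
  define \<epsilon> where "\<epsilon> = min (d / 2) (t / 2)"
  define \<delta> where "\<delta> = min (d / 2) 1"
  define C where "C = 3 * M + 3 * M\<^sup>2"
  have C: "0 < C" using M(1) by (simp add: C_def add_pos_nonneg)
  \<comment> \<open>The three entries give the three bounds in \<open>short\<close>, the first one
    because the speed is at most R.\<close>
  define \<tau> where "\<tau> = min (1 / R) (min (\<epsilon> / 4) (1 / (8 * C)))"
  have \<epsilon>: "0 < \<epsilon>" "\<epsilon> < t" using d t by (auto simp: \<epsilon>_def)
  have \<tau>: "0 < \<tau>" "\<tau> \<le> \<epsilon> / 4" using \<epsilon> R0 C by (auto simp: \<tau>_def)
  have \<delta>: "0 < \<delta>" "\<delta> \<le> 1" using d by (auto simp: \<delta>_def)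
  show ?thesis
  proof (rule that [OF \<delta> \<tau>(1)])
    show "\<tau> < tmax R" using \<tau> \<epsilon> by (simp add: t_def)
    fix a k :: pt and s :: real
    assume a: "norm a \<le> \<Gamma>" and k: "dist k k0 < \<delta>" and s: "0 < s" "s \<le> \<tau>"
    have kR: "norm k \<le> R" using k \<delta>(2) R norm_triangle_ineq2 [of k k0] by (simp add: dist_norm)
    define r where "r = sqrt ((k $ 1)\<^sup>2 + (k $ 2)\<^sup>2)"
    have F_pos: "0 < F (k, u)" if "u \<in> {-\<epsilon>..\<epsilon>}" for u
    proof (rule d(2))
      have "dist (k, u) (k0, 0) \<le> dist k k0 + dist u 0"
        unfolding dist_prod_def using sqrt_sum_squares_le_sum [of "dist k k0" "\<bar>u\<bar>"] by simp
      also have "\<dots> < d" using k that by (auto simp: \<delta>_def \<epsilon>_def)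
      finally show "dist (k, u) (k0, 0) < d" .
    qed
    have r_nn: "0 \<le> r" "r\<^sup>2 = (k $ 1)\<^sup>2 + (k $ 2)\<^sup>2" by (simp_all add: r_def)
    have r: "0 < r"
    proof -
      have "e1 * k $ 1 + e2 * k $ 2 \<noteq> 0" 
      proof -
        have "r / 2 < e1 * k $ 1 + e2 * k $ 2" using F_pos [of 0] \<epsilon> by (simp add: F_def r_def)
        then show ?thesis using r_nn(1) by linarith
      qed
      then have "k $ 1 \<noteq> 0 \<or> k $ 2 \<noteq> 0" by auto
      then show ?thesis by (auto simp: r_def sum_power2_gt_zero_iff)
    qed
    \<comment> \<open>Normalised to be at a at time 0, so that the geodesic in question runs over
      the times from -s to 0.\<close>
    define x where "x u = cartan_mult a (Yf k u)" for u
    have geo: "geo_at (Hf k) x u UNIV" if "u \<in> {-\<epsilon>..\<epsilon>}" for u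
      unfolding x_def using that \<epsilon> kR by (intro geo_at_left_translate flow_geo_at [of _ R]) (auto simp: t_def)
    have spd: "(Hf k u $ 1)\<^sup>2 + (Hf k u $ 2)\<^sup>2 = r\<^sup>2" if "u \<in> {-\<epsilon>..\<epsilon>}" for u
      unfolding r_nn using that \<epsilon> by (intro flow_speed [OF kR]) (auto simp: t_def)
    have bounds: "\<bar>x u $ 1\<bar> \<le> M \<and> \<bar>x u $ 2\<bar> \<le> M \<and> \<bar>Hf k u $ 4\<bar> \<le> M \<and> \<bar>Hf k u $ 5\<bar> \<le> M \<and>
       \<bar>Hf k u $ 3 - x u $ 1 * Hf k u $ 4 - x u $ 2 * Hf k u $ 5\<bar> \<le> M" if "u \<in> {-\<epsilon>..\<epsilon>}" for u
    proof -
      have "(k, u) \<in> S" using that \<epsilon> kR by (auto simp: S_def)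
      then have H: "\<bar>Hf k u $ i\<bar> \<le> \<bar>BH\<bar>" and Y: "\<bar>Yf k u $ i\<bar> \<le> \<bar>BY\<bar>" for i
        using BH [of "(k, u)"] BY [of "(k, u)"] component_le_norm_cart [of "Hf k u" i]
          component_le_norm_cart [of "Yf k u" i] by auto
      have "\<bar>a $ i\<bar> \<le> \<bar>\<Gamma>\<bar>" for i using component_le_norm_cart [of a i] a by linarith
      then have x: "\<bar>x u $ 1\<bar> \<le> P" "\<bar>x u $ 2\<bar> \<le> P"
        using Y [of 1] Y [of 2] by (auto simp: x_def P_def intro!: order_trans [OF abs_triangle_ineq] add_mono)
      have "\<bar>x u $ 1 * Hf k u $ 4\<bar> \<le> P * \<bar>BH\<bar>" "\<bar>x u $ 2 * Hf k u $ 5\<bar> \<le> P * \<bar>BH\<bar>"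
        unfolding abs_mult using x H by (auto intro!: mult_mono order_trans [OF abs_ge_zero x(1)])
      then have "\<bar>Hf k u $ 3 - x u $ 1 * Hf k u $ 4 - x u $ 2 * Hf k u $ 5\<bar> \<le> \<bar>BH\<bar> + 2 * P * \<bar>BH\<bar>"
        using H [of 3] by linarith
      then show ?thesis using x H [of 4] H [of 5] M by linarith
    qed
    have short: "r * (0 - - s) \<le> min 1 (min (\<epsilon> * r / 4) (r / (8 * (3 * M + 3 * M\<^sup>2))))"
    proof -
      have "r \<le> R"
      proof -
        have "r\<^sup>2 \<le> (norm k)\<^sup>2" unfolding r_nn power2_norm_eq_inner inner5 by (simp add: power2_eq_square)
        then show ?thesis using kR by (meson abs_le_square_iff norm_ge_zero order_trans power2_le_imp_le)
      qed
      then have "r * s \<le> R * (1 / R)" using s r R0 by (intro mult_mono) (auto simp: \<tau>_def)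
      moreover have "r * s \<le> r * (\<epsilon> / 4)" "r * s \<le> r * (1 / (8 * C))"
        using s r unfolding \<tau>_def by (intro mult_left_mono; simp)+
      ultimately show ?thesis using R0 by (simp add: C_def mult.commute)
    qed
    have s\<epsilon>: "s \<le> \<epsilon> / 4" using s \<tau> by linarith
    have ends: "x (- s + 0) = cartan_mult a (Yf k (- s))" "x (- s + (0 - - s)) = a"
      by (simp_all add: x_def cartan_mult_0)
    have ref: "admissible_curve (0 - - s) (\<lambda>t. x (- s + t))" "sr_length (0 - - s) (\<lambda>t. x (- s + t)) = r * (0 - - s)"
      by (rule sr_length_geodesic [of "-s" 0 "Hf k" x r]; use s s\<epsilon> \<epsilon> geo spd r_nn(1) in auto)+
    have e_H: "r / 2 \<le> e1 * Hf k u $ 1 + e2 * Hf k u $ 2" if "u \<in> {-\<epsilon>..\<epsilon>}" for u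
      using F_pos [OF that] by (simp add: F_def r_def)
    have "sr_dist (cartan_mult a (Yf k (- s))) a = sr_length (0 - - s) (\<lambda>t. x (- s + t))"
    proof (rule sr_dist_eqI [OF _ ref(1) ends])
      fix T' \<omega>' assume \<omega>': "0 < T'" "admissible_curve T' \<omega>'" "\<omega>' 0 = cartan_mult a (Yf k (- s))" "\<omega>' T' = a"
      show "sr_length (0 - - s) (\<lambda>t. x (- s + t)) \<le> sr_length T' \<omega>'"
        unfolding ref(2)
      proof (rule geodesic_minimizing [where \<epsilon> = \<epsilon> and M = M, OF \<epsilon>(1) geo r spd e e_H M(1) bounds _ _ _ short \<omega>'(1,2)])
        show "\<omega>' 0 = x (- s)" "\<omega>' T' = x 0" using \<omega>'(3,4) ends by simp_all
      qed (use s s\<epsilon> \<epsilon> in auto)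
    qed (use s in auto)
    then show "sr_dist (cartan_mult a (Yf k (- s))) a = s * sqrt ((k $ 1)\<^sup>2 + (k $ 2)\<^sup>2)"
      unfolding ref(2) by (simp add: r_def mult.commute)
  qed
qed

section \<open>Jacobi fields\<close>

text \<open>The Jacobi field with initial value \<open>0\<close> and momentum variation \<open>l\<close>, in the frame \<open>X\<^sub>1, \<dots>, X\<^sub>5\<close>.\<close>

definition xi :: "pt \<Rightarrow> real \<Rightarrow> pt \<Rightarrow> pt" where
  "xi k s l = frame_comp (Yf k s) (dYf k s l)"

lemma xi_0 [simp]: "xi k 0 l = 0"
  by (simp add: xi_def frame_comp_def vec_eq_iff forall5)

text \<open>The Maurer-Cartan equation: the derivative of the components minus the variation of the
  velocity components is minus the bracket of velocity and variation.\<close>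

lemma xi_deriv:
  assumes "norm k \<le> R" "\<bar>s\<bar> < tmax R"
  shows "((\<lambda>s. xi k s l $ 1) has_real_derivative dHf k s l $ 1) (at s)"
    and "((\<lambda>s. xi k s l $ 2) has_real_derivative dHf k s l $ 2) (at s)"
    and "((\<lambda>s. xi k s l $ 3) has_real_derivative - (Hf k s $ 1 * xi k s l $ 2 - Hf k s $ 2 * xi k s l $ 1)) (at s)"
    and "((\<lambda>s. xi k s l $ 4) has_real_derivative - (Hf k s $ 1 * xi k s l $ 3)) (at s)"
    and "((\<lambda>s. xi k s l $ 5) has_real_derivative - (Hf k s $ 2 * xi k s l $ 3)) (at s)"
proof -
  note d = flow_y12 [OF assms] Yf_deriv [OF assms] dYf_deriv [OF assms]
  show "((\<lambda>s. xi k s l $ 1) has_real_derivative dHf k s l $ 1) (at s)"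
    "((\<lambda>s. xi k s l $ 2) has_real_derivative dHf k s l $ 2) (at s)"
    unfolding xi_def frame_comp_def vec5_nth by (rule d)+
  show "((\<lambda>s. xi k s l $ 3) has_real_derivative - (Hf k s $ 1 * xi k s l $ 2 - Hf k s $ 2 * xi k s l $ 1)) (at s)"
    unfolding xi_def frame_comp_def vec5_nth
    by (rule derivative_eq_intros d refl)+ (simp add: algebra_simps)
  show "((\<lambda>s. xi k s l $ 4) has_real_derivative - (Hf k s $ 1 * xi k s l $ 3)) (at s)"
    unfolding xi_def frame_comp_def vec5_nth
    by (rule derivative_eq_intros d refl numeral_neq_zero)+ (simp add: algebra_simps power2_eq_square)
  show "((\<lambda>s. xi k s l $ 5) has_real_derivative - (Hf k s $ 2 * xi k s l $ 3)) (at s)"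
    unfolding xi_def frame_comp_def vec5_nth
    by (rule derivative_eq_intros d refl)+ (simp add: algebra_simps)
qed

lemma speed_variation:
  assumes "norm k \<le> R" "\<bar>s\<bar> < tmax R"
  shows "Hf k s $ 1 * dHf k s l $ 1 + Hf k s $ 2 * dHf k s l $ 2 = k $ 1 * l $ 1 + k $ 2 * l $ 2"
proof -
  have "Hf k s $ 1 * dHf k s l $ 1 + Hf k s $ 2 * dHf k s l $ 2
      = Hf k 0 $ 1 * dHf k 0 l $ 1 + Hf k 0 $ 2 * dHf k 0 l $ 2"
    by (rule has_real_derivative_zero_interval [OF _ assms(2)])
       (rule derivative_eq_intros Hf_deriv [OF assms(1)] dHf_deriv [OF assms(1)] refl | assumption | simp add: algebra_simps)+
  then show ?thesis by simp
qed

text \<open>The derivative of the pairing of momentum and Jacobi field is the variation of the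
  Hamiltonian, which is constant by \<open>speed_variation\<close>; the pairing starts at 0.\<close>

lemma gauss_lemma:
  assumes "norm k \<le> R" "\<bar>s\<bar> < tmax R"
  shows "Hf k s \<bullet> xi k s l = s * (k $ 1 * l $ 1 + k $ 2 * l $ 2)"
proof -
  let ?g = "\<lambda>s. Hf k s $ 1 * xi k s l $ 1 + Hf k s $ 2 * xi k s l $ 2 + Hf k s $ 3 * xi k s l $ 3
    + k $ 4 * xi k s l $ 4 + k $ 5 * xi k s l $ 5 - s * (k $ 1 * l $ 1 + k $ 2 * l $ 2)"
  have "?g s = ?g 0"
  proof (rule has_real_derivative_zero_interval [OF _ assms(2)])
    fix s assume s: "\<bar>s\<bar> < tmax R"
    note d = Hf_deriv(1-3) [OF assms(1) s] xi_deriv [OF assms(1) s]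
    show "(?g has_real_derivative 0) (at s)"
      by (rule derivative_eq_intros d refl)+
         (use speed_variation [OF assms(1) s, of l] in \<open>simp add: algebra_simps\<close>)
  qed
  then show ?thesis using Hf_deriv(4,5) [OF assms] by (simp add: inner5)
qed

text \<open>The momentum maps of the left translations generated at the identity by \<open>X\<^sub>1\<close> and \<open>X\<^sub>2\<close>.\<close>

lemma right_momenta:
  assumes "norm k \<le> R" "\<bar>s\<bar> < tmax R"
  shows "Hf k s $ 1 + Yf k s $ 2 * Hf k s $ 3 + (Yf k s $ 3 - Yf k s $ 1 * Yf k s $ 2) * k $ 4
      - (Yf k s $ 2)\<^sup>2 / 2 * k $ 5 = k $ 1"
    and "Hf k s $ 2 - Yf k s $ 1 * Hf k s $ 3 + (Yf k s $ 1)\<^sup>2 / 2 * k $ 4 + Yf k s $ 3 * k $ 5 = k $ 2"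
proof -
  let ?a = "\<lambda>s. Hf k s $ 1 + Yf k s $ 2 * Hf k s $ 3 + (Yf k s $ 3 - Yf k s $ 1 * Yf k s $ 2) * k $ 4
      - (Yf k s $ 2)\<^sup>2 / 2 * k $ 5"
  let ?b = "\<lambda>s. Hf k s $ 2 - Yf k s $ 1 * Hf k s $ 3 + (Yf k s $ 1)\<^sup>2 / 2 * k $ 4 + Yf k s $ 3 * k $ 5"
  have "?a s = ?a 0"
  proof (rule has_real_derivative_zero_interval [OF _ assms(2)])
    fix s assume s: "\<bar>s\<bar> < tmax R"
    note d = Hf_deriv(1-3) [OF assms(1) s] flow_y12(1,2) [OF assms(1) s] Yf_deriv [OF assms(1) s]
    show "(?a has_real_derivative 0) (at s)"
      by (rule derivative_eq_intros d refl numeral_neq_zero)+ (simp add: algebra_simps)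
  qed
  then show "?a s = k $ 1" by simp
  have "?b s = ?b 0"
  proof (rule has_real_derivative_zero_interval [OF _ assms(2)])
    fix s assume s: "\<bar>s\<bar> < tmax R"
    note d = Hf_deriv(1-3) [OF assms(1) s] flow_y12(1,2) [OF assms(1) s] Yf_deriv [OF assms(1) s]
    show "(?b has_real_derivative 0) (at s)"
      by (rule derivative_eq_intros d refl numeral_neq_zero)+ (simp add: algebra_simps)
  qed
  then show "?b s = k $ 2" by simp
qed

section \<open>Differentials of the group law and of a half square\<close>

definition dmult1 :: "pt \<Rightarrow> pt \<Rightarrow> pt \<Rightarrow> pt" where
  "dmult1 a y v = vec5 (v$1) (v$2) (v$3 + v$1 * y$2) (v$4 + v$1 * y$3 + a$1 * v$1 * y$2)
     (v$5 + (v$1 * a$2 + a$1 * v$2) * y$2 + v$1 * (y$2)\<^sup>2 / 2 + v$2 * y$3)"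

definition dmult2 :: "pt \<Rightarrow> pt \<Rightarrow> pt \<Rightarrow> pt" where
  "dmult2 a y w = vec5 (w$1) (w$2) (w$3 + a$1 * w$2) (w$4 + a$1 * w$3 + (a$1)\<^sup>2 / 2 * w$2)
     (w$5 + a$1 * a$2 * w$2 + a$1 * y$2 * w$2 + a$2 * w$3)"

lemma has_derivative_componentsI:
  fixes f :: "'a::real_normed_vector \<Rightarrow> pt"
  assumes "\<And>i. ((\<lambda>s. f s $ i) has_derivative (\<lambda>v. f' v $ i)) (at x within S)"
  shows "(f has_derivative f') (at x within S)"
  unfolding has_derivative_componentwise_within [of f]
  using assms by (auto simp: Basis_vec_def inner_axis)

lemma cartan_mult_has_derivative_pair:
  assumes "(f has_derivative f') (at p)" "(g has_derivative g') (at p)"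
  shows "((\<lambda>p. cartan_mult (f p) (g p)) has_derivative
    (\<lambda>v. dmult1 (f p) (g p) (f' v) + dmult2 (f p) (g p) (g' v))) (at p)"
proof (rule has_derivative_componentsI)
  fix i
  note d = bounded_linear.has_derivative [OF bounded_linear_vec_nth assms(1)]
    bounded_linear.has_derivative [OF bounded_linear_vec_nth assms(2)]
  have "\<forall>i. ((\<lambda>p. cartan_mult (f p) (g p) $ i) has_derivative
      (\<lambda>v. (dmult1 (f p) (g p) (f' v) + dmult2 (f p) (g p) (g' v)) $ i)) (at p)"
    unfolding forall5 cartan_mult_nth dmult1_def dmult2_def vector_add_component vec5_nth
    by (intro conjI; (rule derivative_eq_intros d refl numeral_neq_zero)+;
        simp add: fun_eq_iff algebra_simps power2_eq_square)
  then show "((\<lambda>p. cartan_mult (f p) (g p) $ i) has_derivative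
      (\<lambda>v. (dmult1 (f p) (g p) (f' v) + dmult2 (f p) (g p) (g' v)) $ i)) (at p)" ..
qed

lemma frame_comp_dmult2: "frame_comp (cartan_mult a y) (dmult2 a y w) = frame_comp y w"
  by (simp add: frame_comp_def dmult2_def vec_eq_iff forall5 algebra_simps power2_eq_square)

text \<open>Moving the left factor is, in the left-invariant frame at the product, the adjoint
  action of the inverse of y on c X1 + d X2. Its pairing with the momentum gives the quantities of
  \<open>right_momenta\<close>.\<close>

lemma frame_comp_dmult1_horiz:
  "frame_comp (cartan_mult a y) (dmult1 a y (horiz a c d))
    = vec5 c d (c * y$2 - d * y$1) (c * (y$3 - y$1 * y$2) + d * (y$1)\<^sup>2 / 2) (d * y$3 - c * (y$2)\<^sup>2 / 2)"
  by (simp add: frame_comp_def dmult1_def vec_eq_iff forall5 field_simps power2_eq_square)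

lemma frame_comp_eq_0_iff: "frame_comp x v = 0 \<longleftrightarrow> v = 0"
  using frame_vec_comp [of x v] linear_0 [OF linear_frame_comp] by (auto simp: frame_vec_def)

text \<open>Where A vanishes, the product rule asks only for continuity of the factor B: the error
  term is A' (y - x) times B y - B x.\<close>

lemma has_derivative_mult_zero:
  fixes A B :: "'a::real_normed_vector \<Rightarrow> real"
  assumes A: "(A has_derivative A') (at x)" "A x = 0" and B: "isCont B x"
  shows "((\<lambda>y. A y * B y) has_derivative (\<lambda>v. A' v * B x)) (at x)"
proof -
  have bl: "bounded_linear A'" using A(1) by (rule has_derivative_bounded_linear)
  then obtain K where K: "\<And>v. norm (A' v) \<le> norm v * K" using bounded_linear.bounded by blast
  have 1: "((\<lambda>y. (A y - A' (y - x)) / norm (y - x) * B y) \<longlongrightarrow> 0 * B x) (at x)"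
    using A B unfolding has_derivative_at_within
    by (intro tendsto_mult) (auto simp: isCont_def divide_inverse mult.commute)
  have 2: "((\<lambda>y. A' (y - x) / norm (y - x) * (B y - B x)) \<longlongrightarrow> 0) (at x)"
  proof (rule Lim_null_comparison)
    show "\<forall>\<^sub>F y in at x. norm (A' (y - x) / norm (y - x) * (B y - B x)) \<le> \<bar>K\<bar> * norm (B y - B x)"
    proof (rule always_eventually, rule allI)
      fix y
      have "norm (A' (y - x)) \<le> norm (y - x) * \<bar>K\<bar>"
        by (rule order_trans [OF K mult_left_mono]) auto
      then have "norm (A' (y - x)) / norm (y - x) \<le> \<bar>K\<bar>"
        by (cases "y = x") (auto simp: divide_le_eq mult.commute)
      then show "norm (A' (y - x) / norm (y - x) * (B y - B x)) \<le> \<bar>K\<bar> * norm (B y - B x)"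
        unfolding norm_mult by (intro mult_right_mono) (auto simp: norm_divide)
    qed
    have "((\<lambda>y. \<bar>K\<bar> * norm (B y - B x)) \<longlongrightarrow> \<bar>K\<bar> * norm (B x - B x)) (at x)"
      using B unfolding isCont_def by (intro tendsto_intros)
    then show "((\<lambda>y. \<bar>K\<bar> * norm (B y - B x)) \<longlongrightarrow> 0) (at x)" by simp
  qed
  have "((\<lambda>y. (A y * B y - A x * B x - A' (y - x) * B x) /\<^sub>R norm (y - x)) \<longlongrightarrow> 0) (at x)"
  proof -
    have "(A y * B y - A x * B x - A' (y - x) * B x) /\<^sub>R norm (y - x)
        = (A y - A' (y - x)) / norm (y - x) * B y + A' (y - x) / norm (y - x) * (B y - B x)" for y
      by (simp add: A(2) divide_inverse algebra_simps)
    then show ?thesis using tendsto_add [OF 1 2] by simp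
  qed
  then show ?thesis
    unfolding has_derivative_at_within
    using bounded_linear_compose [OF bounded_linear_mult_left bl] by simp
qed

text \<open>The linear term is chosen so that the first derivative has the factors k1 y - k1 x and
  k2 y - k2 x. At x the preceding product rule applies, and continuity of the derivatives of k1 and
  k2 is enough.\<close>

lemma second_differential_half_square:
  fixes f :: "pt \<Rightarrow> real" and k1 k2 :: "pt \<Rightarrow> real" and D1 D2 :: "pt \<Rightarrow> pt \<Rightarrow> real"
  assumes N: "open N" "x \<in> N"
    and f: "\<And>y. y \<in> N \<Longrightarrow> f y = ((k1 y)\<^sup>2 + (k2 y)\<^sup>2) / 2 - (k1 y * k1 x + k2 y * k2 x)"
    and d: "\<And>y. y \<in> N \<Longrightarrow> (k1 has_derivative D1 y) (at y)" "\<And>y. y \<in> N \<Longrightarrow> (k2 has_derivative D2 y) (at y)"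
    and c: "isCont (\<lambda>y. D1 y v) x" "isCont (\<lambda>y. D2 y v) x"
  shows "second_differential f x v = (D1 x v)\<^sup>2 + (D2 x v)\<^sup>2"
proof -
  have fd: "(f has_derivative (\<lambda>v. (k1 y - k1 x) * D1 y v + (k2 y - k2 x) * D2 y v)) (at y)" if y: "y \<in> N" for y
  proof -
    have "((\<lambda>y. ((k1 y)\<^sup>2 + (k2 y)\<^sup>2) / 2 - (k1 y * k1 x + k2 y * k2 x)) has_derivative
        (\<lambda>v. (k1 y - k1 x) * D1 y v + (k2 y - k2 x) * D2 y v)) (at y)"
      by (rule derivative_eq_intros d [OF y] refl numeral_neq_zero)+ (simp add: fun_eq_iff algebra_simps)
    then show ?thesis
      by (rule has_derivative_transform_within_open [OF _ N(1) y]) (simp add: f)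
  qed
  have "((\<lambda>y. (k1 y - k1 x) * D1 y v + (k2 y - k2 x) * D2 y v) has_derivative
      (\<lambda>w. D1 x w * D1 x v + D2 x w * D2 x v)) (at x)"
    by (intro has_derivative_add has_derivative_mult_zero c)
       (auto intro!: derivative_eq_intros d [OF N(2)])
  then have "((\<lambda>y. frechet_derivative f (at y) v) has_derivative (\<lambda>w. D1 x w * D1 x v + D2 x w * D2 x v)) (at x)"
    by (rule has_derivative_transform_within_open [OF _ N]) (simp add: frechet_derivative_at [OF fd, symmetric])
  from frechet_derivative_at [OF this, symmetric] show ?thesis
    by (simp add: second_differential_def power2_eq_square)
qed

section \<open>The Hessian of the geodesic cost\<close>

text \<open>With a left inverse C of A x one has w y - w x = C ((A x - A y) (w y)). For y near x
  this bounds w y by twice w x and then forces convergence. It provides continuity of the derivative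
  of a local inverse.\<close>

lemma isCont_solution:
  fixes A :: "'a::real_normed_vector \<Rightarrow> ('b::real_normed_vector \<Rightarrow>\<^sub>L 'b)"
  assumes A: "isCont A x" and inv: "C o\<^sub>L A x = id_blinfun"
    and w: "\<forall>\<^sub>F y in nhds x. blinfun_apply (A y) (w y) = c"
  shows "isCont w x"
proof -
  define \<eta> where "\<eta> y = norm C * norm (A x - A y)" for y
  have \<eta>: "(\<eta> \<longlongrightarrow> 0) (at x)"
  proof -
    have "(\<eta> \<longlongrightarrow> norm C * norm (A x - A x)) (at x)"
      unfolding \<eta>_def using A unfolding isCont_def by (intro tendsto_intros)
    then show ?thesis by simp
  qed
  have wx: "blinfun_apply (A x) (w x) = c" using eventually_nhds_x_imp_x [OF w] .
  have C: "blinfun_apply C (blinfun_apply (A x) v) = v" for v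
    by (metis inv blinfun_apply_blinfun_compose blinfun_apply_id_blinfun)
  have est: "norm (w y - w x) \<le> \<eta> y * norm (w y)" if "blinfun_apply (A y) (w y) = c" for y
  proof -
    have "w y - w x = blinfun_apply C (blinfun_apply (A x - A y) (w y))"
      using that wx C by (simp add: blinfun.diff_left blinfun.diff_right) (metis C)
    then have "norm (w y - w x) \<le> norm C * norm (blinfun_apply (A x - A y) (w y))"
      by (simp add: norm_blinfun)
    also have "\<dots> \<le> norm C * (norm (A x - A y) * norm (w y))"
      by (intro mult_left_mono norm_blinfun) auto
    finally show ?thesis by (simp add: \<eta>_def mult.assoc)
  qed
  have "\<forall>\<^sub>F y in at x. norm (w y - w x) \<le> \<eta> y * (2 * norm (w x))"
  proof -
    have "\<forall>\<^sub>F y in at x. \<eta> y < 1 / 2" using \<eta> by (rule order_tendstoD) simp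
    moreover have "\<forall>\<^sub>F y in at x. blinfun_apply (A y) (w y) = c"
      using w by (auto simp: eventually_at_filter elim: eventually_mono)
    ultimately show ?thesis
    proof eventually_elim
      case (elim y)
      have \<eta>0: "0 \<le> \<eta> y" by (simp add: \<eta>_def)
      have "norm (w y) \<le> norm (w x) + \<eta> y * norm (w y)"
        using est [OF elim(2)] norm_triangle_sub [of "w y" "w x"] by linarith
      also have "\<eta> y * norm (w y) \<le> 1 / 2 * norm (w y)" using elim(1) by (intro mult_right_mono) auto
      finally have "norm (w y) \<le> 2 * norm (w x)" by simp
      then show ?case using est [OF elim(2)] mult_left_mono [OF _ \<eta>0] by (meson order_trans)
    qed
  qed
  moreover have "((\<lambda>y. \<eta> y * (2 * norm (w x))) \<longlongrightarrow> 0) (at x)"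
    using tendsto_mult_right [OF \<eta>, of "2 * norm (w x)"] by simp
  ultimately have "((\<lambda>y. w y - w x) \<longlongrightarrow> 0) (at x)" by (rule Lim_null_comparison)
  then show ?thesis unfolding isCont_def by (rule LIM_zero_cancel)
qed

lemma continuous_on_vec5:
  assumes "continuous_on S a" "continuous_on S b" "continuous_on S c" "continuous_on S d" "continuous_on S e"
  shows "continuous_on S (\<lambda>x. vec5 (a x) (b x) (c x) (d x) (e x))"
proof -
  have "axis i r = r *\<^sub>R axis i (1::real)" for i :: 5 and r by (simp add: vec_eq_iff axis_def)
  then have "vec5 (a x) (b x) (c x) (d x) (e x) = a x *\<^sub>R axis 1 1 + b x *\<^sub>R axis 2 1 + c x *\<^sub>R axis 3 1
      + d x *\<^sub>R axis 4 1 + e x *\<^sub>R axis 5 1" for x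
    unfolding vec5_def by metis
  then show ?thesis using assms by (simp add: continuous_intros)
qed

lemma horiz_vec5: "horiz x a b = vec5 a b (x$1 * b) ((x$1)\<^sup>2 / 2 * b) (x$1 * x$2 * b)"
  by (simp add: vec_eq_iff forall5)

lemma continuous_on_horiz:
  "continuous_on S x \<Longrightarrow> continuous_on S a \<Longrightarrow> continuous_on S b \<Longrightarrow> continuous_on S (\<lambda>p. horiz (x p) (a p) (b p))"
  unfolding horiz_vec5 by (intro continuous_on_vec5 continuous_intros) auto

lemma continuous_on_dmult:
  assumes "continuous_on S a" "continuous_on S y" "continuous_on S v"
  shows "continuous_on S (\<lambda>p. dmult1 (a p) (y p) (v p))" "continuous_on S (\<lambda>p. dmult2 (a p) (y p) (v p))"
  unfolding dmult1_def dmult2_def using assms by (intro continuous_on_vec5 continuous_intros; simp)+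

lemma continuous_on_dYf:
  assumes "\<And>p. p \<in> S \<Longrightarrow> norm (f p) \<le> R \<and> \<bar>g p\<bar> \<le> tmax R" "continuous_on S f" "continuous_on S g" "0 \<le> R"
  shows "continuous_on S (\<lambda>p. Hf (f p) (g p))" "continuous_on S (\<lambda>p. Yf (f p) (g p))"
    "continuous_on S (\<lambda>p. dYf (f p) (g p) l)"
proof -
  have im: "(\<lambda>p. (f p, g p)) ` S \<subseteq> cball 0 R \<times> {- tmax R..tmax R}"
    using assms(1) by (fastforce simp: abs_le_iff)
  have fg: "continuous_on S (\<lambda>p. (f p, g p))" using assms by (intro continuous_intros)
  show "continuous_on S (\<lambda>p. Hf (f p) (g p))" "continuous_on S (\<lambda>p. Yf (f p) (g p))"
    "continuous_on S (\<lambda>p. dYf (f p) (g p) l)"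
    using continuous_on_compose2 [OF continuous_on_flow(1) [OF assms(4)] fg im]
      continuous_on_compose2 [OF continuous_on_flow(2) [OF assms(4)] fg im]
      continuous_on_compose2 [OF continuous_on_flow(3) [OF assms(4)] fg im]
    by simp_all
qed

lemma bounded_linear_dYf: "norm k < R \<Longrightarrow> \<bar>s\<bar> \<le> tmax R \<Longrightarrow> bounded_linear (dYf k s)"
  using linear_dYf linear_conv_bounded_linear by blast

text \<open>Joint differentiability in time and covector, from the two partial derivatives and
  continuity of the one in the covector.\<close>

lemma Yf_backward_derivative:
  assumes k: "norm k < R" and s: "\<bar>s\<bar> < tmax R"
  shows "((\<lambda>p. Yf (snd p) (- fst p)) has_derivative
    (\<lambda>v. fst v *\<^sub>R (- horiz (Yf k (- s)) (Hf k (- s) $ 1) (Hf k (- s) $ 2)) + dYf k (- s) (snd v))) (at (s, k))"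
proof -
  have R: "0 \<le> R" using k norm_ge_zero [of k] by linarith
  let ?X = "{- tmax R<..<tmax R}" and ?Y = "ball (0::pt) R"
  have "((\<lambda>(s, k). Yf k (- s)) has_derivative
     (\<lambda>(\<sigma>, l). \<sigma> *\<^sub>R (- horiz (Yf k (- s)) (Hf k (- s) $ 1) (Hf k (- s) $ 2)) + blinfun_apply (Blinfun (dYf k (- s))) l))
     (at (s, k) within ?X \<times> ?Y)"
  proof (rule has_derivative_partialsI [where fy = "\<lambda>s k. Blinfun (dYf k (- s))"])
    have "((\<lambda>s. - s) has_vector_derivative -1) (at s)" by (auto intro!: derivative_eq_intros)
    moreover have "(Yf k has_vector_derivative horiz (Yf k (- s)) (Hf k (- s) $ 1) (Hf k (- s) $ 2)) (at (- s))"
      using k s by (intro geo_at_velocity flow_geo_at [of _ R]) auto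
    ultimately have "((\<lambda>s. Yf k (- s)) has_vector_derivative - horiz (Yf k (- s)) (Hf k (- s) $ 1) (Hf k (- s) $ 2)) (at s)"
      using vector_diff_chain_at [of uminus "-1" s "Yf k"] by (simp add: o_def)
    then show "((\<lambda>s. Yf k (- s)) has_derivative (\<lambda>\<sigma>. \<sigma> *\<^sub>R (- horiz (Yf k (- s)) (Hf k (- s) $ 1) (Hf k (- s) $ 2))))
        (at s within ?X)"
      unfolding has_vector_derivative_def by (rule has_derivative_at_withinI)
    show "((\<lambda>k. Yf k (- s)) has_derivative blinfun_apply (Blinfun (dYf k (- s)))) (at k within ?Y)"
      if "s \<in> ?X" "k \<in> ?Y" for s k
    proof -
      have ks: "norm k < R" "\<bar>- s\<bar> \<le> tmax R" using that by auto
      show ?thesis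
        unfolding bounded_linear_Blinfun_apply [OF bounded_linear_dYf [OF ks]]
        by (rule has_derivative_at_withinI, rule Yf_has_derivative [OF ks])
    qed
    have "continuous_on (?X \<times> ?Y) (\<lambda>p. Blinfun (dYf (snd p) (- fst p)))"
    proof (rule continuous_on_blinfun_componentwise)
      fix i :: pt
      have "continuous_on (?X \<times> ?Y) (\<lambda>p. dYf (snd p) (- fst p) i)"
        using R by (intro continuous_on_dYf [of _ _ R] continuous_intros) (auto simp: abs_le_iff)
      then show "continuous_on (?X \<times> ?Y) (\<lambda>p. blinfun_apply (Blinfun (dYf (snd p) (- fst p))) i)"
        by (rule continuous_on_cong [THEN iffD1, rotated -1])
           (auto simp: bounded_linear_Blinfun_apply bounded_linear_dYf [of _ R] abs_le_iff)
    qed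
    moreover have "(s, k) \<in> ?X \<times> ?Y" using k s by (auto simp: abs_less_iff)
    ultimately have "continuous (at (s, k) within ?X \<times> ?Y) (\<lambda>p. Blinfun (dYf (snd p) (- fst p)))"
      unfolding continuous_on_eq_continuous_within by blast
    then show "continuous (at (s, k) within ?X \<times> ?Y) (\<lambda>(s, k). Blinfun (dYf k (- s)))"
      by (simp only: case_prod_unfold)
  qed (use k in auto)
  moreover have "at (s, k) within ?X \<times> ?Y = at (s, k)"
    using k s by (intro at_within_open open_Times) (auto simp: abs_less_iff)
  moreover have "blinfun_apply (Blinfun (dYf k (- s))) = dYf k (- s)"
    using k s by (intro bounded_linear_Blinfun_apply bounded_linear_dYf [of _ R]) auto
  ultimately show ?thesis by (simp add: case_prod_unfold)
qed

context cartan_geodesic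
begin

lemma interior_derivative:
  assumes "0 < s" "s < T"
  shows "geo_at m \<gamma> s UNIV"
  using geo [of s] assms at_within_Icc_at [of 0 s T] unfolding geo_at_def by simp

text \<open>The point \<gamma>(s) and a final covector k determine a geodesic ending there, hence
  its initial point y. Inverting (s, k) \<mapsto> (s, y) yields the final covector Kf(s, y); by
  minimality the cost is - s / 2 times its squared horizontal part. The derivative of Kf in y is the
  momentum variation of a Jacobi field vanishing at \<gamma>(t).\<close>

lemma cost_hessian:
  fixes R \<delta> \<tau> t :: real and k0 v :: pt
  assumes R: "\<And>k. dist k k0 < \<delta> \<Longrightarrow> norm k < R" and \<tau>: "\<tau> \<le> T" "\<tau> < tmax R"
    and min: "\<And>k s. dist k k0 < \<delta> \<Longrightarrow> 0 < s \<Longrightarrow> s \<le> \<tau> \<Longrightarrow>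
       sr_dist (cartan_mult (\<gamma> s) (Yf k (- s))) (\<gamma> s) = s * sqrt ((k $ 1)\<^sup>2 + (k $ 2)\<^sup>2)"
    and t: "0 < t" "t < \<tau>" "dist (m t) k0 < \<delta>"
    and closing: "cartan_mult (\<gamma> t) (Yf (m t) (- t)) = \<gamma> 0"
    and inj: "\<And>l. xi (m t) (- t) l = 0 \<Longrightarrow> l = 0"
  shows "\<exists>l. xi (m t) (- t) l = frame_comp (\<gamma> 0) v
    \<and> second_differential (cost_dot \<gamma> t) (\<gamma> 0) v = (l $ 1)\<^sup>2 + (l $ 2)\<^sup>2"
proof -
  have R0: "0 \<le> R" using R [OF t(3)] norm_ge_zero [of "m t"] by linarith
  define U where "U = {0<..<\<tau>} \<times> ball k0 \<delta>"
  have U: "open U" "(t, m t) \<in> U" using t by (auto simp: U_def open_Times dist_commute)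
  have inU: "0 < fst p" "fst p < T" "fst p < \<tau>" "norm (snd p) < R" "\<bar>fst p\<bar> < tmax R" "dist (snd p) k0 < \<delta>"
    if "p \<in> U" for p
    using that \<tau> R by (auto simp: U_def dist_commute)
  define Gm where "Gm p = cartan_mult (\<gamma> (fst p)) (Yf (snd p) (- fst p))" for p
  define dG where "dG p v = dmult1 (\<gamma> (fst p)) (Yf (snd p) (- fst p))
        (fst v *\<^sub>R horiz (\<gamma> (fst p)) (m (fst p) $ 1) (m (fst p) $ 2))
      + dmult2 (\<gamma> (fst p)) (Yf (snd p) (- fst p))
        (fst v *\<^sub>R (- horiz (Yf (snd p) (- fst p)) (Hf (snd p) (- fst p) $ 1) (Hf (snd p) (- fst p) $ 2))
         + dYf (snd p) (- fst p) (snd v))" for p v :: "real \<times> pt"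
  define f where "f p = (fst p, Gm p)" for p
  have df: "(f has_derivative (\<lambda>v. (fst v, dG p v))) (at p)" if p: "p \<in> U" for p
  proof -
    have "((\<lambda>p. \<gamma> (fst p)) has_derivative (\<lambda>v. fst v *\<^sub>R horiz (\<gamma> (fst p)) (m (fst p) $ 1) (m (fst p) $ 2))) (at p)"
      using has_derivative_compose [OF has_derivative_fst [OF has_derivative_ident]
          geo_at_velocity [OF interior_derivative [OF inU(1,2) [OF p]], unfolded has_vector_derivative_def]]
      by simp
    moreover have "((\<lambda>p. Yf (snd p) (- fst p)) has_derivative
        (\<lambda>v. fst v *\<^sub>R (- horiz (Yf (snd p) (- fst p)) (Hf (snd p) (- fst p) $ 1) (Hf (snd p) (- fst p) $ 2))
         + dYf (snd p) (- fst p) (snd v))) (at p)"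
      using Yf_backward_derivative [OF inU(4,5) [OF p]] by simp
    ultimately show ?thesis
      unfolding f_def [abs_def] Gm_def dG_def
      by (intro has_derivative_Pair cartan_mult_has_derivative_pair has_derivative_fst has_derivative_ident)
  qed
  define F' where "F' p = Blinfun (\<lambda>v. (fst v, dG p v))" for p
  have F': "blinfun_apply (F' p) = (\<lambda>v. (fst v, dG p v))" if "p \<in> U" for p
    unfolding F'_def by (intro bounded_linear_Blinfun_apply has_derivative_bounded_linear [OF df [OF that]])
  have cF: "continuous_on U F'"
  proof (rule continuous_on_blinfun_componentwise)
    fix v :: "real \<times> pt"
    have cg: "continuous_on {0<..<\<tau>} (\<lambda>s. \<gamma> s $ i)" "continuous_on {0<..<\<tau>} (\<lambda>s. m s $ i)" for i
    proof -
      have "isCont (\<lambda>s. \<gamma> s $ i) s \<and> isCont (\<lambda>s. m s $ i) s" if "0 < s" "s < T" for s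
      proof -
        note d = geo_atD [OF interior_derivative [OF that], THEN DERIV_isCont]
        have "\<forall>i. isCont (\<lambda>s. \<gamma> s $ i) s \<and> isCont (\<lambda>s. m s $ i) s"
          unfolding forall5 using d by blast
        then show ?thesis ..
      qed
      then show "continuous_on {0<..<\<tau>} (\<lambda>s. \<gamma> s $ i)" "continuous_on {0<..<\<tau>} (\<lambda>s. m s $ i)"
        using \<tau>(1) by (auto intro!: continuous_at_imp_continuous_on)
    qed
    have c1: "continuous_on U (\<lambda>p. \<gamma> (fst p) $ i)" "continuous_on U (\<lambda>p. m (fst p) $ i)" for i
      by (rule continuous_on_compose2 [OF cg(1)] continuous_on_compose2 [OF cg(2)];
          auto intro!: continuous_intros simp: U_def)+
    have c0: "continuous_on U (\<lambda>p. \<gamma> (fst p))"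
    proof -
      have "continuous_on {0<..<\<tau>} \<gamma>"
      proof (rule continuous_at_imp_continuous_on, rule ballI)
        fix s assume "s \<in> {0<..<\<tau>}"
        then have "geo_at m \<gamma> s UNIV" using \<tau>(1) by (intro interior_derivative) auto
        from has_vector_derivative_continuous [OF geo_at_velocity [OF this]] show "isCont \<gamma> s" .
      qed
      then show ?thesis
        by (rule continuous_on_compose2) (auto intro!: continuous_intros simp: U_def)
    qed
    have bd: "norm (snd p) \<le> R \<and> \<bar>- fst p\<bar> \<le> tmax R" if "p \<in> U" for p
      using inU(4,5) [OF that] by simp
    have c2: "continuous_on U (\<lambda>p. Hf (snd p) (- fst p))" "continuous_on U (\<lambda>p. Yf (snd p) (- fst p))"
      "continuous_on U (\<lambda>p. dYf (snd p) (- fst p) (snd v))"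
      by (rule continuous_on_dYf [OF bd _ _ R0]; assumption?; intro continuous_intros)+
    have "continuous_on U (\<lambda>p. (fst v, dG p v))"
      unfolding dG_def
      by (intro continuous_on_Pair continuous_on_add continuous_on_dmult continuous_on_scaleR continuous_on_minus
          continuous_on_horiz continuous_on_component continuous_on_const c0 c1 c2 continuous_intros)
    then show "continuous_on U (\<lambda>p. blinfun_apply (F' p) v)"
      by (rule continuous_on_cong [THEN iffD1, rotated -1]) (simp_all add: F')
  qed
  have lin: "linear (\<lambda>v. (fst v, dG (t, m t) v))"
    using has_derivative_linear [OF df [OF U(2)]] by simp
  \<comment> \<open>With zero time component only the variation of the covector is left, and left
    translation turns it into the Jacobi field \<open>xi\<close>.\<close>
  have "inj (\<lambda>v. (fst v, dG (t, m t) v))"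
  proof (rule linear_injective_0 [OF lin, THEN iffD2], intro allI impI)
    fix v :: "real \<times> pt" assume "(fst v, dG (t, m t) v) = 0"
    then have v: "fst v = 0" "dG (t, m t) v = 0" by (simp_all add: prod_eq_iff)
    then have "dmult2 (\<gamma> t) (Yf (m t) (- t)) (dYf (m t) (- t) (snd v)) = 0"
      by (simp add: dG_def dmult1_def) (simp add: vec_eq_iff forall5)
    then have "xi (m t) (- t) (snd v) = 0"
      using frame_comp_dmult2 [of "\<gamma> t" "Yf (m t) (- t)" "dYf (m t) (- t) (snd v)"] frame_comp_eq_0_iff
      unfolding xi_def by metis
    then show "v = 0" using inj v by (simp add: prod_eq_iff)
  qed
  then obtain inv0 where inv0: "linear inv0" "inv0 \<circ> (\<lambda>v. (fst v, dG (t, m t) v)) = id"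
    using linear_injective_left_inverse [OF lin] by blast
  define C where "C = Blinfun inv0"
  have "blinfun_apply C = inv0"
    unfolding C_def using inv0(1) by (intro bounded_linear_Blinfun_apply) (simp add: linear_conv_bounded_linear)
  then have C: "C o\<^sub>L F' (t, m t) = id_blinfun"
    using fun_cong [OF inv0(2)] by (intro blinfun_eqI) (simp only: blinfun_apply_blinfun_compose F' [OF U(2)] o_apply blinfun_apply_id_blinfun id_apply)
  obtain U' V g g' where "open U'" and U': "U' \<subseteq> U" "(t, m t) \<in> U'" and V: "open V" "f (t, m t) \<in> V"
    and hom: "homeomorphism U' V f g"
    and dg: "\<And>y. y \<in> V \<Longrightarrow> (g has_derivative (g' y)) (at y)"
    and g': "\<And>y. y \<in> V \<Longrightarrow> g' y = inv (blinfun_apply (F' (g y)))"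
    and bij: "\<And>y. y \<in> V \<Longrightarrow> bij (blinfun_apply (F' (g y)))"
    by (rule inverse_function_theorem [OF U(1) _ cF U(2) C, of f]) (use df F' in auto)
  have gU: "g z \<in> U" if "z \<in> V" for z
    using hom U'(1) that unfolding homeomorphism_def by blast
  have fg: "f (g z) = z" if "z \<in> V" for z using homeomorphism_apply2 [OF hom that] .
  have z0: "(t, \<gamma> 0) \<in> V" and gz0: "g (t, \<gamma> 0) = (t, m t)"
    using V(2) homeomorphism_apply1 [OF hom U'(2)] closing by (simp_all add: f_def Gm_def)
  have F'g': "blinfun_apply (F' (g z)) (g' z w) = w" if "z \<in> V" for z w
    unfolding g' [OF that] using bij [OF that] by (simp add: bij_is_surj surj_f_inv_f)
  define Kf where "Kf z = snd (g z)" for z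
  have fst_g: "fst (g z) = fst z" and Gm_g: "cartan_mult (\<gamma> (fst z)) (Yf (Kf z) (- fst z)) = snd z" if "z \<in> V" for z
  proof -
    have "fst (f (g z)) = fst z" "snd (f (g z)) = snd z" by (simp_all only: fg [OF that])
    then show "fst (g z) = fst z" "cartan_mult (\<gamma> (fst z)) (Yf (Kf z) (- fst z)) = snd z"
      by (simp_all add: f_def Gm_def Kf_def)
  qed
  have fst_g': "fst (g' z w) = fst w" and dG_g': "dG (g z) (g' z w) = snd w" if "z \<in> V" for z w
  proof -
    have "fst (blinfun_apply (F' (g z)) (g' z w)) = fst w" "snd (blinfun_apply (F' (g z)) (g' z w)) = snd w"
      by (simp_all only: F'g' [OF that])
    then show "fst (g' z w) = fst w" "dG (g z) (g' z w) = snd w" by (simp_all add: F' [OF gU [OF that]])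
  qed
  have cost: "cost \<gamma> (fst z) (snd z) = - (fst z / 2) * ((Kf z $ 1)\<^sup>2 + (Kf z $ 2)\<^sup>2)" if z: "z \<in> V" for z
  proof -
    have "sr_dist (snd z) (\<gamma> (fst z)) = fst z * sqrt ((Kf z $ 1)\<^sup>2 + (Kf z $ 2)\<^sup>2)"
      using min [of "Kf z" "fst z"] inU [OF gU [OF z]] fst_g [OF z] Gm_g [OF z] by (simp add: Kf_def)
    then show ?thesis
      using inU(1) [OF gU [OF z]] fst_g [OF z]
      by (simp add: cost_def power_mult_distrib power2_eq_square)
  qed
  \<comment> \<open>The relation Gm (s, Kf (s, y)) = y is differentiated in s for fixed y and paired
    with the initial momentum H. The motion of the endpoint contributes the conserved momenta k1 and
    k2; the Gauss lemma evaluates the rest.\<close>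
  have radial: "fst z * (Kf z $ 1 * snd (g' z (1, 0)) $ 1 + Kf z $ 2 * snd (g' z (1, 0)) $ 2)
      = Kf z $ 1 * m (fst z) $ 1 + Kf z $ 2 * m (fst z) $ 2 - ((Kf z $ 1)\<^sup>2 + (Kf z $ 2)\<^sup>2)" if z: "z \<in> V" for z
  proof -
    define s where "s = fst z" define k where "k = Kf z" define l where "l = snd (g' z (1, 0))"
    define Y where "Y = Yf k (- s)" define H where "H = Hf k (- s)"
    have ks: "norm k \<le> R" "\<bar>- s\<bar> < tmax R"
      using inU [OF gU [OF z]] fst_g [OF z] by (auto simp: k_def s_def Kf_def)
    have "dG (g z) (g' z (1, 0)) = 0" using dG_g' [OF z] by simp
    moreover have "g z = (s, k)" "g' z (1, 0) = (1, l)"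
      using fst_g [OF z] fst_g' [OF z, of "(1, 0)"] by (simp_all add: prod_eq_iff s_def k_def l_def Kf_def)
    ultimately have "dmult1 (\<gamma> s) Y (horiz (\<gamma> s) (m s $ 1) (m s $ 2))
        + dmult2 (\<gamma> s) Y (- horiz Y (H $ 1) (H $ 2) + dYf k (- s) l) = 0"
      by (simp add: dG_def Y_def H_def)
    then have "frame_comp (cartan_mult (\<gamma> s) Y) (dmult1 (\<gamma> s) Y (horiz (\<gamma> s) (m s $ 1) (m s $ 2)))
        + frame_comp Y (- horiz Y (H $ 1) (H $ 2) + dYf k (- s) l) = 0"
      using linear_add [OF linear_frame_comp] linear_0 [OF linear_frame_comp] frame_comp_dmult2 by metis
    then have "H \<bullet> frame_comp (cartan_mult (\<gamma> s) Y) (dmult1 (\<gamma> s) Y (horiz (\<gamma> s) (m s $ 1) (m s $ 2)))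
        + H \<bullet> frame_comp Y (- horiz Y (H $ 1) (H $ 2) + dYf k (- s) l) = 0"
      by (metis inner_add_right inner_zero_right)
    moreover have "H \<bullet> frame_comp (cartan_mult (\<gamma> s) Y) (dmult1 (\<gamma> s) Y (horiz (\<gamma> s) (m s $ 1) (m s $ 2)))
        = k $ 1 * m s $ 1 + k $ 2 * m s $ 2"
    proof -
      have "H \<bullet> frame_comp (cartan_mult (\<gamma> s) Y) (dmult1 (\<gamma> s) Y (horiz (\<gamma> s) (m s $ 1) (m s $ 2)))
        = m s $ 1 * (H$1 + Y$2 * H$3 + (Y$3 - Y$1 * Y$2) * H$4 - (Y$2)\<^sup>2 / 2 * H$5)
        + m s $ 2 * (H$2 - Y$1 * H$3 + (Y$1)\<^sup>2 / 2 * H$4 + Y$3 * H$5)"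
        unfolding frame_comp_dmult1_horiz inner5 vec5_nth by (simp add: algebra_simps)
      also have "\<dots> = m s $ 1 * k $ 1 + m s $ 2 * k $ 2"
        using right_momenta [OF ks] Hf_deriv(4,5) [OF ks] by (simp only: H_def Y_def)
      finally show ?thesis by (simp add: mult.commute)
    qed
    moreover have "H \<bullet> frame_comp Y (- horiz Y (H $ 1) (H $ 2) + dYf k (- s) l)
        = - ((k $ 1)\<^sup>2 + (k $ 2)\<^sup>2) - s * (k $ 1 * l $ 1 + k $ 2 * l $ 2)"
    proof -
      have "frame_comp Y (- horiz Y (H $ 1) (H $ 2) + dYf k (- s) l) = - vec5 (H$1) (H$2) 0 0 0 + xi k (- s) l"
        by (simp add: linear_diff [OF linear_frame_comp] frame_comp_horiz xi_def Y_def)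
      moreover have "H \<bullet> vec5 (H$1) (H$2) 0 0 0 = (k $ 1)\<^sup>2 + (k $ 2)\<^sup>2"
        using flow_speed [OF ks] by (simp add: inner5 H_def power2_eq_square)
      ultimately show ?thesis
        using gauss_lemma [OF ks, of l] by (simp add: inner_diff_right H_def [symmetric])
    qed
    ultimately show ?thesis by (simp add: s_def k_def l_def)
  qed
  \<comment> \<open>The time derivative of the square of Kf involves the derivative of Kf only
    through its pairing with Kf, which is what \<open>radial\<close> computes.\<close>
  have cost_dot: "cost_dot \<gamma> (fst z) (snd z)
      = ((Kf z $ 1)\<^sup>2 + (Kf z $ 2)\<^sup>2) / 2 - (Kf z $ 1 * m (fst z) $ 1 + Kf z $ 2 * m (fst z) $ 2)" if z: "z \<in> V" for z
  proof -
    let ?s = "fst z" and ?y = "snd z" and ?l = "snd (g' z (1, 0))"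
    have dK: "((\<lambda>s. Kf (s, ?y) $ i) has_real_derivative ?l $ i) (at ?s)" for i
    proof -
      have p: "((\<lambda>s. (s, ?y)) has_derivative (\<lambda>\<sigma>. (\<sigma>, 0))) (at ?s)" by (auto intro!: derivative_eq_intros)
      have "(g has_derivative g' z) (at (?s, ?y))" using dg [OF z] by simp
      from has_derivative_compose [OF p this]
      have "((\<lambda>s. snd (g (s, ?y)) $ i) has_derivative (\<lambda>\<sigma>. snd (g' z (\<sigma>, 0)) $ i)) (at ?s)"
        by (intro bounded_linear.has_derivative [OF bounded_linear_vec_nth] has_derivative_snd)
      moreover have "snd (g' z (\<sigma>, 0)) $ i = ?l $ i * \<sigma>" for \<sigma>
      proof -
        have "g' z (\<sigma>, 0) = g' z (\<sigma> *\<^sub>R (1, 0))" by simp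
        also have "\<dots> = \<sigma> *\<^sub>R g' z (1, 0)"
          using linear_cmul [OF has_derivative_linear [OF dg [OF z]]] .
        finally show ?thesis by simp
      qed
      then have "(\<lambda>\<sigma>. snd (g' z (\<sigma>, 0)) $ i) = (*) (?l $ i)" by (rule ext)
      ultimately show ?thesis unfolding has_field_derivative_def Kf_def by (simp only:)
    qed
    have "((\<lambda>s. - (s / 2) * ((Kf (s, ?y) $ 1)\<^sup>2 + (Kf (s, ?y) $ 2)\<^sup>2)) has_real_derivative
        ((Kf z $ 1)\<^sup>2 + (Kf z $ 2)\<^sup>2) / 2 - (Kf z $ 1 * m (fst z) $ 1 + Kf z $ 2 * m (fst z) $ 2)) (at ?s)"
      by (rule derivative_eq_intros dK refl numeral_neq_zero)+
         (use radial [OF z] in \<open>simp add: algebra_simps\<close>)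
    moreover have "\<forall>\<^sub>F s in nhds ?s. - (s / 2) * ((Kf (s, ?y) $ 1)\<^sup>2 + (Kf (s, ?y) $ 2)\<^sup>2) = cost \<gamma> s ?y"
    proof -
      have "open ((\<lambda>s. (s, ?y)) -` V)" by (intro open_vimage V continuous_intros)
      then have "\<forall>\<^sub>F s in nhds ?s. s \<in> (\<lambda>s. (s, ?y)) -` V" using z by (intro eventually_nhds_in_open) auto
      then show ?thesis by eventually_elim (use cost in fastforce)
    qed
    ultimately have "((\<lambda>s. cost \<gamma> s ?y) has_real_derivative
        ((Kf z $ 1)\<^sup>2 + (Kf z $ 2)\<^sup>2) / 2 - (Kf z $ 1 * m (fst z) $ 1 + Kf z $ 2 * m (fst z) $ 2)) (at ?s)"
      by (subst (asm) DERIV_cong_ev [OF refl _ refl])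
    then show ?thesis unfolding cost_dot_def by (rule DERIV_imp_deriv)
  qed
  define N where "N = (\<lambda>y. (t, y)) -` V"
  have N: "open N" "\<gamma> 0 \<in> N" using z0 by (auto simp: N_def intro!: open_vimage V continuous_intros)
  \<comment> \<open>At \<gamma>(0) the inverse returns the covector of \<gamma>, so the linear term
    of the cost rate has the coefficients required by
    \<open>second_differential_half_square\<close>.\<close>
  have K0: "Kf (t, \<gamma> 0) = m t" by (simp add: Kf_def gz0)
  let ?D = "\<lambda>y v. snd (g' (t, y) (0, v))"
  have dK: "((\<lambda>y. Kf (t, y) $ i) has_derivative (\<lambda>v. ?D y v $ i)) (at y)" if y: "y \<in> N" for y i
  proof -
    have p: "((\<lambda>y. (t, y)) has_derivative (\<lambda>v. (0, v))) (at y)" by (auto intro!: derivative_eq_intros)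
    have "(g has_derivative g' (t, y)) (at (t, y))" using dg [of "(t, y)"] y by (simp add: N_def)
    from has_derivative_compose [OF p this] show ?thesis
      unfolding Kf_def by (intro bounded_linear.has_derivative [OF bounded_linear_vec_nth] has_derivative_snd)
  qed
  have contD: "isCont (\<lambda>y. g' (t, y) (0, v)) (\<gamma> 0)"
  proof (rule isCont_solution [where A = "\<lambda>y. F' (g (t, y))" and C = C and c = "(0, v)"])
    have "isCont (\<lambda>y. g (t, y)) (\<gamma> 0)"
      using has_derivative_continuous [OF dg [OF z0]]
      by (intro isCont_o2 [where g = g and f = "\<lambda>y. (t, y)"] continuous_intros)
    moreover have "isCont F' (g (t, \<gamma> 0))"
      using cF U gz0 continuous_on_interior [of U F' "g (t, \<gamma> 0)"] by (simp add: interior_open)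
    ultimately show "isCont (\<lambda>y. F' (g (t, y))) (\<gamma> 0)" by (rule isCont_o2)
    show "C o\<^sub>L F' (g (t, \<gamma> 0)) = id_blinfun" using C gz0 by simp
    have "\<forall>\<^sub>F y in nhds (\<gamma> 0). y \<in> N" using N by (rule eventually_nhds_in_open)
    then show "\<forall>\<^sub>F y in nhds (\<gamma> 0). blinfun_apply (F' (g (t, y))) (g' (t, y) (0, v)) = (0, v)"
      by eventually_elim (use F'g' in \<open>auto simp: N_def\<close>)
  qed
  have contDi: "isCont (\<lambda>y. ?D y v $ i) (\<gamma> 0)" for i
    using contD by (intro continuous_intros)
  let ?l = "?D (\<gamma> 0) v"
  have "second_differential (cost_dot \<gamma> t) (\<gamma> 0) v = (?l $ 1)\<^sup>2 + (?l $ 2)\<^sup>2"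
  proof (rule second_differential_half_square [OF N _ dK dK contDi contDi])
    fix y assume "y \<in> N"
    then show "cost_dot \<gamma> t y = ((Kf (t, y) $ 1)\<^sup>2 + (Kf (t, y) $ 2)\<^sup>2) / 2
        - (Kf (t, y) $ 1 * Kf (t, \<gamma> 0) $ 1 + Kf (t, y) $ 2 * Kf (t, \<gamma> 0) $ 2)"
      using cost_dot [of "(t, y)"] by (simp add: N_def K0)
  qed
  moreover have "xi (m t) (- t) ?l = frame_comp (\<gamma> 0) v"
  proof -
    have "dG (t, m t) (0, ?l) = v"
      using dG_g' [OF z0, of "(0, v)"] fst_g' [OF z0, of "(0, v)"] gz0 by (metis fst_conv prod.collapse snd_conv)
    then have "dmult2 (\<gamma> t) (Yf (m t) (- t)) (dYf (m t) (- t) ?l) = v"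
      by (simp add: dG_def dmult1_def) (simp add: vec_eq_iff forall5)
    then show ?thesis using frame_comp_dmult2 closing unfolding xi_def by metis
  qed
  ultimately show ?thesis by blast
qed

end

section \<open>Duality of Jacobi fields vanishing at opposite ends\<close>

lemma geo_at_shift:
  assumes "geo_at m x (s - t) UNIV"
  shows "geo_at (\<lambda>s. m (s - t)) (\<lambda>s. x (s - t)) s S"
proof -
  have "((\<lambda>s. f (s - t)) has_real_derivative D) (at s within S)"
    if "(f has_real_derivative D) (at (s - t))" for f D
  proof -
    have "((\<lambda>s. s - t) has_real_derivative 1) (at s within S)" by (auto intro!: derivative_eq_intros)
    from DERIV_chain2 [OF that this] show ?thesis by simp
  qed
  then show ?thesis using assms unfolding geo_at_def by blast
qed

lemma geo_at_mono: "geo_at m x s S \<Longrightarrow> S' \<subseteq> S \<Longrightarrow> geo_at m x s S'"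
  unfolding geo_at_def using DERIV_subset by blast

context cartan_geodesic
begin

lemma flow_backward:
  assumes t: "t \<in> {0..T}" and R: "norm (m t) \<le> R" "t < tmax R" and s: "s \<in> {0..t}"
  shows "Hf (m t) (s - t) = m s \<and> cartan_mult (\<gamma> t) (Yf (m t) (s - t)) = \<gamma> s"
proof (rule geo_unique [of 0 t _ _ _ _ t])
  fix s assume s: "s \<in> {0..t}"
  have "geo_at (Hf (m t)) (\<lambda>s. cartan_mult (\<gamma> t) (Yf (m t) s)) (s - t) UNIV"
    using s R by (intro geo_at_left_translate flow_geo_at [of _ R]) auto
  from geo_at_shift [OF this]
  show "geo_at (\<lambda>s. Hf (m t) (s - t)) (\<lambda>s. cartan_mult (\<gamma> t) (Yf (m t) (s - t))) s {0..t}" .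
  show "geo_at m \<gamma> s {0..t}" using s t by (intro geo_at_mono [OF geo [of s]]) auto
qed (use assms in \<open>auto simp: cartan_mult_0\<close>)

lemma flow_forward:
  assumes t: "t \<in> {0..T}" and R: "norm (m 0) \<le> R" "t < tmax R" and s: "s \<in> {0..t}"
  shows "Hf (m 0) s = m s"
proof -
  have "Hf (m 0) s = m s \<and> cartan_mult (\<gamma> 0) (Yf (m 0) s) = \<gamma> s"
  proof (rule geo_unique [of 0 t _ _ _ _ 0])
    fix s assume s: "s \<in> {0..t}"
    show "geo_at (Hf (m 0)) (\<lambda>s. cartan_mult (\<gamma> 0) (Yf (m 0) s)) s {0..t}"
      using s R by (intro geo_at_left_translate flow_geo_at [of _ R]) auto
    show "geo_at m \<gamma> s {0..t}" using s t by (intro geo_at_mono [OF geo [of s]]) auto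
  qed (use assms in \<open>auto simp: cartan_mult_0\<close>)
  then show ?thesis ..
qed

text \<open>By conservation of the symplectic form, evaluated on two left-trivialised Jacobi fields.\<close>

lemma jacobi_duality:
  assumes t: "t \<in> {0..T}" and R: "norm (m 0) \<le> R" "norm (m t) \<le> R" "t < tmax R"
  shows "l \<bullet> xi (m 0) t l' = - (l' \<bullet> xi (m t) (- t) l)"
proof -
  define a where "a s = xi (m t) (s - t) l" for s
  define da where "da s = dHf (m t) (s - t) l" for s
  define b where "b s = xi (m 0) s l'" for s
  define db where "db s = dHf (m 0) s l'" for s
  have m45: "m s $ 4 = m 0 $ 4" "m s $ 5 = m 0 $ 5" if "s \<in> {0..t}" for s
    using momentum_const [of s] that t by auto
  have da45: "da s $ 4 = l $ 4" "da s $ 5 = l $ 5" and db45: "db s $ 4 = l' $ 4" "db s $ 5 = l' $ 5"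
    if "s \<in> {0..t}" for s
    using that R dHf_deriv(4,5) [OF R(2), of "s - t" l] dHf_deriv(4,5) [OF R(1), of s l']
    by (auto simp: da_def db_def)
  \<comment> \<open>In the left trivialisation the symplectic form is the canonical pairing
    corrected by the momentum evaluated on the bracket of the two base components. Since a vanishes
    at t and b at 0, its end values are the two sides of the claim.\<close>
  let ?\<Omega> = "\<lambda>s. (da s $ 1 * b s $ 1 + da s $ 2 * b s $ 2 + da s $ 3 * b s $ 3 + l $ 4 * b s $ 4 + l $ 5 * b s $ 5)
    - (db s $ 1 * a s $ 1 + db s $ 2 * a s $ 2 + db s $ 3 * a s $ 3 + l' $ 4 * a s $ 4 + l' $ 5 * a s $ 5)
    - (m s $ 3 * (a s $ 1 * b s $ 2 - a s $ 2 * b s $ 1) + m 0 $ 4 * (a s $ 1 * b s $ 3 - a s $ 3 * b s $ 1)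
     + m 0 $ 5 * (a s $ 2 * b s $ 3 - a s $ 3 * b s $ 2))"
  have "?\<Omega> t = ?\<Omega> 0"
  proof (rule eq_on_interval_if_same_derivative [of 0 t ?\<Omega> "\<lambda>_. 0" "\<lambda>_. ?\<Omega> 0" 0 t])
    fix s assume s: "s \<in> {0..t}"
    have sh: "((\<lambda>s. f (s - t)) has_real_derivative D) (at s within {0..t})"
      if "(f has_real_derivative D) (at (s - t))" for f D
    proof -
      have "((\<lambda>s. s - t) has_real_derivative 1) (at s within {0..t})" by (auto intro!: derivative_eq_intros)
      from DERIV_chain2 [OF that this] show ?thesis by simp
    qed
    have H: "Hf (m t) (s - t) = m s" "Hf (m 0) s = m s"
      using flow_backward [OF t R(2,3) s] flow_forward [OF t R(1,3) s] by auto
    have st: "\<bar>s - t\<bar> < tmax R" "\<bar>s\<bar> < tmax R" using s R by auto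
    note A = xi_deriv [OF R(2) st(1), of l, THEN sh, folded a_def da_def, unfolded H(1)]
    note DA = dHf_deriv(1-3) [OF R(2) st(1), of l, THEN sh, folded a_def da_def, unfolded H(1) m45 [OF s]]
    note B = xi_deriv [OF R(1) st(2), of l', THEN has_field_derivative_at_within, folded b_def db_def, unfolded H(2)]
    note DB = dHf_deriv(1-3) [OF R(1) st(2), of l', THEN has_field_derivative_at_within, folded b_def db_def, unfolded H(2)]
    have M: "((\<lambda>s. m s $ 3) has_real_derivative m s $ 1 * m 0 $ 4 + m s $ 2 * m 0 $ 5) (at s within {0..t})"
      using geo_atD(3) [OF geo_at_mono [OF geo, of s "{0..t}"]] s t m45 [OF s] by auto
    have tt: "m t $ 4 = m 0 $ 4" "m t $ 5 = m 0 $ 5" using m45 [of t] t by auto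
    show "(?\<Omega> has_real_derivative 0) (at s within {0..t})"
      by (rule derivative_eq_intros A DA B DB M refl)+ (simp add: tt algebra_simps)
  qed (use t in auto)
  then show ?thesis
    by (simp add: a_def b_def da_def db_def inner5)
qed

text \<open>The horizontal part of l is split along and across the final velocity. The Gauss lemma
  gives the first part and duality with w, which ends at the unit normal, the second. By the Gauss
  lemma w itself starts normal to the initial velocity, so its pairing with v is a single
  product.\<close>

lemma hessian_reduced:
  assumes t: "0 < t" "t \<le> T" and R: "norm (m 0) \<le> R" "norm (m t) \<le> R" "t < tmax R"
    and r: "0 < r" "(m 0 $ 1)\<^sup>2 + (m 0 $ 2)\<^sup>2 = r\<^sup>2"
    and w: "xi (m 0) t w = vec5 (- m t $ 2 / r) (m t $ 1 / r) 0 0 0"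
    and l: "xi (m t) (- t) l = vec5 v1 v2 0 0 0"
  shows "(l $ 1)\<^sup>2 + (l $ 2)\<^sup>2 = ((m 0 $ 1 * v1 + m 0 $ 2 * v2) / r)\<^sup>2 / t\<^sup>2
    + ((m 0 $ 1 * w $ 2 - m 0 $ 2 * w $ 1) / r)\<^sup>2 * ((m 0 $ 1 * v2 - m 0 $ 2 * v1) / r)\<^sup>2"
proof -
  have t': "t \<in> {0..T}" using t by simp
  have rt: "(m t $ 1)\<^sup>2 + (m t $ 2)\<^sup>2 = r\<^sup>2" using momentum_const(3) [OF t'] r by simp
  have st: "\<bar>t\<bar> < tmax R" "\<bar>- t\<bar> < tmax R" using R t by auto
  have "Hf (m t) (- t) = m 0" "Hf (m 0) t = m t"
    using flow_backward [OF t' R(2,3), of 0] flow_forward [OF t' R(1,3), of t] t by auto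
  then have g1: "m 0 $ 1 * v1 + m 0 $ 2 * v2 = - t * (m t $ 1 * l $ 1 + m t $ 2 * l $ 2)"
    and g2: "t * (m 0 $ 1 * w $ 1 + m 0 $ 2 * w $ 2) = 0"
    using gauss_lemma [OF R(2) st(2), of l] gauss_lemma [OF R(1) st(1), of w] l w
    by (simp_all add: inner5)
  have dual: "(m t $ 1 * l $ 2 - m t $ 2 * l $ 1) / r = - (w $ 1 * v1 + w $ 2 * v2)"
    using jacobi_duality [OF t' R, of l w] l w by (simp add: inner5 diff_divide_distrib mult.commute)
  have w0: "m 0 $ 1 * w $ 1 + m 0 $ 2 * w $ 2 = 0" using g2 t by simp
  have wv: "(w $ 1 * v1 + w $ 2 * v2) * r\<^sup>2
      = (m 0 $ 1 * w $ 2 - m 0 $ 2 * w $ 1) * (m 0 $ 1 * v2 - m 0 $ 2 * v1)"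
  proof -
    have "(w $ 1 * v1 + w $ 2 * v2) * ((m 0 $ 1)\<^sup>2 + (m 0 $ 2)\<^sup>2)
      = (m 0 $ 1 * w $ 2 - m 0 $ 2 * w $ 1) * (m 0 $ 1 * v2 - m 0 $ 2 * v1)
        + (m 0 $ 1 * w $ 1 + m 0 $ 2 * w $ 2) * (m 0 $ 1 * v1 + m 0 $ 2 * v2)"
      by (simp add: power2_eq_square algebra_simps)
    then show ?thesis by (simp add: w0 r(2))
  qed
  have "((l $ 1)\<^sup>2 + (l $ 2)\<^sup>2) * r\<^sup>2 = (m t $ 1 * l $ 1 + m t $ 2 * l $ 2)\<^sup>2 + (m t $ 1 * l $ 2 - m t $ 2 * l $ 1)\<^sup>2"
    unfolding rt [symmetric] by (simp add: power2_eq_square algebra_simps)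
  also have "(m t $ 1 * l $ 1 + m t $ 2 * l $ 2)\<^sup>2 = (m 0 $ 1 * v1 + m 0 $ 2 * v2)\<^sup>2 / t\<^sup>2"
    unfolding g1 using t by (simp add: power_mult_distrib)
  also have "(m t $ 1 * l $ 2 - m t $ 2 * l $ 1)\<^sup>2 = (w $ 1 * v1 + w $ 2 * v2)\<^sup>2 * r\<^sup>2"
  proof -
    have "m t $ 1 * l $ 2 - m t $ 2 * l $ 1 = - (w $ 1 * v1 + w $ 2 * v2) * r"
      using dual r(1) by (simp add: field_simps)
    then show ?thesis by (simp only: power_mult_distrib power2_minus)
  qed
  also have "w $ 1 * v1 + w $ 2 * v2 = (m 0 $ 1 * w $ 2 - m 0 $ 2 * w $ 1) * (m 0 $ 1 * v2 - m 0 $ 2 * v1) / r\<^sup>2"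
    using wv r(1) by (simp add: field_simps)
  finally show ?thesis
    using r(1) t(1) by (simp add: power_mult_distrib power_divide field_simps power2_eq_square)
qed

end

section \<open>Power series of Jacobi fields\<close>

text \<open>Three coefficients are carried because the curvature sits two orders above the leading
  term.\<close>

definition lead :: "nat \<Rightarrow> real \<Rightarrow> real \<Rightarrow> real \<Rightarrow> real fps \<Rightarrow> bool" where
  "lead a x0 x1 x2 F \<longleftrightarrow> (\<forall>n<a. fps_nth F n = 0) \<and> fps_nth F a = x0 \<and> fps_nth F (a + 1) = x1
     \<and> fps_nth F (a + 2) = x2"

lemma lead_add: "lead a x0 x1 x2 F \<Longrightarrow> lead a y0 y1 y2 G \<Longrightarrow> lead a (x0 + y0) (x1 + y1) (x2 + y2) (F + G)"
  and lead_diff: "lead a x0 x1 x2 F \<Longrightarrow> lead a y0 y1 y2 G \<Longrightarrow> lead a (x0 - y0) (x1 - y1) (x2 - y2) (F - G)"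
  by (auto simp: lead_def)

lemma lead_eqI:
  "lead b y0 y1 y2 F \<Longrightarrow> b = a \<Longrightarrow> y0 = x0 \<Longrightarrow> y1 = x1 \<Longrightarrow> y2 = x2 \<Longrightarrow> lead a x0 x1 x2 F"
  by simp

lemma lead_shift: "lead a x0 x1 x2 F \<Longrightarrow> lead 0 x0 x1 x2 (fps_shift a F)"
  by (simp add: lead_def add.commute)

lemma lead_shift_eq: "lead a x0 x1 x2 F \<Longrightarrow> F = fps_X ^ a * fps_shift a F"
  by (rule fps_ext) (auto simp: lead_def fps_X_power_mult_nth)

lemma lead_mult:
  assumes "lead a x0 x1 x2 F" "lead b y0 y1 y2 G"
  shows "lead (a + b) (x0 * y0) (x0 * y1 + x1 * y0) (x0 * y2 + x1 * y1 + x2 * y0) (F * G)"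
proof -
  define F' where "F' = fps_shift a F"
  define G' where "G' = fps_shift b G"
  have F': "lead 0 x0 x1 x2 F'" and G': "lead 0 y0 y1 y2 G'"
    unfolding F'_def G'_def using assms lead_shift by blast+
  have "F * G = fps_X ^ (a + b) * (F' * G')"
    using lead_shift_eq [OF assms(1)] lead_shift_eq [OF assms(2)]
    by (simp add: F'_def G'_def power_add algebra_simps)
  moreover have "fps_nth (F' * G') 0 = x0 * y0" "fps_nth (F' * G') (Suc 0) = x0 * y1 + x1 * y0"
    "fps_nth (F' * G') (Suc (Suc 0)) = x0 * y2 + x1 * y1 + x2 * y0"
    using F' G' by (simp_all add: lead_def fps_mult_nth sum.atLeast0_atMost_Suc numeral_2_eq_2)
  ultimately show ?thesis
    by (simp add: lead_def fps_X_power_mult_nth numeral_2_eq_2)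
qed

lemma lead_integral:
  assumes "lead a x0 x1 x2 (fps_deriv F)" "fps_nth F 0 = 0"
  shows "lead (Suc a) (x0 / real (a + 1)) (x1 / real (a + 2)) (x2 / real (a + 3)) F"
proof -
  have d: "fps_nth (fps_deriv F) n = real (n + 1) * fps_nth F (n + 1)" for n by simp
  have "fps_nth F n = 0" if "n < Suc a" for n
    using assms that d [of "n - 1"] by (cases n) (auto simp: lead_def)
  then show ?thesis
    using assms(1) d [of a] d [of "a + 1"] d [of "a + 2"]
    by (simp add: lead_def field_simps numeral_3_eq_3 numeral_2_eq_2)
qed

lemma lead_trivial: "(\<And>n. n < a \<Longrightarrow> fps_nth F n = 0) \<Longrightarrow>
    lead a (fps_nth F a) (fps_nth F (a + 1)) (fps_nth F (a + 2)) F"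
  by (simp add: lead_def)

lemma fps_mult_nth_eq_0: "(\<And>j. j \<le> n \<Longrightarrow> fps_nth G j = 0) \<Longrightarrow> fps_nth (F * G) n = (0::real)"
  by (simp add: fps_mult_nth)

text \<open>C and S stand for the coordinates of (h1, h2) in the initial velocity and its rotation
  scaled by w, and W for h3 with initial value w. At time 0, \<rho> is (h1 h4 + h2 h5) / h3 and
  \<open>la\<close> is h1 h5 - h2 h4, so E = w^2 / 2 + la and R11 = 6 E - 8 \<rho>^2.\<close>

locale jacobi_series =
  fixes w \<rho> la :: real and C S W :: "real fps"
  assumes w: "w \<noteq> 0"
    and dC: "fps_deriv C = - fps_const w * (S * W)" and dS: "fps_const w * fps_deriv S = C * W"
    and dW: "fps_deriv W = fps_const w * (fps_const \<rho> * C + fps_const la * S)"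
    and init: "fps_nth C 0 = 1" "fps_nth S 0 = 0" "fps_nth W 0 = w"
begin

lemma lead_base: "lead 0 1 0 (- w\<^sup>2 / 2) C" "lead 1 1 (\<rho> / 2) ((la - w\<^sup>2) / 6) S" "lead 0 w (w * \<rho>) (w * la / 2) W"
proof -
  have eC: "real (n + 1) * fps_nth C (n + 1) = - w * fps_nth (S * W) n" for n
    using arg_cong [OF dC, of "\<lambda>F. fps_nth F n"] by (simp flip: fps_const_neg)
  have eS: "w * (real (n + 1) * fps_nth S (n + 1)) = fps_nth (C * W) n" for n
    using arg_cong [OF dS, of "\<lambda>F. fps_nth F n"] by simp
  have eW: "real (n + 1) * fps_nth W (n + 1) = w * (\<rho> * fps_nth C n + la * fps_nth S n)" for n
    using arg_cong [OF dW, of "\<lambda>F. fps_nth F n"] by simp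
  have 1: "fps_nth C (Suc 0) = 0" "fps_nth S (Suc 0) = 1" "fps_nth W (Suc 0) = w * \<rho>"
    using eC [of 0] eS [of 0] eW [of 0] init w by simp_all
  have 2: "fps_nth C (Suc (Suc 0)) = - w\<^sup>2 / 2" "fps_nth S (Suc (Suc 0)) = \<rho> / 2" "fps_nth W (Suc (Suc 0)) = w * la / 2"
    using eC [of 1] eS [of 1] eW [of 1] init w 1 by (simp_all add: fps_mult_nth field_simps power2_eq_square)
  have "w * (3 * fps_nth S (Suc (Suc (Suc 0)))) = w * ((la - w\<^sup>2) / 2)"
    using eS [of 2] init 1 2
    by (simp add: fps_mult_nth numeral_2_eq_2 sum.atLeast0_atMost_Suc field_simps power2_eq_square)
  then have 3: "fps_nth S (Suc (Suc (Suc 0))) = (la - w\<^sup>2) / 6" using w by simp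
  show "lead 0 1 0 (- w\<^sup>2 / 2) C" "lead 1 1 (\<rho> / 2) ((la - w\<^sup>2) / 6) S" "lead 0 w (w * \<rho>) (w * la / 2) W"
    using init 1 2 3 by (simp_all add: lead_def numeral_2_eq_2)
qed

text \<open>Jacobi equations with source F: Z is minus the X3-component of the field, ZP its
  derivative, and P, Q are the coordinates of the X4 and X5 components in the basis behind C and
  S.\<close>

definition column :: "real fps \<Rightarrow> real fps \<Rightarrow> real fps \<Rightarrow> real fps \<Rightarrow> real fps \<Rightarrow> bool" where
  "column F Z ZP P Q \<longleftrightarrow> fps_deriv Z = ZP \<and>
     fps_deriv ZP = F - W * (W * Z - fps_const (w * \<rho>) * P - fps_const (w * la) * Q) \<and>
     fps_deriv P = C * Z \<and> fps_deriv Q = S * Z \<and>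
     fps_nth Z 0 = 0 \<and> fps_nth ZP 0 = 0 \<and> fps_nth P 0 = 0 \<and> fps_nth Q 0 = 0"

text \<open>Two integrations carry the source to Z, one more against C or S to P and Q. The feedback
  \<open>W * U\<close> begins in order e + 2, hence it touches only the third coefficient, through
  the term - w^2 z0.\<close>

lemma lead_column:
  assumes col: "column F Z ZP P Q" and F: "lead e f0 f1 f2 F"
  defines "z0 \<equiv> f0 / (real (e + 1) * real (e + 2))" and "z1 \<equiv> f1 / (real (e + 2) * real (e + 3))"
  defines "z2 \<equiv> (f2 - w\<^sup>2 * z0) / (real (e + 3) * real (e + 4))"
  shows "lead (e + 2) z0 z1 z2 Z"
    and "lead (e + 1) (real (e + 2) * z0) (real (e + 3) * z1) (real (e + 4) * z2) ZP"
    and "lead (e + 3) (z0 / real (e + 3)) (z1 / real (e + 4)) ((z2 - w\<^sup>2 / 2 * z0) / real (e + 5)) P"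
    and "lead (e + 4) (z0 / real (e + 4)) ((z1 + \<rho> / 2 * z0) / real (e + 5))
      ((z2 + \<rho> / 2 * z1 + (la - w\<^sup>2) / 6 * z0) / real (e + 6)) Q"
proof -
  define U where "U = W * Z - fps_const (w * \<rho>) * P - fps_const (w * la) * Q"
  have dZ: "fps_deriv Z = ZP" and dZP: "fps_deriv ZP = F - W * U" and dP: "fps_deriv P = C * Z"
    and dQ: "fps_deriv Q = S * Z"
    and i0: "fps_nth Z 0 = 0" "fps_nth ZP 0 = 0" "fps_nth P 0 = 0" "fps_nth Q 0 = 0"
    using col by (auto simp: column_def U_def)
  have eZ: "real (n + 1) * fps_nth Z (n + 1) = fps_nth ZP n" for n
    using arg_cong [OF dZ, of "\<lambda>F. fps_nth F n"] by simp
  have eZP: "real (n + 1) * fps_nth ZP (n + 1) = fps_nth F n - fps_nth (W * U) n" for n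
    using arg_cong [OF dZP, of "\<lambda>F. fps_nth F n"] by simp
  have eP: "real (n + 1) * fps_nth P (n + 1) = fps_nth (C * Z) n" for n
    using arg_cong [OF dP, of "\<lambda>F. fps_nth F n"] by simp
  have eQ: "real (n + 1) * fps_nth Q (n + 1) = fps_nth (S * Z) n" for n
    using arg_cong [OF dQ, of "\<lambda>F. fps_nth F n"] by simp
  have U0: "fps_nth U n = 0" if "\<And>j. j \<le> n \<Longrightarrow> fps_nth Z j = 0 \<and> fps_nth P j = 0 \<and> fps_nth Q j = 0" for n
    using that fps_mult_nth_eq_0 [of n Z W] by (simp add: U_def)
  \<comment> \<open>Induction on the order: the feedback at a given order uses only coefficients
    already known to vanish.\<close>
  have zero: "j < e + 2 \<Longrightarrow> fps_nth Z j = 0 \<and> fps_nth P j = 0 \<and> fps_nth Q j = 0" for j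
  proof (induction j rule: less_induct)
    case (less j)
    show ?case
    proof (cases j)
      case (Suc n)
      have Zn: "fps_nth Z i = 0 \<and> fps_nth P i = 0 \<and> fps_nth Q i = 0" if "i \<le> n" for i
        using less that Suc by simp
      have "fps_nth ZP n = 0"
      proof (cases n)
        case (Suc k)
        have "fps_nth (W * U) k = 0"
          by (rule fps_mult_nth_eq_0, rule U0, rule Zn) (use Suc in auto)
        moreover have "fps_nth F k = 0" using F less.prems Suc \<open>j = Suc n\<close> by (simp add: lead_def)
        ultimately show ?thesis using eZP [of k] Suc by simp
      qed (simp add: i0)
      moreover have "fps_nth (C * Z) n = 0" "fps_nth (S * Z) n = 0"
        using Zn by (auto intro: fps_mult_nth_eq_0)
      ultimately show ?thesis using eZ [of n] eP [of n] eQ [of n] Suc by simp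
    qed (simp add: i0)
  qed
  have P2: "fps_nth P (e + 2) = 0" "fps_nth Q (e + 2) = 0"
  proof -
    have "fps_nth (C * Z) (e + 1) = 0" "fps_nth (S * Z) (e + 1) = 0"
      using zero by (auto intro!: fps_mult_nth_eq_0)
    then show "fps_nth P (e + 2) = 0" "fps_nth Q (e + 2) = 0" using eP [of "e + 1"] eQ [of "e + 1"] by simp_all
  qed
  have leadZ: "lead (e + 2) (fps_nth Z (e + 2)) (fps_nth Z (e + 2 + 1)) (fps_nth Z (e + 2 + 2)) Z"
    by (rule lead_trivial) (simp add: zero)
  have Uz: "fps_nth U n = 0" if "n < e + 2" for n using that zero by (intro U0) auto
  have WZ: "fps_nth (W * Z) (e + 2) = w * fps_nth Z (e + 2)"
    using lead_mult [OF lead_base(3) leadZ] by (simp add: lead_def)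
  have U2: "fps_nth U (e + 2) = w * fps_nth Z (e + 2)"
    unfolding U_def using P2 WZ by simp
  have leadU: "lead (e + 2) (w * fps_nth Z (e + 2)) (fps_nth U (e + 2 + 1)) (fps_nth U (e + 2 + 2)) U"
    using lead_trivial [of "e + 2" U] Uz U2 by simp
  have V: "fps_nth (W * U) n = (if n = e + 2 then w * (w * fps_nth Z (e + 2)) else 0)" if "n \<le> e + 2" for n
    using lead_mult [OF lead_base(3) leadU] that by (auto simp: lead_def)
  have lF: "fps_nth F n = 0" if "n < e" for n using F that by (simp add: lead_def)
  have lZPd: "lead e f0 f1 (f2 - w\<^sup>2 * fps_nth Z (e + 2)) (fps_deriv ZP)"
    unfolding dZP using F V by (simp add: lead_def power2_eq_square)
  have lZP: "lead (Suc e) (f0 / real (e + 1)) (f1 / real (e + 2)) ((f2 - w\<^sup>2 * fps_nth Z (e + 2)) / real (e + 3)) ZP"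
    by (rule lead_integral [OF lZPd i0(2)])
  then have lZ: "lead (Suc (Suc e)) (f0 / real (e + 1) / real (Suc e + 1)) (f1 / real (e + 2) / real (Suc e + 2))
      ((f2 - w\<^sup>2 * fps_nth Z (e + 2)) / real (e + 3) / real (Suc e + 3)) Z"
    unfolding dZ [symmetric] by (rule lead_integral [OF _ i0(1)])
  have Z2: "fps_nth Z (e + 2) = z0" using lZ by (simp add: lead_def z0_def)
  show Z: "lead (e + 2) z0 z1 z2 Z"
    unfolding z2_def using lZ unfolding Z2 by (simp add: z0_def z1_def add.commute)
  show "lead (e + 1) (real (e + 2) * z0) (real (e + 3) * z1) (real (e + 4) * z2) ZP"
  proof -
    have "real (e + 2) * z0 = f0 / real (e + 1)" "real (e + 3) * z1 = f1 / real (e + 2)"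
      "real (e + 4) * z2 = (f2 - w\<^sup>2 * z0) / real (e + 3)"
      unfolding z2_def by (simp_all add: z0_def z1_def)
    then show ?thesis using lZP unfolding Z2 by (simp only: Suc_eq_plus1)
  qed
  have "lead (Suc (e + 2)) (1 * z0 / real (e + 2 + 1)) ((1 * z1 + 0 * z0) / real (e + 2 + 2))
      ((1 * z2 + 0 * z1 + - w\<^sup>2 / 2 * z0) / real (e + 2 + 3)) P"
    using lead_mult [OF lead_base(1) Z] by (intro lead_integral i0) (simp add: dP)
  then show "lead (e + 3) (z0 / real (e + 3)) (z1 / real (e + 4)) ((z2 - w\<^sup>2 / 2 * z0) / real (e + 5)) P"
    by (simp add: numeral_3_eq_3 add.commute)
  have "lead (Suc (1 + (e + 2))) (1 * z0 / real (1 + (e + 2) + 1)) ((1 * z1 + \<rho> / 2 * z0) / real (1 + (e + 2) + 2))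
      ((1 * z2 + \<rho> / 2 * z1 + (la - w\<^sup>2) / 6 * z0) / real (1 + (e + 2) + 3)) Q"
    using lead_mult [OF lead_base(2) Z] by (intro lead_integral i0) (simp add: dQ)
  then show "lead (e + 4) (z0 / real (e + 4)) ((z1 + \<rho> / 2 * z0) / real (e + 5))
      ((z2 + \<rho> / 2 * z1 + (la - w\<^sup>2) / 6 * z0) / real (e + 6)) Q"
    by (simp add: eval_nat_numeral add.commute)
qed

text \<open>The four cases are the unit vectors among two initial values and the multipliers of C
  and S. Two integrations let them start in orders 0, 1, 2, 3.\<close>

lemma lead_source:
  assumes d: "fps_deriv F = G" "fps_deriv G = (fps_const la * C - fps_const (\<rho> * w\<^sup>2) * S) * F
      + fps_const c3 * C + fps_const c4 * S"
    and i: "fps_nth F 0 = c1" "fps_nth G 0 = c2"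
  shows "c1 = 1 \<Longrightarrow> c2 = 0 \<Longrightarrow> c3 = 0 \<Longrightarrow> c4 = 0 \<Longrightarrow> lead 0 1 0 (la / 2) F"
    and "c1 = 0 \<Longrightarrow> c2 = 1 \<Longrightarrow> c3 = 0 \<Longrightarrow> c4 = 0 \<Longrightarrow> lead 1 1 0 (la / 6) F"
    and "c1 = 0 \<Longrightarrow> c2 = 0 \<Longrightarrow> c3 = 1 \<Longrightarrow> c4 = 0 \<Longrightarrow> lead 2 (1 / 2) 0 ((la - w\<^sup>2) / 24) F"
    and "c1 = 0 \<Longrightarrow> c2 = 0 \<Longrightarrow> c3 = 0 \<Longrightarrow> c4 = 1 \<Longrightarrow> lead 3 (1 / 6) (\<rho> / 24) ((2 * la - w\<^sup>2) / 120) F"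
proof -
  define L where "L = fps_const la * C - fps_const (\<rho> * w\<^sup>2) * S"
  have eF: "real (n + 1) * fps_nth F (n + 1) = fps_nth G n" for n
    using arg_cong [OF d(1), of "\<lambda>F. fps_nth F n"] by simp
  have eG: "real (n + 1) * fps_nth G (n + 1) = fps_nth (L * F) n + c3 * fps_nth C n + c4 * fps_nth S n" for n
    using arg_cong [OF d(2), of "\<lambda>F. fps_nth F n"] by (simp add: L_def)
  note b = lead_base [unfolded lead_def, simplified, unfolded numeral_2_eq_2]
  have L: "fps_nth L 0 = la" using b by (simp add: L_def)
  have F0: "fps_nth F 0 = c1" "fps_nth F (Suc 0) = c2" using i eF [of 0] by simp_all
  have G1: "fps_nth G (Suc 0) = la * c1 + c3" using eG [of 0] b L F0 by simp
  have F2: "fps_nth F (Suc (Suc 0)) = (la * c1 + c3) / 2" using eF [of 1] G1 by simp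
  have LF1: "fps_nth (L * F) (Suc 0) = la * c2 + fps_nth L (Suc 0) * c1"
    by (simp add: fps_mult_nth L F0)
  have G2: "2 * fps_nth G (Suc (Suc 0)) = la * c2 + fps_nth L (Suc 0) * c1 + c4"
    using eG [of 1] b LF1 by simp
  have F3: "6 * fps_nth F (Suc (Suc (Suc 0))) = la * c2 + fps_nth L (Suc 0) * c1 + c4"
    using eF [of 2] G2 by (simp add: numeral_2_eq_2)
  have LF2: "fps_nth (L * F) (Suc (Suc 0)) = la * ((la * c1 + c3) / 2) + fps_nth L (Suc 0) * c2 + fps_nth L (Suc (Suc 0)) * c1"
    by (simp add: fps_mult_nth L F0 F2 sum.atLeast0_atMost_Suc numeral_2_eq_2)
  have F4: "12 * fps_nth F (Suc (Suc (Suc (Suc 0)))) = la * ((la * c1 + c3) / 2) + fps_nth L (Suc 0) * c2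
      + fps_nth L (Suc (Suc 0)) * c1 - c3 * w\<^sup>2 / 2 + c4 * \<rho> / 2"
  proof -
    have "4 * fps_nth F (Suc (Suc (Suc (Suc 0)))) = fps_nth G (Suc (Suc (Suc 0)))"
      using eF [of 3] by (simp add: eval_nat_numeral)
    moreover have "3 * fps_nth G (Suc (Suc (Suc 0))) = fps_nth (L * F) (Suc (Suc 0)) + c3 * (- w\<^sup>2 / 2) + c4 * (\<rho> / 2)"
      using eG [of 2] lead_base by (simp add: lead_def numeral_2_eq_2)
    ultimately show ?thesis unfolding LF2 by simp
  qed
  show "c1 = 1 \<Longrightarrow> c2 = 0 \<Longrightarrow> c3 = 0 \<Longrightarrow> c4 = 0 \<Longrightarrow> lead 0 1 0 (la / 2) F"
    using F0 F2 by (simp add: lead_def eval_nat_numeral)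
  show "c1 = 0 \<Longrightarrow> c2 = 1 \<Longrightarrow> c3 = 0 \<Longrightarrow> c4 = 0 \<Longrightarrow> lead 1 1 0 (la / 6) F"
    using F0 F2 F3 by (simp add: lead_def eval_nat_numeral)
  show "c1 = 0 \<Longrightarrow> c2 = 0 \<Longrightarrow> c3 = 1 \<Longrightarrow> c4 = 0 \<Longrightarrow> lead 2 (1 / 2) 0 ((la - w\<^sup>2) / 24) F"
    using F0 F2 F3 F4 by (simp add: lead_def eval_nat_numeral less_Suc_eq field_simps)
  show "lead 3 (1 / 6) (\<rho> / 24) ((2 * la - w\<^sup>2) / 120) F" if c: "c1 = 0" "c2 = 0" "c3 = 0" "c4 = 1"
  proof -
    have F3': "fps_nth F (Suc (Suc (Suc 0))) = 1 / 6" using F3 c by simp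
    have "fps_nth (L * F) (Suc (Suc (Suc 0))) = la / 6"
      using c by (simp add: fps_mult_nth L F0 F2 F3' sum.atLeast0_atMost_Suc)
    then have "20 * fps_nth F (Suc (Suc (Suc (Suc (Suc 0))))) = la / 6 + (la - w\<^sup>2) / 6"
    proof -
      assume LF: "fps_nth (L * F) (Suc (Suc (Suc 0))) = la / 6"
      have "5 * fps_nth F (Suc (Suc (Suc (Suc (Suc 0))))) = fps_nth G (Suc (Suc (Suc (Suc 0))))"
        using eF [of 4] by (simp add: eval_nat_numeral)
      moreover have "4 * fps_nth G (Suc (Suc (Suc (Suc 0)))) = la / 6 + (la - w\<^sup>2) / 6"
        using eG [of 3] lead_base(2) LF c by (simp add: lead_def eval_nat_numeral)
      ultimately show ?thesis by simp
    qed
    then show ?thesis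
      using F0 F2 F3' F4 c by (simp add: lead_def eval_nat_numeral less_Suc_eq field_simps)
  qed
qed

end

section \<open>Determinants and Cramer's rule over power series\<close>

definition det3 :: "(nat \<Rightarrow> 'a::comm_ring_1) \<Rightarrow> (nat \<Rightarrow> 'a) \<Rightarrow> (nat \<Rightarrow> 'a) \<Rightarrow> nat \<Rightarrow> nat \<Rightarrow> nat \<Rightarrow> 'a" where
  "det3 z p q i j k = z i * (p j * q k - p k * q j) - z j * (p i * q k - p k * q i) + z k * (p i * q j - p j * q i)"

definition det4 :: "(nat \<Rightarrow> 'a::comm_ring_1) \<Rightarrow> (nat \<Rightarrow> 'a) \<Rightarrow> (nat \<Rightarrow> 'a) \<Rightarrow> (nat \<Rightarrow> 'a) \<Rightarrow> 'a" where
  "det4 y z p q = y 1 * det3 z p q 2 3 4 - y 2 * det3 z p q 1 3 4 + y 3 * det3 z p q 1 2 4 - y 4 * det3 z p q 1 2 3"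

text \<open>Laplace expansion along the first row: its cofactors pair with the row y to the
  determinant, with any other row to a determinant with two equal rows. Up to the factor
  \<open>det4\<close> they solve the system with right side (1, 0, 0, 0).\<close>

lemma det4_expand:
  "y 1 * det3 z p q 2 3 4 - y 2 * det3 z p q 1 3 4 + y 3 * det3 z p q 1 2 4 - y 4 * det3 z p q 1 2 3 = det4 y z p q"
  "z 1 * det3 z p q 2 3 4 - z 2 * det3 z p q 1 3 4 + z 3 * det3 z p q 1 2 4 - z 4 * det3 z p q 1 2 3 = 0"
  "p 1 * det3 z p q 2 3 4 - p 2 * det3 z p q 1 3 4 + p 3 * det3 z p q 1 2 4 - p 4 * det3 z p q 1 2 3 = 0"
  "q 1 * det3 z p q 2 3 4 - q 2 * det3 z p q 1 3 4 + q 3 * det3 z p q 1 2 4 - q 4 * det3 z p q 1 2 3 = 0"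
  by (simp_all add: det4_def det3_def algebra_simps)

lemma det4_injective:
  fixes y z p q :: "nat \<Rightarrow> 'a::idom"
  assumes 0: "y 1 * a1 + y 2 * a2 + y 3 * a3 + y 4 * a4 = 0" "z 1 * a1 + z 2 * a2 + z 3 * a3 + z 4 * a4 = 0"
    "p 1 * a1 + p 2 * a2 + p 3 * a3 + p 4 * a4 = 0" "q 1 * a1 + q 2 * a2 + q 3 * a3 + q 4 * a4 = 0"
    and D: "det4 y z p q \<noteq> 0"
  shows "a1 = 0 \<and> a2 = 0 \<and> a3 = 0 \<and> a4 = 0"
proof -
  have "det4 y z p q * a1 = 0" "det4 y z p q * a2 = 0" "det4 y z p q * a3 = 0" "det4 y z p q * a4 = 0"
    using 0 unfolding det4_def det3_def by algebra+
  then show ?thesis using D by simp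
qed

context jacobi_series
begin

definition columns :: "(nat \<Rightarrow> real fps) \<Rightarrow> (nat \<Rightarrow> real fps) \<Rightarrow> (nat \<Rightarrow> real fps) \<Rightarrow> (nat \<Rightarrow> real fps) \<Rightarrow> bool" where
  "columns ZP Z P Q \<longleftrightarrow> (\<exists>F G. \<forall>j\<in>{1..4}. column (F j) (Z j) (ZP j) (P j) (Q j) \<and> fps_deriv (F j) = G j \<and>
     fps_deriv (G j) = (fps_const la * C - fps_const (\<rho> * w\<^sup>2) * S) * F j
       + fps_const (of_bool (j = 3)) * C + fps_const (of_bool (j = 4)) * S \<and>
     fps_nth (F j) 0 = of_bool (j = 1) \<and> fps_nth (G j) 0 = of_bool (j = 2))"

text \<open>With the rows numbered ZP, Z, P, Q, entry (i, j) starts in order i + j - 1. So the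
  powers of t split into row and column factors.\<close>

lemma lead_columns:
  assumes "columns ZP Z P Q"
  shows "lead 1 1 0 ((la - w\<^sup>2) / 6) (ZP 1)" "lead 2 (1/2) 0 ((la - w\<^sup>2) / 24) (ZP 2)"
    "lead 3 (1/6) 0 ((la - 2 * w\<^sup>2) / 120) (ZP 3)" "lead 4 (1/24) (\<rho> / 120) ((la - w\<^sup>2) / 360) (ZP 4)"
    "lead 2 (1/2) 0 ((la - w\<^sup>2) / 24) (Z 1)" "lead 3 (1/6) 0 ((la - w\<^sup>2) / 120) (Z 2)"
    "lead 4 (1/24) 0 ((la - 2 * w\<^sup>2) / 720) (Z 3)" "lead 5 (1/120) (\<rho> / 720) ((la - w\<^sup>2) / 2520) (Z 4)"
    "lead 3 (1/6) 0 ((la - 7 * w\<^sup>2) / 120) (P 1)" "lead 4 (1/24) 0 ((la - 11 * w\<^sup>2) / 720) (P 2)"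
    "lead 5 (1/120) 0 ((la - 17 * w\<^sup>2) / 5040) (P 3)" "lead 6 (1/720) (\<rho> / 5040) ((2 * la - 23 * w\<^sup>2) / 40320) (P 4)"
    "lead 4 (1/8) (\<rho> / 20) ((la - w\<^sup>2) / 48) (Q 1)" "lead 5 (1/30) (\<rho> / 72) (13 * (la - w\<^sup>2) / 2520) (Q 2)"
    "lead 6 (1/144) (\<rho> / 336) ((6 * la - 7 * w\<^sup>2) / 5760) (Q 3)" "lead 7 (1/840) (\<rho> / 1440) (\<rho>\<^sup>2 / 12960 + (la - w\<^sup>2) / 5040) (Q 4)"
proof -
  obtain F G where *: "\<And>j. j \<in> {1..4} \<Longrightarrow> column (F j) (Z j) (ZP j) (P j) (Q j) \<and> fps_deriv (F j) = G j \<and>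
     fps_deriv (G j) = (fps_const la * C - fps_const (\<rho> * w\<^sup>2) * S) * F j
       + fps_const (of_bool (j = 3)) * C + fps_const (of_bool (j = 4)) * S \<and>
     fps_nth (F j) 0 = of_bool (j = 1) \<and> fps_nth (G j) 0 = of_bool (j = 2)"
    using assms unfolding columns_def by blast
  have s: "lead 0 1 0 (la / 2) (F 1)" "lead 1 1 0 (la / 6) (F 2)" "lead 2 (1 / 2) 0 ((la - w\<^sup>2) / 24) (F 3)"
    "lead 3 (1 / 6) (\<rho> / 24) ((2 * la - w\<^sup>2) / 120) (F 4)"
    by (rule lead_source [of _ "G 1" 0 0 1 0] lead_source [of _ "G 2" 0 0 0 1]
        lead_source [of _ "G 3" 1 0 0 0] lead_source [of _ "G 4" 0 1 0 0]; use * [of 1] * [of 2] * [of 3] * [of 4] in simp)+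
  have c: "column (F 1) (Z 1) (ZP 1) (P 1) (Q 1)" "column (F 2) (Z 2) (ZP 2) (P 2) (Q 2)"
    "column (F 3) (Z 3) (ZP 3) (P 3) (Q 3)" "column (F 4) (Z 4) (ZP 4) (P 4) (Q 4)"
    using * by simp_all
  note L = lead_column [OF c(1) s(1)] lead_column [OF c(2) s(2)] lead_column [OF c(3) s(3)] lead_column [OF c(4) s(4)]
  show "lead 1 1 0 ((la - w\<^sup>2) / 6) (ZP 1)"
    by (rule lead_eqI [OF L(2)]; simp add: field_simps power2_eq_square)
  show "lead 2 (1/2) 0 ((la - w\<^sup>2) / 24) (ZP 2)"
    by (rule lead_eqI [OF L(6)]; simp add: field_simps power2_eq_square)
  show "lead 3 (1/6) 0 ((la - 2 * w\<^sup>2) / 120) (ZP 3)"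
    by (rule lead_eqI [OF L(10)]; simp add: field_simps power2_eq_square)
  show "lead 4 (1/24) (\<rho> / 120) ((la - w\<^sup>2) / 360) (ZP 4)"
    by (rule lead_eqI [OF L(14)]; simp add: field_simps power2_eq_square)
  show "lead 2 (1/2) 0 ((la - w\<^sup>2) / 24) (Z 1)"
    by (rule lead_eqI [OF L(1)]; simp add: field_simps power2_eq_square)
  show "lead 3 (1/6) 0 ((la - w\<^sup>2) / 120) (Z 2)"
    by (rule lead_eqI [OF L(5)]; simp add: field_simps power2_eq_square)
  show "lead 4 (1/24) 0 ((la - 2 * w\<^sup>2) / 720) (Z 3)"
    by (rule lead_eqI [OF L(9)]; simp add: field_simps power2_eq_square)
  show "lead 5 (1/120) (\<rho> / 720) ((la - w\<^sup>2) / 2520) (Z 4)"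
    by (rule lead_eqI [OF L(13)]; simp add: field_simps power2_eq_square)
  show "lead 3 (1/6) 0 ((la - 7 * w\<^sup>2) / 120) (P 1)"
    by (rule lead_eqI [OF L(3)]; simp add: field_simps power2_eq_square)
  show "lead 4 (1/24) 0 ((la - 11 * w\<^sup>2) / 720) (P 2)"
    by (rule lead_eqI [OF L(7)]; simp add: field_simps power2_eq_square)
  show "lead 5 (1/120) 0 ((la - 17 * w\<^sup>2) / 5040) (P 3)"
    by (rule lead_eqI [OF L(11)]; simp add: field_simps power2_eq_square)
  show "lead 6 (1/720) (\<rho> / 5040) ((2 * la - 23 * w\<^sup>2) / 40320) (P 4)"
    by (rule lead_eqI [OF L(15)]; simp add: field_simps power2_eq_square)
  show "lead 4 (1/8) (\<rho> / 20) ((la - w\<^sup>2) / 48) (Q 1)"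
    by (rule lead_eqI [OF L(4)]; simp add: field_simps power2_eq_square)
  show "lead 5 (1/30) (\<rho> / 72) (13 * (la - w\<^sup>2) / 2520) (Q 2)"
    by (rule lead_eqI [OF L(8)]; simp add: field_simps power2_eq_square)
  show "lead 6 (1/144) (\<rho> / 336) ((6 * la - 7 * w\<^sup>2) / 5760) (Q 3)"
    by (rule lead_eqI [OF L(12)]; simp add: field_simps power2_eq_square)
  show "lead 7 (1/840) (\<rho> / 1440) (\<rho>\<^sup>2 / 12960 + (la - w\<^sup>2) / 5040) (Q 4)"
    by (rule lead_eqI [OF L(16)]; simp add: field_simps power2_eq_square)
qed


text \<open>Three coefficients are carried from the 2 by 2 minors of the rows p, q up to the full
  determinant. Cofactor and determinant have both their constant and their linear coefficients in
  the ratio -4, so the quotient has no linear term.\<close>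

lemma lead_determinants:
  assumes "columns ZP Z P Q"
  defines "y \<equiv> \<lambda>j. fps_shift j (ZP j)" and "z \<equiv> \<lambda>j. fps_shift (j + 1) (Z j)"
    and "p \<equiv> \<lambda>j. fps_shift (j + 2) (P j)" and "q \<equiv> \<lambda>j. fps_shift (j + 3) (Q j)"
  shows "lead 0 (1 / 217728000) (\<rho> / 217728000) (\<rho>\<^sup>2 / 914457600 + la / 677376000 - w\<^sup>2 / 2438553600) (det3 z p q 2 3 4)"
    and "lead 0 (- 1 / 870912000) (- \<rho> / 870912000) (- \<rho>\<^sup>2 / 3429216000 - 13 * la / 36578304000 + w\<^sup>2 / 9144576000) (det4 y z p q)"
proof -
  note l = lead_columns [OF assms(1), THEN lead_shift]
  have y: "lead 0 (1 / 1) (0) (la / 6 - w\<^sup>2 / 6) (y 1)" "lead 0 (1 / 2) (0) (la / 24 - w\<^sup>2 / 24) (y 2)" "lead 0 (1 / 6) (0) (la / 120 - w\<^sup>2 / 60) (y 3)" "lead 0 (1 / 24) (\<rho> / 120) (la / 360 - w\<^sup>2 / 360) (y 4)"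
    unfolding y_def using l(1-4) by (simp_all add: add_divide_distrib diff_divide_distrib right_diff_distrib distrib_left add_diff_eq eval_nat_numeral)
  have z: "lead 0 (1 / 2) (0) (la / 24 - w\<^sup>2 / 24) (z 1)" "lead 0 (1 / 6) (0) (la / 120 - w\<^sup>2 / 120) (z 2)" "lead 0 (1 / 24) (0) (la / 720 - w\<^sup>2 / 360) (z 3)" "lead 0 (1 / 120) (\<rho> / 720) (la / 2520 - w\<^sup>2 / 2520) (z 4)"
    unfolding z_def using l(5-8) by (simp_all add: add_divide_distrib diff_divide_distrib right_diff_distrib distrib_left add_diff_eq eval_nat_numeral)
  have p: "lead 0 (1 / 6) (0) (la / 120 - 7 * w\<^sup>2 / 120) (p 1)" "lead 0 (1 / 24) (0) (la / 720 - 11 * w\<^sup>2 / 720) (p 2)" "lead 0 (1 / 120) (0) (la / 5040 - 17 * w\<^sup>2 / 5040) (p 3)" "lead 0 (1 / 720) (\<rho> / 5040) (la / 20160 - 23 * w\<^sup>2 / 40320) (p 4)"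
    unfolding p_def using l(9-12) by (simp_all add: add_divide_distrib diff_divide_distrib right_diff_distrib distrib_left add_diff_eq eval_nat_numeral)
  have q: "lead 0 (1 / 8) (\<rho> / 20) (la / 48 - w\<^sup>2 / 48) (q 1)" "lead 0 (1 / 30) (\<rho> / 72) (13 * la / 2520 - 13 * w\<^sup>2 / 2520) (q 2)" "lead 0 (1 / 144) (\<rho> / 336) (la / 960 - 7 * w\<^sup>2 / 5760) (q 3)" "lead 0 (1 / 840) (\<rho> / 1440) (\<rho>\<^sup>2 / 12960 + la / 5040 - w\<^sup>2 / 5040) (q 4)"
    unfolding q_def using l(13-16) by (simp_all add: add_divide_distrib diff_divide_distrib right_diff_distrib distrib_left add_diff_eq eval_nat_numeral)
  note mult = lead_mult [of 0 _ _ _ _ 0, simplified]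
  have m12: "lead 0 (1 / 2880) (\<rho> / 4320) (29 * la / 302400 - w\<^sup>2 / 37800) (p 1 * q 2 - p 2 * q 1)"
    by (rule lead_eqI [OF lead_diff [OF mult [OF p(1) q(2)] mult [OF p(2) q(1)]]]; simp add: field_simps power2_eq_square)
  have m13: "lead 0 (1 / 8640) (\<rho> / 12600) (la / 30240 - w\<^sup>2 / 80640) (p 1 * q 3 - p 3 * q 1)"
    by (rule lead_eqI [OF lead_diff [OF mult [OF p(1) q(3)] mult [OF p(3) q(1)]]]; simp add: field_simps power2_eq_square)
  have m14: "lead 0 (1 / 40320) (13 * \<rho> / 604800) (\<rho>\<^sup>2 / 340200 + 19 * la / 2419200 - 11 * w\<^sup>2 / 4838400) (p 1 * q 4 - p 4 * q 1)"
    by (rule lead_eqI [OF lead_diff [OF mult [OF p(1) q(4)] mult [OF p(4) q(1)]]]; simp add: field_simps power2_eq_square)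
  have m23: "lead 0 (1 / 86400) (\<rho> / 120960) (la / 290304 - 19 * w\<^sup>2 / 14515200) (p 2 * q 3 - p 3 * q 2)"
    by (rule lead_eqI [OF lead_diff [OF mult [OF p(2) q(3)] mult [OF p(3) q(2)]]]; simp add: field_simps power2_eq_square)
  have m24: "lead 0 (1 / 302400) (11 * \<rho> / 3628800) (\<rho>\<^sup>2 / 2177280 + la / 907200 - w\<^sup>2 / 3628800) (p 2 * q 4 - p 4 * q 2)"
    by (rule lead_eqI [OF lead_diff [OF mult [OF p(2) q(4)] mult [OF p(4) q(2)]]]; simp add: field_simps power2_eq_square)
  have m34: "lead 0 (1 / 3628800) (\<rho> / 3628800) (\<rho>\<^sup>2 / 19051200 + la / 10160640 - w\<^sup>2 / 50803200) (p 3 * q 4 - p 4 * q 3)"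
    by (rule lead_eqI [OF lead_diff [OF mult [OF p(3) q(4)] mult [OF p(4) q(3)]]]; simp add: field_simps power2_eq_square)
  have M1: "lead 0 (1 / 217728000) (\<rho> / 217728000) (\<rho>\<^sup>2 / 914457600 + la / 677376000 - w\<^sup>2 / 2438553600) (det3 z p q 2 3 4)"
    unfolding det3_def
    by (rule lead_eqI [OF lead_add [OF lead_diff [OF mult [OF z(2) m34] mult [OF z(3) m24]] mult [OF z(4) m23]]]; simp add: field_simps power2_eq_square)
  have M2: "lead 0 (1 / 14515200) (\<rho> / 15552000) (\<rho>\<^sup>2 / 71442000 + la / 48771072 - 17 * w\<^sup>2 / 2438553600) (det3 z p q 1 3 4)"
    unfolding det3_def
    by (rule lead_eqI [OF lead_add [OF lead_diff [OF mult [OF z(1) m34] mult [OF z(3) m14]] mult [OF z(4) m13]]]; simp add: field_simps power2_eq_square)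
  have M3: "lead 0 (1 / 2419200) (\<rho> / 2903040) (\<rho>\<^sup>2 / 16329600 + la / 9072000 - w\<^sup>2 / 20736000) (det3 z p q 1 2 4)"
    unfolding det3_def
    by (rule lead_eqI [OF lead_add [OF lead_diff [OF mult [OF z(1) m24] mult [OF z(2) m14]] mult [OF z(4) m12]]]; simp add: field_simps power2_eq_square)
  have M4: "lead 0 (1 / 1036800) (\<rho> / 1814400) (la / 4838400 - w\<^sup>2 / 5806080) (det3 z p q 1 2 3)"
    unfolding det3_def
    by (rule lead_eqI [OF lead_add [OF lead_diff [OF mult [OF z(1) m23] mult [OF z(2) m13]] mult [OF z(3) m12]]]; simp add: field_simps power2_eq_square)
  have D: "lead 0 (- 1 / 870912000) (- \<rho> / 870912000) (- \<rho>\<^sup>2 / 3429216000 - 13 * la / 36578304000 + w\<^sup>2 / 9144576000) (det4 y z p q)"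
    unfolding det4_def
    by (rule lead_eqI [OF lead_diff [OF lead_add [OF lead_diff [OF mult [OF y(1) M1] mult [OF y(2) M2]] mult [OF y(3) M3]] mult [OF y(4) M4]]]; simp add: field_simps power2_eq_square)
  show "lead 0 (1 / 217728000) (\<rho> / 217728000) (\<rho>\<^sup>2 / 914457600 + la / 677376000 - w\<^sup>2 / 2438553600) (det3 z p q 2 3 4)" by (rule M1)
  show "lead 0 (- 1 / 870912000) (- \<rho> / 870912000) (- \<rho>\<^sup>2 / 3429216000 - 13 * la / 36578304000 + w\<^sup>2 / 9144576000) (det4 y z p q)" by (rule D)
qed

text \<open>The coefficients follow one after the other from quotient times determinant equals
  cofactor. The quadratic one combines to - (6 E - 8 \<rho>^2) / 126, which is where
  \<open>R11\<close> comes from.\<close>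

lemma lead_cramer_quotient:
  assumes "columns ZP Z P Q"
  defines "y \<equiv> \<lambda>j. fps_shift j (ZP j)" and "z \<equiv> \<lambda>j. fps_shift (j + 1) (Z j)"
    and "p \<equiv> \<lambda>j. fps_shift (j + 2) (P j)" and "q \<equiv> \<lambda>j. fps_shift (j + 3) (Q j)"
  shows "fps_nth (det4 y z p q) 0 \<noteq> 0"
    and "lead 0 (- 4) 0 (- (6 * (w\<^sup>2 / 2 + la) - 8 * \<rho>\<^sup>2) / 126) (det3 z p q 2 3 4 / det4 y z p q)"
proof -
  note l = lead_determinants [OF assms(1), folded assms(2-5)]
  define m where "m = det3 z p q 2 3 4 / det4 y z p q"
  show D: "fps_nth (det4 y z p q) 0 \<noteq> 0" using l(2) by (simp add: lead_def)
  then have "m * det4 y z p q = det3 z p q 2 3 4"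
    by (simp add: m_def fps_divide_times_eq)
  then have "fps_nth (m * det4 y z p q) n = fps_nth (det3 z p q 2 3 4) n" for n by simp
  from this [of 0] this [of 1] this [of 2]
  have *: "fps_nth m 0 * (- 1 / 870912000) = 1 / 217728000"
    "fps_nth m 0 * (- \<rho> / 870912000) + fps_nth m (Suc 0) * (- 1 / 870912000) = \<rho> / 217728000"
    "fps_nth m 0 * (- \<rho>\<^sup>2 / 3429216000 - 13 * la / 36578304000 + w\<^sup>2 / 9144576000)
      + fps_nth m (Suc 0) * (- \<rho> / 870912000) + fps_nth m (Suc (Suc 0)) * (- 1 / 870912000)
      = \<rho>\<^sup>2 / 914457600 + la / 677376000 - w\<^sup>2 / 2438553600"
    using l by (simp_all add: lead_def fps_mult_nth sum.atLeast0_atMost_Suc numeral_2_eq_2)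
  have 0: "fps_nth m 0 = - 4" using *(1) by simp
  have 1: "fps_nth m (Suc 0) = 0" using *(2) unfolding 0 by simp
  have 2: "fps_nth m (Suc (Suc 0)) = - (6 * (w\<^sup>2 / 2 + la) - 8 * \<rho>\<^sup>2) / 126"
    using *(3) unfolding 0 1 by (simp add: field_simps)
  show "lead 0 (- 4) 0 (- (6 * (w\<^sup>2 / 2 + la) - 8 * \<rho>\<^sup>2) / 126) (det3 z p q 2 3 4 / det4 y z p q)"
    using 0 1 2 by (simp add: lead_def m_def numeral_2_eq_2)
qed

end

section \<open>Cramer's rule for Jacobi fields\<close>

text \<open>Otherwise division of the zero function by the leading power of the difference would
  give a continuous function that is 0 away from 0 and nonzero at 0.\<close>

lemma fps_expansion_unique_real:
  fixes f :: "real \<Rightarrow> real"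
  assumes F: "f has_fps_expansion F" and G: "f has_fps_expansion G"
  shows "F = G"
proof (rule ccontr)
  assume ne: "F \<noteq> G"
  define H where "H = F - G"
  define c where "c = fps_nth H (subdegree H)"
  let ?g = "\<lambda>x::real. if x = 0 then c else 0 / x ^ subdegree H"
  have "(\<lambda>x. 0) has_fps_expansion H"
    using has_fps_expansion_diff [OF F G] by (simp add: H_def)
  then have "?g has_fps_expansion fps_shift (subdegree H) H"
    by (rule has_fps_expansion_shift) (simp_all add: c_def)
  then have "isCont ?g 0" by (rule has_fps_expansion_imp_continuous)
  then have "?g \<midarrow>0\<rightarrow> c" by (simp add: isCont_def)
  moreover have "?g \<midarrow>0\<rightarrow> 0"
    by (rule tendsto_eventually) (auto simp: eventually_at_filter)
  ultimately have "c = 0" by (rule LIM_unique)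
  then have "H = 0" unfolding c_def by (simp only: nth_subdegree_zero_iff)
  then show False using ne by (simp add: H_def)
qed

lemma has_fps_expansion_cong_near:
  assumes "f has_fps_expansion F" "\<forall>\<^sub>F x in nhds 0. f x = g x"
  shows "g has_fps_expansion F"
proof -
  have "\<forall>\<^sub>F x in nhds 0. eval_fps F x = f x" using assms(1) by (simp add: has_fps_expansion_def)
  with assms(2) have "\<forall>\<^sub>F x in nhds 0. eval_fps F x = g x" by eventually_elim simp
  then show ?thesis using assms(1) by (simp add: has_fps_expansion_def)
qed

lemma has_fps_expansion_at_0: "f has_fps_expansion F \<Longrightarrow> fps_nth F 0 = f 0"
  unfolding has_fps_expansion_def by (auto dest!: eventually_nhds_x_imp_x simp: eval_fps_at_0)

lemma fps_deriv_of_derivative: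
  fixes f g :: "real \<Rightarrow> real"
  assumes f: "f has_fps_expansion F" and g: "g has_fps_expansion G"
    and d: "\<And>s. \<bar>s\<bar> < \<epsilon> \<Longrightarrow> (f has_real_derivative g s) (at s)" and e: "0 < \<epsilon>"
  shows "fps_deriv F = G"
proof (rule fps_expansion_unique_real [OF has_fps_expansion_deriv [OF f]])
  have "\<forall>\<^sub>F x in nhds (0::real). \<bar>x\<bar> < \<epsilon>"
    using e by (auto simp: eventually_nhds_metric dist_real_def)
  then have "\<forall>\<^sub>F x in nhds 0. g x = deriv f x"
    by eventually_elim (rule DERIV_imp_deriv [OF d, symmetric])
  then show "deriv f has_fps_expansion G" by (rule has_fps_expansion_cong_near [OF g])
qed

definition fps_of :: "(real \<Rightarrow> real) \<Rightarrow> real fps" where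
  "fps_of f = (SOME F. f has_fps_expansion F)"

lemma fps_of: "f has_fps_expansion F \<Longrightarrow> f has_fps_expansion fps_of f"
  unfolding fps_of_def by (rule someI)

lemma plane_decomposition:
  fixes w N a1 a2 k1 k2 :: real
  assumes "w \<noteq> 0" "N \<noteq> 0" "N = k1\<^sup>2 + k2\<^sup>2"
  shows "a1 = k1 * ((k1 * a1 + k2 * a2) / N) - k2 * w * ((k1 * a2 - k2 * a1) / (N * w))"
    and "a2 = k2 * ((k1 * a1 + k2 * a2) / N) + k1 * w * ((k1 * a2 - k2 * a1) / (N * w))"
proof -
  have "N * a1 = k1 * (k1 * a1 + k2 * a2) - k2 * (k1 * a2 - k2 * a1)"
    "N * a2 = k2 * (k1 * a1 + k2 * a2) + k1 * (k1 * a2 - k2 * a1)"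
    unfolding assms(3) by (simp_all add: algebra_simps power2_eq_square)
  then show "a1 = k1 * ((k1 * a1 + k2 * a2) / N) - k2 * w * ((k1 * a2 - k2 * a1) / (N * w))"
    "a2 = k2 * ((k1 * a1 + k2 * a2) / N) + k1 * w * ((k1 * a2 - k2 * a1) / (N * w))"
    using assms(1,2) by (simp_all add: eq_divide_eq flip: diff_divide_distrib add_divide_distrib) (simp_all add: mult.commute)
qed

locale jacobi_flow =
  fixes k :: pt and R r :: real
  assumes kR: "norm k < R" and r: "0 < r" "r\<^sup>2 = (k$1)\<^sup>2 + (k$2)\<^sup>2" and k3: "k $ 3 \<noteq> 0"
begin

abbreviation "H \<equiv> Hf k"

text \<open>The initial velocity and its rotation by a right angle, scaled by \<open>h\<^sub>3\<close>, serve as a basis of the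
  plane, in which the coefficients below depend on the momentum only through \<open>h\<^sub>3\<close>, \<open>\<rho>\<close> and \<open>la\<close>.
  By the Gauss lemma the remaining Jacobi equations close up in \<open>z = - \<xi>\<^sub>3\<close>, \<open>z'\<close> and the components
  \<open>p\<close>, \<open>q\<close> of \<open>(\<xi>\<^sub>4, \<xi>\<^sub>5)\<close>.\<close>

definition "\<rho> = (k$1 * k$4 + k$2 * k$5) / k$3"
definition "la = k$1 * k$5 - k$2 * k$4"
definition "cf s = (k$1 * H s $ 1 + k$2 * H s $ 2) / r\<^sup>2"
definition "sf s = (k$1 * H s $ 2 - k$2 * H s $ 1) / (r\<^sup>2 * k$3)"
definition "phi l s = H s $ 1 * dHf k s l $ 2 - H s $ 2 * dHf k s l $ 1"
definition "psi l s = r\<^sup>2 * dHf k s l $ 3"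
definition "zp l s = H s $ 1 * xi k s l $ 2 - H s $ 2 * xi k s l $ 1"
definition "zf l s = - xi k s l $ 3"
definition "pf l s = (k$1 * xi k s l $ 4 + k$2 * xi k s l $ 5) / r\<^sup>2"
definition "qf l s = (k$1 * xi k s l $ 5 - k$2 * xi k s l $ 4) / (r\<^sup>2 * k$3)"

lemmas defs = cf_def sf_def phi_def psi_def zp_def zf_def pf_def qf_def

lemma R_pos: "0 < tmax R" "norm k \<le> R"
  using kR norm_ge_zero [of k] by (auto intro!: tmax_pos simp del: norm_ge_zero)

lemma r_nz: "r \<noteq> 0" "r\<^sup>2 \<noteq> 0" using r by auto

lemma frame_H: "H s $ 1 = k$1 * cf s - k$2 * k$3 * sf s" "H s $ 2 = k$2 * cf s + k$1 * k$3 * sf s"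
  using plane_decomposition [OF k3 r_nz(2) r(2)] unfolding cf_def sf_def by blast+

lemma frame_xi: "xi k s l $ 4 = k$1 * pf l s - k$2 * k$3 * qf l s" "xi k s l $ 5 = k$2 * pf l s + k$1 * k$3 * qf l s"
  using plane_decomposition [OF k3 r_nz(2) r(2)] unfolding pf_def qf_def by blast+

lemma speed: "\<bar>s\<bar> < tmax R \<Longrightarrow> (H s $ 1)\<^sup>2 + (H s $ 2)\<^sup>2 = r\<^sup>2"
proof -
  assume s: "\<bar>s\<bar> < tmax R"
  have "(H s $ 1)\<^sup>2 + (H s $ 2)\<^sup>2 = (H 0 $ 1)\<^sup>2 + (H 0 $ 2)\<^sup>2"
    by (rule has_real_derivative_zero_interval [OF _ s])
       (rule derivative_eq_intros Hf_deriv [OF R_pos(2)] refl | assumption | simp add: algebra_simps)+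
  then show ?thesis by (simp add: r)
qed

lemma base_derivatives:
  assumes s: "\<bar>s\<bar> < tmax R"
  shows "(cf has_real_derivative - k$3 * (sf s * H s $ 3)) (at s)"
    and "(sf has_real_derivative cf s * H s $ 3 / k$3) (at s)"
    and "((\<lambda>s. H s $ 3) has_real_derivative k$3 * (\<rho> * cf s + la * sf s)) (at s)"
proof -
  note d = Hf_deriv(1-3) [OF R_pos(2) s]
  show "(cf has_real_derivative - k$3 * (sf s * H s $ 3)) (at s)"
    unfolding cf_def [abs_def] sf_def
    by (rule derivative_eq_intros d refl r_nz)+ (use r_nz k3 in \<open>simp add: field_simps\<close>)
  show "(sf has_real_derivative cf s * H s $ 3 / k$3) (at s)"
    unfolding sf_def [abs_def] cf_def
    by (rule derivative_eq_intros d refl)+ (use r_nz k3 in \<open>simp_all add: field_simps\<close>)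
  have "H s $ 1 * k $ 4 + H s $ 2 * k $ 5 = k$3 * (\<rho> * cf s + la * sf s)"
    unfolding frame_H \<rho>_def la_def using k3 by (simp add: field_simps)
  then show "((\<lambda>s. H s $ 3) has_real_derivative k$3 * (\<rho> * cf s + la * sf s)) (at s)"
    using d(3) by simp
qed

text \<open>For l orthogonal to the initial velocity both the variation of the speed and the Gauss
  pairing vanish. The first makes the variation of (h1, h2) a multiple of the rotated momentum,
  measured by \<open>phi\<close>; the second expresses the tangential part of \<open>xi\<close>
  through \<open>zf\<close>, \<open>pf\<close> and \<open>qf\<close>, so that the system
  closes.\<close>

lemma column_derivatives:
  assumes s: "\<bar>s\<bar> < tmax R" and l: "k$1 * l$1 + k$2 * l$2 = 0"
  shows "(phi l has_real_derivative psi l s) (at s)"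
    and "(psi l has_real_derivative (la * cf s - \<rho> * (k$3)\<^sup>2 * sf s) * phi l s
      + r\<^sup>2 * (k$1 * l$4 + k$2 * l$5) * cf s + r\<^sup>2 * k$3 * (k$1 * l$5 - k$2 * l$4) * sf s) (at s)"
    and "(zf l has_real_derivative zp l s) (at s)"
    and "(zp l has_real_derivative
      phi l s - H s $ 3 * (H s $ 3 * zf l s - k$3 * \<rho> * pf l s - k$3 * la * qf l s)) (at s)"
    and "(pf l has_real_derivative cf s * zf l s) (at s)"
    and "(qf l has_real_derivative sf s * zf l s) (at s)"
proof -
  note d = Hf_deriv(1-3) [OF R_pos(2) s] dHf_deriv(1-3) [OF R_pos(2) s] xi_deriv [OF R_pos(2) s]
  have Hd: "H s $ 1 * dHf k s l $ 1 + H s $ 2 * dHf k s l $ 2 = 0"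
    using speed_variation [OF R_pos(2) s, of l] l by simp
  have sp: "r\<^sup>2 = H s $ 1 * H s $ 1 + H s $ 2 * H s $ 2" using speed [OF s] by (simp add: power2_eq_square)
  show "(phi l has_real_derivative psi l s) (at s)"
    unfolding phi_def [abs_def] psi_def
    by (rule derivative_eq_intros d refl)+ (simp add: sp algebra_simps)
  have e1: "r\<^sup>2 * dHf k s l $ 1 = - (phi l s * H s $ 2)" "r\<^sup>2 * dHf k s l $ 2 = phi l s * H s $ 1"
    using Hd unfolding sp phi_def by algebra+
  have e2: "H s $ 1 * k$5 - H s $ 2 * k$4 = la * cf s - \<rho> * (k$3)\<^sup>2 * sf s"
    unfolding frame_H \<rho>_def la_def using k3 by (simp add: field_simps power2_eq_square)
  have "r\<^sup>2 * (H s $ 1 * l $ 4 + dHf k s l $ 1 * k $ 4 + H s $ 2 * l $ 5 + dHf k s l $ 2 * k $ 5)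
      = (H s $ 1 * k$5 - H s $ 2 * k$4) * phi l s + r\<^sup>2 * (H s $ 1 * l $ 4 + H s $ 2 * l $ 5)"
    using e1 by algebra
  also have "H s $ 1 * l $ 4 + H s $ 2 * l $ 5 = (k$1 * l$4 + k$2 * l$5) * cf s + k$3 * (k$1 * l$5 - k$2 * l$4) * sf s"
    unfolding frame_H by (simp add: algebra_simps)
  finally have e3: "r\<^sup>2 * (H s $ 1 * l $ 4 + dHf k s l $ 1 * k $ 4 + H s $ 2 * l $ 5 + dHf k s l $ 2 * k $ 5)
    = (la * cf s - \<rho> * (k$3)\<^sup>2 * sf s) * phi l s
      + r\<^sup>2 * (k$1 * l$4 + k$2 * l$5) * cf s + r\<^sup>2 * k$3 * (k$1 * l$5 - k$2 * l$4) * sf s"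
    unfolding e2 by (simp add: algebra_simps)
  show "(psi l has_real_derivative (la * cf s - \<rho> * (k$3)\<^sup>2 * sf s) * phi l s
      + r\<^sup>2 * (k$1 * l$4 + k$2 * l$5) * cf s + r\<^sup>2 * k$3 * (k$1 * l$5 - k$2 * l$4) * sf s) (at s)"
    unfolding psi_def [abs_def] e3 [symmetric] by (rule DERIV_cmult d)+
  show "(zf l has_real_derivative zp l s) (at s)"
    unfolding zf_def [abs_def] zp_def by (rule derivative_eq_intros d refl)+ simp
  have g: "H s \<bullet> xi k s l = 0" using gauss_lemma [OF R_pos(2) s, of l] l by simp
  have kx: "k$4 * xi k s l $ 4 + k$5 * xi k s l $ 5 = k$3 * \<rho> * pf l s + k$3 * la * qf l s"
    unfolding frame_xi \<rho>_def la_def using k3 by (simp add: field_simps)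
  have g': "H s $ 1 * xi k s l $ 1 + H s $ 2 * xi k s l $ 2
      = H s $ 3 * zf l s - k$3 * \<rho> * pf l s - k$3 * la * qf l s"
    using g kx Hf_deriv(4,5) [OF R_pos(2) s] by (simp add: inner5 zf_def)
  show "(zp l has_real_derivative
      phi l s - H s $ 3 * (H s $ 3 * zf l s - k$3 * \<rho> * pf l s - k$3 * la * qf l s)) (at s)"
    unfolding zp_def [abs_def] phi_def g' [symmetric]
    by (rule derivative_eq_intros d refl)+ (simp add: algebra_simps)
  show "(pf l has_real_derivative cf s * zf l s) (at s)"
    unfolding pf_def [abs_def] cf_def zf_def
    by (rule derivative_eq_intros d refl r_nz)+ (use r_nz in \<open>simp add: field_simps\<close>)
  show "(qf l has_real_derivative sf s * zf l s) (at s)"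
    unfolding qf_def [abs_def] sf_def zf_def
    by (rule derivative_eq_intros d refl)+ (use r_nz k3 in \<open>simp_all add: field_simps\<close>)
qed

end

context jacobi_flow
begin

lemma xi_fps: "\<exists>F. (\<lambda>s. xi k s l $ i) has_fps_expansion F"
proof -
  obtain Y dY where *: "(\<lambda>s. Yf k s $ i) has_fps_expansion Y i" "(\<lambda>s. dYf k s l $ i) has_fps_expansion dY i" for i
    using cartan_flow_fps(2) [of k] cartan_flow_fps(4) [of k l] by metis
  have "\<forall>i. \<exists>F. (\<lambda>s. xi k s l $ i) has_fps_expansion F"
    unfolding xi_def frame_comp_def forall5 vec5_nth power2_eq_square
    by (intro conjI exI; (rule fps_expansion_intros * | simp)+)
  then show ?thesis ..
qed

lemma fps_functions:
  "cf has_fps_expansion fps_of cf" "sf has_fps_expansion fps_of sf"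
  "(\<lambda>s. H s $ 3) has_fps_expansion fps_of (\<lambda>s. H s $ 3)"
  "phi l has_fps_expansion fps_of (phi l)" "psi l has_fps_expansion fps_of (psi l)"
  "zf l has_fps_expansion fps_of (zf l)" "zp l has_fps_expansion fps_of (zp l)"
  "pf l has_fps_expansion fps_of (pf l)" "qf l has_fps_expansion fps_of (qf l)"
proof -
  obtain HF where H: "(\<lambda>s. H s $ i) has_fps_expansion HF i" for i using cartan_flow_fps(1) [of k] by metis
  obtain dH where dH: "(\<lambda>s. dHf k s l $ i) has_fps_expansion dH i" for i using cartan_flow_fps(3) [of k l] by metis
  obtain XF where X: "(\<lambda>s. xi k s l $ i) has_fps_expansion XF i" for i using xi_fps [of l] by metis
  show "cf has_fps_expansion fps_of cf" "sf has_fps_expansion fps_of sf"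
    "(\<lambda>s. H s $ 3) has_fps_expansion fps_of (\<lambda>s. H s $ 3)"
    "phi l has_fps_expansion fps_of (phi l)" "psi l has_fps_expansion fps_of (psi l)"
    "zf l has_fps_expansion fps_of (zf l)" "zp l has_fps_expansion fps_of (zp l)"
    "pf l has_fps_expansion fps_of (pf l)" "qf l has_fps_expansion fps_of (qf l)"
    unfolding defs [abs_def] divide_inverse
    by (rule fps_of; (rule fps_expansion_intros H dH X)+)+
qed

abbreviation "C \<equiv> fps_of cf"
abbreviation "S \<equiv> fps_of sf"
abbreviation "W \<equiv> fps_of (\<lambda>s. H s $ 3)"

sublocale jacobi_series "k $ 3" \<rho> la C S W
proof
  note fps = fps_functions(1-3)
  show "fps_deriv C = - fps_const (k $ 3) * (S * W)"
    by (rule fps_deriv_of_derivative [OF fps(1) _ base_derivatives(1) R_pos(1)])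
       (use has_fps_expansion_cmult_left [OF has_fps_expansion_mult [OF fps(2,3)], of "- k $ 3"] in simp)
  have "fps_deriv S = fps_const (1 / k $ 3) * (C * W)"
    by (rule fps_deriv_of_derivative [OF fps(2) _ base_derivatives(2) R_pos(1)])
       (use has_fps_expansion_cmult_left [OF has_fps_expansion_mult [OF fps(1,3)], of "1 / k $ 3"] in simp)
  then show "fps_const (k $ 3) * fps_deriv S = C * W"
    using k3 by (simp flip: mult.assoc)
  show "fps_deriv W = fps_const (k $ 3) * (fps_const \<rho> * C + fps_const la * S)"
    by (rule fps_deriv_of_derivative [OF fps(3) _ base_derivatives(3) R_pos(1)])
       (intro has_fps_expansion_cmult_left has_fps_expansion_add fps)
  show "fps_nth C 0 = 1" "fps_nth S 0 = 0" "fps_nth W 0 = k $ 3"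
    using fps [THEN has_fps_expansion_at_0] r r_nz
    by (simp_all add: cf_def sf_def flip: power2_eq_square)
qed (fact k3)

text \<open>A basis of the variations orthogonal to the initial velocity, for which the data of the
  source term \<open>phi\<close> in \<open>column_derivatives\<close> are the unit vectors.\<close>

definition lc :: "nat \<Rightarrow> pt" where
  "lc j = (if j = 1 then vec5 (- k$2 / r\<^sup>2) (k$1 / r\<^sup>2) 0 0 0
    else if j = 2 then vec5 0 0 (1 / r\<^sup>2) 0 0
    else if j = 3 then vec5 0 0 0 (k$1 / r^4) (k$2 / r^4)
    else vec5 0 0 0 (- k$2 / (r^4 * k$3)) (k$1 / (r^4 * k$3)))"

lemma lc_perp: "k$1 * lc j $ 1 + k$2 * lc j $ 2 = 0"
  by (simp add: lc_def field_simps)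

lemma r4: "r ^ 4 = r\<^sup>2 * r\<^sup>2" by (simp add: power2_eq_square power4_eq_xxxx)

lemma columns_lc: "columns (\<lambda>j. fps_of (zp (lc j))) (\<lambda>j. fps_of (zf (lc j))) (\<lambda>j. fps_of (pf (lc j))) (\<lambda>j. fps_of (qf (lc j)))"
  unfolding columns_def column_def
proof (intro exI ballI conjI)
  fix j :: nat assume j: "j \<in> {1..4}"
  let ?l = "lc j"
  note cd = column_derivatives [OF _ lc_perp [of j]]
  note fps = fps_functions(1-3) fps_functions(4-9) [of ?l]
  note der = fps_deriv_of_derivative [OF _ _ _ R_pos(1)]
  show "fps_deriv (fps_of (zf ?l)) = fps_of (zp ?l)" by (rule der [OF fps(6,7) cd(3)])
  show "fps_deriv (fps_of (pf ?l)) = C * fps_of (zf ?l)"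
    by (rule der [OF fps(8) _ cd(5)]) (intro has_fps_expansion_mult fps)
  show "fps_deriv (fps_of (qf ?l)) = S * fps_of (zf ?l)"
    by (rule der [OF fps(9) _ cd(6)]) (intro has_fps_expansion_mult fps)
  show "fps_deriv (fps_of (zp ?l)) = fps_of (phi (lc j)) - W * (W * fps_of (zf ?l)
      - fps_const (k $ 3 * \<rho>) * fps_of (pf ?l) - fps_const (k $ 3 * la) * fps_of (qf ?l))"
    by (rule der [OF fps(7) _ cd(4)])
       (intro has_fps_expansion_mult has_fps_expansion_diff has_fps_expansion_cmult_left fps)
  show "fps_deriv (fps_of (phi (lc j))) = fps_of (psi (lc j))" by (rule der [OF fps(4,5) cd(1)])
  have c3: "r\<^sup>2 * (k $ 1 * ?l $ 4 + k $ 2 * ?l $ 5) = of_bool (j = 3)"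
  proof -
    have "r\<^sup>2 * (k $ 1 * (k $ 1 / r ^ 4) + k $ 2 * (k $ 2 / r ^ 4)) = 1"
    proof -
      have "N * (a * (a / (N * N)) + b * (b / (N * N))) = (a * a + b * b) / N" if "N \<noteq> 0" for N a b :: real
        using that by (simp add: field_simps)
      from this [OF r_nz(2)]
      have "r\<^sup>2 * (k $ 1 * (k $ 1 / r ^ 4) + k $ 2 * (k $ 2 / r ^ 4)) = (k$1 * k$1 + k$2 * k$2) / r\<^sup>2"
        by (simp only: r4)
      also have "k$1 * k$1 + k$2 * k$2 = r\<^sup>2" unfolding r(2) unfolding power2_eq_square ..
      also have "r\<^sup>2 / r\<^sup>2 = 1" using r_nz by simp
      finally show ?thesis .
    qed
    then show ?thesis using j by (auto simp: lc_def)
  qed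
  have c4: "r\<^sup>2 * k $ 3 * (k $ 1 * ?l $ 5 - k $ 2 * ?l $ 4) = of_bool (j = 4)"
  proof -
    have "r\<^sup>2 * k $ 3 * (k $ 1 * (k $ 1 / (r ^ 4 * k$3)) - k $ 2 * (- k $ 2 / (r ^ 4 * k$3))) = 1"
    proof -
      have "r\<^sup>2 * k $ 3 * (k $ 1 * (k $ 1 / (r ^ 4 * k$3)) - k $ 2 * (- k $ 2 / (r ^ 4 * k$3)))
          = (k$1 * k$1 + k$2 * k$2) / r\<^sup>2"
      proof -
        have "N * w * (a * (a / (N * N * w)) - b * (- b / (N * N * w))) = (a * a + b * b) / N"
          if "N \<noteq> 0" "w \<noteq> 0" for N w a b :: real
          using that by (simp add: field_simps)
        from this [OF r_nz(2) k3] show ?thesis by (simp only: r4)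
      qed
      also have "k$1 * k$1 + k$2 * k$2 = r\<^sup>2" unfolding r(2) unfolding power2_eq_square ..
      also have "r\<^sup>2 / r\<^sup>2 = 1" using r_nz by simp
      finally show ?thesis .
    qed
    moreover have "j = 4" if "j \<noteq> 1" "j \<noteq> 2" "j \<noteq> 3" using that j by auto
    ultimately show ?thesis by (auto simp: lc_def)
  qed
  show "fps_deriv (fps_of (psi (lc j))) = (fps_const la * C - fps_const (\<rho> * (k $ 3)\<^sup>2) * S) * fps_of (phi (lc j))
      + fps_const (of_bool (j = 3)) * C + fps_const (of_bool (j = 4)) * S"
    by (rule der [OF fps(5) _ cd(2)], unfold c3 c4,
        intro has_fps_expansion_mult has_fps_expansion_diff has_fps_expansion_add has_fps_expansion_cmult_left fps)
  have "k$1 * k$1 + k$2 * k$2 = r\<^sup>2" unfolding r(2) unfolding power2_eq_square ..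
  then have "k $ 1 * (k $ 1 / r\<^sup>2) + k $ 2 * (k $ 2 / r\<^sup>2) = 1"
    using r_nz by (simp flip: add_divide_distrib)
  then show "fps_nth (fps_of (phi (lc j))) 0 = of_bool (j = 1)"
    unfolding has_fps_expansion_at_0 [OF fps(4)] by (auto simp: phi_def lc_def)
  show "fps_nth (fps_of (psi (lc j))) 0 = of_bool (j = 2)"
    unfolding has_fps_expansion_at_0 [OF fps(5)] using r_nz by (auto simp: psi_def lc_def)
  show "fps_nth (fps_of (zf ?l)) 0 = 0" "fps_nth (fps_of (zp ?l)) 0 = 0"
    "fps_nth (fps_of (pf ?l)) 0 = 0" "fps_nth (fps_of (qf ?l)) 0 = 0"
    unfolding fps [THEN has_fps_expansion_at_0] by (simp_all add: zf_def zp_def pf_def qf_def)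
qed

text \<open>The coefficients are the data of the source: the values of \<open>phi\<close> and
  \<open>psi\<close> at 0 and the multipliers of \<open>cf\<close> and \<open>sf\<close> in the
  equation for \<open>psi\<close>.\<close>

lemma lc_decomposition:
  assumes "k$1 * l$1 + k$2 * l$2 = 0"
  shows "l = (k$1 * l$2 - k$2 * l$1) *\<^sub>R lc 1 + (r\<^sup>2 * l$3) *\<^sub>R lc 2
    + (r\<^sup>2 * (k$1 * l$4 + k$2 * l$5)) *\<^sub>R lc 3 + (r\<^sup>2 * k$3 * (k$1 * l$5 - k$2 * l$4)) *\<^sub>R lc 4"
proof -
  note p1 = plane_decomposition [OF k3 r_nz(2) r(2), where ?a1.0 = "l$1" and ?a2.0 = "l$2"]
  note p2 = plane_decomposition [OF k3 r_nz(2) r(2), where ?a1.0 = "l$4" and ?a2.0 = "l$5"]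
  have e: "l$1 = (k$1 * l$2 - k$2 * l$1) * (- k$2 / r\<^sup>2)" "l$2 = (k$1 * l$2 - k$2 * l$1) * (k$1 / r\<^sup>2)"
    by (rule trans [OF p1(1)], use assms k3 in simp, rule trans [OF p1(2)], use assms k3 in simp)
  have e3: "l$3 = (r\<^sup>2 * l$3) * (1 / r\<^sup>2)" using r_nz by simp
  have N: "N * A * (a / (N * N)) = a * (A / N)" "N * w * B * (a / (N * N * w)) = a * w * (B / (N * w))"
    if "N \<noteq> 0" "w \<noteq> 0" for N w A B a :: real
    using that by (simp_all add: field_simps)
  have e4: "l$4 = r\<^sup>2 * (k$1 * l$4 + k$2 * l$5) * (k$1 / r^4)
      + r\<^sup>2 * k$3 * (k$1 * l$5 - k$2 * l$4) * (- k$2 / (r^4 * k$3))"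
    by (rule trans [OF p2(1)]) (unfold r4 N [OF r_nz(2) k3], simp)
  have e5: "l$5 = r\<^sup>2 * (k$1 * l$4 + k$2 * l$5) * (k$2 / r^4)
      + r\<^sup>2 * k$3 * (k$1 * l$5 - k$2 * l$4) * (k$1 / (r^4 * k$3))"
    by (rule trans [OF p2(2)]) (unfold r4 N [OF r_nz(2) k3], simp)
  show ?thesis
    unfolding vec_eq_iff forall5
    by (intro conjI; rule trans [OF e(1)] trans [OF e(2)] trans [OF e3] trans [OF e4] trans [OF e5]; simp add: lc_def)
qed

end

lemma lead_quotient:
  assumes "lead b x0 x1 x2 F" "b = a" "x0 \<noteq> 0" "f has_fps_expansion F"
  shows "(\<lambda>s. if s = 0 then fps_nth F a else f s / s ^ a) has_fps_expansion fps_shift a F"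
proof (rule has_fps_expansion_shift)
  have "F \<noteq> 0" "\<And>i. i < a \<Longrightarrow> fps_nth F i = 0" using assms by (auto simp: lead_def)
  then show "a \<le> subdegree F" by (intro subdegree_geI)
qed (simp_all add: assms)

context jacobi_flow
begin

text \<open>Matrix entries with their row and column powers of s removed; the values at 0 make the
  shifted power series represent them there too.\<close>

definition "yq j s = (if s = 0 then fps_nth (fps_of (zp (lc j))) j else zp (lc j) s / s ^ j)"
definition "zq j s = (if s = 0 then fps_nth (fps_of (zf (lc j))) (j + 1) else zf (lc j) s / s ^ (j + 1))"
definition "pq j s = (if s = 0 then fps_nth (fps_of (pf (lc j))) (j + 2) else pf (lc j) s / s ^ (j + 2))"
definition "qq j s = (if s = 0 then fps_nth (fps_of (qf (lc j))) (j + 3) else qf (lc j) s / s ^ (j + 3))"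

definition "cofactor s = det3 (\<lambda>j. zq j s) (\<lambda>j. pq j s) (\<lambda>j. qq j s)"
definition "determinant s = det4 (\<lambda>j. yq j s) (\<lambda>j. zq j s) (\<lambda>j. pq j s) (\<lambda>j. qq j s)"

lemma cramer_fps:
  shows "\<exists>F. (\<lambda>s. cofactor s 2 3 4 / determinant s) has_fps_expansion F
    \<and> lead 0 (- 4) 0 (- (6 * ((k$3)\<^sup>2 / 2 + la) - 8 * \<rho>\<^sup>2) / 126) F"
    and "\<forall>\<^sub>F s in nhds 0. determinant s \<noteq> 0"
proof -
  note L = lead_columns [OF columns_lc]
  have yq1: "yq 1 has_fps_expansion fps_shift (1) (fps_of (zp (lc 1)))"
    unfolding yq_def by (rule lead_quotient [OF L(1) _ _ fps_functions(7)]) simp_all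
  have yq2: "yq 2 has_fps_expansion fps_shift (2) (fps_of (zp (lc 2)))"
    unfolding yq_def by (rule lead_quotient [OF L(2) _ _ fps_functions(7)]) simp_all
  have yq3: "yq 3 has_fps_expansion fps_shift (3) (fps_of (zp (lc 3)))"
    unfolding yq_def by (rule lead_quotient [OF L(3) _ _ fps_functions(7)]) simp_all
  have yq4: "yq 4 has_fps_expansion fps_shift (4) (fps_of (zp (lc 4)))"
    unfolding yq_def by (rule lead_quotient [OF L(4) _ _ fps_functions(7)]) simp_all
  have zq1: "zq 1 has_fps_expansion fps_shift (1 + 1) (fps_of (zf (lc 1)))"
    unfolding zq_def by (rule lead_quotient [OF L(5) _ _ fps_functions(6)]) simp_all
  have zq2: "zq 2 has_fps_expansion fps_shift (2 + 1) (fps_of (zf (lc 2)))"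
    unfolding zq_def by (rule lead_quotient [OF L(6) _ _ fps_functions(6)]) simp_all
  have zq3: "zq 3 has_fps_expansion fps_shift (3 + 1) (fps_of (zf (lc 3)))"
    unfolding zq_def by (rule lead_quotient [OF L(7) _ _ fps_functions(6)]) simp_all
  have zq4: "zq 4 has_fps_expansion fps_shift (4 + 1) (fps_of (zf (lc 4)))"
    unfolding zq_def by (rule lead_quotient [OF L(8) _ _ fps_functions(6)]) simp_all
  have pq1: "pq 1 has_fps_expansion fps_shift (1 + 2) (fps_of (pf (lc 1)))"
    unfolding pq_def by (rule lead_quotient [OF L(9) _ _ fps_functions(8)]) simp_all
  have pq2: "pq 2 has_fps_expansion fps_shift (2 + 2) (fps_of (pf (lc 2)))"
    unfolding pq_def by (rule lead_quotient [OF L(10) _ _ fps_functions(8)]) simp_all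
  have pq3: "pq 3 has_fps_expansion fps_shift (3 + 2) (fps_of (pf (lc 3)))"
    unfolding pq_def by (rule lead_quotient [OF L(11) _ _ fps_functions(8)]) simp_all
  have pq4: "pq 4 has_fps_expansion fps_shift (4 + 2) (fps_of (pf (lc 4)))"
    unfolding pq_def by (rule lead_quotient [OF L(12) _ _ fps_functions(8)]) simp_all
  have qq1: "qq 1 has_fps_expansion fps_shift (1 + 3) (fps_of (qf (lc 1)))"
    unfolding qq_def by (rule lead_quotient [OF L(13) _ _ fps_functions(9)]) simp_all
  have qq2: "qq 2 has_fps_expansion fps_shift (2 + 3) (fps_of (qf (lc 2)))"
    unfolding qq_def by (rule lead_quotient [OF L(14) _ _ fps_functions(9)]) simp_all
  have qq3: "qq 3 has_fps_expansion fps_shift (3 + 3) (fps_of (qf (lc 3)))"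
    unfolding qq_def by (rule lead_quotient [OF L(15) _ _ fps_functions(9)]) simp_all
  have qq4: "qq 4 has_fps_expansion fps_shift (4 + 3) (fps_of (qf (lc 4)))"
    unfolding qq_def by (rule lead_quotient [OF L(16) _ _ fps_functions(9)]) simp_all
  note fps = yq1 yq2 yq3 yq4 zq1 zq2 zq3 zq4 pq1 pq2 pq3 pq4 qq1 qq2 qq3 qq4
  note l = lead_cramer_quotient [OF columns_lc]
  have N: "(\<lambda>s. cofactor s 2 3 4) has_fps_expansion det3 (\<lambda>j. fps_shift (j + 1) (fps_of (zf (lc j))))
      (\<lambda>j. fps_shift (j + 2) (fps_of (pf (lc j)))) (\<lambda>j. fps_shift (j + 3) (fps_of (qf (lc j)))) 2 3 4"
    unfolding cofactor_def det3_def
    by (intro has_fps_expansion_add has_fps_expansion_diff has_fps_expansion_mult fps)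
  have D: "determinant has_fps_expansion det4 (\<lambda>j. fps_shift j (fps_of (zp (lc j))))
      (\<lambda>j. fps_shift (j + 1) (fps_of (zf (lc j)))) (\<lambda>j. fps_shift (j + 2) (fps_of (pf (lc j))))
      (\<lambda>j. fps_shift (j + 3) (fps_of (qf (lc j))))"
    unfolding determinant_def [abs_def] det4_def det3_def
    by (intro has_fps_expansion_add has_fps_expansion_diff has_fps_expansion_mult fps)
  show "\<exists>F. (\<lambda>s. cofactor s 2 3 4 / determinant s) has_fps_expansion F
    \<and> lead 0 (- 4) 0 (- (6 * ((k$3)\<^sup>2 / 2 + la) - 8 * \<rho>\<^sup>2) / 126) F"
    using has_fps_expansion_divide' [OF N D l(1)] l(2) by blast
  have "isCont determinant 0" by (rule has_fps_expansion_imp_continuous [OF D])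
  moreover have "determinant 0 \<noteq> 0" using l(1) unfolding has_fps_expansion_at_0 [OF D] .
  ultimately show "\<forall>\<^sub>F s in nhds 0. determinant s \<noteq> 0"
    unfolding continuous_within by (subst eventually_nhds_conv_at) (auto intro: tendsto_imp_eventually_ne)
qed

lemma linear_xi: "\<bar>s\<bar> \<le> tmax R \<Longrightarrow> linear (xi k s)"
  using linear_compose [OF linear_dYf [OF kR] linear_frame_comp] by (simp add: xi_def [abs_def] o_def)

lemma rows_linear:
  fixes a1 a2 a3 a4 s :: real
  assumes s: "\<bar>s\<bar> \<le> tmax R"
  defines "l \<equiv> a1 *\<^sub>R lc 1 + a2 *\<^sub>R lc 2 + a3 *\<^sub>R lc 3 + a4 *\<^sub>R lc 4"
  shows "zp l s = zp (lc 1) s * a1 + zp (lc 2) s * a2 + zp (lc 3) s * a3 + zp (lc 4) s * a4"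
    and "zf l s = zf (lc 1) s * a1 + zf (lc 2) s * a2 + zf (lc 3) s * a3 + zf (lc 4) s * a4"
    and "pf l s = pf (lc 1) s * a1 + pf (lc 2) s * a2 + pf (lc 3) s * a3 + pf (lc 4) s * a4"
    and "qf l s = qf (lc 1) s * a1 + qf (lc 2) s * a2 + qf (lc 3) s * a3 + qf (lc 4) s * a4"
proof -
  have "xi k s l = a1 *\<^sub>R xi k s (lc 1) + a2 *\<^sub>R xi k s (lc 2) + a3 *\<^sub>R xi k s (lc 3) + a4 *\<^sub>R xi k s (lc 4)"
    unfolding l_def using linear_xi [OF s] by (simp add: linear_add linear_scale)
  then have x: "xi k s l $ i = a1 * xi k s (lc 1) $ i + a2 * xi k s (lc 2) $ i + a3 * xi k s (lc 3) $ i + a4 * xi k s (lc 4) $ i" for i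
    by simp
  show "zp l s = zp (lc 1) s * a1 + zp (lc 2) s * a2 + zp (lc 3) s * a3 + zp (lc 4) s * a4"
    "zf l s = zf (lc 1) s * a1 + zf (lc 2) s * a2 + zf (lc 3) s * a3 + zf (lc 4) s * a4"
    unfolding zp_def zf_def x by (simp_all add: algebra_simps)
  show "pf l s = pf (lc 1) s * a1 + pf (lc 2) s * a2 + pf (lc 3) s * a3 + pf (lc 4) s * a4"
    "qf l s = qf (lc 1) s * a1 + qf (lc 2) s * a2 + qf (lc 3) s * a3 + qf (lc 4) s * a4"
    unfolding pf_def qf_def x by (simp_all add: algebra_simps add_divide_distrib diff_divide_distrib)
qed

lemma rows_quotient:
  assumes "s \<noteq> 0"
  shows "zp (lc j) s = s ^ j * yq j s" "zf (lc j) s = s * (s ^ j * zq j s)"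
    "pf (lc j) s = s\<^sup>2 * (s ^ j * pq j s)" "qf (lc j) s = s ^ 3 * (s ^ j * qq j s)"
  using assms by (simp_all add: yq_def zq_def pq_def qq_def power_add power2_eq_square)

text \<open>Column powers are absorbed into the unknowns and row powers are pulled out in front,
  which leaves the matrix that stays invertible as s tends to 0.\<close>

lemma rows_combination:
  fixes a1 a2 a3 a4 s :: real
  assumes s: "\<bar>s\<bar> \<le> tmax R" "s \<noteq> 0"
  defines "l \<equiv> a1 *\<^sub>R lc 1 + a2 *\<^sub>R lc 2 + a3 *\<^sub>R lc 3 + a4 *\<^sub>R lc 4"
  defines "b1 \<equiv> s * a1" and "b2 \<equiv> s\<^sup>2 * a2" and "b3 \<equiv> s ^ 3 * a3" and "b4 \<equiv> s ^ 4 * a4"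
  shows "zp l s = yq 1 s * b1 + yq 2 s * b2 + yq 3 s * b3 + yq 4 s * b4"
    and "zf l s = s * (zq 1 s * b1 + zq 2 s * b2 + zq 3 s * b3 + zq 4 s * b4)"
    and "pf l s = s\<^sup>2 * (pq 1 s * b1 + pq 2 s * b2 + pq 3 s * b3 + pq 4 s * b4)"
    and "qf l s = s ^ 3 * (qq 1 s * b1 + qq 2 s * b2 + qq 3 s * b3 + qq 4 s * b4)"
  unfolding l_def rows_linear [OF s(1)] rows_quotient [OF s(2)] b1_def b2_def b3_def b4_def
  by (simp_all add: algebra_simps)

text \<open>The Gauss lemma makes l orthogonal to the initial velocity, hence a combination of the
  \<open>lc j\<close>, to which the invertible matrix applies.\<close>

lemma xi_injective:
  assumes s: "\<bar>s\<bar> < tmax R" "s \<noteq> 0" and D: "determinant s \<noteq> 0" and x: "xi k s l = 0"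
  shows "l = 0"
proof -
  have kl: "k$1 * l$1 + k$2 * l$2 = 0" using gauss_lemma [OF R_pos(2) s(1), of l] x s(2) by simp
  note dec = lc_decomposition [OF kl]
  define a1 a2 a3 a4 where "a1 = k$1 * l$2 - k$2 * l$1" "a2 = r\<^sup>2 * l$3"
    "a3 = r\<^sup>2 * (k$1 * l$4 + k$2 * l$5)" "a4 = r\<^sup>2 * k$3 * (k$1 * l$5 - k$2 * l$4)"
  note a = this
  have l: "l = a1 *\<^sub>R lc 1 + a2 *\<^sub>R lc 2 + a3 *\<^sub>R lc 3 + a4 *\<^sub>R lc 4" using dec unfolding a .
  have z: "zp l s = 0" "zf l s = 0" "pf l s = 0" "qf l s = 0" using x by (simp_all add: zp_def zf_def pf_def qf_def)
  have s': "\<bar>s\<bar> \<le> tmax R" using s by simp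
  note z' = z [unfolded l rows_combination [OF s' s(2)]]
  have "s * a1 = 0 \<and> s\<^sup>2 * a2 = 0 \<and> s ^ 3 * a3 = 0 \<and> s ^ 4 * a4 = 0"
    by (rule det4_injective [OF _ _ _ _ D [unfolded determinant_def]])
       (use z' s(2) in simp_all)
  then show ?thesis using s(2) by (simp add: l)
qed

text \<open>Cramer's rule with right side (r, 0, 0, 0); together with the Gauss lemma these values
  say that the field ends at the unit normal. The angular momentum variation is the coefficient
  \<open>b1 / s\<close> of \<open>lc 1\<close>, whence the single factor 1 / s.\<close>

lemma xi_endpoint:
  assumes s: "\<bar>s\<bar> < tmax R" "s \<noteq> 0" and D: "determinant s \<noteq> 0"
  shows "\<exists>l. xi k s l = vec5 (- H s $ 2 / r) (H s $ 1 / r) 0 0 0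
    \<and> (k$1 * l$2 - k$2 * l$1) / r = cofactor s 2 3 4 / determinant s / s"
proof -
  define d where "d = r / determinant s"
  define b1 b2 b3 b4 where "b1 = d * cofactor s 2 3 4" "b2 = - d * cofactor s 1 3 4"
    "b3 = d * cofactor s 1 2 4" "b4 = - d * cofactor s 1 2 3"
  note b = this
  define l where "l = (b1 / s) *\<^sub>R lc 1 + (b2 / s\<^sup>2) *\<^sub>R lc 2 + (b3 / s ^ 3) *\<^sub>R lc 3 + (b4 / s ^ 4) *\<^sub>R lc 4"
  have s': "\<bar>s\<bar> \<le> tmax R" using s by simp
  have c: "s * (b1 / s) = b1" "s\<^sup>2 * (b2 / s\<^sup>2) = b2" "s ^ 3 * (b3 / s ^ 3) = b3" "s ^ 4 * (b4 / s ^ 4) = b4"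
    using s(2) by auto
  note rc = rows_combination [OF s' s(2), of "b1 / s" "b2 / s\<^sup>2" "b3 / s ^ 3" "b4 / s ^ 4", folded l_def, unfolded c]
  note ex = det4_expand(1) [of "\<lambda>j. yq j s" "\<lambda>j. zq j s" "\<lambda>j. pq j s" "\<lambda>j. qq j s"]
    det4_expand(2-4) [where z = "\<lambda>j. zq j s" and p = "\<lambda>j. pq j s" and q = "\<lambda>j. qq j s"]
  note ex = ex [folded cofactor_def determinant_def]
  have comb: "u1 * b1 + u2 * b2 + u3 * b3 + u4 * b4 = d * (u1 * cofactor s 2 3 4 - u2 * cofactor s 1 3 4
      + u3 * cofactor s 1 2 4 - u4 * cofactor s 1 2 3)" for u1 u2 u3 u4
    unfolding b by (simp add: algebra_simps)
  have z: "zp l s = r" "zf l s = 0" "pf l s = 0" "qf l s = 0"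
    unfolding rc comb ex using D by (simp_all add: d_def)
  have kl: "k$1 * l$1 + k$2 * l$2 = 0"
  proof -
    have "k$1 * l$1 + k$2 * l$2 = b1 / s * (k$1 * lc 1 $ 1 + k$2 * lc 1 $ 2) + b2 / s\<^sup>2 * (k$1 * lc 2 $ 1 + k$2 * lc 2 $ 2)
      + b3 / s ^ 3 * (k$1 * lc 3 $ 1 + k$2 * lc 3 $ 2) + b4 / s ^ 4 * (k$1 * lc 4 $ 1 + k$2 * lc 4 $ 2)"
      by (simp add: l_def algebra_simps)
    then show ?thesis unfolding lc_perp by simp
  qed
  have x345: "xi k s l $ 3 = 0" "xi k s l $ 4 = 0" "xi k s l $ 5 = 0"
    using z by (simp_all add: zf_def frame_xi)
  have "H s $ 1 * xi k s l $ 1 + H s $ 2 * xi k s l $ 2 = 0"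
    using gauss_lemma [OF R_pos(2) s(1), of l] kl x345 by (simp add: inner5)
  moreover have "H s $ 1 * xi k s l $ 2 - H s $ 2 * xi k s l $ 1 = r" using z(1) by (simp add: zp_def)
  moreover have sp: "H s $ 1 * H s $ 1 + H s $ 2 * H s $ 2 = r * r" using speed [OF s(1)] by (simp add: power2_eq_square)
  ultimately have "r * (r * xi k s l $ 1) = r * (- H s $ 2)" "r * (r * xi k s l $ 2) = r * H s $ 1"
    by algebra+
  then have "r * xi k s l $ 1 = - H s $ 2" "r * xi k s l $ 2 = H s $ 1"
    using r_nz mult_left_cancel by blast+
  then have "xi k s l $ 1 = - H s $ 2 / r" "xi k s l $ 2 = H s $ 1 / r"
    using r_nz by (simp_all add: field_simps)
  moreover have "(k$1 * l$2 - k$2 * l$1) / r = cofactor s 2 3 4 / determinant s / s"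
  proof -
    have kk: "k$1 * (k$1 / r\<^sup>2) + k$2 * (k$2 / r\<^sup>2) = 1"
    proof -
      have "k$1 * k$1 + k$2 * k$2 = r\<^sup>2" unfolding r(2) unfolding power2_eq_square ..
      then show ?thesis using r_nz by (simp flip: add_divide_distrib)
    qed
    have "k$1 * l$2 - k$2 * l$1 = b1 / s * (k$1 * (k$1 / r\<^sup>2) + k$2 * (k$2 / r\<^sup>2))"
      by (simp add: l_def lc_def algebra_simps)
    then show ?thesis unfolding kk b d_def using r_nz by simp
  qed
  ultimately show ?thesis using x345 by (intro exI [of _ l]) (simp add: vec_eq_iff forall5)
qed

end

context cartan_geodesic
begin

lemma continuous_momentum: "continuous_on {0..T} m"
  unfolding continuous_on_eq_continuous_within
proof (intro ballI, rule has_vector_derivative_continuous)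
  fix t assume "t \<in> {0..T}"
  note g = geo_atD(1-5) [OF geo [OF this]]
  have "\<forall>i. ((\<lambda>s. m s $ i) has_real_derivative
      vec5 (- (m t $ 2 * m t $ 3)) (m t $ 1 * m t $ 3) (m t $ 1 * m t $ 4 + m t $ 2 * m t $ 5) 0 0 $ i)
      (at t within {0..T})"
    unfolding forall5 using g by simp
  then show "(m has_vector_derivative
      vec5 (- (m t $ 2 * m t $ 3)) (m t $ 1 * m t $ 3) (m t $ 1 * m t $ 4 + m t $ 2 * m t $ 5) 0 0)
      (at t within {0..T})"
    by (intro has_vector_derivative_componentsI) blast
qed

lemma continuous_geodesic: "continuous_on {0..T} \<gamma>"
  unfolding continuous_on_eq_continuous_within
  by (intro ballI, rule has_vector_derivative_continuous, rule geo_at_velocity [OF geo])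

lemma second_differential_expansion:
  assumes nd: "(m 0 $ 1)\<^sup>2 + (m 0 $ 2)\<^sup>2 \<noteq> 0" "m 0 $ 3 \<noteq> 0" and r: "r = sqrt ((m 0 $ 1)\<^sup>2 + (m 0 $ 2)\<^sup>2)"
  obtains M F \<epsilon> where "0 < \<epsilon>" "M has_fps_expansion F"
    "lead 0 (- 4) 0 (- (6 * ((m 0 $ 3)\<^sup>2 / 2 + (m 0 $ 1 * m 0 $ 5 - m 0 $ 2 * m 0 $ 4))
      - 8 * ((m 0 $ 1 * m 0 $ 4 + m 0 $ 2 * m 0 $ 5) / m 0 $ 3)\<^sup>2) / 126) F"
    "\<And>t v1 v2. 0 < t \<Longrightarrow> t < \<epsilon> \<Longrightarrow> second_differential (cost_dot \<gamma> t) (\<gamma> 0) (horiz (\<gamma> 0) v1 v2)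
      = ((m 0 $ 1 * v1 + m 0 $ 2 * v2) / r)\<^sup>2 / t\<^sup>2 + (M t / t)\<^sup>2 * ((m 0 $ 1 * v2 - m 0 $ 2 * v1) / r)\<^sup>2"
proof -
  define R where "R = norm (m 0) + 1"
  have r0: "0 < r" "r\<^sup>2 = (m 0 $ 1)\<^sup>2 + (m 0 $ 2)\<^sup>2"
    using nd(1) unfolding r by (simp_all add: sum_power2_gt_zero_iff)
  interpret J: jacobi_flow "m 0" R r
    by unfold_locales (use r0 nd(2) in \<open>simp_all add: R_def\<close>)
  obtain \<Gamma> where \<Gamma>: "\<And>t. t \<in> {0..T} \<Longrightarrow> norm (\<gamma> t) \<le> \<Gamma>"
    using compact_imp_bounded [OF compact_continuous_image [OF continuous_geodesic compact_Icc]]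
    unfolding bounded_iff by (metis imageI)
  obtain \<delta> \<tau> where \<delta>: "0 < \<delta>" "\<delta> \<le> 1" "0 < \<tau>" "\<tau> < tmax R" and
    min: "\<And>a k s. norm a \<le> \<Gamma> \<Longrightarrow> dist k (m 0) < \<delta> \<Longrightarrow> 0 < s \<Longrightarrow> s \<le> \<tau> \<Longrightarrow>
       sr_dist (cartan_mult a (Yf k (- s))) a = s * sqrt ((k $ 1)\<^sup>2 + (k $ 2)\<^sup>2)"
    by (rule uniformly_minimizing [OF nd(1), of R \<Gamma>]) (simp_all add: R_def)
  obtain F where F: "(\<lambda>s. J.cofactor s 2 3 4 / J.determinant s) has_fps_expansion F"
    "lead 0 (- 4) 0 (- (6 * ((m 0 $ 3)\<^sup>2 / 2 + J.la) - 8 * J.\<rho>\<^sup>2) / 126) F"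
    using J.cramer_fps(1) by blast
  obtain \<epsilon>1 where e1: "0 < \<epsilon>1" "\<And>s. \<bar>s\<bar> < \<epsilon>1 \<Longrightarrow> J.determinant s \<noteq> 0"
    using J.cramer_fps(2) by (auto simp: eventually_nhds_metric dist_real_def)
  obtain \<epsilon>2 where e2: "0 < \<epsilon>2" "\<And>t. t \<in> {0..T} \<Longrightarrow> t < \<epsilon>2 \<Longrightarrow> dist (m t) (m 0) < \<delta>"
    using continuous_momentum T \<delta>(1) unfolding continuous_on_iff
    by (fastforce simp: dist_real_def dest: bspec [of _ _ 0])
  define \<tau>' where "\<tau>' = min \<tau> T"
  define \<epsilon> where "\<epsilon> = min \<tau>' (min \<epsilon>1 \<epsilon>2)"
  have ball: "norm k < R" if "dist k (m 0) < \<delta>" for k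
    using that \<delta>(2) norm_triangle_ineq [of "k - m 0" "m 0"] by (simp add: R_def dist_norm)
  show ?thesis
  proof (rule that [of \<epsilon>, OF _ F(1)])
    show "0 < \<epsilon>" using \<delta> T e1 e2 by (simp add: \<epsilon>_def \<tau>'_def)
    show "lead 0 (- 4) 0 (- (6 * ((m 0 $ 3)\<^sup>2 / 2 + (m 0 $ 1 * m 0 $ 5 - m 0 $ 2 * m 0 $ 4))
      - 8 * ((m 0 $ 1 * m 0 $ 4 + m 0 $ 2 * m 0 $ 5) / m 0 $ 3)\<^sup>2) / 126) F"
      using F(2) unfolding J.la_def J.\<rho>_def .
    fix t v1 v2 :: real assume t: "0 < t" "t < \<epsilon>"
    then have t': "t < \<tau>'" "t < \<tau>" "t < T" "\<bar>t\<bar> < \<epsilon>1" "t < \<epsilon>2" "t \<in> {0..T}" "t < tmax R" "\<bar>t\<bar> < tmax R"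
      using \<delta>(4) by (auto simp: \<epsilon>_def \<tau>'_def)
    have dt: "dist (m t) (m 0) < \<delta>" using e2(2) t' by simp
    have nR: "norm (m 0) \<le> R" "norm (m t) \<le> R" using ball [OF dt] by (simp_all add: R_def)
    have D: "J.determinant t \<noteq> 0" using e1(2) t' by simp
    have Hm: "Hf (m 0) t = m t" using flow_forward [OF t'(6) nR(1) t'(7), of t] t by simp
    have lin: "linear (xi (m 0) t)" using J.linear_xi t' by simp
    have surj: "surj (xi (m 0) t)"
    proof (rule linear_injective_imp_surjective [OF lin])
      show "inj (xi (m 0) t)"
        using J.xi_injective [OF t'(8) _ D] t(1) unfolding linear_injective_0 [OF lin] by simp
    qed simp
    \<comment> \<open>By duality such an l is orthogonal to the range of \<open>xi (m 0) t\<close>,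
      which is the whole space.\<close>
    have inj: "l = 0" if "xi (m t) (- t) l = 0" for l
    proof -
      obtain l' where l': "l = xi (m 0) t l'" using surj by (rule surjE)
      have "l \<bullet> xi (m 0) t l' = 0" using jacobi_duality [OF t'(6) nR t'(7), of l l'] that by simp
      then show ?thesis unfolding l' [symmetric] by simp
    qed
    have closing: "cartan_mult (\<gamma> t) (Yf (m t) (- t)) = \<gamma> 0"
      using flow_backward [OF t'(6) nR(2) t'(7), of 0] t by simp
    obtain l where l: "xi (m t) (- t) l = frame_comp (\<gamma> 0) (horiz (\<gamma> 0) v1 v2)"
      "second_differential (cost_dot \<gamma> t) (\<gamma> 0) (horiz (\<gamma> 0) v1 v2) = (l $ 1)\<^sup>2 + (l $ 2)\<^sup>2"
    proof (rule exE [OF cost_hessian [of "m 0" \<delta> R \<tau>' t "horiz (\<gamma> 0) v1 v2"]])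
      show "\<tau>' \<le> T" "\<tau>' < tmax R" using \<delta>(4) by (auto simp: \<tau>'_def)
      show "sr_dist (cartan_mult (\<gamma> s) (Yf k (- s))) (\<gamma> s) = s * sqrt ((k $ 1)\<^sup>2 + (k $ 2)\<^sup>2)"
        if "dist k (m 0) < \<delta>" "0 < s" "s \<le> \<tau>'" for k s
        using that \<Gamma> [of s] by (intro min) (auto simp: \<tau>'_def)
    qed (use ball t t' dt closing inj in blast)+
    obtain w where w: "xi (m 0) t w = vec5 (- m t $ 2 / r) (m t $ 1 / r) 0 0 0"
      "(m 0 $ 1 * w $ 2 - m 0 $ 2 * w $ 1) / r = J.cofactor t 2 3 4 / J.determinant t / t"
      using J.xi_endpoint [OF t'(8) _ D] t(1) unfolding Hm by blast
    show "second_differential (cost_dot \<gamma> t) (\<gamma> 0) (horiz (\<gamma> 0) v1 v2)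
      = ((m 0 $ 1 * v1 + m 0 $ 2 * v2) / r)\<^sup>2 / t\<^sup>2
        + (J.cofactor t 2 3 4 / J.determinant t / t)\<^sup>2 * ((m 0 $ 1 * v2 - m 0 $ 2 * v1) / r)\<^sup>2"
      using hessian_reduced [OF t(1) _ nR t'(7) r0(1) _ w(1) l(1) [unfolded frame_comp_horiz]] t' r0(2)
      unfolding l(2) w(2) by simp
  qed
qed

end

section \<open>The expansion of the curvature operator\<close>

lemma plane_eta: "v \<in> horizontal_plane x \<Longrightarrow> horiz x (v$1) (v$2) = v"
  by (metis horizontal_plane_iff)

lemma horiz_eq_iff: "horiz x a b = horiz x c d \<longleftrightarrow> a = c \<and> b = d"
  by (metis horiz_nth(1,2))

lemma horiz_scaleR: "c *\<^sub>R horiz x a b = horiz x (c * a) (c * b)"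
  and horiz_add: "horiz x a b + horiz x c d = horiz x (a + c) (b + d)"
  by (simp_all add: horiz_def algebra_simps)

lemma sr_metric_plane:
  "v \<in> horizontal_plane x \<Longrightarrow> w \<in> horizontal_plane x \<Longrightarrow> sr_metric x v w = v$1 * w$1 + v$2 * w$2"
  using sr_metric_horiz [of x "v$1" "v$2" "w$1" "w$2"] plane_eta by metis

text \<open>In the plane at \<open>x\<close>, the operator with eigenvalues \<open>a\<close>, \<open>b\<close> on the unit vector \<open>(u1, u2)\<close>
  and on its rotation by a right angle.\<close>

definition plane_op :: "pt \<Rightarrow> real \<Rightarrow> real \<Rightarrow> real \<Rightarrow> real \<Rightarrow> pt \<Rightarrow> pt" where
  "plane_op x u1 u2 a b = restrict (\<lambda>v. horiz x
      (a * (u1 * v$1 + u2 * v$2) * u1 - b * (u1 * v$2 - u2 * v$1) * u2)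
      (a * (u1 * v$1 + u2 * v$2) * u2 + b * (u1 * v$2 - u2 * v$1) * u1)) (horizontal_plane x)"

lemma plane_op_horiz: "plane_op x u1 u2 a b (horiz x v1 v2) = horiz x
      (a * (u1 * v1 + u2 * v2) * u1 - b * (u1 * v2 - u2 * v1) * u2)
      (a * (u1 * v1 + u2 * v2) * u2 + b * (u1 * v2 - u2 * v1) * u1)"
  by (simp add: plane_op_def)

lemma plane_add: "v \<in> horizontal_plane x \<Longrightarrow> w \<in> horizontal_plane x \<Longrightarrow> v + w \<in> horizontal_plane x"
  by (simp add: horizontal_plane_def span_add)

lemma symmetric_plane_op: "symmetric_operator_at x (plane_op x u1 u2 a b)"
  unfolding symmetric_operator_at_def
proof (intro conjI ballI allI)
  show "plane_op x u1 u2 a b \<in> horizontal_plane x \<rightarrow>\<^sub>E horizontal_plane x"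
    by (simp add: plane_op_def)
  fix v w assume vw: "v \<in> horizontal_plane x" "w \<in> horizontal_plane x"
  then obtain v1 v2 w1 w2 where e: "v = horiz x v1 v2" "w = horiz x w1 w2" by (metis plane_eta)
  show "plane_op x u1 u2 a b (c *\<^sub>R v + d *\<^sub>R w) = c *\<^sub>R plane_op x u1 u2 a b v + d *\<^sub>R plane_op x u1 u2 a b w" for c d
    unfolding e horiz_scaleR horiz_add plane_op_horiz horiz_eq_iff by (simp add: algebra_simps)
  show "sr_metric x (plane_op x u1 u2 a b v) w = sr_metric x v (plane_op x u1 u2 a b w)"
    unfolding e plane_op_horiz sr_metric_horiz by (simp add: algebra_simps)
qed

text \<open>Polarisation of the quadratic form; the operators are extensional on the plane, so
  agreement there is equality.\<close>

lemma symmetric_operator_at_eqI: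
  assumes A: "symmetric_operator_at x A" and B: "symmetric_operator_at x B"
    and eq: "\<And>v. v \<in> horizontal_plane x \<Longrightarrow> sr_metric x (A v) v = sr_metric x (B v) v"
  shows "A = B"
proof (rule PiE_ext)
  show "A \<in> horizontal_plane x \<rightarrow>\<^sub>E horizontal_plane x" "B \<in> horizontal_plane x \<rightarrow>\<^sub>E horizontal_plane x"
    using A B by (auto simp: symmetric_operator_at_def)
  fix v assume v: "v \<in> horizontal_plane x"
  have pol: "2 * sr_metric x (L v) w = sr_metric x (L (v + w)) (v + w) - sr_metric x (L v) v - sr_metric x (L w) w"
    if L: "symmetric_operator_at x L" and w: "w \<in> horizontal_plane x" for L w
  proof -
    have in': "L v \<in> horizontal_plane x" "L w \<in> horizontal_plane x" using L v w by (auto simp: symmetric_operator_at_def)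
    have "L (1 *\<^sub>R v + 1 *\<^sub>R w) = 1 *\<^sub>R L v + 1 *\<^sub>R L w" "sr_metric x (L v) w = sr_metric x v (L w)"
      using L v w unfolding symmetric_operator_at_def by blast+
    then show ?thesis
      using v w in' by (simp add: sr_metric_plane plane_add algebra_simps)
  qed
  have m: "sr_metric x (A v) w = sr_metric x (B v) w" if w: "w \<in> horizontal_plane x" for w
    using pol [OF A w] pol [OF B w] eq v w plane_add [OF v w] by simp
  have in': "A v \<in> horizontal_plane x" "B v \<in> horizontal_plane x"
    using A B v by (auto simp: symmetric_operator_at_def)
  have "A v $ 1 = B v $ 1" "A v $ 2 = B v $ 2"
    using m [of "horiz x 1 0"] m [of "horiz x 0 1"] in' by (simp_all add: sr_metric_plane)
  then show "A v = B v" using plane_eta in' by metis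
qed

lemma cost_op_eqI:
  assumes "symmetric_operator_at (\<gamma> 0) A"
    and "\<And>v. v \<in> horizontal_plane (\<gamma> 0) \<Longrightarrow>
      second_differential (cost_dot \<gamma> t) (\<gamma> 0) v = sr_metric (\<gamma> 0) (A v) v"
  shows "cost_op \<gamma> t = A"
  unfolding cost_op_def
proof (rule the_equality)
  fix B assume B: "symmetric_operator_at (\<gamma> 0) B \<and>
     (\<forall>v\<in>horizontal_plane (\<gamma> 0). second_differential (cost_dot \<gamma> t) (\<gamma> 0) v = sr_metric (\<gamma> 0) (B v) v)"
  show "B = A"
  proof (rule symmetric_operator_at_eqI [OF _ assms(1)])
    fix v assume "v \<in> horizontal_plane (\<gamma> 0)"
    then show "sr_metric (\<gamma> 0) (B v) v = sr_metric (\<gamma> 0) (A v) v" using B assms(2) [of v] by metis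
  qed (use B in blast)
qed (use assms in blast)

text \<open>The first derivative is given on a neighbourhood and the second only at 0, matching the
  iterated derivative in \<open>R_op\<close>.\<close>

lemma fps_derivatives:
  fixes f :: "real \<Rightarrow> real"
  assumes "f has_fps_expansion G"
  obtains f1 \<epsilon> where "0 < \<epsilon>" "\<And>s. \<bar>s\<bar> < \<epsilon> \<Longrightarrow> (f has_real_derivative f1 s) (at s)"
    "f1 0 = fps_nth G 1" "(f1 has_real_derivative 2 * fps_nth G 2) (at 0)"
proof -
  have G: "0 < fps_conv_radius G" "\<forall>\<^sub>F s in nhds 0. eval_fps G s = f s"
    using assms by (simp_all add: has_fps_expansion_def)
  then obtain d where d: "0 < d" "\<And>s. \<bar>s\<bar> < d \<Longrightarrow> eval_fps G s = f s"
    by (auto simp: eventually_nhds_metric dist_real_def)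
  obtain e where e: "0 < e" "ereal e < fps_conv_radius G"
    using ereal_dense2 [OF G(1)] by (metis ereal_less(2))
  have conv: "ereal (norm s) < fps_conv_radius G" if "\<bar>s\<bar> < e" for s :: real
    using that e(2) by (simp add: less_trans [of _ "ereal e"])
  show ?thesis
  proof (rule that [of "min d e" "eval_fps (fps_deriv G)"])
    show "0 < min d e" using d e by simp
    show "(f has_real_derivative eval_fps (fps_deriv G) s) (at s)" if s: "\<bar>s\<bar> < min d e" for s
    proof (rule has_field_derivative_transform_within)
      show "(eval_fps G has_real_derivative eval_fps (fps_deriv G) s) (at s)"
        using s conv by (intro has_field_derivative_eval_fps) auto
      show "0 < d - \<bar>s\<bar>" using s by simp
      show "s \<in> UNIV" by simp
      show "eval_fps G y = f y" if "dist y s < d - \<bar>s\<bar>" for y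
        using that by (intro d(2)) (simp add: dist_real_def)
    qed
    show "eval_fps (fps_deriv G) 0 = fps_nth G 1" by (simp add: eval_fps_at_0)
    have "fps_conv_radius G \<le> fps_conv_radius (fps_deriv G)" by (rule fps_conv_radius_deriv)
    then have "(eval_fps (fps_deriv G) has_real_derivative eval_fps (fps_deriv (fps_deriv G)) 0) (at 0)"
      using G(1) by (intro has_field_derivative_eval_fps) (simp add: zero_ereal_def [symmetric])
    then show "(eval_fps (fps_deriv G) has_real_derivative 2 * fps_nth G 2) (at 0)"
      by (simp add: eval_fps_at_0 numeral_2_eq_2)
  qed
qed

lemma fps_remainder:
  fixes f :: "real \<Rightarrow> real"
  assumes f: "f has_fps_expansion G" and G: "fps_nth G 0 = c0" "fps_nth G 1 = 0" "fps_nth G 2 = c2"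
  shows "(\<lambda>t. f t / t\<^sup>2 - (c0 / t\<^sup>2 + c2)) \<in> O[at_right 0](\<lambda>t. t)"
proof -
  define P where "P = G - (fps_const c0 + fps_const c2 * fps_X ^ 2)"
  have P: "(\<lambda>t. f t - (c0 + c2 * t ^ 2)) has_fps_expansion P"
    unfolding P_def by (intro fps_expansion_intros f)
  have z: "fps_nth P n = 0" if "n < 3" for n
    using that G by (auto simp: P_def less_Suc_eq numeral_3_eq_3 numeral_2_eq_2)
  \<comment> \<open>The remainder divided by t^3, with the value at 0 that makes it continuous and
    hence bounded near 0.\<close>
  define q where "q t = (if t = 0 then fps_nth P 3 else (f t - (c0 + c2 * t ^ 2)) / t ^ 3)" for t
  have "q has_fps_expansion fps_shift 3 P"
  \<comment> \<open>The zero series has \<open>subdegree\<close> 0, so the shift by 3 is justified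
    separately.\<close>
  proof (cases "P = 0")
    case True
    have "(\<lambda>t. 0 :: real) has_fps_expansion 0" by simp
    moreover have "\<forall>\<^sub>F t in nhds 0. 0 = q t"
      using P True by (auto simp: has_fps_expansion_def q_def elim!: eventually_mono)
    ultimately have "q has_fps_expansion 0" by (rule has_fps_expansion_cong_near)
    then show ?thesis by (simp add: True)
  next
    case False
    then have "3 \<le> subdegree P" using z by (intro subdegree_geI)
    then show ?thesis unfolding q_def [abs_def] by (intro has_fps_expansion_shift [OF P]) simp_all
  qed
  then have "isCont q 0" by (rule has_fps_expansion_imp_continuous)
  then have "(q \<longlongrightarrow> q 0) (at_right 0)" by (simp add: isCont_def filterlim_at_split)
  then have "q \<in> O[at_right 0](\<lambda>_. 1)" by (intro bigoI_tendsto [of _ _ "q 0"]) simp_all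
  then have "(\<lambda>t. q t * t) \<in> O[at_right 0](\<lambda>t. 1 * t)" by (intro landau_o.big.mult) simp_all
  then have "(\<lambda>t. q t * t) \<in> O[at_right 0](\<lambda>t. t)" by (simp only: mult_1)
  moreover have "\<forall>\<^sub>F t in at_right 0. q t * t = f t / t\<^sup>2 - (c0 / t\<^sup>2 + c2)"
    using eventually_at_right_less by (rule eventually_mono) (simp add: q_def field_simps eval_nat_numeral)
  ultimately show ?thesis by (simp cong: landau_o.big.in_cong)
qed

lemma at_within_atLeast_neq_bot:
  fixes s :: real assumes "a \<le> s" shows "at s within {a..} \<noteq> bot"
proof -
  have "at_right s \<le> at s within {a..}" using assms by (intro at_le) auto
  then show ?thesis using trivial_limit_at_right_real [of s] by (auto simp: bot_unique)
qed

lemma operators_of_expansion: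
  fixes f :: "real \<Rightarrow> real"
  assumes u: "u1\<^sup>2 + u2\<^sup>2 = 1" and e: "0 < \<epsilon>"
    and q: "\<And>t v1 v2. 0 < t \<Longrightarrow> t < \<epsilon> \<Longrightarrow> second_differential (cost_dot \<gamma> t) (\<gamma> 0) (horiz (\<gamma> 0) v1 v2)
      = (u1 * v1 + u2 * v2)\<^sup>2 / t\<^sup>2 + f t / t\<^sup>2 * (u1 * v2 - u2 * v1)\<^sup>2"
    and f: "f has_fps_expansion G" "fps_nth G 0 = 16" "fps_nth G 1 = 0"
  shows "\<And>t. 0 < t \<Longrightarrow> t < \<epsilon> \<Longrightarrow> cost_op \<gamma> t = plane_op (\<gamma> 0) u1 u2 (1 / t\<^sup>2) (f t / t\<^sup>2)"
    and "\<And>v. v \<in> horizontal_plane (\<gamma> 0) \<Longrightarrow> I_op \<gamma> v = plane_op (\<gamma> 0) u1 u2 1 16 v"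
    and "\<And>v. v \<in> horizontal_plane (\<gamma> 0) \<Longrightarrow> R_op \<gamma> v = plane_op (\<gamma> 0) u1 u2 0 (3 * fps_nth G 2) v"
proof -
  let ?x = "\<gamma> 0"
  show Q: "cost_op \<gamma> t = plane_op ?x u1 u2 (1 / t\<^sup>2) (f t / t\<^sup>2)" if t: "0 < t" "t < \<epsilon>" for t
  proof (rule cost_op_eqI [OF symmetric_plane_op])
    fix v assume "v \<in> horizontal_plane ?x"
    then obtain v1 v2 where v: "v = horiz ?x v1 v2" by (metis plane_eta)
    show "second_differential (cost_dot \<gamma> t) ?x v = sr_metric ?x (plane_op ?x u1 u2 (1 / t\<^sup>2) (f t / t\<^sup>2) v) v"
    proof -
      have *: "(u1 * v1 + u2 * v2)\<^sup>2 / t\<^sup>2 = 1 / t\<^sup>2 * (u1 * v1 + u2 * v2)\<^sup>2" by simp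
      have "a * (u1 * v1 + u2 * v2)\<^sup>2 + b * (u1 * v2 - u2 * v1)\<^sup>2 =
          (a * (u1 * v1 + u2 * v2) * u1 - b * (u1 * v2 - u2 * v1) * u2) * v1
          + (a * (u1 * v1 + u2 * v2) * u2 + b * (u1 * v2 - u2 * v1) * u1) * v2" for a b
        by (simp add: algebra_simps power2_eq_square)
      then show ?thesis unfolding v q [OF t] plane_op_horiz sr_metric_horiz * .
    qed
  qed
  have f0: "f 0 = 16" using has_fps_expansion_at_0 [OF f(1)] f(2) by simp
  have cont: "(f \<longlongrightarrow> 16) (at_right 0)"
    using has_fps_expansion_imp_continuous [OF f(1), of UNIV] f0 by (simp add: isCont_def filterlim_at_split)
  \<comment> \<open>\<open>c v\<close> and \<open>d v\<close> are the parts of v along (u1, u2) and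
    across it; in t^2 Q(t) v = c v + f(t) d v only f depends on t.\<close>
  define c where "c v = horiz ?x ((u1 * v$1 + u2 * v$2) * u1) ((u1 * v$1 + u2 * v$2) * u2)" for v :: pt
  define d where "d v = horiz ?x (- ((u1 * v$2 - u2 * v$1) * u2)) ((u1 * v$2 - u2 * v$1) * u1)" for v :: pt
  have op: "plane_op ?x u1 u2 a b v = a *\<^sub>R c v + b *\<^sub>R d v" if "v \<in> horizontal_plane ?x" for a b v
    using that by (simp add: plane_op_def c_def d_def horiz_scaleR horiz_add horiz_eq_iff algebra_simps)
  have Qt: "t\<^sup>2 *\<^sub>R cost_op \<gamma> t v = c v + f t *\<^sub>R d v"
    if "0 < t" "t < \<epsilon>" "v \<in> horizontal_plane ?x" for t v
    using that by (simp add: Q op scaleR_add_right)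
  show I: "I_op \<gamma> v = plane_op ?x u1 u2 1 16 v" if v: "v \<in> horizontal_plane ?x" for v
    unfolding I_op_def
  proof (rule tendsto_Lim)
    have "((\<lambda>t. c v + f t *\<^sub>R d v) \<longlongrightarrow> c v + 16 *\<^sub>R d v) (at_right 0)"
      by (intro tendsto_intros cont)
    moreover have "\<forall>\<^sub>F t in at_right 0. c v + f t *\<^sub>R d v = t\<^sup>2 *\<^sub>R cost_op \<gamma> t v"
      unfolding eventually_at_right_field using e Qt v by (intro exI [of _ \<epsilon>]) auto
    ultimately show "((\<lambda>t. t\<^sup>2 *\<^sub>R cost_op \<gamma> t v) \<longlongrightarrow> plane_op ?x u1 u2 1 16 v) (at_right 0)"
      unfolding op [OF v] by (simp add: tendsto_cong)
  qed simp
  obtain f1 \<eta> where f1: "0 < \<eta>" "\<And>s. \<bar>s\<bar> < \<eta> \<Longrightarrow> (f has_real_derivative f1 s) (at s)"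
    "f1 0 = fps_nth G 1" "(f1 has_real_derivative 2 * fps_nth G 2) (at 0)"
    by (rule fps_derivatives [OF f(1)], rule that; assumption)
  show "R_op \<gamma> v = plane_op ?x u1 u2 0 (3 * fps_nth G 2) v" if v: "v \<in> horizontal_plane ?x" for v
  proof -
    have ext: "ext_op \<gamma> v s = c v + f s *\<^sub>R d v" if "0 \<le> s" "s < \<epsilon>" for s
      using that Qt [OF _ _ v] I [OF v] by (simp add: ext_op_def f0 op [OF v])
    have d1: "vector_derivative (ext_op \<gamma> v) (at s within {0..}) = f1 s *\<^sub>R d v"
      if s: "0 \<le> s" "s < min \<epsilon> \<eta>" for s
    proof (rule vector_derivative_within)
      show "at s within {0..} \<noteq> bot" using s by (intro at_within_atLeast_neq_bot)
      have "(f has_real_derivative f1 s) (at s within {0..})"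
        by (rule has_field_derivative_at_within [OF f1(2)]) (use s in auto)
      then have "((\<lambda>s. c v + f s *\<^sub>R d v) has_vector_derivative f1 s *\<^sub>R d v) (at s within {0..})"
        by (auto intro!: derivative_eq_intros)
      then show "(ext_op \<gamma> v has_vector_derivative f1 s *\<^sub>R d v) (at s within {0..})"
        by (rule has_vector_derivative_transform_within [of _ _ _ _ "\<epsilon> - s"])
           (use s in \<open>auto simp: ext dist_real_def\<close>)
    qed
    \<comment> \<open>The second derivative of f at 0 is twice its coefficient; the factor 3/2 in
      \<open>R_op\<close> makes this three times the coefficient.\<close>
    have "vector_derivative (\<lambda>s. vector_derivative (ext_op \<gamma> v) (at s within {0..})) (at 0 within {0..})
        = (2 * fps_nth G 2) *\<^sub>R d v"
    proof (rule vector_derivative_within)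
      show "at (0::real) within {0..} \<noteq> bot" by (intro at_within_atLeast_neq_bot) simp
      have "(f1 has_real_derivative 2 * fps_nth G 2) (at 0 within {0..})"
        by (rule has_field_derivative_at_within [OF f1(4)])
      then have "((\<lambda>s. f1 s *\<^sub>R d v) has_vector_derivative (2 * fps_nth G 2) *\<^sub>R d v) (at 0 within {0..})"
        by (auto intro!: derivative_eq_intros)
      then show "((\<lambda>s. vector_derivative (ext_op \<gamma> v) (at s within {0..})) has_vector_derivative
          (2 * fps_nth G 2) *\<^sub>R d v) (at 0 within {0..})"
        by (rule has_vector_derivative_transform_within [of _ _ _ _ "min \<epsilon> \<eta>"])
           (use e f1(1) in \<open>auto simp: d1 dist_real_def\<close>)
    qed
    then show ?thesis unfolding R_op_def op [OF v] by simp
  qed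
qed

text \<open>The normal vector is listed before the velocity, which places the eigenvalue b of the
  normal direction in the upper left entry.\<close>

lemma op_matrix_plane_op:
  fixes u1 u2 :: real and x :: pt
  assumes u: "u1\<^sup>2 + u2\<^sup>2 = 1"
  defines "e \<equiv> \<lambda>i::2. if i = 1 then horiz x (- u2) u1 else horiz x u1 u2"
  shows "orthonormal_basis_at x e"
    and "(\<And>v. v \<in> horizontal_plane x \<Longrightarrow> A v = plane_op x u1 u2 a b v) \<Longrightarrow>
      op_matrix x e A = vector [vector [b, 0], vector [0, a]]"
proof -
  have uu: "u1 * u1 + u2 * u2 = 1" "u2 * u2 + u1 * u1 = 1" using u by (simp_all add: power2_eq_square)
  have e: "e 1 = horiz x (- u2) u1" "e 2 = horiz x u1 u2" by (simp_all add: e_def)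
  have r: "range e = {e 1, e 2}" by (auto simp: UNIV_2)
  have "span (range e) = horizontal_plane x"
  proof
    show "span (range e) \<subseteq> horizontal_plane x"
      unfolding r by (rule span_minimal) (auto simp: e subspace_span horizontal_plane_def [symmetric],
          simp add: horizontal_plane_def)
    show "horizontal_plane x \<subseteq> span (range e)"
    proof
      fix v assume "v \<in> horizontal_plane x"
      then have v: "v = horiz x (v$1) (v$2)" by (simp add: plane_eta)
      have "v$1 = (- u2 * v$1 + u1 * v$2) * - u2 + (u1 * v$1 + u2 * v$2) * u1"
        "v$2 = (- u2 * v$1 + u1 * v$2) * u1 + (u1 * v$1 + u2 * v$2) * u2"
        using uu by algebra+
      then have "horiz x (v$1) (v$2) = (- u2 * v$1 + u1 * v$2) *\<^sub>R e 1 + (u1 * v$1 + u2 * v$2) *\<^sub>R e 2"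
        unfolding e horiz_scaleR horiz_add horiz_eq_iff by blast
      then show "v \<in> span (range e)"
        unfolding r by (subst v) (simp add: span_add span_scale span_base)
    qed
  qed
  then show "orthonormal_basis_at x e"
    unfolding orthonormal_basis_at_def forall_2 e sr_metric_horiz using uu by simp
  assume A: "\<And>v. v \<in> horizontal_plane x \<Longrightarrow> A v = plane_op x u1 u2 a b v"
  have Ae: "A (e 1) = horiz x (- b * u2) (b * u1)" "A (e 2) = horiz x (a * u1) (a * u2)"
    unfolding e A [OF horiz_in_plane] plane_op_horiz horiz_eq_iff using uu by algebra+
  have "b * (u2 * u2) + b * (u1 * u1) = b" "a * (u1 * u1) + a * (u2 * u2) = a"
    using uu by (simp_all flip: distrib_left)
  then show "op_matrix x e A = vector [vector [b, 0], vector [0, a]]"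
    by (simp add: vec_eq_iff forall_2 op_matrix_def Ae [unfolded e] e sr_metric_horiz algebra_simps)
qed

theorem theorem1p2:
  fixes T :: real and \<gamma> :: "real \<Rightarrow> real^5" and x0 :: "real^5" and l0 :: "(real^5) \<times> (real^5)"
  assumes "0 < T"
    and "normal_geodesic T \<gamma> l0"
    and "fst l0 = x0" and "\<gamma> 0 = x0"
    and "ample T \<gamma>" and "equiregular T \<gamma>"
  shows "\<exists>e. orthonormal_basis_at x0 e \<and>
    op_matrix x0 e (I_op \<gamma>) = vector [vector [16, 0], vector [0, 1]] \<and>
    op_matrix x0 e (R_op \<gamma>) = vector [vector [4/21 * R11 l0, 0], vector [0, 0]] \<and>
    (\<forall>i j. (\<lambda>t. op_matrix x0 e (cost_op \<gamma> t) $ i $ j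
        - (1 / t^2 * op_matrix x0 e (I_op \<gamma>) $ i $ j + 1/3 * op_matrix x0 e (R_op \<gamma>) $ i $ j))
      \<in> O[at_right 0](\<lambda>t. t)) \<and>
    (\<forall>v\<in>horizontal_plane x0. (\<lambda>t. second_differential (cost_dot \<gamma> t) x0 v
        - (1 / t^2 * sr_metric x0 (I_op \<gamma> v) v + 1/3 * sr_metric x0 (R_op \<gamma> v) v))
      \<in> O[at_right 0](\<lambda>t. t))"
proof -
  obtain m where m: "m 0 = momentum l0" "\<And>t. t \<in> {0..T} \<Longrightarrow> geo_at m \<gamma> t {0..T}"
    using normal_geodesic_geo [OF assms(2)] by blast
  interpret cartan_geodesic T \<gamma> m using assms(1) m(2) by unfold_locales
  note nd = ample_equiregular_nondegenerate [OF assms(5,6)]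
  define r where "r = sqrt ((m 0 $ 1)\<^sup>2 + (m 0 $ 2)\<^sup>2)"
  have r: "r \<noteq> 0" "r\<^sup>2 = (m 0 $ 1)\<^sup>2 + (m 0 $ 2)\<^sup>2" using nd(1) by (simp_all add: r_def)
  have hm: "h i l0 = m 0 $ i" for i by (simp add: m(1) momentum_def)
  have R11: "R11 l0 = 6 * ((m 0 $ 3)\<^sup>2 / 2 + (m 0 $ 1 * m 0 $ 5 - m 0 $ 2 * m 0 $ 4))
      - 8 * ((m 0 $ 1 * m 0 $ 4 + m 0 $ 2 * m 0 $ 5) / m 0 $ 3)\<^sup>2"
    by (simp add: R11_def E_inv_def hm power_divide)
  obtain M F \<epsilon> where e: "0 < \<epsilon>" and M: "M has_fps_expansion F" "lead 0 (- 4) 0 (- R11 l0 / 126) F"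
    and q: "\<And>t v1 v2. 0 < t \<Longrightarrow> t < \<epsilon> \<Longrightarrow> second_differential (cost_dot \<gamma> t) (\<gamma> 0) (horiz (\<gamma> 0) v1 v2)
      = ((m 0 $ 1 * v1 + m 0 $ 2 * v2) / r)\<^sup>2 / t\<^sup>2 + (M t / t)\<^sup>2 * ((m 0 $ 1 * v2 - m 0 $ 2 * v1) / r)\<^sup>2"
    by (rule second_differential_expansion [OF nd r_def, folded R11], rule that; assumption)
  define u1 u2 where "u1 = m 0 $ 1 / r" "u2 = m 0 $ 2 / r"
  note u12 = this
  define f where "f t = M t * M t" for t
  have u: "u1\<^sup>2 + u2\<^sup>2 = 1" using r(1) by (simp add: u12 power_divide flip: add_divide_distrib r(2))
  have q': "second_differential (cost_dot \<gamma> t) x0 (horiz x0 v1 v2)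
      = (u1 * v1 + u2 * v2)\<^sup>2 / t\<^sup>2 + f t / t\<^sup>2 * (u1 * v2 - u2 * v1)\<^sup>2" if "0 < t" "t < \<epsilon>" for t v1 v2
    using q [OF that, of v1 v2] unfolding assms(4)
    by (simp add: u12 f_def power_divide add_divide_distrib diff_divide_distrib power2_eq_square)
  have f: "f has_fps_expansion F * F" unfolding f_def [abs_def] by (intro has_fps_expansion_mult M)
  \<comment> \<open>(-4)^2 = 16 and 2 (-4) (- R11 / 126) = 8 R11 / 126; three times the latter is
    4/21 R11, the entry of the curvature operator.\<close>
  have "lead 0 16 0 (8 * R11 l0 / 126) (F * F)"
    using lead_mult [OF M(2) M(2)] by simp
  then have FF: "fps_nth (F * F) 0 = 16" "fps_nth (F * F) 1 = 0" "fps_nth (F * F) 2 = 8 * R11 l0 / 126"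
    by (simp_all add: lead_def numeral_2_eq_2)
  note ops' = operators_of_expansion [of u1 u2 \<epsilon> \<gamma> f, OF u e _ f FF(1,2), unfolded assms(4) FF(3)]
  have ops: "\<And>t. 0 < t \<Longrightarrow> t < \<epsilon> \<Longrightarrow> cost_op \<gamma> t = plane_op x0 u1 u2 (1 / t\<^sup>2) (f t / t\<^sup>2)"
    "\<And>v. v \<in> horizontal_plane x0 \<Longrightarrow> I_op \<gamma> v = plane_op x0 u1 u2 1 16 v"
    "\<And>v. v \<in> horizontal_plane x0 \<Longrightarrow> R_op \<gamma> v = plane_op x0 u1 u2 0 (3 * (8 * R11 l0 / 126)) v"
    by (rule ops', rule q'; assumption)+
  define e where "e = (\<lambda>i::2. if i = 1 then horiz x0 (- u2) u1 else horiz x0 u1 u2)"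
  note mat = op_matrix_plane_op [OF u, of x0, folded e_def]
  \<comment> \<open>Every difference in the conclusion is a constant multiple of this remainder,
    since the eigenvalue along the velocity is exactly 1 / t^2.\<close>
  define rem where "rem t = f t / t\<^sup>2 - (16 / t\<^sup>2 + 8 * R11 l0 / 126)" for t
  have rem: "rem \<in> O[at_right 0](\<lambda>t. t)"
    unfolding rem_def [abs_def] by (rule fps_remainder [OF f FF])
  have near: "\<forall>\<^sub>F t in at_right 0. 0 < t \<and> t < \<epsilon>"
    unfolding eventually_at_right_field using \<open>0 < \<epsilon>\<close> by blast
  have O: "g \<in> O[at_right 0](\<lambda>t. t)" if "\<And>t. 0 < t \<Longrightarrow> t < \<epsilon> \<Longrightarrow> g t = c * rem t" for g and c :: real
  proof -
    have "(\<lambda>t. c * rem t) \<in> O[at_right 0](\<lambda>t. t)" using rem by (cases "c = 0") simp_all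
    moreover have "\<forall>\<^sub>F t in at_right 0. c * rem t = g t" using near by eventually_elim (simp add: that)
    ultimately show ?thesis by (simp cong: landau_o.big.in_cong)
  qed
  have mI: "op_matrix x0 e (I_op \<gamma>) = vector [vector [16, 0], vector [0, 1]]"
    by (rule mat(2) [OF ops(2)])
  have mR: "op_matrix x0 e (R_op \<gamma>) = vector [vector [4/21 * R11 l0, 0], vector [0, 0]]"
    using mat(2) [OF ops(3)] by simp
  have mQ: "op_matrix x0 e (cost_op \<gamma> t) = vector [vector [f t / t\<^sup>2, 0], vector [0, 1 / t\<^sup>2]]"
    if "0 < t" "t < \<epsilon>" for t
    by (rule mat(2)) (simp add: ops(1) [OF that])
  have "\<forall>i j. (\<lambda>t. op_matrix x0 e (cost_op \<gamma> t) $ i $ j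
        - (1 / t^2 * op_matrix x0 e (I_op \<gamma>) $ i $ j + 1/3 * op_matrix x0 e (R_op \<gamma>) $ i $ j))
      \<in> O[at_right 0](\<lambda>t. t)"
    unfolding forall_2 mI mR
    by (intro conjI O [of _ 1] O [of _ 0]; simp add: mQ rem_def)
  moreover have "(\<lambda>t. second_differential (cost_dot \<gamma> t) x0 v
        - (1 / t^2 * sr_metric x0 (I_op \<gamma> v) v + 1/3 * sr_metric x0 (R_op \<gamma> v) v))
      \<in> O[at_right 0](\<lambda>t. t)" if v: "v \<in> horizontal_plane x0" for v
  proof (rule O [of _ "(u1 * v$2 - u2 * v$1)\<^sup>2"])
    fix t assume t: "0 < t" "t < \<epsilon>"
    obtain v1 v2 where hv: "v = horiz x0 v1 v2" using v by (metis plane_eta)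
    show "second_differential (cost_dot \<gamma> t) x0 v
        - (1 / t^2 * sr_metric x0 (I_op \<gamma> v) v + 1/3 * sr_metric x0 (R_op \<gamma> v) v)
        = (u1 * v$2 - u2 * v$1)\<^sup>2 * rem t"
      unfolding ops(2,3) [OF v] unfolding hv q' [OF t] plane_op_horiz sr_metric_horiz rem_def
      using t by (simp add: field_simps power2_eq_square)
  qed
  ultimately show ?thesis using mat(1) mI mR by blast
qed

end
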